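(* Consider a third-order ODE $y'''=F(x,y,y',y'')$. The contact invariant information about this equation is given by the following data. (i) The principal fibre bundle $H_6\to\mathcal P^c\to J^2$, where $\dim\mathcal P^c=10$, $J^2$ is the space of second jets of curves in the $xy$-plane, and $H_6$ is the six-dimensional subgroup of $Sp(4,\mathbb R)$ consisting of the matrices $$u=\begin{pmatrix}\sqrt{u_1}&\frac{u_2}{2\sqrt{u_1}}&-\frac{u_4}{2\sqrt{u_1}}&\frac{u_2^2u_5}{24u_1^{3/2}u_3}-\frac12\sqrt{u_1}\,u_6\\0&\frac{u_3}{\sqrt{u_1}}&-\frac{u_5}{\sqrt{u_1}}&\frac{u_2u_5-u_3u_4}{2u_1^{3/2}}\\0&0&\frac{\sqrt{u_1}}{u_3}&-\frac{u_2}{2\sqrt{u_1}\,u_3}\\0&0&0&\frac1{\sqrt{u_1}}\end{pmatrix}.$$ (ii) The coframe $(\theta^1,\theta^2,\theta^3,\theta^4,\Omega_1,\Omega_2,\Omega_3,\Omega_4,\Omega_5,\Omega_6)$ on $\mathcal P^c$, which defines the $\mathfrak o(3,2)\cong\mathfrak{sp}(4,\mathbb R)$-valued Cartan connection, normal in the sense of Tanaka, $\widehat\omega^c$ on $\mathcal P^c$ by $$\widehat\omega^c=\begin{pmatrix}\frac12\Omega_1&\frac12\Omega_2&-\frac12\Omega_4&-\frac14\Omega_6\\\theta^4&\Omega_3-\frac12\Omega_1&-\Omega_5&-\frac12\Omega_4\\\theta^2&\theta^3&\frac12\Omega_1-\Omega_3&-\frac12\Omega_2\\2\theta^1&\theta^2&-\theta^4&-\frac12\Omega_1\end{pmatrix}.$$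 Let $(x,y,p,q,u_1,\dots,u_6)$ be a local coordinate system on $\mathcal P^c$ compatible with the local trivialization $\mathcal P^c=H_6\times J^2$, i.e. $(x,y,p,q)$ are coordinates in $J^2$ and $(u_\mu)$ are the coordinates in $H_6$ displayed above. Then the value of $\widehat\omega^c$ at the point $(x,y,p,q,u_\mu)$ is $$\widehat\omega^c=u^{-1}\,\omega^c\,u+u^{-1}du,$$ where $$\omega^c=\begin{pmatrix}\frac12\Omega_1^0&\frac12\Omega_2^0&-\frac12\Omega_4^0&-\frac14\Omega_6^0\\\omega^4&\Omega_3^0-\frac12\Omega_1^0&-\Omega_5^0&-\frac12\Omega_4^0\\\omega^2&\tilde\omega^3&\frac12\Omega_1^0-\Omega_3^0&-\frac12\Omega_2^0\\2\omega^1&\omega^2&-\omega^4&-\frac12\Omega_1^0\end{pmatrix}$$ is the connection $\widehat\omega^c$ calculated at the point $(x,y,p,q,u_1=1,u_2=0,u_3=1,u_4=0,u_5=0,u_6=0)$. Here $\omega^1=dy-p\,dx$, $\omega^2=dp-q\,dx$, $\tilde\omega^3=dq-F\,dx-\frac13F_q(dp-q\,dx)+K(dy-p\,dx)$, $\omega^4=dx$, and $$\begin{aligned}\Omega_1^0&=-K_q\omega^1,\qquad \Omega_2^0=(\tfrac13W_q+L)\omega^1-K_q\omega^2-K\omega^4,\\ \Omega_3^0&=-K_q\omega^1+\tfrac16F_{qq}\omega^2+\tfrac13F_q\omega^4,\qquad \Omega_4^0=-(\tfrac13W_{qq}+L_q)\omega^1+\tfrac12K_{qq}\omega^2,\\ \Omega_5^0&=\tfrac12K_{qq}\omega^1-\tfrac16F_{qqq}\omega^2-\tfrac16F_{qq}\omega^4,\\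 \Omega_6^0&=\big(\tfrac13\mathcal D(W_{qq})-\tfrac43W_{qp}-\tfrac13F_qW_{qq}+\tfrac13F_{qqq}W+M\big)\omega^1+\tfrac13(F_{qqy}-F_{qqq}K-W_{qq})\omega^2\\&\quad-K_{qq}\tilde\omega^3+\big(\tfrac23F_{qy}-\tfrac13F_{qq}K-2L-\tfrac43W_q\big)\omega^4.\end{aligned}$$
   Context: Everything is local and smooth. $J^2$ has coordinates $(x,y,p,q)$, $p=y'$, $q=y''$; $F=F(x,y,p,q)$ is a smooth real function, subscripts denote partial derivatives. Notation: $\mathcal D=\partial_x+p\partial_y+q\partial_p+F\partial_q$, $K=\frac16\mathcal DF_q-\frac19F_q^2-\frac12F_p$, $L=\frac13F_{qq}K-\frac13F_qK_q-K_p-\frac13F_{qy}$, $M=2K_{qq}K-2K_{qy}+\frac13F_{qq}L-\frac23F_qL_q-2L_p$, $W=(\mathcal D-\frac23F_q)K+F_y$. Contact transformation: a local diffeomorphism $(x,y,p)\mapsto(\chi,\phi,\psi)$ of $J^1$ with $\psi\chi_p=\phi_p$ and $\psi(\chi_x+p\chi_y)=\phi_x+p\phi_y$, prolonged to higher derivatives in the standard way. "The contact invariant information is given by the data" means: two ODEs given by $F$ and $\bar F$ are locally contact equivalent if and only if there exists a local diffeomorphism $\Phi:\mathcal P^c\to\bar{\mathcal P}^c$ between their bundles with $\Phi^*\bar\theta^i=\theta^i$, $\Phi^*\bar\Omega_\mu=\Omega_\mu$ ($i=1,\dots,4$, $\mu=1,\dots,6$); such a $\Phi$ projects to a contact transformation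 mapping one ODE to the other. Cartan connection of type $(G,H)$ on a principal bundle $H\to\mathcal P\to\mathcal M$, $\dim G=\dim\mathcal P$: a $\mathfrak g$-valued one-form $\widehat\omega$ that is an isomorphism $T_w\mathcal P\to\mathfrak g$ at each point, reproduces generators of fundamental fields, and satisfies $R_h^*\widehat\omega=\mathrm{Ad}(h^{-1})\widehat\omega$. Its curvature is $\widehat K=d\widehat\omega+\widehat\omega\wedge\widehat\omega$. Grading: here $\mathfrak{sp}(4,\mathbb R)$ is the algebra of matrices of the form displayed for $\widehat\omega^c$ (with real numbers in place of forms), and $\mathfrak g_k$ ($-3\le k\le3$) is the subspace of such matrices whose $(i,j)$ entry vanishes unless $j-i=k$. Put $\mathfrak m=\mathfrak g_{-3}\oplus\mathfrak g_{-2}\oplus\mathfrak g_{-1}$, $\mathfrak h=\mathfrak g_0\oplus\dots\oplus\mathfrak g_3$ (the Lie algebra of $H_6$). Tanaka normality: the structure function is $\kappa:\mathcal P\to\mathrm{Hom}(\wedge^2\mathfrak m,\mathfrak g)$, $\kappa(A,B)=\widehat K(\widehat\omega^{-1}(A),\widehat\omega^{-1}(B))$. Normal means (i) $\kappa(\mathfrak g_i,\mathfrak g_j)\subset\bigoplus_{k\ge i+j+1}\mathfrak g_k$ for $i,j<0$, and (ii) $\partial^*\kappa=0$, where for $\alpha\in\mathrm{Hom}(\wedge^2\mathfrak m,\mathfrak g)$, $A\in\mathfrak m$, $$(\partial^*\alpha)(A)=\sum_i[e_i^*,\alpha(e_i\wedge A)]+\tfrac12\sum_j\alpha([e_j^*,A]_{\mathfrak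 m}\wedge e_j);$$ here $(e_i)$ is a basis of $\mathfrak m$, $(e_i^* )$ the basis of $\mathfrak g_1\oplus\mathfrak g_2\oplus\mathfrak g_3$ dual to it under the Killing form, and $[\ ,\ ]_{\mathfrak m}$ is the $\mathfrak m$-component along $\mathfrak g=\mathfrak m\oplus\mathfrak h$.
   Formalization: As u₁>0, Φ keeps the sign of θ¹, so the literal "iff" fails (y+q⁴ and y−q⁴ near 0). Proved instead: the iff for contact maps with φ_y−ψχ_y>0; and for all contact maps, with Φ going to the bundle of F̄ or of its image under y→−y. *)

theory Defs
  imports "HOL-Analysis.Analysis" "HOL-Algebra.Group"
begin

text \<open>Only used on open sets \<open>S\<close>; \<open>Ck_on k S f\<close> says that all iterated directional derivatives
  of order at most \<open>k\<close> exist and are continuous on \<open>S\<close>.\<close>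

primrec Ck_on ::
  "nat \<Rightarrow> 'a::euclidean_space set \<Rightarrow> ('a \<Rightarrow> 'b::real_normed_vector) \<Rightarrow> bool" where
  "Ck_on 0 S f \<longleftrightarrow> continuous_on S f"
| "Ck_on (Suc k) S f \<longleftrightarrow>
     (\<forall>x\<in>S. f differentiable (at x)) \<and> (\<forall>v. Ck_on k S (\<lambda>x. frechet_derivative f (at x) v))"

definition smooth_on :: "'a::euclidean_space set \<Rightarrow> ('a \<Rightarrow> 'b::real_normed_vector) \<Rightarrow> bool" where
  "smooth_on S f \<longleftrightarrow> (\<forall>k. Ck_on k S f)"

definition diffeo ::
  "'a::euclidean_space set \<Rightarrow> 'b::euclidean_space set \<Rightarrow> ('a \<Rightarrow> 'b) \<Rightarrow> bool" where
  "diffeo A B f \<longleftrightarrow> open A \<and> open B \<and> bij_betw f A B \<and> smooth_on A f \<and> smooth_on B (inv_into A f)"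

definition pd :: "'n \<Rightarrow> (real^'n \<Rightarrow> real) \<Rightarrow> real^'n \<Rightarrow> real" where
  "pd i f z = frechet_derivative f (at z) (axis i 1)"

text \<open>A point of \<open>J\<^sup>2\<close> is a vector \<open>z = (x, y, p, q)\<close> with components \<open>z $ 1, \<dots>, z $ 4\<close>; a one-form is a
  function of a point and a tangent vector.\<close>

abbreviation Dx :: "(real^4 \<Rightarrow> real) \<Rightarrow> real^4 \<Rightarrow> real" where "Dx \<equiv> pd 1"
abbreviation Dy :: "(real^4 \<Rightarrow> real) \<Rightarrow> real^4 \<Rightarrow> real" where "Dy \<equiv> pd 2"
abbreviation Dp :: "(real^4 \<Rightarrow> real) \<Rightarrow> real^4 \<Rightarrow> real" where "Dp \<equiv> pd 3"
abbreviation Dq :: "(real^4 \<Rightarrow> real) \<Rightarrow> real^4 \<Rightarrow> real" where "Dq \<equiv> pd 4"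

definition total_D :: "(real^4 \<Rightarrow> real) \<Rightarrow> (real^4 \<Rightarrow> real) \<Rightarrow> real^4 \<Rightarrow> real" where
  "total_D F G z = Dx G z + z$3 * Dy G z + z$4 * Dp G z + F z * Dq G z"

definition K_fun :: "(real^4 \<Rightarrow> real) \<Rightarrow> real^4 \<Rightarrow> real" where
  "K_fun F z = 1/6 * total_D F (Dq F) z - 1/9 * (Dq F z)^2 - 1/2 * Dp F z"

definition L_fun :: "(real^4 \<Rightarrow> real) \<Rightarrow> real^4 \<Rightarrow> real" where
  "L_fun F z = 1/3 * Dq (Dq F) z * K_fun F z - 1/3 * Dq F z * Dq (K_fun F) z
     - Dp (K_fun F) z - 1/3 * Dy (Dq F) z"

definition M_fun :: "(real^4 \<Rightarrow> real) \<Rightarrow> real^4 \<Rightarrow> real" where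
  "M_fun F z = 2 * Dq (Dq (K_fun F)) z * K_fun F z - 2 * Dy (Dq (K_fun F)) z
     + 1/3 * Dq (Dq F) z * L_fun F z - 2/3 * Dq F z * Dq (L_fun F) z - 2 * Dp (L_fun F) z"

definition W_fun :: "(real^4 \<Rightarrow> real) \<Rightarrow> real^4 \<Rightarrow> real" where
  "W_fun F z = total_D F (K_fun F) z - 2/3 * Dq F z * K_fun F z + Dy F z"

definition om1 :: "real^4 \<Rightarrow> real^4 \<Rightarrow> real" where
  "om1 z v = v$2 - z$3 * v$1"

definition om2 :: "real^4 \<Rightarrow> real^4 \<Rightarrow> real" where
  "om2 z v = v$3 - z$4 * v$1"

definition om3 :: "(real^4 \<Rightarrow> real) \<Rightarrow> real^4 \<Rightarrow> real^4 \<Rightarrow> real" where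
  "om3 F z v = v$4 - F z * v$1 - 1/3 * Dq F z * (v$3 - z$4 * v$1) + K_fun F z * (v$2 - z$3 * v$1)"

definition om4 :: "real^4 \<Rightarrow> real^4 \<Rightarrow> real" where
  "om4 z v = v$1"

definition Om0 :: "(real^4 \<Rightarrow> real) \<Rightarrow> real^4 \<Rightarrow> real^4 \<Rightarrow> real^6" where
  "Om0 F z v = vector
    [ - Dq (K_fun F) z * om1 z v,
      (1/3 * Dq (W_fun F) z + L_fun F z) * om1 z v - Dq (K_fun F) z * om2 z v - K_fun F z * om4 z v,
      - Dq (K_fun F) z * om1 z v + 1/6 * Dq (Dq F) z * om2 z v + 1/3 * Dq F z * om4 z v,
      - (1/3 * Dq (Dq (W_fun F)) z + Dq (L_fun F) z) * om1 z v + 1/2 * Dq (Dq (K_fun F)) z * om2 z v,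
      1/2 * Dq (Dq (K_fun F)) z * om1 z v - 1/6 * Dq (Dq (Dq F)) z * om2 z v
        - 1/6 * Dq (Dq F) z * om4 z v,
      (1/3 * total_D F (Dq (Dq (W_fun F))) z - 4/3 * Dp (Dq (W_fun F)) z
         - 1/3 * Dq F z * Dq (Dq (W_fun F)) z + 1/3 * Dq (Dq (Dq F)) z * W_fun F z + M_fun F z)
        * om1 z v
        + 1/3 * (Dy (Dq (Dq F)) z - Dq (Dq (Dq F)) z * K_fun F z - Dq (Dq (W_fun F)) z) * om2 z v
        - Dq (Dq (K_fun F)) z * om3 F z v
        + (2/3 * Dy (Dq F) z - 1/3 * Dq (Dq F) z * K_fun F z - 2 * L_fun F z
             - 4/3 * Dq (W_fun F) z) * om4 z v ]"

text \<open>The displayed matrix as a function of \<open>(\<theta>\<^sup>1,\<dots>,\<theta>\<^sup>4)\<close> and \<open>(\<Omega>\<^sub>1,\<dots>,\<Omega>\<^sub>6)\<close>.\<close>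

fun sp4_matrix :: "(real^4) \<times> (real^6) \<Rightarrow> real^4^4" where
  "sp4_matrix (t, w) = vector
    [ vector [1/2 * w$1,  1/2 * w$2,          - 1/2 * w$4,         - 1/4 * w$6],
      vector [t$4,        w$3 - 1/2 * w$1,    - w$5,               - 1/2 * w$4],
      vector [t$2,        t$3,                1/2 * w$1 - w$3,     - 1/2 * w$2],
      vector [2 * t$1,    t$2,                - t$4,               - 1/2 * w$1] ]"

definition sp4 :: "(real^4^4) set" where
  "sp4 = range sp4_matrix"

text \<open>Left inverse of \<open>sp4_matrix\<close>.\<close>

definition sp4_coords :: "real^4^4 \<Rightarrow> (real^4) \<times> (real^6)" where
  "sp4_coords X =
    (vector [1/2 * X$4$1, X$3$1, X$3$2, X$2$1],
     vector [2 * X$1$1, 2 * X$1$2, X$2$2 + X$1$1, - 2 * X$1$3, - X$2$3, - 4 * X$1$4])"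

definition lie_br :: "real^'n^'n \<Rightarrow> real^'n^'n \<Rightarrow> real^'n^'n" where
  "lie_br A B = A ** B - B ** A"

text \<open>Here \<open>i\<close>, \<open>j\<close> are integers; \<open>of_int\<close> casts them into the index type of four elements (in which the
  numerals \<open>4\<close> and \<open>0\<close> coincide, so that the difference \<open>j - i\<close> must not be taken there).\<close>

definition sp4_grade :: "int \<Rightarrow> (real^4^4) set" where
  "sp4_grade k = {X \<in> sp4. \<forall>i\<in>{1..4::int}. \<forall>j\<in>{1..4::int}. j - i \<noteq> k \<longrightarrow> X $ of_int i $ of_int j = 0}"

definition neg_part :: "(real^4^4) set" where
  "neg_part = span (\<Union>k\<in>{-3..-1}. sp4_grade k)"

definition nonneg_part :: "(real^4^4) set" where
  "nonneg_part = span (\<Union>k\<in>{0..3}. sp4_grade k)"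

definition pos_part :: "(real^4^4) set" where
  "pos_part = span (\<Union>k\<in>{1..3}. sp4_grade k)"

definition proj_neg :: "real^4^4 \<Rightarrow> real^4^4" where
  "proj_neg X = (THE Y. Y \<in> neg_part \<and> X - Y \<in> nonneg_part)"

text \<open>The trace of \<open>ad X \<circ> ad Y\<close> on \<open>sp4\<close>, taken in the linear coordinates \<open>sp4_coords\<close>.\<close>

definition killing_form :: "real^4^4 \<Rightarrow> real^4^4 \<Rightarrow> real" where
  "killing_form X Y = (\<Sum>b\<in>Basis. sp4_coords (lie_br X (lie_br Y (sp4_matrix b))) \<bullet> b)"

definition o32 :: "(real^5^5) set" where
  "o32 = (let \<eta> = (\<chi> i j. if i = j then if i \<in> {1, 2, 3} then 1 else -1 else 0)
          in {X. transpose X ** \<eta> + \<eta> ** X = 0})"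

text \<open>The symplectic form for which the Lie algebra of the symplectic group is \<open>sp4\<close>.\<close>

definition sympl_form :: "real^4^4" where
  "sympl_form = vector [vector [0, 0, 0, 1], vector [0, 0, 1, 0], vector [0, -1, 0, 0], vector [-1, 0, 0, 0]]"

definition Sp4 :: "(real^4^4) monoid" where
  "Sp4 = \<lparr>carrier = {A. transpose A ** sympl_form ** A = sympl_form}, mult = (**), one = mat 1\<rparr>"

definition H6_dom :: "(real^6) set" where
  "H6_dom = {u. u$1 > 0 \<and> u$3 \<noteq> 0}"

definition u_matrix :: "real^6 \<Rightarrow> real^4^4" where
  "u_matrix u = vector
    [ vector [sqrt (u$1), u$2 / (2 * sqrt (u$1)), - u$4 / (2 * sqrt (u$1)),
              (u$2)^2 * u$5 / (24 * u$1 powr (3/2) * u$3) - 1/2 * sqrt (u$1) * u$6],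
      vector [0, u$3 / sqrt (u$1), - u$5 / sqrt (u$1),
              (u$2 * u$5 - u$3 * u$4) / (2 * u$1 powr (3/2))],
      vector [0, 0, sqrt (u$1) / u$3, - u$2 / (2 * sqrt (u$1) * u$3)],
      vector [0, 0, 0, 1 / sqrt (u$1)] ]"

definition H6 :: "(real^4^4) set" where
  "H6 = u_matrix ` H6_dom"

definition unit_coords :: "real^6" where
  "unit_coords = vector [1, 0, 1, 0, 0, 0]"

definition lie_algebra :: "(real^'n^'n) set \<Rightarrow> (real^'n^'n) set" where
  "lie_algebra G =
    {A. \<exists>\<gamma>. \<gamma> 0 = mat 1 \<and> (\<forall>t::real. \<gamma> t \<in> G) \<and> (\<gamma> has_vector_derivative A) (at 0)}"

text \<open>\<open>\<phi>\<close> is a global coordinate system, with coordinate domain \<open>D\<close>, on the embedded submanifold \<open>H\<close>.\<close>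

definition global_chart ::
  "'u::euclidean_space set \<Rightarrow> ('u \<Rightarrow> real^'n^'n) \<Rightarrow> (real^'n^'n) set \<Rightarrow> bool" where
  "global_chart D \<phi> H \<longleftrightarrow> open D \<and> smooth_on D \<phi> \<and> bij_betw \<phi> D H \<and>
     continuous_on H (inv_into D \<phi>) \<and> (\<forall>u\<in>D. inj (frechet_derivative \<phi> (at u)))"

text \<open>Principal bundle with projection \<open>\<pi> : P \<rightarrow> M\<close> and right action \<open>act\<close> of a matrix group \<open>H\<close> with
  global chart \<open>\<phi>\<close>; the last clause is local triviality.\<close>

definition principal_bundle ::
  "'u::euclidean_space set \<Rightarrow> ('u \<Rightarrow> real^'n^'n) \<Rightarrow> (real^'n^'n) set \<Rightarrow> 'w::euclidean_space set \<Rightarrow>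
   ('w \<Rightarrow> 'z::euclidean_space) \<Rightarrow> 'z set \<Rightarrow> ('w \<Rightarrow> real^'n^'n \<Rightarrow> 'w) \<Rightarrow> bool" where
  "principal_bundle D \<phi> H P \<pi> M act \<longleftrightarrow>
     global_chart D \<phi> H \<and> open P \<and> open M \<and> smooth_on P \<pi> \<and> \<pi> ` P = M \<and>
     (\<forall>w\<in>P. act w (mat 1) = w) \<and>
     (\<forall>w\<in>P. \<forall>h\<in>H. act w h \<in> P \<and> \<pi> (act w h) = \<pi> w) \<and>
     (\<forall>w\<in>P. \<forall>g\<in>H. \<forall>h\<in>H. act (act w g) h = act w (g ** h)) \<and>
     (\<forall>w\<in>P. \<forall>w'\<in>P. \<pi> w = \<pi> w' \<longrightarrow> (\<exists>!h. h \<in> H \<and> w' = act w h)) \<and>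
     smooth_on (P \<times> D) (\<lambda>(w, u). act w (\<phi> u)) \<and>
     (\<forall>z\<in>M. \<exists>N s. z \<in> N \<and> open N \<and> N \<subseteq> M \<and> smooth_on N s \<and>
        (\<forall>n\<in>N. s n \<in> P \<and> \<pi> (s n) = n) \<and>
        diffeo (N \<times> D) {w \<in> P. \<pi> w \<in> N} (\<lambda>(n, u). act (s n) (\<phi> u)))"

text \<open>\<open>X\<close> is the value at \<open>w\<close> of the fundamental vector field generated by \<open>A\<close>, i.e. the image of \<open>A\<close> under
  the differential at the identity of the orbit map \<open>h \<mapsto> act w h\<close>.\<close>

definition fundamental_vector ::
  "(real^'n^'n) set \<Rightarrow> ('w::euclidean_space \<Rightarrow> real^'n^'n \<Rightarrow> 'w) \<Rightarrow> real^'n^'n \<Rightarrow> 'w \<Rightarrow> 'w \<Rightarrow> bool" where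
  "fundamental_vector H act A w X \<longleftrightarrow>
     (\<exists>\<gamma>. \<gamma> 0 = mat 1 \<and> (\<forall>t::real. \<gamma> t \<in> H) \<and> (\<gamma> has_vector_derivative A) (at 0) \<and>
          ((\<lambda>t. act w (\<gamma> t)) has_vector_derivative X) (at 0))"

definition cartan_connection ::
  "(real^'n^'n) set \<Rightarrow> (real^'n^'n) set \<Rightarrow> 'w::euclidean_space set \<Rightarrow> ('w \<Rightarrow> real^'n^'n \<Rightarrow> 'w) \<Rightarrow>
   ('w \<Rightarrow> 'w \<Rightarrow> real^'n^'n) \<Rightarrow> bool" where
  "cartan_connection G H P act \<omega> \<longleftrightarrow>
     dim (lie_algebra G) = DIM('w) \<and>
     (\<forall>v. smooth_on P (\<lambda>w. \<omega> w v)) \<and>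
     (\<forall>w\<in>P. linear (\<omega> w) \<and> bij_betw (\<omega> w) UNIV (lie_algebra G)) \<and>
     (\<forall>w\<in>P. \<forall>A\<in>lie_algebra H. (\<exists>X. fundamental_vector H act A w X) \<and>
        (\<forall>X. fundamental_vector H act A w X \<longrightarrow> \<omega> w X = A)) \<and>
     (\<forall>h\<in>H. \<forall>w\<in>P. \<forall>v. \<omega> (act w h) (frechet_derivative (\<lambda>w. act w h) (at w) v)
        = matrix_inv h ** \<omega> w v ** h)"

text \<open>\<open>d\<omega> + \<omega> \<and> \<omega>\<close>, with \<open>d\<omega>(v,v') = v(\<omega>(v')) - v'(\<omega>(v))\<close> for constant vector fields \<open>v, v'\<close> and
  \<open>(\<omega> \<and> \<omega>)(v,v') = \<omega>(v)\<omega>(v') - \<omega>(v')\<omega>(v)\<close>.\<close>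

definition curvature ::
  "('w::euclidean_space \<Rightarrow> 'w \<Rightarrow> real^'n^'n) \<Rightarrow> 'w \<Rightarrow> 'w \<Rightarrow> 'w \<Rightarrow> real^'n^'n" where
  "curvature \<omega> w v v' =
     frechet_derivative (\<lambda>w. \<omega> w v') (at w) v - frechet_derivative (\<lambda>w. \<omega> w v) (at w) v'
     + (\<omega> w v ** \<omega> w v' - \<omega> w v' ** \<omega> w v)"

definition structure_function ::
  "('w::euclidean_space \<Rightarrow> 'w \<Rightarrow> real^'n^'n) \<Rightarrow> 'w \<Rightarrow> real^'n^'n \<Rightarrow> real^'n^'n \<Rightarrow> real^'n^'n" where
  "structure_function \<omega> w A B = curvature \<omega> w (inv_into UNIV (\<omega> w) A) (inv_into UNIV (\<omega> w) B)"

definition dual_bases :: "(4 \<Rightarrow> real^4^4) \<Rightarrow> (4 \<Rightarrow> real^4^4) \<Rightarrow> bool" where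
  "dual_bases e e' \<longleftrightarrow> inj e \<and> independent (range e) \<and> span (range e) = neg_part \<and>
     range e' \<subseteq> pos_part \<and> (\<forall>i j. killing_form (e i) (e' j) = (if i = j then 1 else 0))"

definition codifferential ::
  "(4 \<Rightarrow> real^4^4) \<Rightarrow> (4 \<Rightarrow> real^4^4) \<Rightarrow> (real^4^4 \<Rightarrow> real^4^4 \<Rightarrow> real^4^4) \<Rightarrow> real^4^4 \<Rightarrow> real^4^4" where
  "codifferential e e' \<alpha> A =
     (\<Sum>i\<in>UNIV. lie_br (e' i) (\<alpha> (e i) A))
     + (1/2) *\<^sub>R (\<Sum>j\<in>UNIV. \<alpha> (proj_neg (lie_br (e' j) A)) (e j))"

definition tanaka_normal ::
  "'w::euclidean_space set \<Rightarrow> ('w \<Rightarrow> 'w \<Rightarrow> real^4^4) \<Rightarrow> bool" where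
  "tanaka_normal P \<omega> \<longleftrightarrow>
     (\<forall>w\<in>P. \<forall>i\<in>{-3..-1}. \<forall>j\<in>{-3..-1}. \<forall>A\<in>sp4_grade i. \<forall>B\<in>sp4_grade j.
        structure_function \<omega> w A B \<in> span (\<Union>k\<in>{i+j+1..3}. sp4_grade k)) \<and>
     (\<forall>w\<in>P. \<forall>e e'. dual_bases e e' \<longrightarrow>
        (\<forall>A\<in>neg_part. codifferential e e' (structure_function \<omega> w) A = 0))"

text \<open>The equation is given by \<open>F\<close> on an open set \<open>U\<close> of the second jet space.  A point of the bundle is a
  pair of \<open>z = (x,y,p,q)\<close> and \<open>u = (u\<^sub>1,\<dots>,u\<^sub>6)\<close>.\<close>

definition Pc :: "(real^4) set \<Rightarrow> ((real^4) \<times> (real^6)) set" where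
  "Pc U = U \<times> H6_dom"

definition H6_act :: "(real^4) \<times> (real^6) \<Rightarrow> real^4^4 \<Rightarrow> (real^4) \<times> (real^6)" where
  "H6_act w h = (fst w, inv_into H6_dom u_matrix (u_matrix (snd w) ** h))"

definition omega_c :: "(real^4 \<Rightarrow> real) \<Rightarrow> real^4 \<Rightarrow> real^4 \<Rightarrow> real^4^4" where
  "omega_c F z v = sp4_matrix (vector [om1 z v, om2 z v, om3 F z v, om4 z v], Om0 F z v)"

definition omega_hat ::
  "(real^4 \<Rightarrow> real) \<Rightarrow> (real^4) \<times> (real^6) \<Rightarrow> (real^4) \<times> (real^6) \<Rightarrow> real^4^4" where
  "omega_hat F w v =
     matrix_inv (u_matrix (snd w)) ** omega_c F (fst w) (fst v) ** u_matrix (snd w)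
     + matrix_inv (u_matrix (snd w)) ** frechet_derivative u_matrix (at (snd w)) (snd v)"

text \<open>The ten forms \<open>((\<theta>\<^sup>1,\<dots>,\<theta>\<^sup>4), (\<Omega>\<^sub>1,\<dots>,\<Omega>\<^sub>6))\<close>, read off from the entries of \<open>omega_hat\<close>.\<close>

definition coframe ::
  "(real^4 \<Rightarrow> real) \<Rightarrow> (real^4) \<times> (real^6) \<Rightarrow> (real^4) \<times> (real^6) \<Rightarrow> (real^4) \<times> (real^6)" where
  "coframe F w v = sp4_coords (omega_hat F w v)"

definition is_coframe ::
  "'w::euclidean_space set \<Rightarrow> ('w \<Rightarrow> 'w \<Rightarrow> 'w) \<Rightarrow> bool" where
  "is_coframe P \<theta> \<longleftrightarrow> (\<forall>v. smooth_on P (\<lambda>w. \<theta> w v)) \<and> (\<forall>w\<in>P. linear (\<theta> w) \<and> bij (\<theta> w))"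

definition coframe_iso ::
  "(real^4) set \<Rightarrow> (real^4 \<Rightarrow> real) \<Rightarrow> (real^4) set \<Rightarrow> (real^4 \<Rightarrow> real) \<Rightarrow>
   ((real^4) \<times> (real^6)) set \<Rightarrow> ((real^4) \<times> (real^6)) set \<Rightarrow> ((real^4) \<times> (real^6) \<Rightarrow> (real^4) \<times> (real^6)) \<Rightarrow> bool" where
  "coframe_iso U F U' F' S S' \<Phi> \<longleftrightarrow> S \<subseteq> Pc U \<and> S' \<subseteq> Pc U' \<and> diffeo S S' \<Phi> \<and>
     (\<forall>w\<in>S. \<forall>v. coframe F' (\<Phi> w) (frechet_derivative \<Phi> (at w) v) = coframe F w v)"

definition coframe_equivalent ::
  "(real^4) set \<Rightarrow> (real^4 \<Rightarrow> real) \<Rightarrow> real^4 \<Rightarrow> (real^4) set \<Rightarrow> (real^4 \<Rightarrow> real) \<Rightarrow> real^4 \<Rightarrow> bool" where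
  "coframe_equivalent U F z U' F' z' \<longleftrightarrow>
     (\<exists>S S' \<Phi>. coframe_iso U F U' F' S S' \<Phi> \<and> (\<exists>w\<in>S. fst w = z \<and> fst (\<Phi> w) = z'))"

definition contact_transformation :: "(real^3) set \<Rightarrow> (real^3 \<Rightarrow> real^3) \<Rightarrow> bool" where
  "contact_transformation V f \<longleftrightarrow> diffeo V (f ` V) f \<and>
     (let \<xi> = \<lambda>z. f z $ 1; \<phi> = \<lambda>z. f z $ 2; \<psi> = \<lambda>z. f z $ 3 in
      \<forall>z\<in>V. \<psi> z * pd 3 \<xi> z = pd 3 \<phi> z \<and>
        \<psi> z * (pd 1 \<xi> z + z$3 * pd 2 \<xi> z) = pd 1 \<phi> z + z$3 * pd 2 \<phi> z)"

text \<open>The pullback of \<open>dy - p dx\<close> under a contact transformation is \<open>(\<phi>\<^sub>y - \<psi> \<chi>\<^sub>y) (dy - p dx)\<close>.\<close>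

definition cooriented :: "(real^3) set \<Rightarrow> (real^3 \<Rightarrow> real^3) \<Rightarrow> bool" where
  "cooriented V f \<longleftrightarrow>
     (\<forall>z\<in>V. pd 2 (\<lambda>z. f z $ 2) z - f z $ 3 * pd 2 (\<lambda>z. f z $ 1) z > 0)"

definition jet1 :: "real^4 \<Rightarrow> real^3" where
  "jet1 z = vector [z$1, z$2, z$3]"

definition total_D1 :: "(real^3 \<Rightarrow> real) \<Rightarrow> real^4 \<Rightarrow> real" where
  "total_D1 g z = pd 1 g (jet1 z) + z$3 * pd 2 g (jet1 z) + z$4 * pd 3 g (jet1 z)"

definition prolong :: "(real^3 \<Rightarrow> real^3) \<Rightarrow> real^4 \<Rightarrow> real^4" where
  "prolong f z = vector
     [f (jet1 z) $ 1, f (jet1 z) $ 2, f (jet1 z) $ 3,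
      total_D1 (\<lambda>z. f z $ 3) z / total_D1 (\<lambda>z. f z $ 1) z]"

text \<open>Over \<open>Z\<close>, the prolongation of \<open>f\<close> to third derivatives takes \<open>y''' = F\<close> to \<open>y''' = F'\<close>.  Along
  \<open>y''' = F\<close> the total derivative is \<open>total_D F\<close>.\<close>

definition maps_ode ::
  "(real^4) set \<Rightarrow> (real^4 \<Rightarrow> real) \<Rightarrow> (real^4) set \<Rightarrow> (real^4 \<Rightarrow> real) \<Rightarrow>
   (real^3) set \<Rightarrow> (real^3 \<Rightarrow> real^3) \<Rightarrow> (real^4) set \<Rightarrow> bool" where
  "maps_ode U F U' F' V f Z \<longleftrightarrow> open Z \<and> Z \<subseteq> U \<and>
     (\<forall>z\<in>Z. jet1 z \<in> V \<and> total_D1 (\<lambda>z. f z $ 1) z \<noteq> 0 \<and> prolong f z \<in> U' \<and>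
        F' (prolong f z) = total_D F (\<lambda>z. prolong f z $ 4) z / total_D F (\<lambda>z. prolong f z $ 1) z)"

text \<open>Local equivalence is stated for the germs of the two equations at given points \<open>z\<close> and \<open>z'\<close>.\<close>

definition contact_equivalent ::
  "(real^4) set \<Rightarrow> (real^4 \<Rightarrow> real) \<Rightarrow> real^4 \<Rightarrow> (real^4) set \<Rightarrow> (real^4 \<Rightarrow> real) \<Rightarrow> real^4 \<Rightarrow> bool" where
  "contact_equivalent U F z U' F' z' \<longleftrightarrow>
     (\<exists>V f Z. contact_transformation V f \<and> maps_ode U F U' F' V f Z \<and> z \<in> Z \<and> prolong f z = z')"

definition cooriented_contact_equivalent ::
  "(real^4) set \<Rightarrow> (real^4 \<Rightarrow> real) \<Rightarrow> real^4 \<Rightarrow> (real^4) set \<Rightarrow> (real^4 \<Rightarrow> real) \<Rightarrow> real^4 \<Rightarrow> bool" where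
  "cooriented_contact_equivalent U F z U' F' z' \<longleftrightarrow>
     (\<exists>V f Z. contact_transformation V f \<and> cooriented V f \<and> maps_ode U F U' F' V f Z \<and>
        z \<in> Z \<and> prolong f z = z')"

text \<open>The reflection \<open>(x,y) \<mapsto> (x,-y)\<close> reverses the coorientation of the contact structure.  Every matrix of
  \<open>H6\<close> has \<open>u\<^sub>1 > 0\<close>, and \<open>\<theta>\<^sup>1 = u\<^sub>1 \<omega>\<^sup>1\<close>, so maps preserving the coframe never reverse it.\<close>

definition reflect :: "real^4 \<Rightarrow> real^4" where
  "reflect z = vector [z$1, - z$2, - z$3, - z$4]"

definition reflect_ode :: "(real^4 \<Rightarrow> real) \<Rightarrow> real^4 \<Rightarrow> real" where
  "reflect_ode F z = - F (reflect z)"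

end

theory Submission
  imports Defs
begin

text \<open>
  The connection \<open>omega_hat\<close> is gauge-equivalent to the pullback of \<open>omega_c\<close>, so all conditions on its
  curvature that are invariant under \<open>H6\<close> need to be checked for \<open>omega_c\<close> only, where they reduce to
  identities between the derivatives of \<open>F\<close>.  The conditions \<open>normal_curvature\<close> are invariant, imply
  normality in the sense of Tanaka, and leave no freedom: an \<open>sp4\<close>-valued form that satisfies them and in
  which finitely many components are normalised as in \<open>omega_c\<close> equals \<open>omega_c\<close>.  Since the prolongation of a contact transformation
  between two equations preserves the filtration of \<open>J\<^sup>2\<close>, the pullback of the second connection agrees
  with the first one up to an \<open>H6\<close>-valued gauge function, and this gauge function lifts the transformation to the
  bundles.  Conversely, a map that preserves the coframe preserves the kernels of
  \<open>(\<theta>\<^sup>1, \<theta>\<^sup>2, \<theta>\<^sup>3, \<theta>\<^sup>4)\<close> and of \<open>(\<theta>\<^sup>1, \<theta>\<^sup>2, \<theta>\<^sup>4)\<close>, so it descends to \<open>J\<^sup>2\<close> and to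
  \<open>J\<^sup>1\<close>.  It preserves \<open>\<theta>\<^sup>1\<close>, hence the contact structure on \<open>J\<^sup>1\<close> with its coorientation, and it preserves the
  common kernel of \<open>\<theta>\<^sup>1, \<theta>\<^sup>2, \<theta>\<^sup>3\<close>, hence the solution curves.
\<close>

section \<open>Calculus of smooth maps\<close>

text \<open>How \<open>K_fun\<close>, \<open>L_fun\<close>, \<open>M_fun\<close> and
  \<open>W_fun\<close> change under a contact transformation is never computed: uniqueness of the
  normal connection takes the place of such formulas. The codifferential is awkward for that
  purpose, being tied to dual bases and the Killing form, whereas conditions on the columns of the
  curvature matrix are stable because right multiplication by an upper triangular matrix only adds
  earlier columns. The identities between derivatives are kept small by reading the definitions of
  \<open>K_fun\<close> and \<open>W_fun\<close> as rules for the total derivatives of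
  \<open>Dq F\<close> and \<open>K_fun F\<close>; the jets of \<open>F\<close>, \<open>K\<close> and
  \<open>W\<close> then count as independent symbols. The coordinates of \<open>H6\<close> allow
  both signs of \<open>u\<^sub>3\<close> but only \<open>u\<^sub>1 > 0\<close>, so a transformation
  that reverses the coorientation has no lift. Hence the equivalence is literal for cooriented maps
  and otherwise holds up to reflecting one of the equations. A diffeomorphism must have an inverse
  with derivatives of all orders, so the inverse function theorem is first raised to that
  class.\<close>

lemma Ck_on_cong_aux:
  assumes "open S"
  shows "Ck_on k S f \<Longrightarrow> (\<And>x. x \<in> S \<Longrightarrow> f x = g x) \<Longrightarrow> Ck_on k S g"
proof (induction k arbitrary: f g)
  case 0
  then show ?case by (simp cong: continuous_on_cong)
next
  case (Suc k)
  have f: "(f has_derivative frechet_derivative f (at x)) (at x)" if "x \<in> S" for x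
    using Suc.prems(1) that by (auto simp: frechet_derivative_works)
  have g: "(g has_derivative frechet_derivative f (at x)) (at x)" if "x \<in> S" for x
    by (rule has_derivative_transform_within_open[OF f[OF that] assms that Suc.prems(2)])
  then have eq: "frechet_derivative f (at x) = frechet_derivative g (at x)" if "x \<in> S" for x
    using that frechet_derivative_at by blast
  have "Ck_on k S (\<lambda>x. frechet_derivative g (at x) v)" for v
    by (rule Suc.IH[of "\<lambda>x. frechet_derivative f (at x) v"]) (use Suc.prems(1) eq in auto)
  then show ?case
    using g by (auto simp: differentiable_def)
qed

text \<open>Any derivative \<open>f'\<close> may be supplied by hand: derivatives are unique, so it
  agrees with \<open>frechet_derivative\<close> on \<open>S\<close>. Smoothness proofs can thus
  choose a form of the derivative for which the induction on the order closes.\<close>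

lemma Ck_on_Suc_intro:
  assumes "\<And>x. x \<in> S \<Longrightarrow> (f has_derivative f' x) (at x)" and "open S"
    and "\<And>v. Ck_on k S (\<lambda>x. f' x v)"
  shows "Ck_on (Suc k) S f"
proof -
  have "f' x = frechet_derivative f (at x)" if "x \<in> S" for x
    using assms(1)[OF that] frechet_derivative_at by blast
  then have "Ck_on k S (\<lambda>x. frechet_derivative f (at x) v)" for v
    by (intro Ck_on_cong_aux[OF assms(2) assms(3)[of v]]) auto
  then show ?thesis
    using assms(1) by (auto simp: differentiable_def)
qed

lemma Ck_on_cong:
  assumes "open S" "\<And>x. x \<in> S \<Longrightarrow> f x = g x"
  shows "Ck_on k S f \<longleftrightarrow> Ck_on k S g"
  using Ck_on_cong_aux[OF assms(1)] assms(2) by metis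

lemma Ck_on_has_derivative:
  "Ck_on (Suc k) S f \<Longrightarrow> x \<in> S \<Longrightarrow> (f has_derivative frechet_derivative f (at x)) (at x)"
  by (auto simp: frechet_derivative_works)

lemma Ck_on_SucD: "Ck_on (Suc k) S f \<Longrightarrow> Ck_on k S f"
proof (induction k arbitrary: f)
  case 0
  then show ?case
    by (auto intro!: continuous_at_imp_continuous_on differentiable_imp_continuous_within)
qed simp

lemma Ck_on_subset: "Ck_on k S f \<Longrightarrow> T \<subseteq> S \<Longrightarrow> Ck_on k T f"
  by (induction k arbitrary: f) (auto intro: continuous_on_subset)

lemma Ck_on_const: "open S \<Longrightarrow> Ck_on k S (\<lambda>_. c)"
proof (induction k arbitrary: c)
  case (Suc k)
  then show ?case by (intro Ck_on_Suc_intro[where f' = "\<lambda>_ _. 0"]) auto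
qed auto

lemma Ck_on_bounded_linear:
  assumes "open S" "bounded_linear L"
  shows "Ck_on k S f \<Longrightarrow> Ck_on k S (\<lambda>x. L (f x))"
proof (induction k arbitrary: f)
  case 0
  then show ?case
    using bounded_linear.continuous_on[OF assms(2)] by auto
next
  case (Suc k)
  show ?case
  proof (rule Ck_on_Suc_intro)
    show "((\<lambda>x. L (f x)) has_derivative (\<lambda>v. L (frechet_derivative f (at x) v))) (at x)" if "x \<in> S" for x
      using bounded_linear.has_derivative[OF assms(2) Ck_on_has_derivative[OF Suc.prems that]] .
    show "Ck_on k S (\<lambda>x. L (frechet_derivative f (at x) v))" for v
      using Suc by auto
  qed (use assms in auto)
qed

lemma Ck_on_add:
  assumes "open S"
  shows "Ck_on k S f \<Longrightarrow> Ck_on k S g \<Longrightarrow> Ck_on k S (\<lambda>x. f x + g x)"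
proof (induction k arbitrary: f g)
  case 0
  then show ?case by (auto intro: continuous_on_add)
next
  case (Suc k)
  show ?case
  proof (rule Ck_on_Suc_intro)
    show "((\<lambda>x. f x + g x) has_derivative
        (\<lambda>v. frechet_derivative f (at x) v + frechet_derivative g (at x) v)) (at x)" if "x \<in> S" for x
      by (rule has_derivative_add[OF Ck_on_has_derivative[OF Suc.prems(1) that] Ck_on_has_derivative[OF Suc.prems(2) that]])
    show "Ck_on k S (\<lambda>x. frechet_derivative f (at x) v + frechet_derivative g (at x) v)" for v
      by (rule Suc.IH) (use Suc.prems in auto)
  qed (use assms in auto)
qed

lemma (in bounded_bilinear) Ck_on_bilinear:
  assumes "open S"
  shows "Ck_on k S f \<Longrightarrow> Ck_on k S g \<Longrightarrow> Ck_on k S (\<lambda>x. prod (f x) (g x))"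
proof (induction k arbitrary: f g)
  case 0
  then show ?case by (auto intro: continuous_on)
next
  case (Suc k)
  show ?case
  proof (rule Ck_on_Suc_intro)
    show "((\<lambda>x. prod (f x) (g x)) has_derivative
        (\<lambda>v. prod (f x) (frechet_derivative g (at x) v) + prod (frechet_derivative f (at x) v) (g x))) (at x)"
      if "x \<in> S" for x
      using FDERIV[OF Ck_on_has_derivative[OF Suc.prems(1) that] Ck_on_has_derivative[OF Suc.prems(2) that]] .
    show "Ck_on k S (\<lambda>x. prod (f x) (frechet_derivative g (at x) v) + prod (frechet_derivative f (at x) v) (g x))" for v
      using Suc.prems by (intro Ck_on_add assms Suc.IH Suc.prems[THEN Ck_on_SucD]) auto
  qed (use assms in auto)
qed

lemma Ck_on_sum:
  assumes "open S" "finite I" "\<And>i. i \<in> I \<Longrightarrow> Ck_on k S (f i)"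
  shows "Ck_on k S (\<lambda>x. \<Sum>i\<in>I. f i x)"
  using assms(2,3)
  by (induction I) (auto simp: Ck_on_const Ck_on_add assms(1))

lemma linear_eq_sum_Basis:
  fixes L :: "'a::euclidean_space \<Rightarrow> 'b::real_vector"
  assumes "linear L"
  shows "L v = (\<Sum>b\<in>Basis. (v \<bullet> b) *\<^sub>R L b)"
proof -
  have "L v = L (\<Sum>b\<in>Basis. (v \<bullet> b) *\<^sub>R b)" by (simp only: euclidean_representation)
  then show ?thesis by (simp add: linear_sum[OF assms] linear_cmul[OF assms])
qed

text \<open>The chain rule applies the derivative of \<open>g\<close> at \<open>f x\<close> to a
  vector that moves with \<open>x\<close>. Expanding this vector in \<open>Basis\<close> leaves
  derivatives of \<open>g\<close> in fixed directions, composed with \<open>f\<close>, and to these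
  the induction hypothesis applies; \<open>f\<close> stays fixed in the induction.\<close>

lemma Ck_on_compose:
  fixes f :: "'a::euclidean_space \<Rightarrow> 'b::euclidean_space"
  assumes "open S" "open T" "f ` S \<subseteq> T"
  shows "Ck_on k T g \<Longrightarrow> Ck_on k S f \<Longrightarrow> Ck_on k S (\<lambda>x. g (f x))"
proof (induction k arbitrary: g)
  case 0
  then show ?case
    using assms(3) by (auto intro: continuous_on_compose2)
next
  case (Suc k)
  show ?case
  proof (rule Ck_on_Suc_intro)
    show "((\<lambda>x. g (f x)) has_derivative
       (\<lambda>v. \<Sum>b\<in>Basis. (frechet_derivative f (at x) v \<bullet> b) *\<^sub>R frechet_derivative g (at (f x)) b)) (at x)"
      if "x \<in> S" for x
    proof -
      have g: "(g has_derivative frechet_derivative g (at (f x))) (at (f x))"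
        using Ck_on_has_derivative[OF Suc.prems(1)] assms(3) that by auto
      have "linear (frechet_derivative g (at (f x)))"
        using g has_derivative_linear by blast
      note eq = linear_eq_sum_Basis[OF this]
      show ?thesis
        using has_derivative_compose[OF Ck_on_has_derivative[OF Suc.prems(2) that] g]
        by (rule has_derivative_eq_rhs) (rule ext, rule eq)
    qed
    show "Ck_on k S (\<lambda>x. \<Sum>b\<in>Basis. (frechet_derivative f (at x) v \<bullet> b) *\<^sub>R frechet_derivative g (at (f x)) b)" for v
    proof (intro Ck_on_sum bounded_bilinear.Ck_on_bilinear[OF bounded_bilinear_scaleR] assms finite_Basis)
      show "Ck_on k S (\<lambda>x. frechet_derivative f (at x) v \<bullet> b)" for b
        by (rule Ck_on_bounded_linear[OF assms(1) bounded_linear_inner_left]) (use Suc.prems in simp)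
      show "Ck_on k S (\<lambda>x. frechet_derivative g (at (f x)) b)" for b
        by (rule Suc.IH[OF _ Ck_on_SucD[OF Suc.prems(2)]]) (use Suc.prems in simp)
    qed
  qed (use assms in auto)
qed

lemma smooth_on_CkI: "(\<And>k. Ck_on k S f) \<Longrightarrow> smooth_on S f"
  by (simp add: smooth_on_def)

lemma smooth_on_cong:
  "open S \<Longrightarrow> (\<And>x. x \<in> S \<Longrightarrow> f x = g x) \<Longrightarrow> smooth_on S f \<longleftrightarrow> smooth_on S g"
  unfolding smooth_on_def by (metis Ck_on_cong)

lemma smooth_on_subset: "smooth_on S f \<Longrightarrow> T \<subseteq> S \<Longrightarrow> smooth_on T f"
  unfolding smooth_on_def using Ck_on_subset by blast

lemma smooth_on_has_derivative:
  "smooth_on S f \<Longrightarrow> x \<in> S \<Longrightarrow> (f has_derivative frechet_derivative f (at x)) (at x)"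
  unfolding smooth_on_def using Ck_on_has_derivative by blast

lemma smooth_on_linear_derivative:
  "smooth_on S f \<Longrightarrow> x \<in> S \<Longrightarrow> linear (frechet_derivative f (at x))"
  using smooth_on_has_derivative has_derivative_linear by blast

lemma smooth_on_continuous_on: "smooth_on S f \<Longrightarrow> continuous_on S f"
  unfolding smooth_on_def by (metis Ck_on.simps(1))

lemma smooth_on_derivative: "smooth_on S f \<Longrightarrow> smooth_on S (\<lambda>x. frechet_derivative f (at x) v)"
  unfolding smooth_on_def by (metis Ck_on.simps(2))

lemma smooth_on_const: "open S \<Longrightarrow> smooth_on S (\<lambda>_. c)"
  by (simp add: smooth_on_def Ck_on_const)

lemma smooth_on_bounded_linear:
  "bounded_linear L \<Longrightarrow> open S \<Longrightarrow> smooth_on S f \<Longrightarrow> smooth_on S (\<lambda>x. L (f x))"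
  by (simp add: smooth_on_def Ck_on_bounded_linear)

lemma smooth_on_id: "open S \<Longrightarrow> smooth_on S (\<lambda>x. x)"
  unfolding smooth_on_def
proof
  fix k assume "open S"
  then show "Ck_on k S (\<lambda>x. x)"
    by (cases k) (auto intro!: Ck_on_Suc_intro[where f' = "\<lambda>_ v. v"] Ck_on_const continuous_on_id)
qed

lemma smooth_on_add: "open S \<Longrightarrow> smooth_on S f \<Longrightarrow> smooth_on S g \<Longrightarrow> smooth_on S (\<lambda>x. f x + g x)"
  by (simp add: smooth_on_def Ck_on_add)

lemma (in bounded_bilinear) smooth_on_bilinear:
  "open S \<Longrightarrow> smooth_on S f \<Longrightarrow> smooth_on S g \<Longrightarrow> smooth_on S (\<lambda>x. prod (f x) (g x))"
  by (simp add: smooth_on_def Ck_on_bilinear)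

lemmas smooth_on_scaleR = bounded_bilinear.smooth_on_bilinear[OF bounded_bilinear_scaleR]
lemmas smooth_on_mult = bounded_bilinear.smooth_on_bilinear[OF bounded_bilinear_mult]

lemma smooth_on_minus: "open S \<Longrightarrow> smooth_on S f \<Longrightarrow> smooth_on S (\<lambda>x. - f x)"
  using smooth_on_bounded_linear[OF bounded_linear_minus[OF bounded_linear_ident]] .

lemma smooth_on_diff: "open S \<Longrightarrow> smooth_on S f \<Longrightarrow> smooth_on S g \<Longrightarrow> smooth_on S (\<lambda>x. f x - g x)"
  using smooth_on_add[of S f "\<lambda>x. - g x"] smooth_on_minus by auto

lemma smooth_on_sum:
  "open S \<Longrightarrow> finite I \<Longrightarrow> (\<And>i. i \<in> I \<Longrightarrow> smooth_on S (f i)) \<Longrightarrow> smooth_on S (\<lambda>x. \<Sum>i\<in>I. f i x)"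
  by (simp add: smooth_on_def Ck_on_sum)

lemma smooth_on_power:
  fixes f :: "_ \<Rightarrow> real"
  shows "open S \<Longrightarrow> smooth_on S f \<Longrightarrow> smooth_on S (\<lambda>x. f x ^ n)"
  by (induction n) (auto intro: smooth_on_const smooth_on_mult)

lemma smooth_on_compose:
  fixes f :: "'a::euclidean_space \<Rightarrow> 'b::euclidean_space"
  assumes "open S" "open T" "f ` S \<subseteq> T" "smooth_on T g" "smooth_on S f"
  shows "smooth_on S (\<lambda>x. g (f x))"
  using Ck_on_compose[OF assms(1-3)] assms(4,5) unfolding smooth_on_def by metis

text \<open>The derivative is a polynomial in the inverse itself, so order k + 1 follows from order
  k.\<close>

lemma smooth_on_inverse_real: "smooth_on (- {0}) (inverse :: real \<Rightarrow> real)"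
proof (rule smooth_on_CkI)
  fix k
  have o: "open (- {0::real})" by auto
  show "Ck_on k (- {0}) (inverse :: real \<Rightarrow> real)"
  proof (induction k)
    case 0
    then show ?case by (auto intro!: continuous_intros)
  next
    case (Suc k)
    have "Ck_on k (-{0}) (\<lambda>x::real. - (inverse x * inverse x) * v)" for v
      by (intro bounded_bilinear.Ck_on_bilinear[OF bounded_bilinear_mult] Ck_on_const o Suc
          Ck_on_bounded_linear[OF _ bounded_linear_minus[OF bounded_linear_ident]])
    then show ?case
      by (intro Ck_on_Suc_intro[where f' = "\<lambda>x v. - (inverse x * inverse x) * v"] o)
        (auto intro!: derivative_eq_intros simp: o algebra_simps)
  qed
qed

lemma smooth_on_sqrt_real: "smooth_on {0<..} sqrt"
proof (rule smooth_on_CkI)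
  fix k
  have o: "open {0::real<..}" by auto
  show "Ck_on k {0<..} sqrt"
  proof (induction k)
    case 0
    then show ?case by (auto intro!: continuous_intros)
  next
    case (Suc k)
    \<comment> \<open>The derivative of the root is half the inverse of the root, so order k of
      \<open>sqrt\<close> composed with the smooth inverse gives order k of the derivative.\<close>
    have "Ck_on k {0<..} (\<lambda>x::real. inverse (sqrt x))"
      by (rule Ck_on_compose[where T = "- {0}"])
        (use Suc smooth_on_inverse_real in \<open>auto simp: smooth_on_def\<close>)
    then have "Ck_on k {0<..} (\<lambda>x. (inverse (sqrt x) * (1/2)) * v)" for v
      by (intro bounded_bilinear.Ck_on_bilinear[OF bounded_bilinear_mult] Ck_on_const o)
    then show ?case
      by (intro Ck_on_Suc_intro[where f' = "\<lambda>x v. (inverse (sqrt x) * (1/2)) * v"] o)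
        (auto intro!: derivative_eq_intros simp: o field_simps)
  qed
qed

lemma smooth_on_inverse:
  fixes f :: "'a::euclidean_space \<Rightarrow> real"
  assumes "open S" "smooth_on S f" "\<And>x. x \<in> S \<Longrightarrow> f x \<noteq> 0"
  shows "smooth_on S (\<lambda>x. inverse (f x))"
  by (rule smooth_on_compose[OF assms(1) _ _ smooth_on_inverse_real assms(2)]) (use assms(3) in auto)

lemma smooth_on_divide:
  fixes f :: "'a::euclidean_space \<Rightarrow> real"
  assumes "open S" "smooth_on S f" "smooth_on S g" "\<And>x. x \<in> S \<Longrightarrow> g x \<noteq> 0"
  shows "smooth_on S (\<lambda>x. f x / g x)"
  unfolding divide_inverse by (intro smooth_on_mult smooth_on_inverse assms)

lemma smooth_on_sqrt:
  fixes f :: "'a::euclidean_space \<Rightarrow> real"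
  assumes "open S" "smooth_on S f" "\<And>x. x \<in> S \<Longrightarrow> f x > 0"
  shows "smooth_on S (\<lambda>x. sqrt (f x))"
  by (rule smooth_on_compose[OF assms(1) _ _ smooth_on_sqrt_real assms(2)]) (use assms(3) in auto)

lemma smooth_on_vec_nth: "open S \<Longrightarrow> smooth_on S f \<Longrightarrow> smooth_on S (\<lambda>x. f x $ i)"
  by (rule smooth_on_bounded_linear[OF bounded_linear_vec_nth])

lemma smooth_on_fst: "open S \<Longrightarrow> smooth_on S f \<Longrightarrow> smooth_on S (\<lambda>x. fst (f x))"
  by (rule smooth_on_bounded_linear[OF bounded_linear_fst])

lemma smooth_on_snd: "open S \<Longrightarrow> smooth_on S f \<Longrightarrow> smooth_on S (\<lambda>x. snd (f x))"
  by (rule smooth_on_bounded_linear[OF bounded_linear_snd])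

lemma smooth_on_vec:
  fixes f :: "'a::euclidean_space \<Rightarrow> ('b::euclidean_space)^'n"
  assumes "open S" "\<And>i. smooth_on S (\<lambda>x. f x $ i)"
  shows "smooth_on S f"
proof -
  have "bounded_linear (axis i :: 'b \<Rightarrow> 'b^'n)" for i
    unfolding linear_conv_bounded_linear[symmetric]
    by (rule linearI) (auto simp: vec_eq_iff axis_def)
  then have "smooth_on S (\<lambda>x. axis i (f x $ i))" for i
    by (rule smooth_on_bounded_linear[OF _ assms])
  then have "smooth_on S (\<lambda>x. \<Sum>i\<in>UNIV. axis i (f x $ i))"
    by (intro smooth_on_sum assms(1)) auto
  moreover have "(\<Sum>i\<in>UNIV. axis i (f x $ i)) = f x" for x
    by (auto simp: vec_eq_iff axis_def sum.delta if_distrib cong: if_cong)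
  ultimately show ?thesis by simp
qed

lemma smooth_on_Pair:
  assumes "open S" "smooth_on S f" "smooth_on S g"
  shows "smooth_on S (\<lambda>x. (f x, g x))"
proof -
  have "smooth_on S (\<lambda>x. (f x, 0) + (0, g x))"
    by (rule smooth_on_add[OF assms(1)
        smooth_on_bounded_linear[OF bounded_linear_Pair[OF bounded_linear_ident bounded_linear_zero] assms(1,2)]
        smooth_on_bounded_linear[OF bounded_linear_Pair[OF bounded_linear_zero bounded_linear_ident] assms(1,3)]])
  then show ?thesis by simp
qed

lemmas smooth_intros = smooth_on_const smooth_on_id smooth_on_add smooth_on_diff smooth_on_minus
  smooth_on_mult smooth_on_scaleR smooth_on_power smooth_on_vec_nth smooth_on_fst smooth_on_snd
  smooth_on_Pair

subsection \<open>Symmetry of second derivatives\<close>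

text \<open>Two applications of the mean value theorem: to \<open>?g\<close>, which moves along
  \<open>v\<close> and already contains the difference along \<open>w\<close>, and then to the
  directional derivative along \<open>v\<close> while moving along \<open>w\<close>. The bound by
  \<open>r\<close> keeps the whole parallelogram in the ball.\<close>

lemma smooth_on_second_difference:
  fixes f :: "'a::euclidean_space \<Rightarrow> real"
  assumes f: "smooth_on S f" and r: "cball x r \<subseteq> S" and t: "0 < t" "t * (norm v + norm w) \<le> r"
  obtains a b where "a \<in> {0<..<t}" "b \<in> {0<..<t}"
    "f (x + t *\<^sub>R v + t *\<^sub>R w) - f (x + t *\<^sub>R v) - f (x + t *\<^sub>R w) + f x
      = t * (t * frechet_derivative (\<lambda>x. frechet_derivative f (at x) v) (at (x + a *\<^sub>R v + b *\<^sub>R w)) w)"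
proof -
  have inS: "x + a *\<^sub>R v + b *\<^sub>R w \<in> S" if "a \<in> {0..t}" "b \<in> {0..t}" for a b
  proof -
    have "norm (a *\<^sub>R v + b *\<^sub>R w) \<le> norm (a *\<^sub>R v) + norm (b *\<^sub>R w)" by (rule norm_triangle_ineq)
    also have "\<dots> \<le> t * norm v + t * norm w"
      using that by (auto intro!: add_mono mult_right_mono)
    also have "\<dots> \<le> r" using t by (simp add: distrib_left)
    finally have "x + a *\<^sub>R v + b *\<^sub>R w \<in> cball x r"
      by (metis add.assoc add_diff_cancel_left' dist_commute dist_norm mem_cball)
    then show ?thesis using r by blast
  qed
  let ?g = "\<lambda>s. f (x + s *\<^sub>R v + t *\<^sub>R w) - f (x + s *\<^sub>R v)"
  let ?D = "\<lambda>y. frechet_derivative f (at y) v"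
  have dir: "((\<lambda>s. h (y + s *\<^sub>R u)) has_real_derivative frechet_derivative h (at (y + s *\<^sub>R u)) u) (at s)"
    if "smooth_on S h" "y + s *\<^sub>R u \<in> S" for h :: "'a \<Rightarrow> real" and y u s
  proof -
    have l: "linear (frechet_derivative h (at (y + s *\<^sub>R u)))"
      using that smooth_on_linear_derivative by blast
    have "((\<lambda>s. y + s *\<^sub>R u) has_derivative (\<lambda>k. k *\<^sub>R u)) (at s)"
      by (auto intro!: derivative_eq_intros)
    from has_derivative_compose[OF this smooth_on_has_derivative[OF that]]
    show ?thesis
      unfolding has_field_derivative_def
      by (rule has_derivative_eq_rhs) (auto simp: linear_cmul[OF l])
  qed
  have "\<exists>a. 0 < a \<and> a < t \<and> ?g t - ?g 0 = (t - 0) * (?D (x + a *\<^sub>R v + t *\<^sub>R w) - ?D (x + a *\<^sub>R v))"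
  proof (rule MVT2)
    fix s assume s: "0 \<le> s" "s \<le> t"
    have "((\<lambda>s. f ((x + t *\<^sub>R w) + s *\<^sub>R v)) has_real_derivative ?D ((x + t *\<^sub>R w) + s *\<^sub>R v)) (at s)"
      by (rule dir[OF f]) (use inS[of s t] s in \<open>simp add: algebra_simps\<close>)
    moreover have "((\<lambda>s. f (x + s *\<^sub>R v)) has_real_derivative ?D (x + s *\<^sub>R v)) (at s)"
      by (rule dir[OF f]) (use inS[of s 0] s in simp)
    ultimately show "(?g has_real_derivative ?D (x + s *\<^sub>R v + t *\<^sub>R w) - ?D (x + s *\<^sub>R v)) (at s)"
      by (intro DERIV_diff) (auto simp: add_ac)
  qed (use t in auto)
  then obtain a where a: "0 < a" "a < t" "?g t - ?g 0 = t * (?D (x + a *\<^sub>R v + t *\<^sub>R w) - ?D (x + a *\<^sub>R v))"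
    by auto
  have "\<exists>b. 0 < b \<and> b < t \<and> ?D (x + a *\<^sub>R v + t *\<^sub>R w) - ?D (x + a *\<^sub>R v + 0 *\<^sub>R w)
     = (t - 0) * frechet_derivative ?D (at (x + a *\<^sub>R v + b *\<^sub>R w)) w"
    by (rule MVT2) (use t a inS in \<open>auto intro!: dir smooth_on_derivative f\<close>)
  then obtain b where "0 < b" "b < t" "?D (x + a *\<^sub>R v + t *\<^sub>R w) - ?D (x + a *\<^sub>R v)
     = t * frechet_derivative ?D (at (x + a *\<^sub>R v + b *\<^sub>R w)) w" by auto
  with a that[of a b] show thesis by (auto simp: algebra_simps)
qed

text \<open>The second difference is symmetric in \<open>v\<close> and \<open>w\<close>, so the two
  mixed derivatives agree at two points close to \<open>x\<close>; continuity moves both points to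
  \<open>x\<close>.\<close>

lemma smooth_on_symmetric_real:
  fixes f :: "'a::euclidean_space \<Rightarrow> real"
  assumes "open S" and f: "smooth_on S f" and "x \<in> S"
  shows "frechet_derivative (\<lambda>x. frechet_derivative f (at x) v) (at x) w =
    frechet_derivative (\<lambda>x. frechet_derivative f (at x) w) (at x) v"
proof -
  obtain r where r: "r > 0" "cball x r \<subseteq> S"
    using assms open_contains_cball by blast
  define A where "A v w y = frechet_derivative (\<lambda>x. frechet_derivative f (at x) v) (at y) w" for v w y
  have cA: "isCont (A v w) x" for v w
    using smooth_on_continuous_on[OF smooth_on_derivative[OF smooth_on_derivative[OF f]]] assms(1,3)
    unfolding A_def by (simp add: continuous_on_eq_continuous_at)
  have lim: "A v w x \<le> A w v x + e" if e: "e > 0" for v w e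
  proof -
    let ?n = "norm v + norm w + 1"
    have n: "?n > 0" by (simp add: add_nonneg_pos)
    obtain d1 where d1: "d1 > 0" "\<And>y. dist y x < d1 \<Longrightarrow> dist (A v w y) (A v w x) < e/2"
      using cA[of v w] e unfolding continuous_at_eps_delta by (metis half_gt_zero_iff)
    obtain d2 where d2: "d2 > 0" "\<And>y. dist y x < d2 \<Longrightarrow> dist (A w v y) (A w v x) < e/2"
      using cA[of w v] e unfolding continuous_at_eps_delta by (metis half_gt_zero_iff)
    \<comment> \<open>Small enough for both continuity radii and for the parallelogram to stay in
      the ball; the summand 1 in \<open>?n\<close> covers the case that both vectors are
      zero.\<close>
    define t where "t = min r (min d1 d2) / ?n"
    have t: "t > 0" using r d1 d2 n by (simp add: t_def)
    have "t * ?n = min r (min d1 d2)" using n by (simp add: t_def)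
    then have tr: "t * (norm v + norm w) \<le> r" "t * (norm w + norm v) \<le> r" "t * (norm v + norm w) < d1" "t * (norm v + norm w) < d2"
      using t by (auto simp: distrib_left)
    have near: "dist (x + a *\<^sub>R v + b *\<^sub>R w) x \<le> t * (norm v + norm w)" if "a \<in> {0<..<t}" "b \<in> {0<..<t}" for a b
    proof -
      have "dist (x + a *\<^sub>R v + b *\<^sub>R w) x \<le> norm (a *\<^sub>R v) + norm (b *\<^sub>R w)"
        by (metis add.assoc add_diff_cancel_left' dist_norm norm_triangle_ineq)
      also have "\<dots> \<le> t * norm v + t * norm w"
        using that by (auto intro!: add_mono mult_right_mono)
      finally show ?thesis by (simp add: distrib_left)
    qed
    obtain a b where ab: "a \<in> {0<..<t}" "b \<in> {0<..<t}"
      "f (x + t *\<^sub>R v + t *\<^sub>R w) - f (x + t *\<^sub>R v) - f (x + t *\<^sub>R w) + f x = t * (t * A v w (x + a *\<^sub>R v + b *\<^sub>R w))"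
      using smooth_on_second_difference[OF f r(2) t tr(1)] unfolding A_def by metis
    obtain a' b' where ab': "a' \<in> {0<..<t}" "b' \<in> {0<..<t}"
      "f (x + t *\<^sub>R w + t *\<^sub>R v) - f (x + t *\<^sub>R w) - f (x + t *\<^sub>R v) + f x = t * (t * A w v (x + a' *\<^sub>R w + b' *\<^sub>R v))"
      using smooth_on_second_difference[OF f r(2) t tr(2)] unfolding A_def by metis
    have sw: "x + a' *\<^sub>R w + b' *\<^sub>R v = x + b' *\<^sub>R v + a' *\<^sub>R w" "x + t *\<^sub>R w + t *\<^sub>R v = x + t *\<^sub>R v + t *\<^sub>R w"
      by (simp_all add: add_ac)
    have "t * (t * A v w (x + a *\<^sub>R v + b *\<^sub>R w)) = t * (t * A w v (x + b' *\<^sub>R v + a' *\<^sub>R w))"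
      using ab(3) ab'(3) unfolding sw by linarith
    then have "A v w (x + a *\<^sub>R v + b *\<^sub>R w) = A w v (x + b' *\<^sub>R v + a' *\<^sub>R w)"
      using t by simp
    moreover have "dist (A v w (x + a *\<^sub>R v + b *\<^sub>R w)) (A v w x) < e/2"
      using d1(2) near[OF ab(1,2)] tr by (meson le_less_trans)
    moreover have "dist (A w v (x + b' *\<^sub>R v + a' *\<^sub>R w)) (A w v x) < e/2"
      using d2(2) near[OF ab'(2,1)] tr by (meson le_less_trans)
    ultimately show ?thesis unfolding dist_real_def by linarith
  qed
  have "A v w x \<le> A w v x" "A w v x \<le> A v w x"
    using lim field_le_epsilon by blast+
  then show ?thesis by (simp add: A_def)
qed

lemma frechet_derivative_bounded_linear:
  assumes "bounded_linear L" "f differentiable (at x)"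
  shows "frechet_derivative (\<lambda>x. L (f x)) (at x) v = L (frechet_derivative f (at x) v)"
  using bounded_linear.has_derivative[OF assms(1)] assms(2)
  by (metis frechet_derivative_at frechet_derivative_works)

lemma smooth_on_differentiable: "smooth_on S f \<Longrightarrow> x \<in> S \<Longrightarrow> f differentiable (at x)"
  using smooth_on_has_derivative differentiable_def by blast

lemma smooth_on_symmetric:
  fixes f :: "'a::euclidean_space \<Rightarrow> 'b::euclidean_space"
  assumes "open S" and f: "smooth_on S f" and x: "x \<in> S"
  shows "frechet_derivative (\<lambda>x. frechet_derivative f (at x) v) (at x) w =
    frechet_derivative (\<lambda>x. frechet_derivative f (at x) w) (at x) v"
proof (rule euclidean_eqI)
  fix b :: 'b assume "b \<in> Basis"
  let ?L = "\<lambda>y::'b. y \<bullet> b"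
  have L: "bounded_linear ?L" by (rule bounded_linear_inner_left)
  have 1: "frechet_derivative f (at y) u \<bullet> b = frechet_derivative (\<lambda>x. f x \<bullet> b) (at y) u" if "y \<in> S" for y u
    using frechet_derivative_bounded_linear[OF L smooth_on_differentiable[OF f that]] by simp
  have 2: "frechet_derivative (\<lambda>x. frechet_derivative f (at x) u) (at x) u' \<bullet> b
      = frechet_derivative (\<lambda>x. frechet_derivative (\<lambda>x. f x \<bullet> b) (at x) u) (at x) u'" for u u'
  proof -
    note d = smooth_on_differentiable[OF smooth_on_derivative[OF f] x, of u]
    have "frechet_derivative (\<lambda>x. frechet_derivative f (at x) u) (at x) u' \<bullet> b
      = frechet_derivative (\<lambda>x. frechet_derivative f (at x) u \<bullet> b) (at x) u'"
      using frechet_derivative_bounded_linear[OF L d] by simp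
    also have "\<dots> = frechet_derivative (\<lambda>x. frechet_derivative (\<lambda>x. f x \<bullet> b) (at x) u) (at x) u'"
      by (rule fun_cong[OF frechet_derivative_transform_within_open[OF _ assms(1) x]])
        (use d L 1 in \<open>auto intro: differentiable_compose bounded_linear_imp_differentiable\<close>)
    finally show ?thesis .
  qed
  show "frechet_derivative (\<lambda>x. frechet_derivative f (at x) v) (at x) w \<bullet> b =
    frechet_derivative (\<lambda>x. frechet_derivative f (at x) w) (at x) v \<bullet> b"
    unfolding 2 by (rule smooth_on_symmetric_real[OF assms(1) _ x]) (rule smooth_on_bounded_linear[OF L assms(1) f])
qed

subsection \<open>The smooth inverse function theorem\<close>

text \<open>The differentiability of \<open>x \<mapsto> (Df x)\<inverse> w\<close> is read off from the inverse of the map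
  \<open>(x, v) \<mapsto> (x, Df x v)\<close>.\<close>

lemma smooth_on_inverse_derivative_aux:
  fixes f :: "'a::euclidean_space \<Rightarrow> 'a"
  assumes "open S" and f: "smooth_on S f" and bij: "\<And>x. x \<in> S \<Longrightarrow> bij (frechet_derivative f (at x))"
    and x: "x \<in> S"
  shows "((\<lambda>x. inv_into UNIV (frechet_derivative f (at x)) w) has_derivative
    (\<lambda>a. - (\<Sum>c\<in>Basis. \<Sum>b\<in>Basis. ((inv_into UNIV (frechet_derivative f (at x)) w \<bullet> c) *
       (frechet_derivative (\<lambda>x. frechet_derivative f (at x) c) (at x) a \<bullet> b)) *\<^sub>R
         inv_into UNIV (frechet_derivative f (at x)) b))) (at x)"
proof -
  define T where "T x = inv_into UNIV (frechet_derivative f (at x))" for x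
  define d where "d c x = frechet_derivative f (at x) c" for c x
  define Psi where "Psi p = (fst p, \<Sum>c\<in>Basis. (snd p \<bullet> c) *\<^sub>R d c (fst p))" for p :: "'a \<times> 'a"
  define Th where "Th p = (fst p, T (fst p) (snd p))" for p :: "'a \<times> 'a"
  have lin: "linear (frechet_derivative f (at x))" if "x \<in> S" for x
    using smooth_on_linear_derivative[OF f that] .
  have sumd: "(\<Sum>c\<in>Basis. (v \<bullet> c) *\<^sub>R d c x) = frechet_derivative f (at x) v" if "x \<in> S" for x v
    using linear_eq_sum_Basis[OF lin[OF that], of v] by (simp add: d_def)
  have TD: "T x (frechet_derivative f (at x) v) = v" "frechet_derivative f (at x) (T x v) = v" if "x \<in> S" for x v
    using bij[OF that] by (auto simp: T_def bij_is_inj bij_is_surj surj_f_inv_f)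
  have linT: "linear (T x)" if "x \<in> S" for x
  proof (rule linearI)
    show "T x (u + v) = T x u + T x v" for u v
      using TD(1)[OF that, of "T x u + T x v"] by (simp add: TD[OF that] linear_add[OF lin[OF that]])
    show "T x (r *\<^sub>R v) = r *\<^sub>R T x v" for r v
      using TD(1)[OF that, of "r *\<^sub>R T x v"] by (simp add: TD[OF that] linear_cmul[OF lin[OF that]])
  qed
  let ?v = "T x w"
  let ?d2 = "\<lambda>a. \<Sum>c\<in>Basis. (?v \<bullet> c) *\<^sub>R frechet_derivative (d c) (at x) a"
  let ?Psi' = "\<lambda>p. (fst p, ?d2 (fst p) + frechet_derivative f (at x) (snd p))"
  \<comment> \<open>The derivative of \<open>Psi\<close> is block triangular, with the identity and
    the derivative of \<open>f\<close> on the diagonal, hence this explicit inverse.\<close>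
  let ?Th' = "\<lambda>p. (fst p, T x (snd p - ?d2 (fst p)))"
  have sd: "smooth_on S (d c)" for c
    unfolding d_def by (rule smooth_on_derivative[OF f])
  have dd: "((\<lambda>p. d c (fst p)) has_derivative (\<lambda>a. frechet_derivative (d c) (at x) (fst a))) (at (x, ?v))" for c
    by (rule has_derivative_compose[OF bounded_linear_imp_has_derivative[OF bounded_linear_fst]])
      (use smooth_on_has_derivative[OF sd x] in simp)
  have dPsi: "(Psi has_derivative ?Psi') (at (x, ?v))"
    unfolding Psi_def
    by (auto intro!: derivative_eq_intros dd simp: fun_eq_iff sum.distrib sumd[OF x] add_ac)
  have "(Th has_derivative ?Th') (at (Psi (x, ?v)))"
  proof (rule has_derivative_inverse_strong[OF _ _ _ _ dPsi])
    show "open (S \<times> (UNIV::'a set))" using assms(1) by (simp add: open_Times)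
    show "(x, ?v) \<in> S \<times> UNIV" using x by simp
    show "continuous_on (S \<times> UNIV) Psi"
      unfolding Psi_def
      by (intro continuous_intros continuous_on_compose2[OF smooth_on_continuous_on[OF sd]]) auto
    show "Th (Psi p) = p" if "p \<in> S \<times> UNIV" for p
      using that by (auto simp: Th_def Psi_def sumd TD)
    show "?Psi' \<circ> ?Th' = id"
      using x by (auto simp: fun_eq_iff TD)
  qed
  moreover have "Psi (x, ?v) = (x, w)" using x by (simp add: Psi_def sumd TD)
  ultimately have "(Th has_derivative ?Th') (at (x, w))" by simp
  then have "((\<lambda>y. snd (Th (y, w))) has_derivative (\<lambda>a. snd (?Th' (a, 0)))) (at x)"
    by (intro has_derivative_snd has_derivative_compose[of "\<lambda>y. (y, w)" "\<lambda>a. (a, 0)" x UNIV Th])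
      (auto intro!: derivative_eq_intros)
  then have "((\<lambda>y. T y w) has_derivative (\<lambda>a. T x (0 - ?d2 a))) (at x)"
    by (simp add: Th_def)
  moreover have "T x (0 - ?d2 a) = - (\<Sum>c\<in>Basis. \<Sum>b\<in>Basis. ((?v \<bullet> c) *
       (frechet_derivative (d c) (at x) a \<bullet> b)) *\<^sub>R T x b)" for a
  proof -
    have "T x (0 - ?d2 a) = - (\<Sum>c\<in>Basis. (?v \<bullet> c) *\<^sub>R T x (frechet_derivative (d c) (at x) a))"
      using linT[OF x] by (simp add: linear_neg linear_sum linear_cmul)
    also have "T x u = (\<Sum>b\<in>Basis. (u \<bullet> b) *\<^sub>R T x b)" for u
      by (rule linear_eq_sum_Basis[OF linT[OF x]])
    then have "(\<Sum>c\<in>Basis. (?v \<bullet> c) *\<^sub>R T x (frechet_derivative (d c) (at x) a)) =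
       (\<Sum>c\<in>Basis. (?v \<bullet> c) *\<^sub>R (\<Sum>b\<in>Basis. (frechet_derivative (d c) (at x) a \<bullet> b) *\<^sub>R T x b))"
      by (metis (no_types))
    finally show ?thesis by (simp add: scaleR_sum_right)
  qed
  ultimately show ?thesis unfolding T_def d_def by simp
qed

text \<open>The derivative found in the preceding lemma is built from second derivatives of
  \<open>f\<close> and from maps of the same kind with other vectors in place of \<open>w\<close>,
  so the order rises by induction with \<open>w\<close> arbitrary.\<close>

lemma smooth_on_inverse_derivative:
  fixes f :: "'a::euclidean_space \<Rightarrow> 'a"
  assumes "open S" and f: "smooth_on S f" and bij: "\<And>x. x \<in> S \<Longrightarrow> bij (frechet_derivative f (at x))"
  shows "smooth_on S (\<lambda>x. inv_into UNIV (frechet_derivative f (at x)) w)"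
proof (rule smooth_on_CkI)
  note der = smooth_on_inverse_derivative_aux[OF assms]
  fix k show "Ck_on k S (\<lambda>x. inv_into UNIV (frechet_derivative f (at x)) w)"
  proof (induction k arbitrary: w)
    case 0
    show ?case
      by (auto intro!: continuous_at_imp_continuous_on has_derivative_continuous[OF der])
  next
    case (Suc k)
    show ?case
    proof (rule Ck_on_Suc_intro[OF der assms(1)])
      fix a
      have sm: "smooth_on S (\<lambda>x. frechet_derivative (\<lambda>x. frechet_derivative f (at x) c) (at x) a)" for c
        by (rule smooth_on_derivative[OF smooth_on_derivative[OF f]])
      show "Ck_on k S (\<lambda>x. - (\<Sum>c\<in>Basis. \<Sum>b\<in>Basis. ((inv_into UNIV (frechet_derivative f (at x)) w \<bullet> c) *
       (frechet_derivative (\<lambda>x. frechet_derivative f (at x) c) (at x) a \<bullet> b)) *\<^sub>R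
         inv_into UNIV (frechet_derivative f (at x)) b))"
        by (intro Ck_on_bounded_linear[OF assms(1) bounded_linear_minus[OF bounded_linear_ident]]
            Ck_on_sum assms(1) finite_Basis bounded_bilinear.Ck_on_bilinear[OF bounded_bilinear_scaleR]
            bounded_bilinear.Ck_on_bilinear[OF bounded_bilinear_mult]
            Ck_on_bounded_linear[OF assms(1) bounded_linear_inner_left] Suc.IH)
          (use sm in \<open>auto simp: smooth_on_def\<close>)
    qed
  qed
qed

text \<open>The inverse function theorem yields a continuous inverse \<open>g\<close> whose
  derivative at \<open>y\<close> is the inverse of the derivative of \<open>f\<close> at
  \<open>g y\<close>. If \<open>g\<close> has order k, so has its derivative, and \<open>g\<close>
  gains one order.\<close>

lemma smooth_local_diffeo:
  fixes f :: "'a::euclidean_space \<Rightarrow> 'a"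
  assumes "open S" and f: "smooth_on S f" and x: "x \<in> S" and inj: "inj (frechet_derivative f (at x))"
  obtains A where "open A" "x \<in> A" "A \<subseteq> S" "diffeo A (f ` A) f"
proof -
  \<comment> \<open>The derivative as a map into the space of bounded operators, as the inverse
    function theorem expects it; its continuity can be tested on basis vectors.\<close>
  define f' where "f' y = Blinfun (frechet_derivative f (at y))" for y
  have app: "blinfun_apply (f' y) = frechet_derivative f (at y)" if "y \<in> S" for y
    unfolding f'_def using smooth_on_has_derivative[OF f that]
    by (intro bounded_linear_Blinfun_apply) (simp add: has_derivative_bounded_linear)
  have der: "(f has_derivative blinfun_apply (f' y)) (at y)" if "y \<in> S" for y
    using app that smooth_on_has_derivative[OF f] by auto
  have cont: "continuous_on S f'"
  proof (rule continuous_on_blinfun_componentwise)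
    fix i
    show "continuous_on S (\<lambda>y. blinfun_apply (f' y) i)"
      using smooth_on_continuous_on[OF smooth_on_derivative[OF f, of i]]
      by (rule continuous_on_eq) (simp add: app)
  qed
  obtain g0 where g0: "linear g0" "g0 \<circ> frechet_derivative f (at x) = id"
    using linear_injective_left_inverse[OF smooth_on_linear_derivative[OF f x] inj] by blast
  have "Blinfun g0 o\<^sub>L f' x = id_blinfun"
    using g0 by (intro blinfun_eqI)
      (simp add: app[OF x] bounded_linear_Blinfun_apply linear_conv_bounded_linear fun_eq_iff)
  from inverse_function_theorem[OF assms(1) der cont x this]
  obtain U V g g' where U: "open U" "U \<subseteq> S" "x \<in> U" and V: "open V" "f x \<in> V" and h: "homeomorphism U V f g"
    and g: "\<And>y. y \<in> V \<Longrightarrow> (g has_derivative (g' y)) (at y)"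
    and g': "\<And>y. y \<in> V \<Longrightarrow> g' y = inv_into UNIV (blinfun_apply (f' (g y)))"
    and bij: "\<And>y. y \<in> V \<Longrightarrow> bij (blinfun_apply (f' (g y)))"
    by metis
  have gf: "g (f y) = y" "f y \<in> V" if "y \<in> U" for y
    using h that by (auto simp: homeomorphism_def)
  have fg: "f (g y) = y" "g y \<in> U" if "y \<in> V" for y
    using h that by (auto simp: homeomorphism_def)
  have fU: "smooth_on U f" using smooth_on_subset[OF f U(2)] .
  have bij': "bij (frechet_derivative f (at y))" if "y \<in> U" for y
    using bij[of "f y"] gf that app U by auto
  note T = smooth_on_inverse_derivative[OF U(1) fU bij']
  have "Ck_on k V g" for k
  proof (induction k)
    case 0
    then show ?case using h by (simp add: homeomorphism_def)
  next
    case (Suc k)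
    show ?case
    proof (rule Ck_on_Suc_intro[OF g V(1)])
      fix v
      have "Ck_on k V (\<lambda>y. inv_into UNIV (frechet_derivative f (at (g y))) v)"
        by (rule Ck_on_compose[OF V(1) U(1) _ _ Suc]) (use T fg in \<open>auto simp: smooth_on_def\<close>)
      then show "Ck_on k V (\<lambda>y. g' y v)"
        by (subst Ck_on_cong[OF V(1)]) (use g' fg app subsetD[OF U(2)] in auto)
    qed
  qed
  then have sg: "smooth_on V g" by (rule smooth_on_CkI)
  have fU_V: "f ` U = V" using h by (auto simp: homeomorphism_def)
  have inj_f: "inj_on f U" by (metis gf(1) inj_onI)
  have "inv_into U f y = g y" if "y \<in> V" for y
    using that fg inv_into_f_eq[OF inj_f] by auto
  then have "smooth_on V (inv_into U f)"
    using sg smooth_on_cong[OF V(1)] by metis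
  then have "diffeo U (f ` U) f"
    using U V fU inj_f fU_V by (auto simp: diffeo_def bij_betw_def)
  then show thesis using that U by blast
qed

section \<open>Matrix-valued one-forms\<close>

lemma bounded_bilinear_matrix_mult:
  "bounded_bilinear ((**) :: real^'n^'m \<Rightarrow> real^'p^'n \<Rightarrow> real^'p^'m)"
  unfolding bilinear_conv_bounded_bilinear[symmetric] bilinear_def
  by (auto intro!: linearI simp: matrix_matrix_mult_def vec_eq_iff sum.distrib algebra_simps sum_distrib_left)

lemmas smooth_on_matrix_mult = bounded_bilinear.smooth_on_bilinear[OF bounded_bilinear_matrix_mult]
lemmas matrix_mult_simps =
  bounded_bilinear.add_left[OF bounded_bilinear_matrix_mult]
  bounded_bilinear.add_right[OF bounded_bilinear_matrix_mult]
  bounded_bilinear.diff_left[OF bounded_bilinear_matrix_mult]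
  bounded_bilinear.diff_right[OF bounded_bilinear_matrix_mult]
  bounded_bilinear.minus_left[OF bounded_bilinear_matrix_mult]
  bounded_bilinear.minus_right[OF bounded_bilinear_matrix_mult]
  bounded_bilinear.scaleR_left[OF bounded_bilinear_matrix_mult]
  bounded_bilinear.scaleR_right[OF bounded_bilinear_matrix_mult]
  bounded_bilinear.zero_left[OF bounded_bilinear_matrix_mult]
  bounded_bilinear.zero_right[OF bounded_bilinear_matrix_mult]

definition smooth_form :: "'w::euclidean_space set \<Rightarrow> ('w \<Rightarrow> 'w \<Rightarrow> 'b::real_normed_vector) \<Rightarrow> bool" where
  "smooth_form P \<eta> \<longleftrightarrow> (\<forall>v. smooth_on P (\<lambda>w. \<eta> w v)) \<and> (\<forall>w\<in>P. linear (\<eta> w))"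

text \<open>The arguments are extended to constant fields, whose bracket vanishes, so the usual
  third term is absent.\<close>

definition extd :: "('w::euclidean_space \<Rightarrow> 'w \<Rightarrow> 'b::real_normed_vector) \<Rightarrow> 'w \<Rightarrow> 'w \<Rightarrow> 'w \<Rightarrow> 'b" where
  "extd \<eta> w v v' = frechet_derivative (\<lambda>w. \<eta> w v') (at w) v - frechet_derivative (\<lambda>w. \<eta> w v) (at w) v'"

definition pullback_form :: "('a::euclidean_space \<Rightarrow> 'w::euclidean_space) \<Rightarrow> ('w \<Rightarrow> 'w \<Rightarrow> 'b) \<Rightarrow> 'a \<Rightarrow> 'a \<Rightarrow> 'b" where
  "pullback_form \<phi> \<eta> z v = \<eta> (\<phi> z) (frechet_derivative \<phi> (at z) v)"

text \<open>The inverse of \<open>g\<close> is a separate argument \<open>gi\<close>, so that an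
  inverse that is visibly smooth, such as \<open>sp_inv\<close>, can be used instead of
  \<open>matrix_inv\<close>.\<close>

definition gauge_form :: "('w::euclidean_space \<Rightarrow> real^'n^'n) \<Rightarrow> ('w \<Rightarrow> real^'n^'n) \<Rightarrow> ('w \<Rightarrow> 'w \<Rightarrow> real^'n^'n) \<Rightarrow> 'w \<Rightarrow> 'w \<Rightarrow> real^'n^'n" where
  "gauge_form g gi \<eta> w v = gi w ** \<eta> w v ** g w + gi w ** frechet_derivative g (at w) v"

lemma curvature_eq: "curvature \<eta> w v v' = extd \<eta> w v v' + lie_br (\<eta> w v) (\<eta> w v')"
  by (simp add: curvature_def extd_def lie_br_def)

lemma frechet_derivative_eqI: "(f has_derivative f') (at x) \<Longrightarrow> frechet_derivative f (at x) = f'"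
  using frechet_derivative_at by metis

text \<open>Base point and argument both move. Expanding the argument in \<open>Basis\<close> turns
  the form into a finite sum of products, and the product rule yields the two terms.\<close>

lemma form_has_derivative:
  fixes \<eta> :: "'w::euclidean_space \<Rightarrow> 'w \<Rightarrow> 'b::real_normed_vector"
  assumes \<eta>: "smooth_form P \<eta>" and P: "open P" and Z: "open Z" "z \<in> Z" "a ` Z \<subseteq> P"
    and a: "(a has_derivative a') (at z)" and b: "(b has_derivative b') (at z)"
  shows "((\<lambda>z. \<eta> (a z) (b z)) has_derivative
    (\<lambda>v. frechet_derivative (\<lambda>w. \<eta> w (b z)) (at (a z)) (a' v) + \<eta> (a z) (b' v))) (at z)"
proof -
  have lin: "\<eta> w v = (\<Sum>i\<in>Basis. (v \<bullet> i) *\<^sub>R \<eta> w i)" if "w \<in> P" for w v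
    using \<eta> that by (intro linear_eq_sum_Basis) (simp add: smooth_form_def)
  have az: "a z \<in> P" using Z by auto
  have d: "((\<lambda>w. \<eta> w v) has_derivative frechet_derivative (\<lambda>w. \<eta> w v) (at (a z))) (at (a z))" for v
    using \<eta> az smooth_on_has_derivative unfolding smooth_form_def by blast
  have linD: "frechet_derivative (\<lambda>w. \<eta> w v) (at (a z)) u =
      (\<Sum>i\<in>Basis. (v \<bullet> i) *\<^sub>R frechet_derivative (\<lambda>w. \<eta> w i) (at (a z)) u)" for v u
  proof -
    have "((\<lambda>w. \<Sum>i\<in>Basis. (v \<bullet> i) *\<^sub>R \<eta> w i) has_derivative
      (\<lambda>u. \<Sum>i\<in>Basis. (v \<bullet> i) *\<^sub>R frechet_derivative (\<lambda>w. \<eta> w i) (at (a z)) u)) (at (a z))"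
      by (intro has_derivative_sum has_derivative_scaleR_right d)
    from frechet_derivative_eqI[OF has_derivative_transform_within_open[OF this \<open>open P\<close> az lin[symmetric]]]
    show ?thesis by simp
  qed
  have "((\<lambda>z. \<Sum>i\<in>Basis. (b z \<bullet> i) *\<^sub>R \<eta> (a z) i) has_derivative
     (\<lambda>v. \<Sum>i\<in>Basis. (b z \<bullet> i) *\<^sub>R frechet_derivative (\<lambda>w. \<eta> w i) (at (a z)) (a' v)
        + (b' v \<bullet> i) *\<^sub>R \<eta> (a z) i)) (at z)"
    by (intro has_derivative_sum has_derivative_scaleR has_derivative_inner_left b
        has_derivative_compose[OF a d])
  moreover have "(\<Sum>i\<in>Basis. (b z \<bullet> i) *\<^sub>R frechet_derivative (\<lambda>w. \<eta> w i) (at (a z)) (a' v)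
        + (b' v \<bullet> i) *\<^sub>R \<eta> (a z) i)
     = frechet_derivative (\<lambda>w. \<eta> w (b z)) (at (a z)) (a' v) + \<eta> (a z) (b' v)" for v
    by (simp only: sum.distrib linD[of "b z"] lin[OF az, of "b' v"])
  ultimately have "((\<lambda>z. \<Sum>i\<in>Basis. (b z \<bullet> i) *\<^sub>R \<eta> (a z) i) has_derivative
    (\<lambda>v. frechet_derivative (\<lambda>w. \<eta> w (b z)) (at (a z)) (a' v) + \<eta> (a z) (b' v))) (at z)"
    by simp
  then show ?thesis
    by (rule has_derivative_transform_within_open[OF _ Z(1,2)]) (use Z(3) lin[symmetric] in auto)
qed

lemma smooth_form_pullback:
  assumes "smooth_form P \<eta>" "open P" "smooth_on Z \<phi>" "open Z" "\<phi> ` Z \<subseteq> P"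
  shows "smooth_form Z (pullback_form \<phi> \<eta>)"
  unfolding smooth_form_def
proof (intro conjI allI ballI)
  have lin: "\<eta> w v = (\<Sum>i\<in>Basis. (v \<bullet> i) *\<^sub>R \<eta> w i)" if "w \<in> P" for w v
    using assms(1) that by (intro linear_eq_sum_Basis) (simp add: smooth_form_def)
  fix v
  have "smooth_on Z (\<lambda>z. \<eta> (\<phi> z) i)" for i
    using assms(1) by (intro smooth_on_compose[OF assms(4,2,5) _ assms(3)]) (simp add: smooth_form_def)
  then have "smooth_on Z (\<lambda>z. \<Sum>i\<in>Basis. (frechet_derivative \<phi> (at z) v \<bullet> i) *\<^sub>R \<eta> (\<phi> z) i)"
    by (intro smooth_on_sum smooth_on_scaleR assms(4) finite_Basis
        smooth_on_bounded_linear[OF bounded_linear_inner_left] smooth_on_derivative assms(3))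
  then show "smooth_on Z (\<lambda>z. pullback_form \<phi> \<eta> z v)"
    by (rule iffD1[OF smooth_on_cong[OF assms(4)], rotated])
      (use assms(5) lin in \<open>auto simp: pullback_form_def\<close>)
next
  fix z assume "z \<in> Z"
  then have "linear (\<eta> (\<phi> z))" "linear (frechet_derivative \<phi> (at z))"
    using assms smooth_on_linear_derivative by (auto simp: smooth_form_def)
  then show "linear (pullback_form \<phi> \<eta> z)"
    unfolding pullback_form_def using linear_compose[unfolded o_def] by blast
qed

text \<open>Differentiating the pushed forward vectors produces second derivatives of
  \<open>\<phi>\<close>; these are symmetric and cancel in the difference.\<close>

lemma extd_pullback:
  assumes \<eta>: "smooth_form P \<eta>" and P: "open P" and \<phi>: "smooth_on Z \<phi>" and Z: "open Z" "\<phi> ` Z \<subseteq> P" "z \<in> Z"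
  shows "extd (pullback_form \<phi> \<eta>) z v v' =
    extd \<eta> (\<phi> z) (frechet_derivative \<phi> (at z) v) (frechet_derivative \<phi> (at z) v')"
proof -
  have "frechet_derivative (\<lambda>z. pullback_form \<phi> \<eta> z v) (at z) =
    (\<lambda>u. frechet_derivative (\<lambda>w. \<eta> w (frechet_derivative \<phi> (at z) v)) (at (\<phi> z)) (frechet_derivative \<phi> (at z) u) +
      \<eta> (\<phi> z) (frechet_derivative (\<lambda>z. frechet_derivative \<phi> (at z) v) (at z) u))" for v
    unfolding pullback_form_def
    by (intro frechet_derivative_eqI form_has_derivative[OF \<eta> P Z(1,3,2)]
        smooth_on_has_derivative[OF _ Z(3)] smooth_on_derivative \<phi>)
  then show ?thesis
    by (simp add: extd_def smooth_on_symmetric[OF Z(1) \<phi> Z(3), of v v'])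
qed

lemma curvature_pullback:
  assumes "smooth_form P \<eta>" "open P" "smooth_on Z \<phi>" "open Z" "\<phi> ` Z \<subseteq> P" "z \<in> Z"
  shows "curvature (pullback_form \<phi> \<eta>) z v v' =
    curvature \<eta> (\<phi> z) (frechet_derivative \<phi> (at z) v) (frechet_derivative \<phi> (at z) v')"
  by (simp add: curvature_eq extd_pullback[OF assms]) (simp add: pullback_form_def)

lemma smooth_form_gauge:
  assumes \<eta>: "smooth_form P \<eta>" and P: "open P" and g: "smooth_on P g" "smooth_on P gi"
  shows "smooth_form P (gauge_form g gi \<eta>)"
  unfolding smooth_form_def
proof (intro conjI allI ballI)
  show "smooth_on P (\<lambda>w. gauge_form g gi \<eta> w v)" for v
    unfolding gauge_form_def using \<eta>
    by (intro smooth_on_add smooth_on_matrix_mult P g smooth_on_derivative) (simp add: smooth_form_def)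
  show "linear (gauge_form g gi \<eta> w)" if "w \<in> P" for w
    using \<eta> that smooth_on_linear_derivative[OF g(1) that] unfolding gauge_form_def smooth_form_def
    by (intro linearI) (simp_all add: linear_add linear_cmul matrix_mult_simps algebra_simps)
qed

lemma frechet_derivative_matrix_inverse:
  fixes g :: "'w::euclidean_space \<Rightarrow> real^'n^'n"
  assumes P: "open P" and g: "smooth_on P g" "smooth_on P gi"
    and inv: "\<And>w. w \<in> P \<Longrightarrow> gi w ** g w = mat 1" "\<And>w. w \<in> P \<Longrightarrow> g w ** gi w = mat 1" and w: "w \<in> P"
  shows "frechet_derivative gi (at w) v = - (gi w ** frechet_derivative g (at w) v ** gi w)"
proof -
  have 1: "((\<lambda>w. gi w ** g w) has_derivative (\<lambda>v. gi w ** frechet_derivative g (at w) v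
      + frechet_derivative gi (at w) v ** g w)) (at w)"
    by (intro bounded_bilinear.FDERIV[OF bounded_bilinear_matrix_mult] smooth_on_has_derivative[OF _ w] g)
  have 2: "((\<lambda>w. gi w ** g w) has_derivative (\<lambda>v. 0)) (at w)"
    by (rule has_derivative_transform_within_open[OF has_derivative_const[of "mat 1"] P w]) (simp add: inv)
  have "gi w ** frechet_derivative g (at w) v + frechet_derivative gi (at w) v ** g w = 0"
    using fun_cong[OF has_derivative_unique[OF 1 2], of v] .
  then have "frechet_derivative gi (at w) v ** g w = - (gi w ** frechet_derivative g (at w) v)"
    by (simp add: add_eq_0_iff)
  then have "frechet_derivative gi (at w) v ** g w ** gi w = - (gi w ** frechet_derivative g (at w) v) ** gi w"
    by simp
  then show ?thesis
    by (simp add: matrix_mul_assoc[symmetric] inv w matrix_mult_simps)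
qed

text \<open>The second derivatives of \<open>g\<close> cancel by symmetry, and the terms with first
  derivatives of \<open>g\<close> cancel between the exterior derivative and the bracket, so only
  the conjugated curvature survives.\<close>

lemma curvature_gauge:
  fixes g :: "'w::euclidean_space \<Rightarrow> real^'n^'n"
  assumes \<eta>: "smooth_form P \<eta>" and P: "open P" and g: "smooth_on P g" "smooth_on P gi"
    and inv: "\<And>w. w \<in> P \<Longrightarrow> gi w ** g w = mat 1" "\<And>w. w \<in> P \<Longrightarrow> g w ** gi w = mat 1" and w: "w \<in> P"
  shows "curvature (gauge_form g gi \<eta>) w v v' = gi w ** curvature \<eta> w v v' ** g w"
proof -
  note gi' = frechet_derivative_matrix_inverse[OF P g inv w]
  have d: "frechet_derivative (\<lambda>w. gauge_form g gi \<eta> w v) (at w) u =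
      (gi w ** \<eta> w v) ** frechet_derivative g (at w) u
      + (gi w ** frechet_derivative (\<lambda>w. \<eta> w v) (at w) u + frechet_derivative gi (at w) u ** \<eta> w v) ** g w
      + (gi w ** frechet_derivative (\<lambda>w. frechet_derivative g (at w) v) (at w) u
         + frechet_derivative gi (at w) u ** frechet_derivative g (at w) v)" for v u
    unfolding gauge_form_def using \<eta>
    by (intro fun_cong[OF frechet_derivative_eqI, where x = u] has_derivative_add
        bounded_bilinear.FDERIV[OF bounded_bilinear_matrix_mult]
        smooth_on_has_derivative[OF _ w] smooth_on_derivative g) (simp_all add: smooth_form_def)
  have c: "g w ** (gi w ** X) = X" for X :: "real^'n^'n"
    by (simp add: matrix_mul_assoc inv w)
  show ?thesis
    unfolding curvature_def d
    unfolding smooth_on_symmetric[OF P g(1) w, of v v'] gauge_form_def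
    by (simp add: gi' matrix_mult_simps matrix_mul_assoc[symmetric] c)
qed

section \<open>The symplectic group and its Lie algebra\<close>

lemma exhaust_6: fixes x :: 6 shows "x = 1 \<or> x = 2 \<or> x = 3 \<or> x = 4 \<or> x = 5 \<or> x = 6"
proof (induct x)
  case (of_int z)
  then have "z = 0 \<or> z = 1 \<or> z = 2 \<or> z = 3 \<or> z = 4 \<or> z = 5" by fastforce
  then show ?case by auto
qed

lemma exhaust_5: fixes x :: 5 shows "x = 1 \<or> x = 2 \<or> x = 3 \<or> x = 4 \<or> x = 5"
proof (induct x)
  case (of_int z)
  then have "z = 0 \<or> z = 1 \<or> z = 2 \<or> z = 3 \<or> z = 4" by fastforce
  then show ?case by auto
qed

lemma forall_6: "(\<forall>i::6. P i) \<longleftrightarrow> P 1 \<and> P 2 \<and> P 3 \<and> P 4 \<and> P 5 \<and> P 6"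
  by (metis exhaust_6)

lemma forall_5: "(\<forall>i::5. P i) \<longleftrightarrow> P 1 \<and> P 2 \<and> P 3 \<and> P 4 \<and> P 5"
  by (metis exhaust_5)

lemma UNIV_5: "UNIV = {1, 2, 3, 4, 5::5}"
  using exhaust_5 by auto

lemma UNIV_6: "UNIV = {1, 2, 3, 4, 5, 6::6}"
  using exhaust_6 by auto

lemma sum_5: "sum f (UNIV::5 set) = f 1 + f 2 + f 3 + f 4 + f 5"
  unfolding UNIV_5 by (simp add: ac_simps)

lemma sum_6: "sum f (UNIV::6 set) = f 1 + f 2 + f 3 + f 4 + f 5 + f 6"
  unfolding UNIV_6 by (simp add: ac_simps)

lemma vector_4 [simp]:
  "(vector [a, b, c, d] :: 'a::zero^4) $ 1 = a"
  "(vector [a, b, c, d] :: 'a::zero^4) $ 2 = b"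
  "(vector [a, b, c, d] :: 'a::zero^4) $ 3 = c"
  "(vector [a, b, c, d] :: 'a::zero^4) $ 4 = d"
  unfolding vector_def by simp_all

lemma vector_5 [simp]:
  "(vector [a, b, c, d, e] :: 'a::zero^5) $ 1 = a"
  "(vector [a, b, c, d, e] :: 'a::zero^5) $ 2 = b"
  "(vector [a, b, c, d, e] :: 'a::zero^5) $ 3 = c"
  "(vector [a, b, c, d, e] :: 'a::zero^5) $ 4 = d"
  "(vector [a, b, c, d, e] :: 'a::zero^5) $ 5 = e"
  unfolding vector_def by simp_all

lemma vector_6 [simp]:
  "(vector [a, b, c, d, e, f] :: 'a::zero^6) $ 1 = a"
  "(vector [a, b, c, d, e, f] :: 'a::zero^6) $ 2 = b"
  "(vector [a, b, c, d, e, f] :: 'a::zero^6) $ 3 = c"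
  "(vector [a, b, c, d, e, f] :: 'a::zero^6) $ 4 = d"
  "(vector [a, b, c, d, e, f] :: 'a::zero^6) $ 5 = e"
  "(vector [a, b, c, d, e, f] :: 'a::zero^6) $ 6 = f"
  unfolding vector_def by simp_all

lemmas mat4_simps = vec_eq_iff forall_4 matrix_matrix_mult_def sum_4 transpose_def mat_def

declare sp4_matrix.simps [simp del]

lemma sp4_matrix_nth [simp]:
  "sp4_matrix p $ 1 $ 1 = 1/2 * snd p $ 1" "sp4_matrix p $ 1 $ 2 = 1/2 * snd p $ 2"
  "sp4_matrix p $ 1 $ 3 = - 1/2 * snd p $ 4" "sp4_matrix p $ 1 $ 4 = - 1/4 * snd p $ 6"
  "sp4_matrix p $ 2 $ 1 = fst p $ 4" "sp4_matrix p $ 2 $ 2 = snd p $ 3 - 1/2 * snd p $ 1"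
  "sp4_matrix p $ 2 $ 3 = - snd p $ 5" "sp4_matrix p $ 2 $ 4 = - 1/2 * snd p $ 4"
  "sp4_matrix p $ 3 $ 1 = fst p $ 2" "sp4_matrix p $ 3 $ 2 = fst p $ 3"
  "sp4_matrix p $ 3 $ 3 = 1/2 * snd p $ 1 - snd p $ 3" "sp4_matrix p $ 3 $ 4 = - 1/2 * snd p $ 2"
  "sp4_matrix p $ 4 $ 1 = 2 * fst p $ 1" "sp4_matrix p $ 4 $ 2 = fst p $ 2"
  "sp4_matrix p $ 4 $ 3 = - fst p $ 4" "sp4_matrix p $ 4 $ 4 = - 1/2 * snd p $ 1"
  by (cases p; simp add: sp4_matrix.simps)+

lemma sp4_coords_nth [simp]:
  "fst (sp4_coords X) $ 1 = 1/2 * X$4$1" "fst (sp4_coords X) $ 2 = X$3$1"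
  "fst (sp4_coords X) $ 3 = X$3$2" "fst (sp4_coords X) $ 4 = X$2$1"
  "snd (sp4_coords X) $ 1 = 2 * X$1$1" "snd (sp4_coords X) $ 2 = 2 * X$1$2"
  "snd (sp4_coords X) $ 3 = X$2$2 + X$1$1" "snd (sp4_coords X) $ 4 = - 2 * X$1$3"
  "snd (sp4_coords X) $ 5 = - X$2$3" "snd (sp4_coords X) $ 6 = - 4 * X$1$4"
  by (simp_all add: sp4_coords_def)

lemma sympl_form_nth [simp]:
  "sympl_form $ 1 $ 1 = 0" "sympl_form $ 1 $ 2 = 0" "sympl_form $ 1 $ 3 = 0" "sympl_form $ 1 $ 4 = 1"
  "sympl_form $ 2 $ 1 = 0" "sympl_form $ 2 $ 2 = 0" "sympl_form $ 2 $ 3 = 1" "sympl_form $ 2 $ 4 = 0"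
  "sympl_form $ 3 $ 1 = 0" "sympl_form $ 3 $ 2 = -1" "sympl_form $ 3 $ 3 = 0" "sympl_form $ 3 $ 4 = 0"
  "sympl_form $ 4 $ 1 = -1" "sympl_form $ 4 $ 2 = 0" "sympl_form $ 4 $ 3 = 0" "sympl_form $ 4 $ 4 = 0"
  by (simp_all add: sympl_form_def)

lemma sp4_coords_matrix [simp]: "sp4_coords (sp4_matrix p) = p"
  by (simp add: prod_eq_iff vec_eq_iff forall_4 forall_6)

lemma inj_sp4_matrix: "inj sp4_matrix"
  by (metis injI sp4_coords_matrix)

lemma linear_sp4_matrix: "linear sp4_matrix"
  by (rule linearI) (simp_all add: mat4_simps field_simps)

lemma linear_sp4_coords: "linear sp4_coords"
  by (rule linearI) (simp_all add: prod_eq_iff vec_eq_iff forall_4 forall_6 algebra_simps)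

lemma sp4_iff_coords: "X \<in> sp4 \<longleftrightarrow> sp4_matrix (sp4_coords X) = X"
  unfolding sp4_def by (metis rangeE rangeI sp4_coords_matrix)

lemma sp4_iff_entries: "X \<in> sp4 \<longleftrightarrow>
   X$4$4 = - X$1$1 \<and> X$3$3 = - X$2$2 \<and> X$3$4 = - X$1$2 \<and> X$2$4 = X$1$3 \<and> X$4$2 = X$3$1 \<and> X$4$3 = - X$2$1"
  unfolding sp4_iff_coords by (auto simp: mat4_simps)

lemma sp4_iff: "X \<in> sp4 \<longleftrightarrow> transpose X ** sympl_form + sympl_form ** X = 0"
  unfolding sp4_iff_entries by (auto simp: mat4_simps)

text \<open>Turns strictly lower triangular elements into upper triangular ones, for which curves in
  \<open>H6\<close> are at hand; this is used in \<open>lie_algebra_Sp4\<close>.\<close>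

lemma sp4_transpose: "X \<in> sp4 \<Longrightarrow> transpose X \<in> sp4"
  unfolding sp4_iff_entries by (auto simp: transpose_def)

lemma subspace_sp4: "subspace sp4"
  unfolding sp4_def using linear_subspace_image[OF linear_sp4_matrix subspace_UNIV] .

lemma sp4_lie_br: "A \<in> sp4 \<Longrightarrow> B \<in> sp4 \<Longrightarrow> lie_br A B \<in> sp4"
  unfolding sp4_iff_entries lie_br_def by (simp add: mat4_simps algebra_simps)

lemma dim_sp4: "dim sp4 = 10"
proof -
  have "dim sp4 = dim (UNIV :: ((real^4) \<times> (real^6)) set)"
    unfolding sp4_def by (rule dim_image_eq[OF linear_sp4_matrix]) (use inj_sp4_matrix in \<open>auto simp: span_UNIV\<close>)
  then show ?thesis by simp
qed

text \<open>The five-dimensional representation on the primitive part of \<open>\<Lambda>\<^sup>2 \<real>\<^sup>4\<close>, in a basis that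
  diagonalises the wedge pairing.\<close>

definition sp4_to_o32 :: "real^4^4 \<Rightarrow> real^5^5" where
  "sp4_to_o32 X = (let t = fst (sp4_coords X); w = snd (sp4_coords X) in vector
    [vector [0, - t$4 + w$2/2, t$2 + w$4/2, - t$4 - w$2/2, t$2 - w$4/2],
     vector [t$4 - w$2/2, 0, - t$1 + t$3/2 + w$5/2 - w$6/8, w$1 - w$3, - t$1 + t$3/2 - w$5/2 + w$6/8],
     vector [- t$2 - w$4/2, t$1 - t$3/2 - w$5/2 + w$6/8, 0, t$1 + t$3/2 - w$5/2 - w$6/8, w$3],
     vector [- t$4 - w$2/2, w$1 - w$3, t$1 + t$3/2 - w$5/2 - w$6/8, 0, t$1 + t$3/2 + w$5/2 + w$6/8],
     vector [t$2 - w$4/2, - t$1 + t$3/2 - w$5/2 + w$6/8, w$3, - t$1 - t$3/2 - w$5/2 - w$6/8, 0]])"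

text \<open>Solves the entries of \<open>sp4_to_o32\<close> for the ten coordinates, reading only
  the entries above the diagonal; on \<open>o32\<close> these determine the matrix.\<close>

definition o32_to_sp4 :: "real^5^5 \<Rightarrow> real^4^4" where
  "o32_to_sp4 Y = sp4_matrix
    (vector [(- Y$2$3 - Y$2$5 + Y$3$4 + Y$4$5)/4, (Y$1$3 + Y$1$5)/2,
        (Y$2$3 + Y$2$5 + Y$3$4 + Y$4$5)/2, - (Y$1$2 + Y$1$4)/2],
     vector [Y$2$4 + Y$3$5, Y$1$2 - Y$1$4, Y$3$5, Y$1$3 - Y$1$5,
        (Y$2$3 - Y$2$5 - Y$3$4 + Y$4$5)/2, 2 * (- Y$2$3 + Y$2$5 - Y$3$4 + Y$4$5)])"

lemma o32_iff: "Y \<in> o32 \<longleftrightarrow> Y$1$1 = 0 \<and> Y$2$2 = 0 \<and> Y$3$3 = 0 \<and> Y$4$4 = 0 \<and> Y$5$5 = 0 \<and>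
   Y$2$1 = - Y$1$2 \<and> Y$3$1 = - Y$1$3 \<and> Y$3$2 = - Y$2$3 \<and> Y$5$4 = - Y$4$5 \<and>
   Y$4$1 = Y$1$4 \<and> Y$5$1 = Y$1$5 \<and> Y$4$2 = Y$2$4 \<and> Y$5$2 = Y$2$5 \<and> Y$4$3 = Y$3$4 \<and> Y$5$3 = Y$3$5"
  unfolding o32_def Let_def
  by (simp add: vec_eq_iff forall_5 matrix_matrix_mult_def sum_5 transpose_def) argo

lemma sp4_o32_iso: "\<exists>\<rho>. linear \<rho> \<and> bij_betw \<rho> sp4 o32 \<and>
   (\<forall>A\<in>sp4. \<forall>B\<in>sp4. \<rho> (lie_br A B) = lie_br (\<rho> A) (\<rho> B))"
proof (intro exI[of _ sp4_to_o32] conjI ballI)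
  show "linear sp4_to_o32"
    by (rule linearI) (simp_all add: sp4_to_o32_def Let_def vec_eq_iff forall_5 algebra_simps add_divide_distrib diff_divide_distrib)
  have 1: "sp4_to_o32 A \<in> o32" if "A \<in> sp4" for A
    unfolding o32_iff by (simp add: sp4_to_o32_def Let_def algebra_simps)
  have 2: "o32_to_sp4 Y \<in> sp4" for Y
    unfolding o32_to_sp4_def sp4_def by simp
  have 3: "o32_to_sp4 (sp4_to_o32 A) = A" if "A \<in> sp4" for A
    using that unfolding sp4_iff_entries
    by (simp add: o32_to_sp4_def sp4_to_o32_def Let_def mat4_simps field_simps)
  have 4: "sp4_to_o32 (o32_to_sp4 Y) = Y" if "Y \<in> o32" for Y
    using that unfolding o32_iff
    by (simp add: o32_to_sp4_def sp4_to_o32_def Let_def vec_eq_iff forall_5 field_simps)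
  show "bij_betw sp4_to_o32 sp4 o32"
    by (rule bij_betw_byWitness[where f' = o32_to_sp4]) (use 1 2 3 4 in auto)
  fix A B assume A: "A \<in> sp4" and B: "B \<in> sp4"
  then obtain p q where "A = sp4_matrix p" "B = sp4_matrix q" by (auto simp: sp4_def)
  then show "sp4_to_o32 (lie_br A B) = lie_br (sp4_to_o32 A) (sp4_to_o32 B)"
    by (simp add: sp4_to_o32_def Let_def lie_br_def vec_eq_iff forall_5 matrix_matrix_mult_def sum_4 sum_5)
      (simp add: field_simps)
qed

section \<open>The symplectic group\<close>

lemma sympl_form_simps: "sympl_form ** sympl_form = - mat 1" "transpose sympl_form = - sympl_form"
  by (simp_all add: mat4_simps)

lemma Sp4_iff: "A \<in> carrier Sp4 \<longleftrightarrow> transpose A ** sympl_form ** A = sympl_form"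
  by (simp add: Sp4_def)

text \<open>With \<open>J\<close> for \<open>sympl_form\<close>, the relations
  \<open>transpose A ** J ** A = J\<close> and \<open>J ** J = - mat 1\<close> show that this is the
  inverse of a symplectic matrix. It is linear in \<open>A\<close>, hence defined everywhere and
  smooth at once.\<close>

definition sp_inv :: "real^4^4 \<Rightarrow> real^4^4" where
  "sp_inv A = - (sympl_form ** transpose A ** sympl_form)"

lemma sp_inv_left: "A \<in> carrier Sp4 \<Longrightarrow> sp_inv A ** A = mat 1"
  unfolding Sp4_iff sp_inv_def
  by (simp add: matrix_mult_simps matrix_mul_assoc[symmetric] sympl_form_simps)

lemma sp_inv_right: "A \<in> carrier Sp4 \<Longrightarrow> A ** sp_inv A = mat 1"
  using sp_inv_left matrix_left_right_inverse by blast

lemma matrix_inv_eqI: "B ** A = mat 1 \<Longrightarrow> A ** B = mat 1 \<Longrightarrow> matrix_inv (A :: real^'n^'n) = B"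
proof -
  assume B: "B ** A = mat 1" "A ** B = mat 1"
  then have "A ** matrix_inv A = mat 1 \<and> matrix_inv A ** A = mat 1"
    unfolding matrix_inv_def by (intro someI[of "\<lambda>C. A ** C = mat 1 \<and> C ** A = mat 1" B]) simp
  then have "matrix_inv A = B ** A ** matrix_inv A" "B = B ** (A ** matrix_inv A)"
    using B by simp_all
  then show ?thesis by (simp add: matrix_mul_assoc)
qed

lemma matrix_inv_Sp4: "A \<in> carrier Sp4 \<Longrightarrow> matrix_inv A = sp_inv A"
  using matrix_inv_eqI sp_inv_left sp_inv_right by blast

lemma Sp4_mult: "A \<in> carrier Sp4 \<Longrightarrow> B \<in> carrier Sp4 \<Longrightarrow> A ** B \<in> carrier Sp4"
proof -
  assume A: "A \<in> carrier Sp4" and B: "B \<in> carrier Sp4"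
  have "transpose (A ** B) ** sympl_form ** (A ** B) = transpose B ** (transpose A ** sympl_form ** A) ** B"
    by (simp add: matrix_transpose_mul matrix_mul_assoc)
  then show ?thesis using A B by (simp add: Sp4_iff)
qed

lemma Sp4_one: "mat 1 \<in> carrier Sp4"
  unfolding Sp4_iff by (simp add: transpose_mat)

lemma Sp4_sp_inv: assumes "A \<in> carrier Sp4" shows "sp_inv A \<in> carrier Sp4"
proof -
  let ?B = "sp_inv A"
  have "transpose ?B ** sympl_form ** ?B = transpose ?B ** (transpose A ** sympl_form ** A) ** ?B"
    using assms by (simp add: Sp4_iff)
  also have "\<dots> = transpose (A ** ?B) ** sympl_form ** (A ** ?B)"
    by (simp add: matrix_transpose_mul matrix_mul_assoc)
  finally show ?thesis unfolding Sp4_iff by (simp add: sp_inv_right[OF assms] transpose_mat)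
qed

text \<open>A left inverse of a square matrix is also a right inverse; written out with
  \<open>sp_inv\<close>, this is the symplectic condition for the transpose.\<close>

lemma Sp4_transpose: assumes "A \<in> carrier Sp4" shows "transpose A \<in> carrier Sp4"
proof -
  have "sympl_form = A ** sympl_form ** transpose A"
  proof -
    have "A ** (- (sympl_form ** transpose A ** sympl_form)) = mat 1"
      using sp_inv_right[OF assms] by (simp add: sp_inv_def)
    then have "A ** (- (sympl_form ** transpose A ** sympl_form)) ** sympl_form = sympl_form" by simp
    then show ?thesis
      by (simp add: matrix_mult_simps matrix_mul_assoc[symmetric] sympl_form_simps)
  qed
  then show ?thesis unfolding Sp4_iff by simp
qed

lemma group_Sp4: "Group.group Sp4"
proof (rule groupI)
  fix A B C assume A: "A \<in> carrier Sp4" and B: "B \<in> carrier Sp4" and C: "C \<in> carrier Sp4"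
  show "A \<otimes>\<^bsub>Sp4\<^esub> B \<in> carrier Sp4" using Sp4_mult[OF A B] by (simp add: Sp4_def)
  show "A \<otimes>\<^bsub>Sp4\<^esub> B \<otimes>\<^bsub>Sp4\<^esub> C = A \<otimes>\<^bsub>Sp4\<^esub> (B \<otimes>\<^bsub>Sp4\<^esub> C)" by (simp add: Sp4_def matrix_mul_assoc)
next
  show "\<one>\<^bsub>Sp4\<^esub> \<in> carrier Sp4" using Sp4_one by (simp add: Sp4_def)
next
  fix A assume A: "A \<in> carrier Sp4"
  show "\<one>\<^bsub>Sp4\<^esub> \<otimes>\<^bsub>Sp4\<^esub> A = A" by (simp add: Sp4_def)
  show "\<exists>B\<in>carrier Sp4. B \<otimes>\<^bsub>Sp4\<^esub> A = \<one>\<^bsub>Sp4\<^esub>"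
    using Sp4_sp_inv[OF A] sp_inv_left[OF A] by (auto simp: Sp4_def)
qed

subsection \<open>The Borel subgroup\<close>

definition borel_upper :: "real^4^4 \<Rightarrow> bool" where
  "borel_upper A \<longleftrightarrow> A$2$1 = 0 \<and> A$3$1 = 0 \<and> A$3$2 = 0 \<and> A$4$1 = 0 \<and> A$4$2 = 0 \<and> A$4$3 = 0"

text \<open>The entries of \<open>u_matrix\<close> solved for \<open>u\<close>. No root occurs, so
  the map is rational and smooth wherever the first two diagonal entries are nonzero; on
  \<open>H6\<close> it is the inverse of the chart.\<close>

definition u_coords :: "real^4^4 \<Rightarrow> real^6" where
  "u_coords A = vector [(A$1$1)^2, 2 * A$1$1 * A$1$2, A$1$1 * A$2$2, - 2 * A$1$1 * A$1$3, - A$1$1 * A$2$3,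
     2 / A$1$1 * (- ((A$1$2)^2 * A$2$3 / (6 * A$1$1 * A$2$2)) - A$1$4)]"

lemma powr_three_halves: "x > 0 \<Longrightarrow> x powr (3/2) = sqrt x ^ 3" for x :: real
  by (simp add: powr_half_sqrt[symmetric] powr_powr powr_numeral[symmetric])

lemma H6_dom_cases:
  assumes "u \<in> H6_dom"
  obtains s where "s > 0" "u $ 1 = s^2" "sqrt (u $ 1) = s" "u $ 1 powr (3/2) = s^3" "u $ 3 \<noteq> 0"
  using assms that[of "sqrt (u $ 1)"] powr_three_halves[of "u $ 1"] by (auto simp: H6_dom_def)

lemma u_matrix_nth [simp]:
  "u_matrix u $ 1 $ 1 = sqrt (u$1)" "u_matrix u $ 1 $ 2 = u$2 / (2 * sqrt (u$1))"
  "u_matrix u $ 1 $ 3 = - u$4 / (2 * sqrt (u$1))"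
  "u_matrix u $ 1 $ 4 = (u$2)^2 * u$5 / (24 * u$1 powr (3/2) * u$3) - 1/2 * sqrt (u$1) * u$6"
  "u_matrix u $ 2 $ 1 = 0" "u_matrix u $ 2 $ 2 = u$3 / sqrt (u$1)"
  "u_matrix u $ 2 $ 3 = - u$5 / sqrt (u$1)" "u_matrix u $ 2 $ 4 = (u$2 * u$5 - u$3 * u$4) / (2 * u$1 powr (3/2))"
  "u_matrix u $ 3 $ 1 = 0" "u_matrix u $ 3 $ 2 = 0"
  "u_matrix u $ 3 $ 3 = sqrt (u$1) / u$3" "u_matrix u $ 3 $ 4 = - u$2 / (2 * sqrt (u$1) * u$3)"
  "u_matrix u $ 4 $ 1 = 0" "u_matrix u $ 4 $ 2 = 0" "u_matrix u $ 4 $ 3 = 0" "u_matrix u $ 4 $ 4 = 1 / sqrt (u$1)"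
  by (simp_all add: u_matrix_def)

lemma u_matrix_Sp4: assumes "u \<in> H6_dom" shows "u_matrix u \<in> carrier Sp4"
  using assms
proof (cases rule: H6_dom_cases)
  case (1 s)
  then show ?thesis unfolding Sp4_iff
    by (simp add: mat4_simps) (simp add: field_simps power2_eq_square power3_eq_cube)
qed

lemma borel_upper_u_matrix: "borel_upper (u_matrix u)"
  by (simp add: borel_upper_def)

lemma u_coords_u_matrix: assumes "u \<in> H6_dom" shows "u_coords (u_matrix u) = u"
  using assms
proof (cases rule: H6_dom_cases)
  case (1 s)
  then show ?thesis
    by (simp add: u_coords_def vec_eq_iff forall_6) (simp add: field_simps power2_eq_square power3_eq_cube)
qed

text \<open>The symplectic condition is skew, and for an upper triangular matrix its entries (1,2)
  and (1,3) are trivial; these are the other four.\<close>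

lemma Sp4_borel_entries:
  assumes "A \<in> carrier Sp4" "borel_upper A"
  shows "A$1$1 * A$4$4 = 1" "A$2$2 * A$3$3 = 1" "A$1$2 * A$4$4 + A$2$2 * A$3$4 = 0"
    "A$1$3 * A$4$4 + A$2$3 * A$3$4 = A$3$3 * A$2$4"
proof -
  have e: "(transpose A ** sympl_form ** A) $ i $ j = sympl_form $ i $ j" for i j
    using assms(1) by (simp add: Sp4_iff)
  note simps = borel_upper_def matrix_matrix_mult_def sum_4 transpose_def
  show "A$1$1 * A$4$4 = 1" using e[of 1 4] assms(2) by (simp add: simps)
  show "A$2$2 * A$3$3 = 1" using e[of 2 3] assms(2) by (simp add: simps)
  show "A$1$2 * A$4$4 + A$2$2 * A$3$4 = 0" using e[of 2 4] assms(2) by (simp add: simps)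
  show "A$1$3 * A$4$4 + A$2$3 * A$3$4 = A$3$3 * A$2$4" using e[of 3 4] assms(2) by (simp add: simps)
qed

lemma u_coords_H6_dom:
  assumes "A \<in> carrier Sp4" "borel_upper A" shows "A$1$1 \<noteq> 0" "A$2$2 \<noteq> 0" "u_coords A \<in> H6_dom"
  using Sp4_borel_entries[OF assms] by (auto simp: u_coords_def H6_dom_def)

text \<open>Of the ten entries of an upper triangular symplectic matrix six are free, and the rest
  is solved from the four relations. Positivity enters because \<open>u_matrix\<close> takes the
  positive root of the squared first entry.\<close>

lemma u_matrix_u_coords:
  assumes A: "A \<in> carrier Sp4" "borel_upper A" "A$1$1 > 0"
  shows "u_matrix (u_coords A) = A"
proof -
  note nz = u_coords_H6_dom[OF A(1,2)]
  have eqs: "A$4$4 = 1 / A$1$1" "A$3$3 = 1 / A$2$2" 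
    using Sp4_borel_entries[OF A(1,2)] nz by (simp_all add: field_simps)
  have e34: "A$3$4 = - A$1$2 / (A$1$1 * A$2$2)"
    using Sp4_borel_entries(3)[OF A(1,2)] nz eqs by (simp add: field_simps)
  have e24: "A$2$4 = A$2$2 * (A$1$3 / A$1$1 - A$2$3 * A$1$2 / (A$1$1 * A$2$2))"
    using Sp4_borel_entries(4)[OF A(1,2)] nz eqs e34 by (simp add: field_simps)
  have s: "sqrt ((A$1$1)^2) = A$1$1" "((A$1$1)^2) powr (3/2) = (A$1$1)^3"
    using A(3) powr_three_halves[of "(A$1$1)^2"] by auto
  show ?thesis
    using A(2) nz unfolding borel_upper_def
    by (simp add: vec_eq_iff forall_4 u_coords_def s eqs e34 e24)
      (use A(3) in \<open>simp add: field_simps power2_eq_square power3_eq_cube\<close>)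
qed

text \<open>Replaces the parametrisation by conditions that are visibly stable under products and
  inverses; the subgroup properties of \<open>H6\<close> rest on it. The sign of
  \<open>u\<^sub>3\<close> stays free.\<close>

lemma H6_iff: "A \<in> H6 \<longleftrightarrow> A \<in> carrier Sp4 \<and> borel_upper A \<and> A$1$1 > 0"
proof
  assume "A \<in> H6"
  then show "A \<in> carrier Sp4 \<and> borel_upper A \<and> A$1$1 > 0"
    unfolding H6_def using u_matrix_Sp4 borel_upper_u_matrix by (auto simp: H6_dom_def)
next
  assume "A \<in> carrier Sp4 \<and> borel_upper A \<and> A$1$1 > 0"
  then show "A \<in> H6"
    unfolding H6_def using u_matrix_u_coords[of A] u_coords_H6_dom[of A] by (metis image_eqI)
qed

lemma u_matrix_H6: "u \<in> H6_dom \<Longrightarrow> u_matrix u \<in> H6"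
  by (simp add: H6_def)

lemma u_coords_mem: "A \<in> H6 \<Longrightarrow> u_coords A \<in> H6_dom \<and> u_matrix (u_coords A) = A"
  using H6_iff u_coords_H6_dom u_matrix_u_coords by blast

lemma bij_u_matrix: "bij_betw u_matrix H6_dom H6"
  by (rule bij_betw_byWitness[where f' = u_coords])
    (use u_coords_u_matrix u_coords_mem u_matrix_H6 in auto)

lemma inv_into_u_matrix: "A \<in> H6 \<Longrightarrow> inv_into H6_dom u_matrix A = u_coords A"
  by (metis bij_betw_imp_inj_on bij_u_matrix inv_into_f_eq u_coords_mem)

lemma H6_mult: "A \<in> H6 \<Longrightarrow> B \<in> H6 \<Longrightarrow> A ** B \<in> H6"
  unfolding H6_iff using Sp4_mult by (auto simp: borel_upper_def matrix_matrix_mult_def sum_4)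

lemma H6_one: "mat 1 \<in> H6"
  unfolding H6_iff using Sp4_one by (auto simp: borel_upper_def mat_def)

lemma sp_inv_nth: "sp_inv A = vector
   [vector [A$4$4, A$3$4, - A$2$4, - A$1$4], vector [A$4$3, A$3$3, - A$2$3, - A$1$3],
    vector [- A$4$2, - A$3$2, A$2$2, A$1$2], vector [- A$4$1, - A$3$1, A$2$1, A$1$1]]"
  by (simp add: sp_inv_def mat4_simps)

lemma H6_sp_inv: assumes "A \<in> H6" shows "sp_inv A \<in> H6"
proof -
  have A: "A \<in> carrier Sp4" "borel_upper A" "A$1$1 > 0" using assms by (simp_all add: H6_iff)
  have "A$4$4 > 0"
    using zero_less_mult_pos[of "A$1$1" "A$4$4"] A(3) Sp4_borel_entries(1)[OF A(1,2)] by simp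
  then show ?thesis
    using A(2) Sp4_sp_inv[OF A(1)] unfolding H6_iff by (simp add: borel_upper_def sp_inv_nth)
qed

lemma subgroup_H6: "subgroup H6 Sp4"
proof (rule subgroup.intro)
  show "H6 \<subseteq> carrier Sp4" by (auto simp: H6_iff)
  show "A \<otimes>\<^bsub>Sp4\<^esub> B \<in> H6" if "A \<in> H6" "B \<in> H6" for A B
    using H6_mult[OF that] by (simp add: Sp4_def)
  show "\<one>\<^bsub>Sp4\<^esub> \<in> H6" using H6_one by (simp add: Sp4_def)
  fix A assume A: "A \<in> H6"
  then have A': "A \<in> carrier Sp4" by (simp add: H6_iff)
  have "inv\<^bsub>Sp4\<^esub> A = sp_inv A"
    by (rule group.inv_equality[OF group_Sp4])
      (use A' sp_inv_left[OF A'] Sp4_sp_inv[OF A'] in \<open>simp_all add: Sp4_def\<close>)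
  then show "inv\<^bsub>Sp4\<^esub> A \<in> H6" using H6_sp_inv[OF A] by simp
qed

lemma open_H6_dom: "open H6_dom"
  unfolding H6_dom_def
  by (intro open_Collect_conj open_Collect_less open_Collect_neq continuous_intros)

lemma smooth_on_powr_three_halves:
  fixes f :: "'a::euclidean_space \<Rightarrow> real"
  assumes "open S" "smooth_on S f" "\<And>x. x \<in> S \<Longrightarrow> f x > 0"
  shows "smooth_on S (\<lambda>x. f x powr (3/2))"
proof -
  have "smooth_on S (\<lambda>x. sqrt (f x) ^ 3)"
    by (intro smooth_on_power smooth_on_sqrt assms)
  then show ?thesis
    by (rule iffD1[OF smooth_on_cong[OF assms(1)], rotated]) (simp add: powr_three_halves assms(3))
qed

lemma forall_4': "P 1 \<Longrightarrow> P 2 \<Longrightarrow> P 3 \<Longrightarrow> P 4 \<Longrightarrow> P (i::4)"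
  using forall_4[of P] by blast

lemma forall_6': "P 1 \<Longrightarrow> P 2 \<Longrightarrow> P 3 \<Longrightarrow> P 4 \<Longrightarrow> P 5 \<Longrightarrow> P 6 \<Longrightarrow> P (i::6)"
  using forall_6[of P] by blast

lemma smooth_on_u_matrix: "smooth_on H6_dom u_matrix"
proof (intro smooth_on_vec open_H6_dom)
  fix i j :: 4
  show "smooth_on H6_dom (\<lambda>u. u_matrix u $ i $ j)"
    by (rule forall_4'[of _ i]; rule forall_4'[of _ j]; unfold u_matrix_nth)
      (intro smooth_intros smooth_on_divide smooth_on_sqrt smooth_on_powr_three_halves open_H6_dom; auto simp: H6_dom_def)+
qed

lemma open_u_coords_dom: "open {A :: real^4^4. A$1$1 \<noteq> 0 \<and> A$2$2 \<noteq> 0}"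
  by (intro open_Collect_conj open_Collect_neq continuous_intros)

lemma smooth_on_u_coords: "smooth_on {A. A$1$1 \<noteq> 0 \<and> A$2$2 \<noteq> 0} u_coords"
proof (intro smooth_on_vec open_u_coords_dom)
  fix i :: 6
  show "smooth_on {A. A$1$1 \<noteq> 0 \<and> A$2$2 \<noteq> 0} (\<lambda>A. u_coords A $ i)"
    by (rule forall_6'[of _ i]; simp only: u_coords_def vector_6)
      (intro smooth_intros smooth_on_divide open_u_coords_dom; auto)+
qed

lemma H6_diag: "A \<in> H6 \<Longrightarrow> A$1$1 \<noteq> 0 \<and> A$2$2 \<noteq> 0"
  using u_coords_H6_dom H6_iff by blast

lemma has_derivative_u_matrix: "u \<in> H6_dom \<Longrightarrow> (u_matrix has_derivative frechet_derivative u_matrix (at u)) (at u)"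
  using smooth_on_has_derivative[OF smooth_on_u_matrix] .

lemma has_derivative_u_coords: "A \<in> H6 \<Longrightarrow> (u_coords has_derivative frechet_derivative u_coords (at A)) (at A)"
  using smooth_on_has_derivative[OF smooth_on_u_coords] H6_diag by blast

text \<open>Makes the chart an immersion, which is needed for \<open>global_chart\<close> and for
  the injectivity of \<open>mc_form\<close>.\<close>

lemma u_coords_derivative_left_inverse:
  assumes u: "u \<in> H6_dom"
  shows "frechet_derivative u_coords (at (u_matrix u)) (frechet_derivative u_matrix (at u) v) = v"
proof -
  have 1: "((\<lambda>u. u_coords (u_matrix u)) has_derivative
     (\<lambda>v. frechet_derivative u_coords (at (u_matrix u)) (frechet_derivative u_matrix (at u) v))) (at u)"
    by (rule has_derivative_compose[OF has_derivative_u_matrix has_derivative_u_coords])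
      (use u u_matrix_H6 in auto)
  have 2: "((\<lambda>u. u_coords (u_matrix u)) has_derivative (\<lambda>v. v)) (at u)"
    by (rule has_derivative_transform_within_open[OF has_derivative_ident open_H6_dom u])
      (simp add: u_coords_u_matrix)
  show ?thesis using fun_cong[OF has_derivative_unique[OF 1 2], of v] .
qed

lemma global_chart_u_matrix: "global_chart H6_dom u_matrix H6"
  unfolding global_chart_def
proof (intro conjI ballI open_H6_dom smooth_on_u_matrix bij_u_matrix)
  have "continuous_on H6 u_coords"
    by (rule continuous_on_subset[OF smooth_on_continuous_on[OF smooth_on_u_coords]]) (use H6_diag in auto)
  then show "continuous_on H6 (inv_into H6_dom u_matrix)"
    by (rule continuous_on_eq) (simp add: inv_into_u_matrix)
  show "inj (frechet_derivative u_matrix (at u))" if "u \<in> H6_dom" for u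
    using u_coords_derivative_left_inverse[OF that] by (metis injI)
qed

lemma unit_coords_H6_dom: "unit_coords \<in> H6_dom"
  by (simp add: unit_coords_def H6_dom_def)

lemma u_matrix_unit_coords: "u_matrix unit_coords = mat 1"
  by (simp add: unit_coords_def mat4_simps)

subsection \<open>The grading\<close>

lemma ball_int_1_4: "(\<forall>i\<in>{1..4::int}. P i) \<longleftrightarrow> P 1 \<and> P 2 \<and> P 3 \<and> P 4"
proof -
  have "{1..4::int} = {1, 2, 3, 4}" by auto
  then show ?thesis by simp
qed

lemma sp4_grade_iff: "X \<in> sp4_grade k \<longleftrightarrow> X \<in> sp4 \<and> (k \<noteq> -3 \<longrightarrow> X$4$1 = 0) \<and> (k \<noteq> -2 \<longrightarrow> X$3$1 = 0) \<and>
   (k \<noteq> -1 \<longrightarrow> X$3$2 = 0 \<and> X$2$1 = 0) \<and> (k \<noteq> 0 \<longrightarrow> X$1$1 = 0 \<and> X$2$2 = 0) \<and>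
   (k \<noteq> 1 \<longrightarrow> X$1$2 = 0 \<and> X$2$3 = 0) \<and> (k \<noteq> 2 \<longrightarrow> X$1$3 = 0) \<and> (k \<noteq> 3 \<longrightarrow> X$1$4 = 0)"
  unfolding sp4_grade_def sp4_iff_entries ball_int_1_4 mem_Collect_eq by simp argo

text \<open>Each entry of an \<open>sp4\<close> matrix belongs to one degree, so lying in a sum of
  degrees means that the entries of the missing degrees vanish. All parts of the grading that occur
  later are instances.\<close>

lemma span_sp4_grades: "X \<in> span (\<Union>k\<in>K. sp4_grade k) \<longleftrightarrow>
   X \<in> sp4 \<and> (-3 \<notin> K \<longrightarrow> X$4$1 = 0) \<and> (-2 \<notin> K \<longrightarrow> X$3$1 = 0) \<and>
   (-1 \<notin> K \<longrightarrow> X$3$2 = 0 \<and> X$2$1 = 0) \<and> (0 \<notin> K \<longrightarrow> X$1$1 = 0 \<and> X$2$2 = 0) \<and>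
   (1 \<notin> K \<longrightarrow> X$1$2 = 0 \<and> X$2$3 = 0) \<and> (2 \<notin> K \<longrightarrow> X$1$3 = 0) \<and> (3 \<notin> K \<longrightarrow> X$1$4 = 0)"
  (is "_ \<longleftrightarrow> X \<in> sp4 \<and> ?R X")
proof
  have "subspace {X. X \<in> sp4 \<and> ?R X}"
    using subspace_sp4 by (auto simp: subspace_def)
  moreover have "(\<Union>k\<in>K. sp4_grade k) \<subseteq> {X. X \<in> sp4 \<and> ?R X}"
    by (auto simp: sp4_grade_iff)
  ultimately show "X \<in> span (\<Union>k\<in>K. sp4_grade k) \<Longrightarrow> X \<in> sp4 \<and> ?R X"
    using span_minimal by blast
next
  assume X: "X \<in> sp4 \<and> ?R X"
  define t where "t = fst (sp4_coords X)"
  define w where "w = snd (sp4_coords X)"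
  define G where "G = span (\<Union>k\<in>K. sp4_grade k)"
  have tw: "sp4_matrix (t, w) = X" using X by (simp add: t_def w_def sp4_iff_coords)
  have G0: "0 \<in> G" by (simp add: G_def span_zero)
  have G: "Y \<in> G" if "Y \<in> sp4_grade k" "k \<notin> K \<Longrightarrow> Y = 0" for k Y
    using that G0 by (cases "k \<in> K") (auto simp: G_def intro: span_base)
  have mem: "sp4_matrix p \<in> sp4" for p by (simp add: sp4_def)
  have 1: "sp4_matrix (vector [t$1, 0, 0, 0], 0) \<in> G"
    by (rule G[of _ "-3"]) (use X in \<open>simp_all add: sp4_grade_iff mem mat4_simps t_def\<close>)
  have 2: "sp4_matrix (vector [0, t$2, 0, 0], 0) \<in> G"
    by (rule G[of _ "-2"]) (use X in \<open>simp_all add: sp4_grade_iff mem mat4_simps t_def\<close>)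
  have 3: "sp4_matrix (vector [0, 0, t$3, t$4], 0) \<in> G"
    by (rule G[of _ "-1"]) (use X in \<open>simp_all add: sp4_grade_iff mem mat4_simps t_def\<close>)
  have 4: "sp4_matrix (0, vector [w$1, 0, w$3, 0, 0, 0]) \<in> G"
    by (rule G[of _ "0"]) (use X in \<open>simp_all add: sp4_grade_iff mem mat4_simps w_def\<close>)
  have 5: "sp4_matrix (0, vector [0, w$2, 0, 0, w$5, 0]) \<in> G"
    by (rule G[of _ "1"]) (use X in \<open>simp_all add: sp4_grade_iff mem mat4_simps w_def\<close>)
  have 6: "sp4_matrix (0, vector [0, 0, 0, w$4, 0, 0]) \<in> G"
    by (rule G[of _ "2"]) (use X in \<open>simp_all add: sp4_grade_iff mem mat4_simps w_def\<close>)
  have 7: "sp4_matrix (0, vector [0, 0, 0, 0, 0, w$6]) \<in> G"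
    by (rule G[of _ "3"]) (use X in \<open>simp_all add: sp4_grade_iff mem mat4_simps w_def\<close>)
  have "X = sp4_matrix (vector [t$1, 0, 0, 0], 0) + (sp4_matrix (vector [0, t$2, 0, 0], 0) +
     (sp4_matrix (vector [0, 0, t$3, t$4], 0) + (sp4_matrix (0, vector [w$1, 0, w$3, 0, 0, 0]) +
     (sp4_matrix (0, vector [0, w$2, 0, 0, w$5, 0]) + (sp4_matrix (0, vector [0, 0, 0, w$4, 0, 0]) +
     sp4_matrix (0, vector [0, 0, 0, 0, 0, w$6]))))))"
    unfolding tw[symmetric] by (simp add: mat4_simps)
  also have "\<dots> \<in> G"
    unfolding G_def by (intro span_add; fold G_def; fact 1 2 3 4 5 6 7)
  finally show "X \<in> span (\<Union>k\<in>K. sp4_grade k)" by (simp add: G_def)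
qed

lemma neg_part_iff: "X \<in> neg_part \<longleftrightarrow> (\<exists>t. X = sp4_matrix (t, 0))"
proof
  assume "X \<in> neg_part"
  then have "X = sp4_matrix (fst (sp4_coords X), 0)"
    unfolding neg_part_def span_sp4_grades sp4_iff_entries by (simp add: mat4_simps)
  then show "\<exists>t. X = sp4_matrix (t, 0)" by blast
qed (auto simp: neg_part_def span_sp4_grades sp4_def)

lemma pos_part_iff: "X \<in> pos_part \<longleftrightarrow> (\<exists>w. w$1 = 0 \<and> w$3 = 0 \<and> X = sp4_matrix (0, w))"
proof
  assume "X \<in> pos_part"
  then have "X = sp4_matrix (0, snd (sp4_coords X)) \<and> snd (sp4_coords X) $ 1 = 0 \<and> snd (sp4_coords X) $ 3 = 0"
    unfolding pos_part_def span_sp4_grades sp4_iff_entries by (simp add: mat4_simps)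
  then show "\<exists>w. w$1 = 0 \<and> w$3 = 0 \<and> X = sp4_matrix (0, w)" by blast
qed (auto simp: pos_part_def span_sp4_grades sp4_def)

lemma nonneg_part_iff: "X \<in> nonneg_part \<longleftrightarrow> X \<in> sp4 \<and> borel_upper X"
  unfolding nonneg_part_def span_sp4_grades sp4_iff_entries borel_upper_def by auto

lemma nonneg_part_coords: "X \<in> nonneg_part \<longleftrightarrow> (\<exists>w. X = sp4_matrix (0, w))"
proof
  assume "X \<in> nonneg_part"
  then have "X = sp4_matrix (0, snd (sp4_coords X))"
    unfolding nonneg_part_iff borel_upper_def sp4_iff_entries by (simp add: mat4_simps)
  then show "\<exists>w. X = sp4_matrix (0, w)" by blast
qed (auto simp: nonneg_part_iff sp4_def borel_upper_def)

lemma proj_neg_eq: assumes "X \<in> sp4" shows "proj_neg X = sp4_matrix (fst (sp4_coords X), 0)"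
  unfolding proj_neg_def
proof (rule the_equality)
  have "X - sp4_matrix (fst (sp4_coords X), 0) \<in> sp4"
    using assms subspace_sp4 by (auto intro: subspace_diff simp: sp4_def)
  then show "sp4_matrix (fst (sp4_coords X), 0) \<in> neg_part \<and> X - sp4_matrix (fst (sp4_coords X), 0) \<in> nonneg_part"
    using assms by (auto simp: neg_part_iff nonneg_part_iff borel_upper_def sp4_iff_entries)
next
  fix Y assume Y: "Y \<in> neg_part \<and> X - Y \<in> nonneg_part"
  then obtain t where t: "Y = sp4_matrix (t, 0)" by (auto simp: neg_part_iff)
  with Y have "t = fst (sp4_coords X)"
    by (auto simp: nonneg_part_iff borel_upper_def vec_eq_iff forall_4)
  with t show "Y = sp4_matrix (fst (sp4_coords X), 0)" by simp
qed

subsection \<open>The Maurer-Cartan form\<close>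

text \<open>The left-invariant Maurer-Cartan form of \<open>H6\<close> in the coordinates
  \<open>u\<close>; it is the vertical part of \<open>omega_hat\<close>.\<close>

definition mc_form :: "real^6 \<Rightarrow> real^6 \<Rightarrow> real^4^4" where
  "mc_form u v = sp_inv (u_matrix u) ** frechet_derivative u_matrix (at u) v"

lemma linear_mc_form: "u \<in> H6_dom \<Longrightarrow> linear (mc_form u)"
  using smooth_on_linear_derivative[OF smooth_on_u_matrix] unfolding mc_form_def
  by (intro linearI) (simp_all add: linear_add linear_cmul matrix_mult_simps)

lemma u_matrix_mc_form: "u \<in> H6_dom \<Longrightarrow> u_matrix u ** mc_form u v = frechet_derivative u_matrix (at u) v"
  unfolding mc_form_def by (simp add: matrix_mul_assoc sp_inv_right u_matrix_Sp4)

lemma has_vector_derivative_nth2: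
  "(\<gamma> has_vector_derivative A) (at t) \<Longrightarrow> ((\<lambda>t. \<gamma> t $ i $ j) has_vector_derivative A $ i $ j) (at t)"
  for \<gamma> :: "real \<Rightarrow> real^'n^'m"
  by (rule bounded_linear.has_vector_derivative[OF bounded_linear_vec_nth])
    (rule bounded_linear.has_vector_derivative[OF bounded_linear_vec_nth])

lemma bounded_linear_transpose: "bounded_linear (transpose :: real^'n^'m \<Rightarrow> _)"
  unfolding linear_conv_bounded_linear[symmetric]
  by (rule linearI) (simp_all add: transpose_def vec_eq_iff)

text \<open>Differentiates the symplectic condition along the curve; left translation by
  \<open>sp_inv (\<gamma> t)\<close> moves the velocity to the identity, where the condition is that
  of \<open>sp4\<close>.\<close>

lemma curve_Sp4_derivative:
  assumes \<gamma>: "\<And>t. \<gamma> t \<in> carrier Sp4" and A: "(\<gamma> has_vector_derivative A) (at t)"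
  shows "sp_inv (\<gamma> t) ** A \<in> sp4"
proof -
  let ?X = "sp_inv (\<gamma> t) ** A"
  have A_eq: "A = \<gamma> t ** ?X" using \<gamma> by (simp add: matrix_mul_assoc sp_inv_right)
  have 1: "((\<lambda>t. transpose (\<gamma> t) ** sympl_form ** \<gamma> t) has_vector_derivative
     transpose (\<gamma> t) ** sympl_form ** A + (transpose (\<gamma> t) ** 0 + transpose A ** sympl_form) ** \<gamma> t) (at t)"
    by (intro bounded_bilinear.has_vector_derivative[OF bounded_bilinear_matrix_mult]
        bounded_linear.has_vector_derivative[OF bounded_linear_transpose] A has_vector_derivative_const)
  have 2: "((\<lambda>t. transpose (\<gamma> t) ** sympl_form ** \<gamma> t) has_vector_derivative 0) (at t)"
    using \<gamma> unfolding Sp4_iff by simp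
  have e: "transpose (\<gamma> t) ** (sympl_form ** \<gamma> t) = sympl_form"
    using \<gamma>[of t] unfolding Sp4_iff by (simp add: matrix_mul_assoc)
  then have e': "transpose (\<gamma> t) ** (sympl_form ** (\<gamma> t ** Y)) = sympl_form ** Y" for Y :: "real^4^4"
    by (metis matrix_mul_assoc)
  have "transpose (\<gamma> t) ** sympl_form ** A + transpose A ** sympl_form ** \<gamma> t = 0"
    using vector_derivative_unique_at[OF 1 2] by (simp add: matrix_mult_simps)
  then show ?thesis
    unfolding sp4_iff by (subst (asm) (1 2) A_eq)
      (simp add: matrix_transpose_mul matrix_mul_assoc[symmetric] e e' add.commute)
qed

text \<open>\<open>lie_algebra\<close> asks for curves that stay in the group for all real times,
  while the line through \<open>u\<close> in direction \<open>v\<close> may leave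
  \<open>H6_dom\<close>. There it is replaced by the constant \<open>u\<close>, which does not
  affect the derivative at 0.\<close>

lemma u_matrix_curve:
  assumes u: "u \<in> H6_dom"
  obtains \<gamma> where "\<gamma> 0 = u_matrix u" "\<And>t::real. \<gamma> t \<in> H6"
    "(\<gamma> has_vector_derivative frechet_derivative u_matrix (at u) v) (at 0)"
proof -
  define \<gamma> where "\<gamma> t = u_matrix (if u + t *\<^sub>R v \<in> H6_dom then u + t *\<^sub>R v else u)" for t
  have "\<gamma> t \<in> H6" for t
    using u by (simp add: u_matrix_H6 \<gamma>_def)
  moreover have "(\<gamma> has_vector_derivative frechet_derivative u_matrix (at u) v) (at 0)"
  proof -
    have lin: "linear (frechet_derivative u_matrix (at u))"
      using smooth_on_linear_derivative[OF smooth_on_u_matrix u] .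
    have "((\<lambda>t. u + t *\<^sub>R v) has_derivative (\<lambda>t. t *\<^sub>R v)) (at (0::real))"
      by (auto intro!: derivative_eq_intros)
    from has_derivative_compose[OF this, of u_matrix "frechet_derivative u_matrix (at u)"] has_derivative_u_matrix[OF u]
    have "((\<lambda>t. u_matrix (u + t *\<^sub>R v)) has_derivative (\<lambda>t. t *\<^sub>R frechet_derivative u_matrix (at u) v)) (at 0)"
      by (simp add: linear_cmul[OF lin])
    then show ?thesis
      unfolding has_vector_derivative_def
    proof (rule has_derivative_transform_within_open)
      have "open ((\<lambda>t. u + t *\<^sub>R v) -` H6_dom)"
        by (rule open_vimage[OF open_H6_dom]) (intro continuous_intros)
      then show "open {t. u + t *\<^sub>R v \<in> H6_dom}" by (simp add: vimage_def)
    qed (auto simp: \<gamma>_def u)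
  qed
  ultimately show thesis using that[of \<gamma>] by (simp add: \<gamma>_def)
qed

lemma curve_H6_derivative:
  assumes \<gamma>: "\<And>t. \<gamma> t \<in> H6" and A: "(\<gamma> has_vector_derivative A) (at t)"
  shows "sp_inv (\<gamma> t) ** A \<in> nonneg_part"
proof -
  have sp: "\<gamma> t \<in> carrier Sp4" "borel_upper (\<gamma> t)" for t
    using \<gamma>[of t] by (auto simp: H6_iff)
  have "A $ i $ j = 0" if "\<And>t. \<gamma> t $ i $ j = 0" for i j
    using vector_derivative_unique_at[OF has_vector_derivative_nth2[OF A, of i j]] that by simp
  then have "borel_upper A"
    using sp(2) by (simp add: borel_upper_def)
  then have "borel_upper (sp_inv (\<gamma> t) ** A)"
    using sp(2)[of t] by (simp add: borel_upper_def sp_inv_nth matrix_matrix_mult_def sum_4)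
  then show ?thesis
    using curve_Sp4_derivative[OF sp(1) A] by (simp add: nonneg_part_iff)
qed

lemma mc_form_nonneg: assumes u: "u \<in> H6_dom" shows "mc_form u v \<in> nonneg_part"
proof -
  obtain \<gamma> where "\<gamma> 0 = u_matrix u" "\<And>t::real. \<gamma> t \<in> H6"
    "(\<gamma> has_vector_derivative frechet_derivative u_matrix (at u) v) (at 0)"
    using u_matrix_curve[OF u] by metis
  with curve_H6_derivative[OF this(2,3)] show ?thesis by (simp add: mc_form_def)
qed

text \<open>The chart has an injective derivative, and \<open>nonneg_part\<close> has six
  coordinates just like \<open>u\<close>, so surjectivity follows from injectivity.\<close>

lemma mc_form_bij: assumes u: "u \<in> H6_dom" shows "bij_betw (mc_form u) UNIV nonneg_part"
proof -
  let ?f = "\<lambda>v. snd (sp4_coords (mc_form u v))"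
  have lin: "linear ?f"
    using linear_compose[OF linear_compose[OF linear_mc_form[OF u] linear_sp4_coords] linear_snd] by (simp add: o_def)
  have eq: "sp4_matrix (0, ?f v) = mc_form u v" for v
  proof -
    obtain w where "mc_form u v = sp4_matrix (0, w)" using mc_form_nonneg[OF u] nonneg_part_coords by metis
    then show ?thesis by simp
  qed
  have inj: "inj (mc_form u)"
  proof (rule injI)
    fix v v' assume "mc_form u v = mc_form u v'"
    then have "frechet_derivative u_matrix (at u) v = frechet_derivative u_matrix (at u) v'"
      using u_matrix_mc_form[OF u, of v] u_matrix_mc_form[OF u, of v'] by simp
    from arg_cong[OF this, of "frechet_derivative u_coords (at (u_matrix u))"]
    show "v = v'" unfolding u_coords_derivative_left_inverse[OF u] .
  qed
  have "inj ?f"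
  proof (rule injI)
    fix v v' assume "?f v = ?f v'"
    from arg_cong[OF this, of "\<lambda>w. sp4_matrix (0, w)"] have "mc_form u v = mc_form u v'" unfolding eq .
    then show "v = v'" by (rule injD[OF inj])
  qed
  then have surj: "surj ?f" using linear_injective_imp_surjective[OF lin] by blast
  have "X \<in> range (mc_form u)" if "X \<in> nonneg_part" for X
  proof -
    obtain w where "X = sp4_matrix (0, w)" using \<open>X \<in> nonneg_part\<close> nonneg_part_coords by blast
    moreover obtain v where "w = ?f v" using surj by (rule surjE)
    ultimately have "X = mc_form u v" by (simp only: eq)
    then show ?thesis by blast
  qed
  then show ?thesis using inj mc_form_nonneg[OF u] by (auto simp: bij_betw_def)
qed

lemma sp_inv_one: "sp_inv (mat 1) = mat 1"
  by (simp add: mat4_simps sp_inv_nth)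

lemma H6_curve:
  assumes "A \<in> nonneg_part"
  obtains \<gamma> where "\<gamma> 0 = mat 1" "\<And>t::real. \<gamma> t \<in> H6" "(\<gamma> has_vector_derivative A) (at 0)"
proof -
  obtain v where "A = mc_form unit_coords v"
    using mc_form_bij[OF unit_coords_H6_dom] assms by (auto simp: bij_betw_def)
  then have "A = frechet_derivative u_matrix (at unit_coords) v"
    by (simp add: mc_form_def u_matrix_unit_coords sp_inv_one)
  then show thesis
    using u_matrix_curve[OF unit_coords_H6_dom, of v] that u_matrix_unit_coords by metis
qed

lemma lie_algebra_H6: "lie_algebra H6 = nonneg_part"
proof
  show "lie_algebra H6 \<subseteq> nonneg_part"
    using curve_H6_derivative by (fastforce simp: lie_algebra_def sp_inv_one)
  show "nonneg_part \<subseteq> lie_algebra H6"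
  proof
    fix A assume "A \<in> nonneg_part"
    from H6_curve[OF this] show "A \<in> lie_algebra H6"
      unfolding lie_algebra_def by blast
  qed
qed

lemma lie_algebra_Sp4: "lie_algebra (carrier Sp4) = sp4"
proof
  show "lie_algebra (carrier Sp4) \<subseteq> sp4"
    using curve_Sp4_derivative by (fastforce simp: lie_algebra_def sp_inv_one)
  show "sp4 \<subseteq> lie_algebra (carrier Sp4)"
  proof
    fix A assume A: "A \<in> sp4"
    \<comment> \<open>Splits \<open>A\<close> into an upper triangular part and a strictly lower
      triangular one, whose transpose lies in \<open>nonneg_part\<close> too. A curve in
      \<open>H6\<close> times a transposed curve in \<open>H6\<close> then has velocity
      \<open>A\<close> at the identity.\<close>
    define B where "B = sp4_matrix (0, snd (sp4_coords A))"
    define C where "C = transpose (A - B)"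
    have B: "B \<in> nonneg_part" by (auto simp: nonneg_part_coords B_def)
    have "A - B \<in> sp4" using A B subspace_sp4 by (auto intro: subspace_diff simp: nonneg_part_iff)
    then have "C \<in> sp4" by (simp add: C_def sp4_transpose)
    moreover have "borel_upper C"
      using A by (simp add: C_def B_def borel_upper_def transpose_def sp4_iff_entries)
    ultimately have C: "C \<in> nonneg_part" by (simp add: nonneg_part_iff)
    obtain \<gamma> where \<gamma>: "\<gamma> 0 = mat 1" "\<And>t::real. \<gamma> t \<in> H6" "(\<gamma> has_vector_derivative B) (at 0)"
      using H6_curve[OF B] by metis
    obtain \<delta> where \<delta>: "\<delta> 0 = mat 1" "\<And>t::real. \<delta> t \<in> H6" "(\<delta> has_vector_derivative C) (at 0)"
      using H6_curve[OF C] by metis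
    have "((\<lambda>t. \<gamma> t ** transpose (\<delta> t)) has_vector_derivative
        \<gamma> 0 ** transpose C + B ** transpose (\<delta> 0)) (at 0)"
      by (intro bounded_bilinear.has_vector_derivative[OF bounded_bilinear_matrix_mult]
          bounded_linear.has_vector_derivative[OF bounded_linear_transpose] \<gamma> \<delta>)
    then have "((\<lambda>t. \<gamma> t ** transpose (\<delta> t)) has_vector_derivative A) (at 0)"
      by (simp add: \<gamma>(1) \<delta>(1) C_def transpose_transpose transpose_mat)
    moreover have "\<gamma> t ** transpose (\<delta> t) \<in> carrier Sp4" for t
      using \<gamma>(2)[of t] \<delta>(2)[of t] by (intro Sp4_mult Sp4_transpose) (auto simp: H6_iff)
    ultimately show "A \<in> lie_algebra (carrier Sp4)"
      unfolding lie_algebra_def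
      by (intro CollectI exI[of _ "\<lambda>t. \<gamma> t ** transpose (\<delta> t)"]) (simp add: \<gamma>(1) \<delta>(1) transpose_mat)
  qed
qed

section \<open>The principal bundle\<close>

lemma H6_act_eq: "snd w \<in> H6_dom \<Longrightarrow> h \<in> H6 \<Longrightarrow> H6_act w h = (fst w, u_coords (u_matrix (snd w) ** h))"
  by (simp add: H6_act_def inv_into_u_matrix H6_mult u_matrix_H6)

lemma u_matrix_H6_act: "snd w \<in> H6_dom \<Longrightarrow> h \<in> H6 \<Longrightarrow> u_matrix (snd (H6_act w h)) = u_matrix (snd w) ** h"
  using u_coords_mem[of "u_matrix (snd w) ** h"] by (simp add: H6_act_eq H6_mult u_matrix_H6)

lemma H6_act_Pc: "w \<in> Pc U \<Longrightarrow> h \<in> H6 \<Longrightarrow> H6_act w h \<in> Pc U"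
  using u_coords_mem[of "u_matrix (snd w) ** h"]
  by (auto simp: Pc_def H6_act_eq H6_mult u_matrix_H6)

lemma open_Pc: "open U \<Longrightarrow> open (Pc U)"
  by (simp add: Pc_def open_Times open_H6_dom)

lemma smooth_on_u_matrix_compose:
  fixes f :: "'a::euclidean_space \<Rightarrow> real^6"
  assumes "open S" "smooth_on S f" "f ` S \<subseteq> H6_dom"
  shows "smooth_on S (\<lambda>x. u_matrix (f x))"
  by (rule smooth_on_compose[OF assms(1) open_H6_dom assms(3) smooth_on_u_matrix assms(2)])

lemma smooth_on_u_coords_compose:
  fixes f :: "'a::euclidean_space \<Rightarrow> real^4^4"
  assumes "open S" "smooth_on S f" "f ` S \<subseteq> H6"
  shows "smooth_on S (\<lambda>x. u_coords (f x))"
  by (rule smooth_on_compose[OF assms(1) open_u_coords_dom _ smooth_on_u_coords assms(2)])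
    (use assms(3) H6_diag in blast)

text \<open>The bundle is trivial: the constant section at \<open>unit_coords\<close> serves for
  every point, and the trivialisation it induces is the identity of
  \<open>U \<times> H6_dom\<close>.\<close>

lemma principal_bundle_Pc:
  assumes U: "open U"
  shows "principal_bundle H6_dom u_matrix H6 (Pc U) fst U H6_act"
  unfolding principal_bundle_def
proof (intro conjI ballI impI global_chart_u_matrix open_Pc U)
  show "smooth_on (Pc U) fst"
    using smooth_on_fst[OF open_Pc[OF U] smooth_on_id[OF open_Pc[OF U]]] by simp
  show "fst ` Pc U = U"
    using unit_coords_H6_dom by (auto simp: Pc_def)
  show "H6_act w (mat 1) = w" if "w \<in> Pc U" for w
    using that by (auto simp: Pc_def H6_act_eq H6_one u_coords_u_matrix)
  show "H6_act w h \<in> Pc U" "fst (H6_act w h) = fst w" if "w \<in> Pc U" "h \<in> H6" for w h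
    using H6_act_Pc[OF that] by (simp_all add: H6_act_def)
  show "H6_act (H6_act w g) h = H6_act w (g ** h)" if "w \<in> Pc U" "g \<in> H6" "h \<in> H6" for w g h
    using that u_matrix_H6_act[of w g] by (simp add: H6_act_def Pc_def matrix_mul_assoc mem_Times_iff)
  show "\<exists>!h. h \<in> H6 \<and> w' = H6_act w h" if "w \<in> Pc U" "w' \<in> Pc U" "fst w = fst w'" for w w'
  proof (rule ex1I)
    let ?u = "u_matrix (snd w)" and ?u' = "u_matrix (snd w')"
    have dom: "snd w \<in> H6_dom" "snd w' \<in> H6_dom" using that by (auto simp: Pc_def)
    then have sp: "?u \<in> carrier Sp4" by (simp add: u_matrix_Sp4)
    have h: "sp_inv ?u ** ?u' \<in> H6" using dom by (simp add: H6_mult H6_sp_inv u_matrix_H6)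
    moreover have "w' = H6_act w (sp_inv ?u ** ?u')"
      using that dom h by (simp add: H6_act_eq matrix_mul_assoc sp_inv_right[OF sp] u_coords_u_matrix prod_eq_iff)
    ultimately show "sp_inv ?u ** ?u' \<in> H6 \<and> w' = H6_act w (sp_inv ?u ** ?u')" ..
    fix h assume h: "h \<in> H6 \<and> w' = H6_act w h"
    then have "?u' = ?u ** h" using u_matrix_H6_act dom by blast
    then show "h = sp_inv ?u ** ?u'" by (simp add: matrix_mul_assoc sp_inv_left[OF sp])
  qed
  have o: "open (Pc U \<times> H6_dom)" by (intro open_Times open_Pc U open_H6_dom)
  have "smooth_on (Pc U \<times> H6_dom) (\<lambda>p. (fst (fst p), u_coords (u_matrix (snd (fst p)) ** u_matrix (snd p))))"
    by (intro smooth_intros smooth_on_u_coords_compose smooth_on_matrix_mult smooth_on_u_matrix_compose o)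
      (auto simp: Pc_def H6_mult u_matrix_H6)
  then show "smooth_on (Pc U \<times> H6_dom) (\<lambda>(w, u). H6_act w (u_matrix u))"
    by (rule iffD1[OF smooth_on_cong[OF o], rotated]) (auto simp: Pc_def H6_act_eq u_matrix_H6)
  fix z assume z: "z \<in> U"
  have U': "open (U \<times> H6_dom)" by (intro open_Times U open_H6_dom)
  let ?f = "\<lambda>(n, u). H6_act (n, unit_coords) (u_matrix u)"
  have f: "?f p = p" if "p \<in> U \<times> H6_dom" for p
    using that by (auto simp: H6_act_eq unit_coords_H6_dom u_matrix_H6 u_matrix_unit_coords u_coords_u_matrix)
  have set: "{w \<in> Pc U. fst w \<in> U} = U \<times> H6_dom" by (auto simp: Pc_def)
  have inj: "inj_on ?f (U \<times> H6_dom)" using f by (intro inj_onI) metis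
  have "diffeo (U \<times> H6_dom) {w \<in> Pc U. fst w \<in> U} ?f"
    unfolding diffeo_def set bij_betw_def
  proof (intro conjI U' inj)
    have "?f ` (U \<times> H6_dom) = (\<lambda>p. p) ` (U \<times> H6_dom)" by (rule image_cong[OF refl f])
    then show "?f ` (U \<times> H6_dom) = U \<times> H6_dom" by simp
    show "smooth_on (U \<times> H6_dom) ?f"
      by (rule iffD2[OF smooth_on_cong[OF U' f] smooth_on_id[OF U']])
    have "inv_into (U \<times> H6_dom) ?f p = p" if "p \<in> U \<times> H6_dom" for p
      using inv_into_f_f[OF inj that] f[OF that] by simp
    from iffD2[OF smooth_on_cong[OF U' this] smooth_on_id[OF U']]
    show "smooth_on (U \<times> H6_dom) (inv_into (U \<times> H6_dom) ?f)" by simp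
  qed
  then show "\<exists>N s. z \<in> N \<and> open N \<and> N \<subseteq> U \<and> smooth_on N s \<and> (\<forall>n\<in>N. s n \<in> Pc U \<and> fst (s n) = n) \<and>
     diffeo (N \<times> H6_dom) {w \<in> Pc U. fst w \<in> N} (\<lambda>(n, u). H6_act (s n) (u_matrix u))"
    using z U unit_coords_H6_dom
    by (intro exI[of _ U] exI[of _ "\<lambda>n. (n, unit_coords)"] conjI smooth_on_Pair smooth_on_const smooth_on_id)
      (auto simp: Pc_def)
qed

section \<open>The Cartan connection\<close>

lemma smooth_on_pd: "smooth_on S f \<Longrightarrow> smooth_on S (pd i f)"
  unfolding pd_def[abs_def] by (rule smooth_on_derivative)

lemma smooth_on_total_D: "open S \<Longrightarrow> smooth_on S F \<Longrightarrow> smooth_on S G \<Longrightarrow> smooth_on S (total_D F G)"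
  unfolding total_D_def[abs_def] by (intro smooth_intros smooth_on_pd)

lemma smooth_on_K_fun: "open S \<Longrightarrow> smooth_on S F \<Longrightarrow> smooth_on S (K_fun F)"
  unfolding K_fun_def[abs_def] by (intro smooth_intros smooth_on_pd smooth_on_total_D)

lemma smooth_on_L_fun: "open S \<Longrightarrow> smooth_on S F \<Longrightarrow> smooth_on S (L_fun F)"
  unfolding L_fun_def[abs_def] by (intro smooth_intros smooth_on_pd smooth_on_K_fun)

lemma smooth_on_M_fun: "open S \<Longrightarrow> smooth_on S F \<Longrightarrow> smooth_on S (M_fun F)"
  unfolding M_fun_def[abs_def] by (intro smooth_intros smooth_on_pd smooth_on_K_fun smooth_on_L_fun)

lemma smooth_on_W_fun: "open S \<Longrightarrow> smooth_on S F \<Longrightarrow> smooth_on S (W_fun F)"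
  unfolding W_fun_def[abs_def] by (intro smooth_intros smooth_on_pd smooth_on_K_fun smooth_on_total_D)

lemmas smooth_on_jet = smooth_on_pd smooth_on_total_D smooth_on_K_fun smooth_on_L_fun smooth_on_M_fun smooth_on_W_fun

lemma smooth_on_om:
  assumes "open S"
  shows "smooth_on S (\<lambda>z. om1 z v)" "smooth_on S (\<lambda>z. om2 z v)" "smooth_on S (\<lambda>z. om4 z v)"
    "smooth_on S F \<Longrightarrow> smooth_on S (\<lambda>z. om3 F z v)"
  unfolding om1_def om2_def om3_def om4_def by (intro smooth_intros smooth_on_jet assms; assumption?)+

lemma smooth_on_Om0:
  assumes "open S" "smooth_on S F"
  shows "smooth_on S (\<lambda>z. Om0 F z v)"
proof (intro smooth_on_vec assms(1))
  fix i :: 6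
  show "smooth_on S (\<lambda>z. Om0 F z v $ i)"
    by (rule forall_6'[of _ i]; unfold Om0_def vector_6)
      (intro smooth_intros smooth_on_jet smooth_on_om assms)+
qed

lemma linear_om: "linear (om1 z)" "linear (om2 z)" "linear (om4 z)" "linear (om3 F z)"
  by (auto intro!: linearI simp: om1_def om2_def om3_def om4_def algebra_simps)

lemma linear_Om0: "linear (Om0 F z)"
  by (rule linearI)
    (simp_all add: Om0_def vec_eq_iff forall_6 linear_add[OF linear_om(1)] linear_add[OF linear_om(2)]
      linear_add[OF linear_om(3)] linear_add[OF linear_om(4)] linear_cmul[OF linear_om(1)] linear_cmul[OF linear_om(2)]
      linear_cmul[OF linear_om(3)] linear_cmul[OF linear_om(4)] algebra_simps add_divide_distrib)

definition om :: "(real^4 \<Rightarrow> real) \<Rightarrow> real^4 \<Rightarrow> real^4 \<Rightarrow> real^4" where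
  "om F z v = vector [om1 z v, om2 z v, om3 F z v, om4 z v]"

lemma omega_c_eq: "omega_c F z v = sp4_matrix (om F z v, Om0 F z v)"
  by (simp add: omega_c_def om_def)

lemma linear_om_vec: "linear (om F z)"
  by (rule linearI)
    (simp_all add: om_def vec_eq_iff forall_4 linear_add[OF linear_om(1)] linear_add[OF linear_om(2)]
      linear_add[OF linear_om(3)] linear_add[OF linear_om(4)] linear_cmul[OF linear_om(1)] linear_cmul[OF linear_om(2)]
      linear_cmul[OF linear_om(3)] linear_cmul[OF linear_om(4)])

lemma smooth_on_om_vec:
  assumes "open S" "smooth_on S F"
  shows "smooth_on S (\<lambda>z. om F z v)"
proof (intro smooth_on_vec assms(1))
  fix i :: 4
  show "smooth_on S (\<lambda>z. om F z v $ i)"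
    by (rule forall_4'[of _ i]; unfold om_def vector_4) (intro smooth_on_om assms)+
qed

text \<open>The four forms are triangular in \<open>dx\<close>, \<open>dy\<close>,
  \<open>dp\<close>, \<open>dq\<close> with nonzero diagonal.\<close>

lemma om_inj: assumes "om F z v = 0" shows "v = 0"
proof -
  have "om F z v $ i = 0" for i using assms by simp
  from this[of 1] this[of 2] this[of 3] this[of 4] show ?thesis
    by (simp add: om_def om1_def om2_def om3_def om4_def vec_eq_iff forall_4)
qed

lemma smooth_on_sp4_matrix: "open S \<Longrightarrow> smooth_on S f \<Longrightarrow> smooth_on S (\<lambda>x. sp4_matrix (f x))"
  using smooth_on_bounded_linear linear_sp4_matrix linear_conv_bounded_linear by blast

lemma smooth_on_sp4_coords: "open S \<Longrightarrow> smooth_on S f \<Longrightarrow> smooth_on S (\<lambda>x. sp4_coords (f x))"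
  using smooth_on_bounded_linear linear_sp4_coords linear_conv_bounded_linear by blast

lemma smooth_form_omega_c: assumes "open U" "smooth_on U F" shows "smooth_form U (omega_c F)"
  unfolding smooth_form_def omega_c_eq
proof (intro conjI allI ballI)
  show "smooth_on U (\<lambda>z. sp4_matrix (om F z v, Om0 F z v))" for v
    by (intro smooth_on_sp4_matrix smooth_on_Pair smooth_on_om_vec smooth_on_Om0 assms)
  show "linear (\<lambda>v. sp4_matrix (om F z v, Om0 F z v))" for z
  proof (rule linearI)
    fix a b :: "real^4" and r :: real
    have "(om F z (a + b), Om0 F z (a + b)) = (om F z a, Om0 F z a) + (om F z b, Om0 F z b)"
      by (simp add: linear_add[OF linear_om_vec] linear_add[OF linear_Om0])
    then show "sp4_matrix (om F z (a + b), Om0 F z (a + b)) = sp4_matrix (om F z a, Om0 F z a) + sp4_matrix (om F z b, Om0 F z b)"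
      by (simp only: linear_add[OF linear_sp4_matrix])
    have "(om F z (r *\<^sub>R a), Om0 F z (r *\<^sub>R a)) = r *\<^sub>R (om F z a, Om0 F z a)"
      by (simp add: linear_cmul[OF linear_om_vec] linear_cmul[OF linear_Om0])
    then show "sp4_matrix (om F z (r *\<^sub>R a), Om0 F z (r *\<^sub>R a)) = r *\<^sub>R sp4_matrix (om F z a, Om0 F z a)"
      by (simp only: linear_cmul[OF linear_sp4_matrix])
  qed
qed

lemma omega_c_sp4: "omega_c F z v \<in> sp4"
  by (simp add: omega_c_def sp4_def)

section \<open>The connection on the bundle as a gauge transform\<close>

lemma sp4_Ad: assumes g: "g \<in> carrier Sp4" and X: "X \<in> sp4" shows "sp_inv g ** X ** g \<in> sp4"
proof -
  have 1: "sympl_form ** sp_inv g = transpose g ** sympl_form"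
    by (simp add: sp_inv_def matrix_mul_assoc matrix_mult_simps sympl_form_simps)
  have 2: "transpose (sp_inv g) ** sympl_form = sympl_form ** g"
    by (simp add: sp_inv_def matrix_transpose_mul matrix_mul_assoc[symmetric] matrix_mult_simps sympl_form_simps
        linear_neg[OF bounded_linear.linear[OF bounded_linear_transpose]])
  have "transpose (sp_inv g ** X ** g) ** sympl_form + sympl_form ** (sp_inv g ** X ** g)
     = transpose g ** transpose X ** (transpose (sp_inv g) ** sympl_form) + (sympl_form ** sp_inv g) ** X ** g"
    by (simp add: matrix_transpose_mul matrix_mul_assoc)
  also have "\<dots> = transpose g ** (transpose X ** sympl_form + sympl_form ** X) ** g"
    unfolding 1 2 by (simp add: matrix_mult_simps matrix_mul_assoc)
  also have "\<dots> = 0" using X by (simp add: sp4_iff matrix_mult_simps)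
  finally show ?thesis by (simp add: sp4_iff)
qed

lemma borel_upper_mult: "borel_upper A \<Longrightarrow> borel_upper B \<Longrightarrow> borel_upper (A ** B)"
  by (simp add: borel_upper_def matrix_matrix_mult_def sum_4)

lemma nonneg_part_Ad: "g \<in> H6 \<Longrightarrow> X \<in> nonneg_part \<Longrightarrow> sp_inv g ** X ** g \<in> nonneg_part"
  using H6_sp_inv[of g] by (auto simp: nonneg_part_iff H6_iff sp4_Ad borel_upper_mult)

text \<open>The fibre coordinate as an \<open>H6\<close>-valued gauge function on the total space;
  \<open>omega_hat\<close> is the gauge transform by it of the pulled back
  \<open>omega_c\<close>.\<close>

definition hat_g :: "(real^4) \<times> (real^6) \<Rightarrow> real^4^4" where
  "hat_g w = u_matrix (snd w)"

definition hat_gi :: "(real^4) \<times> (real^6) \<Rightarrow> real^4^4" where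
  "hat_gi w = sp_inv (u_matrix (snd w))"

lemma hat_g_H6: "w \<in> Pc U \<Longrightarrow> hat_g w \<in> H6"
  by (auto simp: hat_g_def Pc_def u_matrix_H6)

lemma hat_g_Sp4: "w \<in> Pc U \<Longrightarrow> hat_g w \<in> carrier Sp4"
  using hat_g_H6 H6_iff by blast

lemma bounded_linear_sp_inv: "bounded_linear sp_inv"
  unfolding linear_conv_bounded_linear[symmetric]
  by (rule linearI) (simp_all add: sp_inv_nth mat4_simps)

lemma smooth_on_hat_g: assumes "open U" shows "smooth_on (Pc U) hat_g" "smooth_on (Pc U) hat_gi"
proof -
  note o = open_Pc[OF assms]
  show 1: "smooth_on (Pc U) hat_g"
    unfolding hat_g_def[abs_def]
    by (intro smooth_on_u_matrix_compose smooth_on_snd smooth_on_id o) (auto simp: Pc_def)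
  show "smooth_on (Pc U) hat_gi"
    using smooth_on_bounded_linear[OF bounded_linear_sp_inv o 1] by (simp add: hat_gi_def[abs_def] hat_g_def)
qed

lemma hat_gi: "w \<in> Pc U \<Longrightarrow> hat_gi w ** hat_g w = mat 1" "w \<in> Pc U \<Longrightarrow> hat_g w ** hat_gi w = mat 1"
  using hat_g_Sp4 sp_inv_left sp_inv_right by (auto simp: hat_g_def hat_gi_def)

lemma frechet_derivative_fst: "frechet_derivative fst (at w) = fst"
  by (rule frechet_derivative_eqI[OF bounded_linear_imp_has_derivative[OF bounded_linear_fst]])

lemma frechet_derivative_hat_g: "w \<in> Pc U \<Longrightarrow> frechet_derivative hat_g (at w) v = frechet_derivative u_matrix (at (snd w)) (snd v)"
  unfolding hat_g_def[abs_def]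
  by (rule fun_cong[OF frechet_derivative_eqI[OF has_derivative_compose[OF
      bounded_linear_imp_has_derivative[OF bounded_linear_snd] has_derivative_u_matrix]]])
    (auto simp: Pc_def)

abbreviation omega_hat_gauge where
  "omega_hat_gauge F \<equiv> gauge_form hat_g hat_gi (pullback_form fst (omega_c F))"

lemma omega_hat_eq_gauge:
  assumes "w \<in> Pc U" shows "omega_hat F w v = omega_hat_gauge F w v"
proof -
  have "matrix_inv (u_matrix (snd w)) = hat_gi w"
    using hat_g_Sp4[OF assms] by (simp add: hat_gi_def hat_g_def matrix_inv_Sp4)
  then show ?thesis
    by (simp add: omega_hat_def gauge_form_def pullback_form_def frechet_derivative_fst
        frechet_derivative_hat_g[OF assms]) (simp add: hat_g_def)
qed

text \<open>The working form of the connection: a conjugated part that sees only the base direction,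
  plus the Maurer-Cartan form of the fibre direction.\<close>

lemma omega_hat_eq:
  assumes "w \<in> Pc U"
  shows "omega_hat F w v = hat_gi w ** omega_c F (fst w) (fst v) ** hat_g w + mc_form (snd w) (snd v)"
  unfolding omega_hat_eq_gauge[OF assms]
  by (simp add: gauge_form_def pullback_form_def frechet_derivative_fst frechet_derivative_hat_g[OF assms] mc_form_def hat_gi_def)

lemma smooth_form_pullback_fst:
  assumes "open U" "smooth_on U F"
  shows "smooth_form (Pc U) (pullback_form fst (omega_c F))"
proof (rule smooth_form_pullback[OF smooth_form_omega_c[OF assms] assms(1) _ open_Pc[OF assms(1)]])
  show "smooth_on (Pc U) fst"
    using smooth_on_fst[OF open_Pc[OF assms(1)] smooth_on_id[OF open_Pc[OF assms(1)]]] by simp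
qed (auto simp: Pc_def)

lemma smooth_form_cong:
  assumes "open P" "\<And>w v. w \<in> P \<Longrightarrow> \<eta> w v = \<eta>' w v" "smooth_form P \<eta>"
  shows "smooth_form P \<eta>'"
  unfolding smooth_form_def
proof (intro conjI allI ballI)
  show "smooth_on P (\<lambda>w. \<eta>' w v)" for v
    using smooth_on_cong[OF assms(1), of "\<lambda>w. \<eta> w v" "\<lambda>w. \<eta>' w v"] assms(2,3) by (auto simp: smooth_form_def)
  show "linear (\<eta>' w)" if "w \<in> P" for w
  proof -
    have "\<eta>' w = \<eta> w" using assms(2)[OF that] by (simp add: fun_eq_iff)
    then show ?thesis using assms(3) that by (simp add: smooth_form_def)
  qed
qed

lemma curvature_cong:
  assumes "open P" "\<And>w v. w \<in> P \<Longrightarrow> \<eta> w v = \<eta>' w v" "smooth_form P \<eta>" "w \<in> P"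
  shows "curvature \<eta> w v v' = curvature \<eta>' w v v'"
proof -
  have "frechet_derivative (\<lambda>w. \<eta> w v) (at w) = frechet_derivative (\<lambda>w. \<eta>' w v) (at w)" for v
    by (rule frechet_derivative_transform_within_open[OF smooth_on_differentiable assms(1)])
      (use assms in \<open>auto simp: smooth_form_def\<close>)
  then show ?thesis by (simp add: curvature_def assms(2,4))
qed

lemma smooth_form_omega_hat:
  assumes "open U" "smooth_on U F"
  shows "smooth_form (Pc U) (omega_hat F)"
  by (rule smooth_form_cong[OF open_Pc[OF assms(1)] omega_hat_eq_gauge[symmetric]])
    (auto intro!: smooth_form_gauge smooth_form_pullback_fst open_Pc smooth_on_hat_g assms)

text \<open>The gauge formula and then pullback along \<open>fst\<close>: the curvature is
  horizontal and determined by that of \<open>omega_c\<close> on the base.\<close>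

lemma curvature_omega_hat:
  assumes U: "open U" "smooth_on U F" and w: "w \<in> Pc U"
  shows "curvature (omega_hat F) w v v' = hat_gi w ** curvature (omega_c F) (fst w) (fst v) (fst v') ** hat_g w"
proof -
  note o = open_Pc[OF U(1)]
  have "curvature (omega_hat F) w v v' = curvature (omega_hat_gauge F) w v v'"
    by (rule curvature_cong[OF o omega_hat_eq_gauge smooth_form_omega_hat[OF U] w])
  also have "\<dots> = hat_gi w ** curvature (pullback_form fst (omega_c F)) w v v' ** hat_g w"
    by (rule curvature_gauge[OF smooth_form_pullback_fst[OF U] o smooth_on_hat_g[OF U(1)] hat_gi w])
  also have "curvature (pullback_form fst (omega_c F)) w v v' = curvature (omega_c F) (fst w) (fst v) (fst v')"
    using curvature_pullback[OF smooth_form_omega_c[OF U] U(1) _ o _ w, of fst]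
      smooth_on_fst[OF o smooth_on_id[OF o]] by (simp add: frechet_derivative_fst Pc_def image_subset_iff)
  finally show ?thesis .
qed

lemma omega_hat_sp4: assumes "w \<in> Pc U" shows "omega_hat F w v \<in> sp4"
proof -
  have "mc_form (snd w) (snd v) \<in> sp4"
    using mc_form_nonneg assms nonneg_part_iff by (auto simp: Pc_def)
  moreover have "hat_gi w ** omega_c F (fst w) (fst v) ** hat_g w \<in> sp4"
    using sp4_Ad[OF hat_g_Sp4[OF assms] omega_c_sp4] by (simp add: hat_gi_def hat_g_def)
  ultimately show ?thesis
    unfolding omega_hat_eq[OF assms] using subspace_sp4 by (auto intro: subspace_add)
qed

lemma omega_hat_coframe: "w \<in> Pc U \<Longrightarrow> omega_hat F w v = sp4_matrix (coframe F w v)"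
  using omega_hat_sp4 by (simp add: coframe_def sp4_iff_coords)

lemma coframe_linear:
  assumes "open U" "smooth_on U F" "w \<in> Pc U"
  shows "linear (omega_hat F w)" "linear (coframe F w)"
proof -
  show 1: "linear (omega_hat F w)"
    using smooth_form_omega_hat[OF assms(1,2)] assms(3) by (simp add: smooth_form_def)
  show "linear (coframe F w)"
    using linear_compose[OF 1 linear_sp4_coords] by (simp add: coframe_def[abs_def] o_def)
qed

text \<open>Subtracting the Maurer-Cartan part and undoing the conjugation both preserve
  \<open>nonneg_part\<close>, so \<open>omega_c F (fst w) (fst v)\<close> lies there and all four
  forms \<open>om\<close> vanish on \<open>fst v\<close>. The connection alone thus recognises
  vertical vectors, which is why maps preserving it descend to the base.\<close>

lemma omega_hat_nonneg:
  assumes w: "w \<in> Pc U" and v: "omega_hat F w v \<in> nonneg_part"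
  shows "fst v = 0" "omega_hat F w v = mc_form (snd w) (snd v)"
proof -
  let ?g = "hat_g w"
  have g: "?g \<in> H6" "hat_gi w = sp_inv ?g" using hat_g_H6[OF w] by (auto simp: hat_gi_def hat_g_def)
  have "snd w \<in> H6_dom" using w by (auto simp: Pc_def)
  then have m: "mc_form (snd w) (snd v) \<in> nonneg_part" by (rule mc_form_nonneg)
  have sub: "subspace nonneg_part" by (simp add: nonneg_part_def)
  have "sp_inv ?g ** omega_c F (fst w) (fst v) ** ?g \<in> nonneg_part"
    using subspace_diff[OF sub v m] by (simp add: omega_hat_eq[OF w] g)
  from nonneg_part_Ad[OF H6_sp_inv[OF g(1)] this]
  have "sp_inv (sp_inv ?g) ** sp_inv ?g ** omega_c F (fst w) (fst v) ** (?g ** sp_inv ?g) \<in> nonneg_part"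
    by (simp add: matrix_mul_assoc)
  moreover have "?g \<in> carrier Sp4" using g H6_iff by blast
  ultimately have "omega_c F (fst w) (fst v) \<in> nonneg_part"
    by (simp add: sp_inv_left Sp4_sp_inv sp_inv_right)
  then have "om F (fst w) (fst v) = 0"
    by (auto simp: omega_c_eq nonneg_part_coords dest!: arg_cong[where f = sp4_coords])
  then show "fst v = 0" by (rule om_inj)
  then show "omega_hat F w v = mc_form (snd w) (snd v)"
    by (simp add: omega_hat_eq[OF w] omega_c_eq linear_0[OF linear_om_vec] linear_0[OF linear_Om0]
        linear_0[OF linear_sp4_matrix] zero_prod_def[symmetric] matrix_mult_simps)
qed

text \<open>Domain and target have equal dimension, so the kernel decides: a vector killed by the
  coframe is vertical, and on vertical vectors the form is \<open>mc_form\<close>, which is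
  injective.\<close>

lemma coframe_bij:
  assumes "open U" "smooth_on U F" "w \<in> Pc U"
  shows "bij (coframe F w)"
proof -
  note lin = coframe_linear[OF assms]
  have dom: "snd w \<in> H6_dom" using assms(3) by (auto simp: Pc_def)
  have "v = 0" if "coframe F w v = 0" for v
  proof -
    have 0: "omega_hat F w v = 0"
      using omega_hat_coframe[OF assms(3), of F v] that by (simp add: linear_0[OF linear_sp4_matrix])
    then have "omega_hat F w v \<in> nonneg_part" by (simp add: nonneg_part_def span_zero)
    from omega_hat_nonneg[OF assms(3) this] 0 have "fst v = 0" "mc_form (snd w) (snd v) = mc_form (snd w) 0"
      by (simp_all add: linear_0[OF linear_mc_form[OF dom]])
    then show "v = 0"
      using mc_form_bij[OF dom] by (auto simp: bij_betw_def inj_eq prod_eq_iff)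
  qed
  then have "inj (coframe F w)" using linear_injective_0[OF lin(2)] by blast
  then show ?thesis using linear_injective_imp_surjective[OF lin(2)] by (auto simp: bij_def)
qed

lemma omega_hat_bij:
  assumes "open U" "smooth_on U F" "w \<in> Pc U"
  shows "bij_betw (omega_hat F w) UNIV sp4"
proof -
  have "omega_hat F w = sp4_matrix \<circ> coframe F w"
    by (simp add: fun_eq_iff omega_hat_coframe[OF assms(3)])
  moreover have "bij_betw sp4_matrix UNIV sp4"
    using inj_sp4_matrix by (simp add: bij_betw_def sp4_def)
  ultimately show ?thesis using coframe_bij[OF assms] bij_betw_trans by metis
qed

lemma is_coframe_Pc:
  assumes "open U" "smooth_on U F"
  shows "is_coframe (Pc U) (coframe F)"
  unfolding is_coframe_def
proof (intro conjI allI ballI)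
  show "smooth_on (Pc U) (\<lambda>w. coframe F w v)" for v
    unfolding coframe_def using smooth_form_omega_hat[OF assms]
    by (intro smooth_on_sp4_coords open_Pc assms) (simp add: smooth_form_def del: split_paired_All)
qed (use coframe_linear coframe_bij assms in blast)+

lemma omega_hat_unit:
  assumes "z \<in> U" shows "omega_hat F (z, unit_coords) (v, 0) = omega_c F z v"
proof -
  have w: "(z, unit_coords) \<in> Pc U" using assms unit_coords_H6_dom by (simp add: Pc_def)
  show ?thesis
    unfolding omega_hat_eq[OF w]
    by (simp add: hat_g_def hat_gi_def u_matrix_unit_coords sp_inv_one linear_0[OF linear_mc_form[OF unit_coords_H6_dom]])
qed


section \<open>Fundamental vectors and equivariance\<close>

lemma matrix_inv_H6: "h \<in> H6 \<Longrightarrow> matrix_inv h = sp_inv h"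
  using matrix_inv_Sp4 H6_iff by blast

lemma sp_inv_mult: "sp_inv (A ** B) = sp_inv B ** sp_inv A"
proof -
  have "sp_inv B ** sp_inv A = sympl_form ** transpose B ** (sympl_form ** sympl_form) ** transpose A ** sympl_form"
    by (simp add: sp_inv_def matrix_mult_simps(5,6) matrix_mul_assoc)
  also have "\<dots> = sp_inv (A ** B)"
    unfolding sympl_form_simps by (simp add: sp_inv_def matrix_transpose_mul matrix_mult_simps matrix_mul_assoc)
  finally show ?thesis ..
qed

lemma fundamental_vector_exists:
  assumes w: "w \<in> Pc U" and A: "A \<in> nonneg_part"
  shows "\<exists>X. fundamental_vector H6 H6_act A w X"
proof -
  obtain \<gamma> where \<gamma>: "\<gamma> 0 = mat 1" "\<And>t::real. \<gamma> t \<in> H6" "(\<gamma> has_vector_derivative A) (at 0)"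
    using H6_curve[OF A] by metis
  have dom: "snd w \<in> H6_dom" using w by (auto simp: Pc_def)
  let ?g = "hat_g w"
  have g: "?g \<in> H6" using hat_g_H6[OF w] .
  have 1: "((\<lambda>t. ?g ** \<gamma> t) has_vector_derivative ?g ** A) (at 0)"
    by (rule bounded_linear.has_vector_derivative[OF bounded_bilinear.bounded_linear_right[OF bounded_bilinear_matrix_mult] \<gamma>(3)])
  have 2: "(u_coords has_derivative frechet_derivative u_coords (at ?g)) (at (?g ** \<gamma> 0))"
    using has_derivative_u_coords[OF g] by (simp add: \<gamma>(1))
  have "((\<lambda>t. u_coords (?g ** \<gamma> t)) has_vector_derivative frechet_derivative u_coords (at ?g) (?g ** A)) (at 0)"
    using has_derivative_compose[OF 1[unfolded has_vector_derivative_def] 2]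
    unfolding has_vector_derivative_def
    by (simp add: linear_cmul[OF has_derivative_linear[OF 2]])
  then have "((\<lambda>t. (fst w, u_coords (?g ** \<gamma> t))) has_vector_derivative (0, frechet_derivative u_coords (at ?g) (?g ** A))) (at 0)"
    by (intro has_vector_derivative_Pair has_vector_derivative_const)
  moreover have "H6_act w (\<gamma> t) = (fst w, u_coords (?g ** \<gamma> t))" for t
    using dom \<gamma>(2) by (simp add: H6_act_eq hat_g_def)
  ultimately have "((\<lambda>t. H6_act w (\<gamma> t)) has_vector_derivative (0, frechet_derivative u_coords (at ?g) (?g ** A))) (at 0)"
    by simp
  then show ?thesis
    unfolding fundamental_vector_def using \<gamma> by blast
qed

text \<open>Any curve with velocity \<open>A\<close> may have produced \<open>X\<close>, so no
  formula for \<open>X\<close> is available. Its base part vanishes, and its fibre part is found by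
  differentiating the matrix curve \<open>u_matrix (snd w) ** \<gamma> t\<close> in two
  ways.\<close>

lemma omega_hat_fundamental_vector:
  assumes w: "w \<in> Pc U" and X: "fundamental_vector H6 H6_act A w X"
  shows "omega_hat F w X = A"
proof -
  obtain \<gamma> where \<gamma>: "\<gamma> 0 = mat 1" "\<And>t::real. \<gamma> t \<in> H6" "(\<gamma> has_vector_derivative A) (at 0)"
    and d: "((\<lambda>t. H6_act w (\<gamma> t)) has_vector_derivative X) (at 0)"
    using X unfolding fundamental_vector_def by blast
  have dom: "snd w \<in> H6_dom" using w by (auto simp: Pc_def)
  let ?g = "hat_g w"
  have g: "?g \<in> H6" "hat_gi w = sp_inv ?g" using hat_g_H6[OF w] by (auto simp: hat_gi_def hat_g_def)
  have "((\<lambda>t. fst (H6_act w (\<gamma> t))) has_vector_derivative fst X) (at 0)"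
    by (rule bounded_linear.has_vector_derivative[OF bounded_linear_fst d])
  moreover have "((\<lambda>t. fst (H6_act w (\<gamma> t))) has_vector_derivative 0) (at 0)"
    by (simp add: H6_act_def)
  ultimately have f: "fst X = 0" by (rule vector_derivative_unique_at)
  have s: "((\<lambda>t. snd (H6_act w (\<gamma> t))) has_vector_derivative snd X) (at 0)"
    by (rule bounded_linear.has_vector_derivative[OF bounded_linear_snd d])
  have s0: "snd (H6_act w (\<gamma> 0)) = snd w"
    using dom by (simp add: \<gamma>(1) H6_act_eq H6_one u_coords_u_matrix)
  have um: "(u_matrix has_derivative frechet_derivative u_matrix (at (snd w))) (at (snd (H6_act w (\<gamma> 0))))"
    using has_derivative_u_matrix[OF dom] by (simp add: s0)
  have "((\<lambda>t. u_matrix (snd (H6_act w (\<gamma> t)))) has_vector_derivative frechet_derivative u_matrix (at (snd w)) (snd X)) (at 0)"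
    using has_derivative_compose[OF s[unfolded has_vector_derivative_def] um]
    unfolding has_vector_derivative_def by (simp add: linear_cmul[OF has_derivative_linear[OF um]])
  moreover have "((\<lambda>t. u_matrix (snd (H6_act w (\<gamma> t)))) has_vector_derivative ?g ** A) (at 0)"
    using bounded_linear.has_vector_derivative[OF bounded_bilinear.bounded_linear_right[OF bounded_bilinear_matrix_mult] \<gamma>(3), of ?g]
    by (simp add: u_matrix_H6_act dom \<gamma>(2)) (simp add: hat_g_def)
  ultimately have e: "frechet_derivative u_matrix (at (snd w)) (snd X) = ?g ** A"
    by (rule vector_derivative_unique_at)
  have "mc_form (snd w) (snd X) = A"
    using sp_inv_left[of ?g] g H6_iff[of ?g] by (simp add: mc_form_def e) (simp add: hat_g_def matrix_mul_assoc)
  then show ?thesis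
    unfolding omega_hat_eq[OF w] f
    by (simp add: omega_c_eq linear_0[OF linear_om_vec] linear_0[OF linear_Om0]
        linear_0[OF linear_sp4_matrix] zero_prod_def[symmetric] matrix_mult_simps)
qed

text \<open>Right translation fixes the base point and multiplies the fibre matrix by
  \<open>h\<close>; differentiating these two facts gives the base and the fibre part of the pushed
  forward vector.\<close>

lemma omega_hat_equivariant:
  assumes U: "open U" and w: "w \<in> Pc U" and h: "h \<in> H6"
  shows "omega_hat F (H6_act w h) (frechet_derivative (\<lambda>w. H6_act w h) (at w) v) = matrix_inv h ** omega_hat F w v ** h"
proof -
  have dom: "snd w \<in> H6_dom" using w by (auto simp: Pc_def)
  note o = open_Pc[OF U]
  let ?a = "\<lambda>w. H6_act w h"
  have sm: "smooth_on (Pc U) (\<lambda>w. (fst w, u_coords (hat_g w ** h)))"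
    by (intro smooth_intros smooth_on_u_coords_compose smooth_on_matrix_mult smooth_on_hat_g U o)
      (auto simp: H6_mult h hat_g_H6)
  have eq: "(fst w, u_coords (hat_g w ** h)) = ?a w" if "w \<in> Pc U" for w
    using that h by (auto simp: Pc_def H6_act_eq hat_g_def)
  have "smooth_on (Pc U) ?a"
    by (rule iffD1[OF smooth_on_cong[OF o] sm]) (rule eq)
  then have da: "(?a has_derivative frechet_derivative ?a (at w)) (at w)"
    using w smooth_on_has_derivative by blast
  let ?v = "frechet_derivative ?a (at w) v"
  have aw: "?a w \<in> Pc U" using H6_act_Pc[OF w h] .
  have f: "fst ?v = fst v"
  proof -
    have 1: "((\<lambda>w. fst (?a w)) has_derivative (\<lambda>v. fst (frechet_derivative ?a (at w) v))) (at w)"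
      by (rule has_derivative_fst[OF da])
    have 2: "((\<lambda>w. fst (?a w)) has_derivative fst) (at w)"
      using bounded_linear_imp_has_derivative[OF bounded_linear_fst] by (simp add: H6_act_def)
    show ?thesis using fun_cong[OF has_derivative_unique[OF 1 2], of v] .
  qed
  have s: "frechet_derivative u_matrix (at (snd (?a w))) (snd ?v) = frechet_derivative u_matrix (at (snd w)) (snd v) ** h"
  proof -
    have 1: "((\<lambda>w. hat_g (?a w)) has_derivative (\<lambda>v. frechet_derivative u_matrix (at (snd (?a w))) (snd (frechet_derivative ?a (at w) v)))) (at w)"
      unfolding hat_g_def
      by (rule has_derivative_compose[OF has_derivative_snd[OF da] has_derivative_u_matrix])
        (use aw in \<open>auto simp: Pc_def\<close>)
    have 2: "((\<lambda>w. hat_g w ** h) has_derivative (\<lambda>v. frechet_derivative u_matrix (at (snd w)) (snd v) ** h)) (at w)"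
      unfolding hat_g_def
      by (intro bounded_linear.has_derivative[OF bounded_bilinear.bounded_linear_left[OF bounded_bilinear_matrix_mult]]
          has_derivative_compose[OF bounded_linear_imp_has_derivative[OF bounded_linear_snd] has_derivative_u_matrix] dom)
    have 3: "((\<lambda>w. hat_g (?a w)) has_derivative (\<lambda>v. frechet_derivative u_matrix (at (snd w)) (snd v) ** h)) (at w)"
      by (rule has_derivative_transform_within_open[OF 2 o w])
        (use h in \<open>auto simp: hat_g_def u_matrix_H6_act Pc_def\<close>)
    show ?thesis using fun_cong[OF has_derivative_unique[OF 1 3], of v] .
  qed
  have g: "hat_g (?a w) = hat_g w ** h" using dom h by (simp add: hat_g_def u_matrix_H6_act)
  then have gi: "hat_gi (?a w) = sp_inv h ** hat_gi w" by (simp add: hat_gi_def hat_g_def sp_inv_mult)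
  have "mc_form (snd (?a w)) (snd ?v) = sp_inv h ** mc_form (snd w) (snd v) ** h"
    using gi by (simp add: mc_form_def s hat_gi_def matrix_mul_assoc)
  then show ?thesis
    unfolding omega_hat_eq[OF aw] omega_hat_eq[OF w] f matrix_inv_H6[OF h] gi g
    by (simp add: H6_act_def matrix_mult_simps matrix_mul_assoc)
qed

lemma cartan_connection_omega_hat:
  assumes U: "open U" "smooth_on U F"
  shows "cartan_connection (carrier Sp4) H6 (Pc U) H6_act (omega_hat F)"
  unfolding cartan_connection_def lie_algebra_Sp4 lie_algebra_H6
proof (intro conjI ballI allI impI)
  show "dim sp4 = DIM((real^4) \<times> (real^6))" by (simp add: dim_sp4)
  show "smooth_on (Pc U) (\<lambda>w. omega_hat F w v)" for v
    using smooth_form_omega_hat[OF U] by (simp add: smooth_form_def del: split_paired_All)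
qed (use coframe_linear[OF U] omega_hat_bij[OF U] fundamental_vector_exists omega_hat_fundamental_vector
      omega_hat_equivariant[OF U(1)] in blast)+

section \<open>Normal curvature\<close>

text \<open>A pointwise, manifestly \<open>H6\<close>-invariant form of Tanaka normality for the curvature at hand.  With
  \<open>E\<^sub>1, \<dots>, E\<^sub>4\<close> dual to \<open>\<theta>\<^sup>1, \<dots>, \<theta>\<^sup>4\<close> and the standard basis \<open>e\<^sub>1, \<dots>, e\<^sub>4\<close> of \<open>\<real>\<^sup>4\<close> the conditions are
  \<open>K e\<^sub>1 = 0\<close>, \<open>K(E\<^sub>4, E\<^sub>2) = K(E\<^sub>4, E\<^sub>3) = 0\<close>, \<open>K(E\<^sub>3, \<cdot>) e\<^sub>2 = 0\<close> and \<open>K(\<cdot>, E\<^sub>2) e\<^sub>2 = K(\<cdot>, E\<^sub>4) e\<^sub>3\<close>.\<close>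

definition normal_curvature :: "('w \<Rightarrow> real^4^4) \<Rightarrow> ('w \<Rightarrow> 'w \<Rightarrow> real^4^4) \<Rightarrow> bool" where
  "normal_curvature \<eta> K \<longleftrightarrow>
    (\<forall>v v' i. K v v' $ i $ 1 = 0) \<and>
    (\<forall>v v'. \<eta> v $ 4 $ 1 = 0 \<longrightarrow> \<eta> v $ 3 $ 1 = 0 \<longrightarrow> \<eta> v $ 3 $ 2 = 0 \<longrightarrow> \<eta> v' $ 4 $ 1 = 0 \<longrightarrow> K v v' = 0) \<and>
    (\<forall>v v' i. \<eta> v $ 4 $ 1 = 0 \<longrightarrow> \<eta> v $ 3 $ 1 = 0 \<longrightarrow> \<eta> v $ 2 $ 1 = 0 \<longrightarrow> K v v' $ i $ 2 = 0) \<and>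
    (\<forall>v v2 v4 i. \<eta> v2 $ 4 $ 1 = 0 \<longrightarrow> \<eta> v4 $ 4 $ 1 = 0 \<longrightarrow> \<eta> v4 $ 3 $ 1 = 0 \<longrightarrow> \<eta> v4 $ 3 $ 2 = 0 \<longrightarrow>
       \<eta> v4 $ 2 $ 1 * K v v2 $ i $ 2 = \<eta> v2 $ 3 $ 1 * K v v4 $ i $ 3 + \<eta> v2 $ 2 $ 1 * K v v4 $ i $ 2)"

lemma normal_curvatureD:
  assumes "normal_curvature \<eta> K"
  shows "K v v' $ i $ 1 = 0"
    "\<eta> v $ 4 $ 1 = 0 \<Longrightarrow> \<eta> v $ 3 $ 1 = 0 \<Longrightarrow> \<eta> v $ 3 $ 2 = 0 \<Longrightarrow> \<eta> v' $ 4 $ 1 = 0 \<Longrightarrow> K v v' = 0"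
    "\<eta> v $ 4 $ 1 = 0 \<Longrightarrow> \<eta> v $ 3 $ 1 = 0 \<Longrightarrow> \<eta> v $ 2 $ 1 = 0 \<Longrightarrow> K v v' $ i $ 2 = 0"
    "\<eta> v2 $ 4 $ 1 = 0 \<Longrightarrow> \<eta> v4 $ 4 $ 1 = 0 \<Longrightarrow> \<eta> v4 $ 3 $ 1 = 0 \<Longrightarrow> \<eta> v4 $ 3 $ 2 = 0 \<Longrightarrow>
       \<eta> v4 $ 2 $ 1 * K v v2 $ i $ 2 = \<eta> v2 $ 3 $ 1 * K v v4 $ i $ 3 + \<eta> v2 $ 2 $ 1 * K v v4 $ i $ 2"
  using assms unfolding normal_curvature_def by blast+

lemma normal_curvature_compose:
  "normal_curvature \<eta> K \<Longrightarrow> normal_curvature (\<lambda>v. \<eta> (f v)) (\<lambda>v v'. K (f v) (f v'))"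
  unfolding normal_curvature_def by blast

lemma H6_conj_entries:
  assumes h: "h \<in> H6" and X: "X \<in> sp4"
  shows "(sp_inv h ** X ** h) $ 4 $ 1 = h$1$1 * h$1$1 * X$4$1"
    "(sp_inv h ** X ** h) $ 3 $ 1 = h$1$1 * (h$2$2 * X$3$1 + h$1$2 * X$4$1)"
    "(sp_inv h ** X ** h) $ 2 $ 1 = h$1$1 * (h$3$3 * X$2$1 - h$2$3 * X$3$1 - h$1$3 * X$4$1)"
    "(sp_inv h ** X ** h) $ 3 $ 2 = h$2$2 * (h$1$2 * X$3$1 + h$2$2 * X$3$2) + h$1$2 * (h$1$2 * X$4$1 + h$2$2 * X$3$1)"
  using h X unfolding H6_iff borel_upper_def sp4_iff_entries
  by (simp_all add: sp_inv_nth matrix_matrix_mult_def sum_4 algebra_simps)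

lemma H6_diag': "h \<in> H6 \<Longrightarrow> h$1$1 \<noteq> 0 \<and> h$2$2 \<noteq> 0 \<and> h$3$3 \<noteq> 0 \<and> h$4$4 \<noteq> 0"
  using Sp4_borel_entries[of h] H6_iff[of h] by auto

text \<open>Right multiplication by \<open>h\<close> adds to a column multiples of earlier columns
  only; left multiplication mixes rows, which is harmless because the column conditions hold for all
  row indices. The kernels used as hypotheses of the conditions do not change under the
  conjugation.\<close>

lemma normal_curvature_gauge:
  assumes h: "h \<in> H6" and \<eta>: "\<And>v. \<eta> v \<in> sp4" and \<beta>: "\<And>v. \<beta> v \<in> nonneg_part"
    and N: "normal_curvature \<eta> K"
  shows "normal_curvature (\<lambda>v. sp_inv h ** \<eta> v ** h + \<beta> v) (\<lambda>v v'. sp_inv h ** K v v' ** h)"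
proof -
  let ?\<eta> = "\<lambda>v. sp_inv h ** \<eta> v ** h + \<beta> v" and ?K = "\<lambda>v v'. sp_inv h ** K v v' ** h"
  have b: "\<beta> v $ 4 $ 1 = 0" "\<beta> v $ 3 $ 1 = 0" "\<beta> v $ 3 $ 2 = 0" "\<beta> v $ 2 $ 1 = 0" for v
    using \<beta>[of v] by (auto simp: nonneg_part_iff borel_upper_def)
  have nz: "h$1$1 \<noteq> 0" "h$2$2 \<noteq> 0" "h$3$3 \<noteq> 0" using H6_diag'[OF h] by auto
  have up: "h$2$1 = 0" "h$3$1 = 0" "h$3$2 = 0" "h$4$1 = 0" "h$4$2 = 0" "h$4$3 = 0"
    using h by (auto simp: H6_iff borel_upper_def)
  note e = H6_conj_entries[OF h \<eta>]
  have z: "?\<eta> v $ 4 $ 1 = 0 \<longleftrightarrow> \<eta> v $ 4 $ 1 = 0"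
    "\<eta> v $ 4 $ 1 = 0 \<Longrightarrow> ?\<eta> v $ 3 $ 1 = 0 \<longleftrightarrow> \<eta> v $ 3 $ 1 = 0"
    "\<eta> v $ 4 $ 1 = 0 \<Longrightarrow> \<eta> v $ 3 $ 1 = 0 \<Longrightarrow> ?\<eta> v $ 3 $ 2 = 0 \<longleftrightarrow> \<eta> v $ 3 $ 2 = 0"
    "\<eta> v $ 4 $ 1 = 0 \<Longrightarrow> \<eta> v $ 3 $ 1 = 0 \<Longrightarrow> ?\<eta> v $ 2 $ 1 = 0 \<longleftrightarrow> \<eta> v $ 2 $ 1 = 0" for v
    using nz by (simp_all add: e b)
  have K1: "?K v v' $ i $ 1 = (\<Sum>k\<in>UNIV. sp_inv h $ i $ k * K v v' $ k $ 1) * h$1$1" for v v' i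
    using up by (simp add: matrix_matrix_mult_def sum_4 algebra_simps)
  have K2: "?K v v' $ i $ 2 = (\<Sum>k\<in>UNIV. sp_inv h $ i $ k * K v v' $ k $ 2) * h$2$2" for v v' i
    using up by (simp add: matrix_matrix_mult_def sum_4 algebra_simps normal_curvatureD(1)[OF N])
  have K3: "?K v v' $ i $ 3 = (\<Sum>k\<in>UNIV. sp_inv h $ i $ k * (h$2$3 * K v v' $ k $ 2 + h$3$3 * K v v' $ k $ 3))" for v v' i
    using up by (simp add: matrix_matrix_mult_def sum_4 algebra_simps normal_curvatureD(1)[OF N])
  show ?thesis
    unfolding normal_curvature_def
  proof (intro conjI allI impI)
    show "?K v v' $ i $ 1 = 0" for v v' i
      unfolding K1 by (simp add: normal_curvatureD(1)[OF N])
    show "?K v v' = 0" if "?\<eta> v $ 4 $ 1 = 0" "?\<eta> v $ 3 $ 1 = 0" "?\<eta> v $ 3 $ 2 = 0" "?\<eta> v' $ 4 $ 1 = 0" for v v'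
      using normal_curvatureD(2)[OF N, of v v'] that z by (simp add: matrix_mult_simps)
    show "?K v v' $ i $ 2 = 0" if "?\<eta> v $ 4 $ 1 = 0" "?\<eta> v $ 3 $ 1 = 0" "?\<eta> v $ 2 $ 1 = 0" for v v' i
      unfolding K2 using normal_curvatureD(3)[OF N, of v v'] that z by simp
    fix v v2 v4 i
    assume "?\<eta> v2 $ 4 $ 1 = 0" "?\<eta> v4 $ 4 $ 1 = 0" "?\<eta> v4 $ 3 $ 1 = 0" "?\<eta> v4 $ 3 $ 2 = 0"
    then have v: "\<eta> v2 $ 4 $ 1 = 0" "\<eta> v4 $ 4 $ 1 = 0" "\<eta> v4 $ 3 $ 1 = 0" "\<eta> v4 $ 3 $ 2 = 0"
      using z by auto
    note N4 = normal_curvatureD(4)[OF N v]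
    \<comment> \<open>The shift of \<open>\<eta> v2 $ 2 $ 1\<close> by a multiple of
      \<open>h$2$3\<close> cancels the multiple of the second column that enters the third; the last
      term of the fourth condition exists for this purpose.\<close>
    have t: "?\<eta> v4 $ 2 $ 1 = h$1$1 * h$3$3 * \<eta> v4 $ 2 $ 1" "?\<eta> v2 $ 3 $ 1 = h$1$1 * h$2$2 * \<eta> v2 $ 3 $ 1"
      "?\<eta> v2 $ 2 $ 1 = h$1$1 * (h$3$3 * \<eta> v2 $ 2 $ 1 - h$2$3 * \<eta> v2 $ 3 $ 1)"
      by (simp_all add: e b v)
    have "?\<eta> v4 $ 2 $ 1 * ?K v v2 $ i $ 2 =
        h$1$1 * h$2$2 * h$3$3 * (\<Sum>k\<in>UNIV. sp_inv h $ i $ k * (\<eta> v4 $ 2 $ 1 * K v v2 $ k $ 2))"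
      unfolding t K2 by (simp add: sum_4 algebra_simps)
    also have "\<dots> = ?\<eta> v2 $ 3 $ 1 * ?K v v4 $ i $ 3 + ?\<eta> v2 $ 2 $ 1 * ?K v v4 $ i $ 2"
      unfolding t K2 K3 N4 by (simp add: sum_4 algebra_simps)
    finally show "?\<eta> v4 $ 2 $ 1 * ?K v v2 $ i $ 2 = ?\<eta> v2 $ 3 $ 1 * ?K v v4 $ i $ 3 + ?\<eta> v2 $ 2 $ 1 * ?K v v4 $ i $ 2" .
  qed
qed

lemma curvature_antisym: "curvature \<eta> w v v' = - curvature \<eta> w v' v"
  by (simp add: curvature_def)

lemma curvature_linear:
  assumes \<eta>: "smooth_form P \<eta>" and P: "open P" and w: "w \<in> P"
  shows "linear (curvature \<eta> w v)" "linear (\<lambda>v. curvature \<eta> w v v')"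
proof -
  have lin: "linear (\<eta> w)" if "w \<in> P" for w using \<eta> that by (simp add: smooth_form_def)
  have d: "((\<lambda>w. \<eta> w v) has_derivative frechet_derivative (\<lambda>w. \<eta> w v) (at w)) (at w)" for v
    using \<eta> w smooth_on_has_derivative unfolding smooth_form_def by blast
  have D1: "frechet_derivative (\<lambda>w. \<eta> w (a + b)) (at w) v = frechet_derivative (\<lambda>w. \<eta> w a) (at w) v + frechet_derivative (\<lambda>w. \<eta> w b) (at w) v" for a b v
    by (rule fun_cong[OF frechet_derivative_eqI[OF has_derivative_transform_within_open[OF has_derivative_add[OF d d] P w]]])
      (simp add: linear_add[OF lin])
  have D2: "frechet_derivative (\<lambda>w. \<eta> w (r *\<^sub>R a)) (at w) v = r *\<^sub>R frechet_derivative (\<lambda>w. \<eta> w a) (at w) v" for r a v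
    by (rule fun_cong[OF frechet_derivative_eqI[OF has_derivative_transform_within_open[OF has_derivative_scaleR_right[OF d] P w]]])
      (simp add: linear_cmul[OF lin])
  note D3 = linear_add[OF has_derivative_linear[OF d]] linear_cmul[OF has_derivative_linear[OF d]]
  show "linear (curvature \<eta> w v)"
    by (rule linearI)
      (simp_all add: curvature_def D1 D2 D3 linear_add[OF lin[OF w]] linear_cmul[OF lin[OF w]] matrix_mult_simps algebra_simps)
  then show "linear (\<lambda>v. curvature \<eta> w v v')"
    by (subst curvature_antisym) (rule linearI; simp add: D1 D2 D3 curvature_def linear_add[OF lin[OF w]] linear_cmul[OF lin[OF w]] matrix_mult_simps algebra_simps)
qed

text \<open>A form with values in the subspace \<open>sp4\<close> is fixed by
  \<open>sp4_coords\<close> followed by \<open>sp4_matrix\<close>; being linear, this map also fixes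
  its directional derivatives.\<close>

lemma curvature_sp4:
  assumes \<eta>: "smooth_form P \<eta>" and P: "open P" and w: "w \<in> P" and sp: "\<And>w v. w \<in> P \<Longrightarrow> \<eta> w v \<in> sp4"
  shows "curvature \<eta> w v v' \<in> sp4"
proof -
  have L: "bounded_linear (\<lambda>X. sp4_matrix (sp4_coords X))"
    using linear_compose[OF linear_sp4_coords linear_sp4_matrix] linear_conv_bounded_linear by (auto simp: o_def)
  have "frechet_derivative (\<lambda>w. \<eta> w v) (at w) u \<in> sp4" for u v
  proof -
    have d: "((\<lambda>w. \<eta> w v) has_derivative frechet_derivative (\<lambda>w. \<eta> w v) (at w)) (at w)"
      using \<eta> w smooth_on_has_derivative unfolding smooth_form_def by blast
    have "((\<lambda>w. \<eta> w v) has_derivative (\<lambda>u. sp4_matrix (sp4_coords (frechet_derivative (\<lambda>w. \<eta> w v) (at w) u)))) (at w)"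
      by (rule has_derivative_transform_within_open[OF bounded_linear.has_derivative[OF L d] P w])
        (use sp in \<open>simp add: sp4_iff_coords\<close>)
    from fun_cong[OF has_derivative_unique[OF d this], of u] show ?thesis by (simp add: sp4_iff_coords)
  qed
  then show ?thesis
    unfolding curvature_eq extd_def using subspace_sp4 sp4_lie_br sp w
    by (auto intro!: subspace_add subspace_diff)
qed

subsection \<open>Tanaka normality\<close>

lemma sum_Basis_vec:
  fixes f :: "real^'n \<Rightarrow> 'b::comm_monoid_add"
  shows "(\<Sum>b\<in>Basis. f b) = (\<Sum>i\<in>UNIV. f (axis i 1))"
proof -
  have 1: "(Basis :: (real^'n) set) = range (\<lambda>i. axis i 1)" by (auto simp: Basis_vec_def)
  have 2: "inj (\<lambda>i::'n. axis i (1::real))" by (auto simp: inj_def axis_eq_axis)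
  show ?thesis unfolding 1 by (subst sum.reindex[OF 2]) (simp add: o_def)
qed

text \<open>The coefficients are those of six times the trace of the product, the Killing form of
  this algebra; here they are computed from the definition as a sum over ten basis vectors.\<close>

lemma killing_form_neg_pos:
  assumes "w$1 = 0" "w$3 = 0"
  shows "killing_form (sp4_matrix (t, 0)) (sp4_matrix (0, w)) = - 3 * t$1 * w$6 - 6 * t$2 * w$4 - 6 * t$3 * w$5 + 6 * t$4 * w$2"
proof -
  have "killing_form X Y = (\<Sum>i\<in>UNIV. fst (sp4_coords (lie_br X (lie_br Y (sp4_matrix (axis i 1, 0))))) $ i)
     + (\<Sum>i\<in>UNIV. snd (sp4_coords (lie_br X (lie_br Y (sp4_matrix (0, axis i 1))))) $ i)" for X Y
  proof -
    have 1: "(Basis :: ((real^4) \<times> (real^6)) set) = (\<lambda>u. (u, 0)) ` Basis \<union> (\<lambda>u. (0, u)) ` Basis"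
      by (simp add: Basis_prod_def)
    have 2: "(\<lambda>u. (u, 0)) ` Basis \<inter> (\<lambda>u. (0, u)) ` Basis = ({} :: ((real^4) \<times> (real^6)) set)" by auto
    have "killing_form X Y = (\<Sum>b\<in>Basis. sp4_coords (lie_br X (lie_br Y (sp4_matrix (b, 0)))) \<bullet> (b, 0))
       + (\<Sum>b\<in>Basis. sp4_coords (lie_br X (lie_br Y (sp4_matrix (0, b)))) \<bullet> (0, b))"
      unfolding killing_form_def 1
      by (subst sum.union_disjoint[OF _ _ 2]) (simp_all add: sum.reindex inj_on_def)
    then show ?thesis by (simp add: sum_Basis_vec inner_prod_def inner_axis)
  qed
  then show ?thesis
    by (simp add: sum_4 sum_6 lie_br_def matrix_matrix_mult_def axis_def assms) (simp add: field_simps)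
qed

text \<open>Chosen so that \<open>killing_form (sp4_matrix (t, 0)) (dual_pos y)\<close> is the
  standard inner product of \<open>t\<close> and \<open>y\<close>; the denominators invert the
  coefficients of \<open>killing_form_neg_pos\<close>.\<close>

definition dual_pos :: "real^4 \<Rightarrow> real^4^4" where
  "dual_pos y = sp4_matrix (0, vector [0, y$4/6, 0, - y$2/6, - y$3/6, - y$1/3])"

text \<open>Such a sum is a trace and does not depend on the pair of dual bases, so the
  codifferential can be evaluated in the standard basis. The displayed vectors are the coordinates
  of \<open>e' i\<close> with respect to \<open>dual_pos\<close>.\<close>

lemma dual_bases_sum:
  assumes dual: "dual_bases e e'" and f: "bilinear f"
  shows "(\<Sum>i\<in>UNIV. f (fst (sp4_coords (e i))) (vector [- 3 * snd (sp4_coords (e' i)) $ 6,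
      - 6 * snd (sp4_coords (e' i)) $ 4, - 6 * snd (sp4_coords (e' i)) $ 5, 6 * snd (sp4_coords (e' i)) $ 2]))
    = (\<Sum>k\<in>UNIV. f (axis k 1) (axis k 1))"
    and "e i = sp4_matrix (fst (sp4_coords (e i)), 0)"
    and "e' i = dual_pos (vector [- 3 * snd (sp4_coords (e' i)) $ 6,
      - 6 * snd (sp4_coords (e' i)) $ 4, - 6 * snd (sp4_coords (e' i)) $ 5, 6 * snd (sp4_coords (e' i)) $ 2])"
proof -
  let ?t = "\<lambda>i. fst (sp4_coords (e i))" and ?w = "\<lambda>i. snd (sp4_coords (e' i))"
  let ?y = "\<lambda>i. vector [- 3 * ?w i $ 6, - 6 * ?w i $ 4, - 6 * ?w i $ 5, 6 * ?w i $ 2] :: real^4"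
  have "e i \<in> span (range e)" for i by (intro span_base) simp
  then have "e i \<in> neg_part" for i using dual by (simp add: dual_bases_def)
  then show et: "e i = sp4_matrix (?t i, 0)" for i
    using neg_part_iff[of "e i"] by auto
  have "e' i \<in> pos_part" for i using dual by (auto simp: dual_bases_def)
  then have ew: "e' i = sp4_matrix (0, ?w i)" "?w i $ 1 = 0" "?w i $ 3 = 0" for i
    by (metis pos_part_iff snd_conv sp4_coords_matrix)+
  then show "e' i = dual_pos (?y i)" for i
    unfolding dual_pos_def by (subst ew(1)) (simp add: mat4_simps)
  define T where "T = (\<chi> i k. ?t i $ k)"
  define Y where "Y = (\<chi> k i. ?y i $ k)"
  have "killing_form (e i) (e' j) = (\<Sum>k\<in>UNIV. ?t i $ k * ?y j $ k)" for i j
    by (subst et, subst ew(1), subst killing_form_neg_pos[OF ew(2,3)]) (simp add: sum_4)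
  then have "T ** Y = mat 1"
    using dual by (simp add: T_def Y_def vec_eq_iff matrix_matrix_mult_def mat_def dual_bases_def)
  \<comment> \<open>Duality is the statement \<open>T ** Y = mat 1\<close>, but the sum over the
    basis index needs the product in the other order.\<close>
  then have "Y ** T = mat 1" by (simp add: matrix_left_right_inverse)
  then have YT: "(\<Sum>i\<in>UNIV. ?y i $ k * ?t i $ l) = (if k = l then 1 else 0)" for k l
    by (simp add: T_def Y_def vec_eq_iff matrix_matrix_mult_def mat_def)
  have ex: "f a b = (\<Sum>k\<in>UNIV. \<Sum>l\<in>UNIV. (b $ k * a $ l) *\<^sub>R f (axis l 1) (axis k 1))" for a b
  proof -
    have fa: "linear (f a)" "linear (\<lambda>a. f a b)" for a b using f by (auto simp: bilinear_def)
    have "f a b = (\<Sum>k\<in>UNIV. b $ k *\<^sub>R f a (axis k 1))"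
      using linear_eq_sum_Basis[OF fa(1)[of a], of b] by (simp add: sum_Basis_vec inner_axis)
    also have "\<dots> = (\<Sum>k\<in>UNIV. b $ k *\<^sub>R (\<Sum>l\<in>UNIV. a $ l *\<^sub>R f (axis l 1) (axis k 1)))"
      using linear_eq_sum_Basis[OF fa(2), of a] by (simp add: sum_Basis_vec inner_axis)
    finally show ?thesis by (simp add: scaleR_sum_right)
  qed
  have "(\<Sum>i\<in>UNIV. f (?t i) (?y i)) = (\<Sum>i\<in>UNIV. \<Sum>k\<in>UNIV. \<Sum>l\<in>UNIV. (?y i $ k * ?t i $ l) *\<^sub>R f (axis l 1) (axis k 1))"
    by (subst ex) (rule refl)
  also have "\<dots> = (\<Sum>k\<in>UNIV. \<Sum>l\<in>UNIV. (\<Sum>i\<in>UNIV. ?y i $ k * ?t i $ l) *\<^sub>R f (axis l 1) (axis k 1))"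
    unfolding scaleR_sum_left by (subst sum.swap, intro sum.cong refl sum.swap)
  also have "\<dots> = (\<Sum>k\<in>UNIV. f (axis k 1) (axis k 1))"
    unfolding YT by (simp add: if_distrib[of "\<lambda>c. c *\<^sub>R _"] sum.delta cong: if_cong)
  finally show "(\<Sum>i\<in>UNIV. f (?t i) (?y i)) = (\<Sum>k\<in>UNIV. f (axis k 1) (axis k 1))" .
qed

text \<open>The assumptions \<open>n1\<close> to \<open>n4\<close> are the conditions of
  \<open>normal_curvature\<close> on basis vectors. After expansion the claim is a finite identity
  between the remaining entries of \<open>k\<close>, where \<open>n4\<close> ties those of
  \<open>k 1 2\<close> to those of \<open>k 1 4\<close>.\<close>

lemma codifferential_zero:
  assumes \<beta>: "bilinear \<beta>" and anti: "\<And>s t. \<beta> s t = - \<beta> t s" and sp: "\<And>s t. \<beta> s t \<in> sp4"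
    and n1: "\<And>s t i. \<beta> s t $ i $ 1 = 0"
    and n2: "\<beta> (axis 4 1) (axis 2 1) = 0" "\<beta> (axis 4 1) (axis 3 1) = 0"
    and n3: "\<And>t i. \<beta> (axis 3 1) t $ i $ 2 = 0"
    and n4: "\<And>i. \<beta> (axis 1 1) (axis 2 1) $ i $ 2 = \<beta> (axis 1 1) (axis 4 1) $ i $ 3"
  shows "(\<Sum>k\<in>UNIV. lie_br (dual_pos (axis k 1)) (\<beta> (axis k 1) a)
     + (1/2) *\<^sub>R \<beta> (fst (sp4_coords (lie_br (dual_pos (axis k 1)) (sp4_matrix (a, 0))))) (axis k 1)) = 0"
proof -
  define k where "k i j = \<beta> (axis i 1) (axis j 1)" for i j :: 4
  have lin: "linear (\<beta> s)" "linear (\<lambda>s. \<beta> s t)" for s t using \<beta> by (auto simp: bilinear_def)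
  have right: "\<beta> s t = t$1 *\<^sub>R \<beta> s (axis 1 1) + t$2 *\<^sub>R \<beta> s (axis 2 1) + t$3 *\<^sub>R \<beta> s (axis 3 1) + t$4 *\<^sub>R \<beta> s (axis 4 1)" for s t
    using linear_eq_sum_Basis[OF lin(1), of s t] by (simp add: sum_Basis_vec inner_axis sum_4)
  have left: "\<beta> s t = s$1 *\<^sub>R \<beta> (axis 1 1) t + s$2 *\<^sub>R \<beta> (axis 2 1) t + s$3 *\<^sub>R \<beta> (axis 3 1) t + s$4 *\<^sub>R \<beta> (axis 4 1) t" for s t
    using linear_eq_sum_Basis[OF lin(2), of s t] by (simp add: sum_Basis_vec inner_axis sum_4)
  have ka: "k i j = - k j i" for i j unfolding k_def by (rule anti)
  have kd: "k i i = 0" for i using ka[of i i] by (simp add: vec_eq_iff)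
  have k4: "k 4 2 = 0" "k 4 3 = 0" by (simp_all add: k_def n2)
  then have k4': "k 2 4 = 0" "k 3 4 = 0" using ka[of 2 4] ka[of 3 4] by simp_all
  note kk = ka[of 2 1] ka[of 3 1] ka[of 4 1] ka[of 3 2] k4 k4' kd
  have ksp: "k i j $ 1 $ 1 = 0" "k i j $ 2 $ 1 = 0" "k i j $ 3 $ 1 = 0" "k i j $ 4 $ 1 = 0"
    "k i j $ 4 $ 2 = 0" "k i j $ 4 $ 3 = 0" "k i j $ 4 $ 4 = 0" "k i j $ 3 $ 3 = - k i j $ 2 $ 2"
    "k i j $ 3 $ 4 = - k i j $ 1 $ 2" "k i j $ 2 $ 4 = k i j $ 1 $ 3" for i j
    using sp[of "axis i 1" "axis j 1"] n1[of "axis i 1" "axis j 1"] unfolding sp4_iff_entries k_def by simp_all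
  have k13: "k 1 3 $ i $ 2 = 0" "k 2 3 $ i $ 2 = 0" for i
    using n3[of "axis 1 1" i] n3[of "axis 2 1" i] anti[of "axis 1 1" "axis 3 1"] anti[of "axis 2 1" "axis 3 1"]
    by (simp_all add: k_def)
  have k14: "k 1 4 $ 1 $ 3 = k 1 2 $ 1 $ 2" "k 1 4 $ 2 $ 3 = k 1 2 $ 2 $ 2" "k 1 2 $ 3 $ 2 = - k 1 4 $ 2 $ 2"
    using n4[of 1] n4[of 2] n4[of 3] ksp(8)[of 1 4] unfolding k_def by simp_all
  show ?thesis
    unfolding sum_4
    apply (subst right[of _ a])+
    apply (subst left[of "fst _"])+
    unfolding k_def[symmetric]
    by (simp add: kk vec_eq_iff forall_4 lie_br_def matrix_matrix_mult_def sum_4 dual_pos_def axis_def ksp k13 k14)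
qed

lemma tanaka_normalI:
  fixes \<omega> :: "'w::euclidean_space \<Rightarrow> 'w \<Rightarrow> real^4^4"
  assumes \<omega>: "smooth_form P \<omega>" and P: "open P" and sp: "\<And>w v. w \<in> P \<Longrightarrow> \<omega> w v \<in> sp4"
    and bij: "\<And>w. w \<in> P \<Longrightarrow> bij_betw (\<omega> w) UNIV sp4"
    and N: "\<And>w. w \<in> P \<Longrightarrow> normal_curvature (\<omega> w) (curvature \<omega> w)"
  shows "tanaka_normal P \<omega>"
proof -
  {
  fix w assume w: "w \<in> P"
  define X where "X A = inv_into UNIV (\<omega> w) A" for A
  define \<beta> where "\<beta> s t = curvature \<omega> w (X (sp4_matrix (s, 0))) (X (sp4_matrix (t, 0)))" for s t
  have inj: "inj (\<omega> w)" and ran: "range (\<omega> w) = sp4" using bij[OF w] by (auto simp: bij_betw_def)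
  have \<omega>X: "\<omega> w (X A) = A" if "A \<in> sp4" for A
    using that ran unfolding X_def by (auto intro: f_inv_into_f)
  have lin: "linear (\<omega> w)" using \<omega> w by (simp add: smooth_form_def)
  have mem: "sp4_matrix p \<in> sp4" for p by (simp add: sp4_def)
  have linX: "linear (\<lambda>t. X (sp4_matrix (t, 0)))"
  proof (rule linearI)
    fix s t :: "real^4" and r :: real
    have "sp4_matrix (s + t, 0) = sp4_matrix (s, 0) + sp4_matrix (t, 0)"
      using linear_add[OF linear_sp4_matrix, of "(s, 0)" "(t, 0)"] by simp
    then have "\<omega> w (X (sp4_matrix (s + t, 0))) = \<omega> w (X (sp4_matrix (s, 0)) + X (sp4_matrix (t, 0)))"
      unfolding linear_add[OF lin] \<omega>X[OF mem] .
    then show "X (sp4_matrix (s + t, 0)) = X (sp4_matrix (s, 0)) + X (sp4_matrix (t, 0))" by (rule injD[OF inj])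
    have "sp4_matrix (r *\<^sub>R s, 0) = r *\<^sub>R sp4_matrix (s, 0)"
      using linear_cmul[OF linear_sp4_matrix, of r "(s, 0)"] by simp
    then have "\<omega> w (X (sp4_matrix (r *\<^sub>R s, 0))) = \<omega> w (r *\<^sub>R X (sp4_matrix (s, 0)))"
      unfolding linear_cmul[OF lin] \<omega>X[OF mem] .
    then show "X (sp4_matrix (r *\<^sub>R s, 0)) = r *\<^sub>R X (sp4_matrix (s, 0))" by (rule injD[OF inj])
  qed
  have bil: "bilinear \<beta>"
    unfolding bilinear_def \<beta>_def
    using linear_compose[OF linX curvature_linear(1)[OF \<omega> P w]] linear_compose[OF linX curvature_linear(2)[OF \<omega> P w]]
    by (simp add: o_def)
  have \<kappa>: "structure_function \<omega> w A B = \<beta> (fst (sp4_coords A)) (fst (sp4_coords B))"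
    if "A \<in> neg_part" "B \<in> neg_part" for A B
    using that by (auto simp: neg_part_iff \<beta>_def X_def structure_function_def)
  have anti: "\<beta> s t = - \<beta> t s" for s t unfolding \<beta>_def by (rule curvature_antisym)
  have bsp: "\<beta> s t \<in> sp4" for s t unfolding \<beta>_def by (rule curvature_sp4[OF \<omega> P w sp])
  note ND = normal_curvatureD[OF N[OF w]]
  have n1: "\<beta> s t $ i $ 1 = 0" for s t i unfolding \<beta>_def by (rule ND(1))
  have n2: "\<beta> (axis 4 1) (axis 2 1) = 0" "\<beta> (axis 4 1) (axis 3 1) = 0"
    unfolding \<beta>_def by (rule ND(2); simp add: \<omega>X mem axis_def)+
  have n3: "\<beta> (axis 3 1) t $ i $ 2 = 0" for t i
    unfolding \<beta>_def by (rule ND(3); simp add: \<omega>X mem axis_def)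
  have n4: "\<beta> (axis 1 1) (axis 2 1) $ i $ 2 = \<beta> (axis 1 1) (axis 4 1) $ i $ 3" for i
    using ND(4)[of "X (sp4_matrix (axis 2 1, 0))" "X (sp4_matrix (axis 4 1, 0))" "X (sp4_matrix (axis 1 1, 0))" i]
    unfolding \<beta>_def by (simp add: \<omega>X mem axis_def)
  have grade: "structure_function \<omega> w A B \<in> span (\<Union>k\<in>{i+j+1..3}. sp4_grade k)"
    if ij: "i \<in> {-3..-1}" "j \<in> {-3..-1}" and A: "A \<in> sp4_grade i" and B: "B \<in> sp4_grade j" for i j A B
  proof -
    have AB: "A \<in> neg_part" "B \<in> neg_part"
      using A B ij unfolding neg_part_def by (auto intro!: span_base)
    let ?s = "fst (sp4_coords A)" and ?t = "fst (sp4_coords B)"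
    have lin: "linear (\<beta> s)" "linear (\<lambda>s. \<beta> s t)" for s t using bil by (auto simp: bilinear_def)
    have ex: "\<beta> s t = (\<Sum>k\<in>UNIV. \<Sum>l\<in>UNIV. (t $ k * s $ l) *\<^sub>R \<beta> (axis l 1) (axis k 1))" for s t
    proof -
      have "\<beta> s t = (\<Sum>k\<in>UNIV. t $ k *\<^sub>R \<beta> s (axis k 1))"
        using linear_eq_sum_Basis[OF lin(1), of s t] by (simp add: sum_Basis_vec inner_axis)
      also have "\<dots> = (\<Sum>k\<in>UNIV. t $ k *\<^sub>R (\<Sum>l\<in>UNIV. s $ l *\<^sub>R \<beta> (axis l 1) (axis k 1)))"
        using linear_eq_sum_Basis[OF lin(2), of s] by (simp add: sum_Basis_vec inner_axis)
      finally show ?thesis by (simp add: scaleR_sum_right)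
    qed
    have diag: "\<beta> (axis k 1) (axis k 1) = 0" for k
      using anti[of "axis k 1" "axis k 1"] by (simp add: vec_eq_iff)
    have n2': "\<beta> (axis 3 1) (axis 4 1) = 0" using anti[of "axis 3 1" "axis 4 1"] n2 by simp
    have s: "i \<noteq> -3 \<Longrightarrow> ?s $ 1 = 0" "i \<noteq> -2 \<Longrightarrow> ?s $ 2 = 0" "i \<noteq> -1 \<Longrightarrow> ?s $ 3 = 0 \<and> ?s $ 4 = 0"
      using A by (auto simp: sp4_grade_iff)
    have t: "j \<noteq> -3 \<Longrightarrow> ?t $ 1 = 0" "j \<noteq> -2 \<Longrightarrow> ?t $ 2 = 0" "j \<noteq> -1 \<Longrightarrow> ?t $ 3 = 0 \<and> ?t $ 4 = 0"
      using B by (auto simp: sp4_grade_iff)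
    have i: "i = -3 \<or> i = -2 \<or> i = -1" and j: "j = -3 \<or> j = -2 \<or> j = -1" using ij by auto
    \<comment> \<open>By \<open>n1\<close> the values of \<open>\<beta>\<close> have degree at least
      -1, which settles the sums \<open>i + j + 1\<close> up to -2. Two vectors of degree -2 are
      proportional and give zero by antisymmetry; two of degree -1 give zero by
      \<open>n2\<close>.\<close>
    have "\<beta> ?s ?t = 0 \<or> i + j + 1 \<le> -3 \<or> i + j + 1 = -2"
      using i j
    proof (elim disjE)
      assume "i = -2" "j = -2"
      then have "\<beta> ?s ?t = 0" unfolding ex[of ?s ?t] using s t by (simp add: sum_4 diag)
      then show ?thesis ..
    next
      assume "i = -1" "j = -1"
      then have "\<beta> ?s ?t = 0" unfolding ex[of ?s ?t] using s t by (simp add: sum_4 diag n2 n2')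
      then show ?thesis ..
    qed simp_all
    then show ?thesis
      unfolding \<kappa>[OF AB]
    proof (elim disjE)
      assume "\<beta> ?s ?t = 0" then show "\<beta> ?s ?t \<in> span (\<Union>k\<in>{i+j+1..3}. sp4_grade k)" by (simp add: span_zero)
    qed (auto simp: span_sp4_grades bsp n1)
  qed
  have codiff: "codifferential e e' (structure_function \<omega> w) A = 0"
    if dual: "dual_bases e e'" and A: "A \<in> neg_part" for e e' A
  proof -
    obtain a where a: "A = sp4_matrix (a, 0)" using A by (auto simp: neg_part_iff)
    \<comment> \<open>The summand of the codifferential as a bilinear function of the coordinates of
      \<open>e i\<close> and \<open>e' i\<close>, the shape required by
      \<open>dual_bases_sum\<close>.\<close>
    define f where "f t y = lie_br (dual_pos y) (\<beta> t a) + (1/2) *\<^sub>R \<beta> (fst (sp4_coords (lie_br (dual_pos y) (sp4_matrix (a, 0))))) t" for t y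
    have ldp: "linear dual_pos"
      by (rule linearI) (simp_all add: dual_pos_def mat4_simps field_simps)
    have lbr: "linear (\<lambda>y. lie_br (dual_pos y) Z)" for Z
      by (rule linearI) (simp_all add: lie_br_def linear_add[OF ldp] linear_cmul[OF ldp] matrix_mult_simps algebra_simps)
    have bl: "linear (\<beta> s)" "linear (\<lambda>s. \<beta> s t)" for s t using bil by (auto simp: bilinear_def)
    have bf: "bilinear f"
      unfolding bilinear_def
    proof (intro conjI allI)
      show "linear (f t)" for t
        unfolding f_def
        by (rule linearI) (simp_all add: linear_add[OF lbr] linear_cmul[OF lbr] linear_add[OF linear_sp4_coords]
          linear_cmul[OF linear_sp4_coords] linear_add[OF bl(2)] linear_cmul[OF bl(2)] algebra_simps)
      show "linear (\<lambda>t. f t y)" for y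
        unfolding f_def
        by (rule linearI) (simp_all add: lie_br_def linear_add[OF bl(1)] linear_cmul[OF bl(1)]
            linear_add[OF bl(2)] linear_cmul[OF bl(2)] matrix_mult_simps algebra_simps)
    qed
    note D = dual_bases_sum[OF dual bf]
    have mem': "e i \<in> neg_part" for i using D(2)[of i] neg_part_iff by blast
    have pm: "proj_neg (lie_br (e' j) A) = sp4_matrix (fst (sp4_coords (lie_br (e' j) A)), 0)" for j
    proof (rule proj_neg_eq[OF sp4_lie_br])
      show "e' j \<in> sp4" by (subst D(3)[of j]) (simp add: dual_pos_def mem)
    qed (simp add: a mem)
    then have pm': "proj_neg (lie_br (e' j) A) \<in> neg_part" for j by (auto simp: neg_part_iff)
    have s1: "structure_function \<omega> w (proj_neg (lie_br (e' j) A)) (e j)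
        = \<beta> (fst (sp4_coords (lie_br (e' j) A))) (fst (sp4_coords (e j)))" for j
      unfolding \<kappa>[OF pm' mem'] unfolding pm by simp
    have s2: "structure_function \<omega> w (e j) A = \<beta> (fst (sp4_coords (e j))) a" for j
      unfolding \<kappa>[OF mem' A] by (simp add: a)
    have "codifferential e e' (structure_function \<omega> w) A =
        (\<Sum>i\<in>UNIV. lie_br (e' i) (\<beta> (fst (sp4_coords (e i))) a)
          + (1/2) *\<^sub>R \<beta> (fst (sp4_coords (lie_br (e' i) A))) (fst (sp4_coords (e i))))"
      unfolding codifferential_def
      unfolding s1 s2 by (simp only: sum.distrib scaleR_sum_right)
    also have "\<dots> = (\<Sum>i\<in>UNIV. f (fst (sp4_coords (e i))) (vector [- 3 * snd (sp4_coords (e' i)) $ 6,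
      - 6 * snd (sp4_coords (e' i)) $ 4, - 6 * snd (sp4_coords (e' i)) $ 5, 6 * snd (sp4_coords (e' i)) $ 2]))"
      unfolding f_def D(3)[symmetric] a ..
    also have "\<dots> = 0"
      unfolding D(1) unfolding f_def by (rule codifferential_zero[OF bil anti bsp n1 n2 n3 n4])
    finally show ?thesis .
  qed
  note grade codiff
  }
  then show ?thesis unfolding tanaka_normal_def by blast
qed

section \<open>The structure equations\<close>

lemma pd_linear:
  assumes "smooth_on U f" "z \<in> U"
  shows "frechet_derivative f (at z) v = (\<Sum>i\<in>UNIV. v $ i * pd i f z)"
  using linear_eq_sum_Basis[OF smooth_on_linear_derivative[OF assms], of v]
  by (simp add: sum_Basis_vec inner_axis pd_def)

lemma pd_eqI: "(f has_derivative f') (at z) \<Longrightarrow> pd i f z = f' (axis i 1)"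
  by (simp add: pd_def frechet_derivative_eqI)

lemma pd_cong:
  assumes "open U" "smooth_on U f" "\<And>z. z \<in> U \<Longrightarrow> f z = g z" "z \<in> U"
  shows "pd i f z = pd i g z"
  unfolding pd_def
  by (rule fun_cong[OF frechet_derivative_transform_within_open[OF smooth_on_differentiable assms(1)]])
    (use assms in auto)

lemma pd_add:
  "smooth_on U f \<Longrightarrow> smooth_on U g \<Longrightarrow> z \<in> U \<Longrightarrow> pd i (\<lambda>z. f z + g z) z = pd i f z + pd i g z"
  unfolding pd_def by (rule fun_cong[OF frechet_derivative_eqI[OF has_derivative_add[OF
    smooth_on_has_derivative smooth_on_has_derivative]]])

lemma pd_diff:
  "smooth_on U f \<Longrightarrow> smooth_on U g \<Longrightarrow> z \<in> U \<Longrightarrow> pd i (\<lambda>z. f z - g z) z = pd i f z - pd i g z"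
  unfolding pd_def by (rule fun_cong[OF frechet_derivative_eqI[OF has_derivative_diff[OF
    smooth_on_has_derivative smooth_on_has_derivative]]])

lemma pd_minus:
  "smooth_on U f \<Longrightarrow> z \<in> U \<Longrightarrow> pd i (\<lambda>z. - f z) z = - pd i f z"
  unfolding pd_def by (rule fun_cong[OF frechet_derivative_eqI[OF has_derivative_minus[OF
    smooth_on_has_derivative]]])

lemma pd_mult:
  "smooth_on U f \<Longrightarrow> smooth_on U g \<Longrightarrow> z \<in> U \<Longrightarrow>
    pd i (\<lambda>z. f z * g z) z = f z * pd i g z + pd i f z * g z"
  unfolding pd_def by (rule fun_cong[OF frechet_derivative_eqI[OF has_derivative_mult[OF
    smooth_on_has_derivative smooth_on_has_derivative]]])

lemma pd_const: "pd i (\<lambda>z. c) z = 0"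
  by (simp add: pd_def)

lemma pd_power2:
  "smooth_on U f \<Longrightarrow> z \<in> U \<Longrightarrow> pd i (\<lambda>z. (f z)^2) z = 2 * f z * pd i f z"
  unfolding power2_eq_square by (simp add: pd_mult)

lemma pd_divide_const:
  "smooth_on U f \<Longrightarrow> z \<in> U \<Longrightarrow> pd i (\<lambda>z. f z / c) z = pd i f z / c"
  unfolding pd_def by (rule fun_cong[OF frechet_derivative_eqI[OF bounded_linear.has_derivative[OF
    bounded_linear_divide smooth_on_has_derivative]]])

lemma pd_nth: "pd i (\<lambda>z. z $ j) z = (if i = j then 1 else 0)"
  by (subst pd_eqI[OF bounded_linear_imp_has_derivative[OF bounded_linear_vec_nth]]) (simp add: axis_def)

lemma pd_commute:
  assumes "open U" "smooth_on U f" "z \<in> U"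
  shows "pd i (pd j f) z = pd j (pd i f) z"
  unfolding pd_def[abs_def] by (rule smooth_on_symmetric[OF assms])

lemma pd_commute2:
  assumes "open U" "smooth_on U f" "z \<in> U"
  shows "pd k (pd i (pd j f)) z = pd k (pd j (pd i f)) z"
  by (rule pd_cong[OF assms(1) _ pd_commute[OF assms(1,2)] assms(3)]) (intro smooth_on_pd assms)

text \<open>The frame dual to the forms \<open>om\<close>; its last vector is the vector field
  behind \<open>total_D F\<close>, tangent to the solution curves.\<close>

definition frame :: "(real^4 \<Rightarrow> real) \<Rightarrow> real^4 \<Rightarrow> 4 \<Rightarrow> real^4" where
  "frame F z a = vector [vector [0, 1, 0, - K_fun F z], vector [0, 0, 1, 1/3 * Dq F z],
     vector [0, 0, 0, 1], vector [1, z$3, z$4, F z]] $ a"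

lemma om_frame: "om F z (frame F z a) = axis a 1"
  by (rule forall_4'[of _ a])
    (simp_all add: frame_def om_def om1_def om2_def om3_def om4_def vec_eq_iff forall_4 axis_def)

lemma frame_expand: "v = (\<Sum>a\<in>UNIV. om F z v $ a *\<^sub>R frame F z a)"
proof -
  have "om F z v = om F z (\<Sum>a\<in>UNIV. om F z v $ a *\<^sub>R frame F z a)"
    by (simp add: linear_add[OF linear_om_vec] linear_cmul[OF linear_om_vec] om_frame vec_eq_iff axis_def sum_4 forall_4)
  then have "om F z (v - (\<Sum>a\<in>UNIV. om F z v $ a *\<^sub>R frame F z a)) = 0"
    by (simp add: linear_diff[OF linear_om_vec])
  then show ?thesis using om_inj by fastforce
qed

text \<open>Row \<open>j\<close>, column \<open>a\<close> holds the coefficient of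
  \<open>\<omega>\<^sup>a\<close> in \<open>\<Omega>\<^sub>j\<^sup>0\<close>. With coefficients and
  forms separated, exterior derivatives of \<open>Om0\<close> follow from the product rule.\<close>

definition oc :: "(real^4 \<Rightarrow> real) \<Rightarrow> real^4 \<Rightarrow> real^4^6" where
  "oc F z = vector
    [vector [- Dq (K_fun F) z, 0, 0, 0],
     vector [1/3 * Dq (W_fun F) z + L_fun F z, - Dq (K_fun F) z, 0, - K_fun F z],
     vector [- Dq (K_fun F) z, 1/6 * Dq (Dq F) z, 0, 1/3 * Dq F z],
     vector [- (1/3 * Dq (Dq (W_fun F)) z + Dq (L_fun F) z), 1/2 * Dq (Dq (K_fun F)) z, 0, 0],
     vector [1/2 * Dq (Dq (K_fun F)) z, - 1/6 * Dq (Dq (Dq F)) z, 0, - 1/6 * Dq (Dq F) z],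
     vector [1/3 * total_D F (Dq (Dq (W_fun F))) z - 4/3 * Dp (Dq (W_fun F)) z
         - 1/3 * Dq F z * Dq (Dq (W_fun F)) z + 1/3 * Dq (Dq (Dq F)) z * W_fun F z + M_fun F z,
       1/3 * (Dy (Dq (Dq F)) z - Dq (Dq (Dq F)) z * K_fun F z - Dq (Dq (W_fun F)) z),
       - Dq (Dq (K_fun F)) z,
       2/3 * Dy (Dq F) z - 1/3 * Dq (Dq F) z * K_fun F z - 2 * L_fun F z - 4/3 * Dq (W_fun F) z]]"

lemma Om0_eq_oc: "Om0 F z v $ j = (\<Sum>i\<in>UNIV. oc F z $ j $ i * om F z v $ i)"
  by (rule forall_6'[of _ j]) (simp_all add: Om0_def oc_def om_def sum_4)

lemma Om0_frame: "Om0 F z (frame F z a) $ j = oc F z $ j $ a"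
  by (simp add: Om0_eq_oc om_frame axis_def if_distrib[of "\<lambda>c. _ * c"] sum.delta' cong: if_cong)

context
  fixes F :: "real^4 \<Rightarrow> real" and U :: "(real^4) set"
  assumes U: "open U" and F: "smooth_on U F"
begin

private abbreviation "K \<equiv> K_fun F"
private abbreviation "L \<equiv> L_fun F"
private abbreviation "M \<equiv> M_fun F"
private abbreviation "W \<equiv> W_fun F"
private abbreviation "D \<equiv> total_D F"

lemma smooth_nth: "smooth_on U (\<lambda>z. z $ i)"
  by (intro smooth_intros U)

lemma smooth_divide_const: "smooth_on U f \<Longrightarrow> smooth_on U (\<lambda>z. f z / c)" for f :: "real^4 \<Rightarrow> real"
  by (rule smooth_on_bounded_linear[OF bounded_linear_divide U])

lemmas smU = F smooth_on_pd smooth_on_total_D[OF U F] smooth_on_K_fun[OF U F] smooth_on_L_fun[OF U F]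
  smooth_on_M_fun[OF U F] smooth_on_W_fun[OF U F] smooth_nth smooth_on_const[OF U] smooth_on_add[OF U]
  smooth_on_diff[OF U] smooth_on_minus[OF U] smooth_on_mult[OF U] smooth_on_power[OF U] smooth_divide_const

lemmas pdU = pd_add[where U = U] pd_diff[where U = U] pd_minus[where U = U] pd_mult[where U = U]
  pd_power2[where U = U] pd_divide_const[where U = U] pd_const pd_nth

lemma smooth_oc: "smooth_on U (\<lambda>z. oc F z $ j $ i)"
  by (rule forall_6'[of _ j]; rule forall_4'[of _ i]; simp only: oc_def vector_6 vector_4; intro smU)

lemma frame_derivative:
  assumes "smooth_on U f" "z \<in> U"
  shows "frechet_derivative f (at z) (frame F z 1) = Dy f z - K z * Dq f z"
    "frechet_derivative f (at z) (frame F z 2) = Dp f z + 1/3 * Dq F z * Dq f z"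
    "frechet_derivative f (at z) (frame F z 3) = Dq f z"
    "frechet_derivative f (at z) (frame F z 4) = D f z"
  by (simp_all add: pd_linear[OF assms] frame_def sum_4 total_D_def)

section \<open>Elimination of the total derivative\<close>

lemma D_rules:
  assumes "z \<in> U"
  shows "smooth_on U f \<Longrightarrow> smooth_on U g \<Longrightarrow> D (\<lambda>z. f z + g z) z = D f z + D g z"
    "smooth_on U f \<Longrightarrow> smooth_on U g \<Longrightarrow> D (\<lambda>z. f z - g z) z = D f z - D g z"
    "smooth_on U f \<Longrightarrow> D (\<lambda>z. - f z) z = - D f z"
    "smooth_on U f \<Longrightarrow> smooth_on U g \<Longrightarrow> D (\<lambda>z. f z * g z) z = f z * D g z + D f z * g z"
    "smooth_on U f \<Longrightarrow> D (\<lambda>z. (f z)^2) z = 2 * f z * D f z"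
    "smooth_on U f \<Longrightarrow> D (\<lambda>z. f z / c) z = D f z / c"
    "D (\<lambda>z. c) z = 0"
  using assms by (simp_all add: total_D_def pdU algebra_simps add_divide_distrib)

lemma D_cong:
  assumes "smooth_on U f" "\<And>z. z \<in> U \<Longrightarrow> f z = g z" "z \<in> U"
  shows "D f z = D g z"
  using pd_cong[OF U assms] by (simp add: total_D_def)

text \<open>The commutators of the total derivative with the coordinate fields; the extra terms come
  from the coefficients \<open>p\<close>, \<open>q\<close> and \<open>F\<close> in
  \<open>total_D\<close>.\<close>

lemma D_commute:
  assumes f: "smooth_on U f" and z: "z \<in> U"
  shows "D (Dq f) z = Dq (D f) z - Dp f z - Dq F z * Dq f z"
    "D (Dp f) z = Dp (D f) z - Dy f z - Dp F z * Dq f z"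
    "D (Dy f) z = Dy (D f) z - Dy F z * Dq f z"
proof -
  note c = pd_commute[OF U f z]
  have e: "pd i (D f) z = pd i (pd 1 f) z + z$3 * pd i (pd 2 f) z + (if i = 3 then Dy f z else 0)
     + z$4 * pd i (pd 3 f) z + (if i = 4 then Dp f z else 0) + F z * pd i (pd 4 f) z + pd i F z * Dq f z" for i
    unfolding total_D_def[abs_def] using z f by (simp add: pdU smU)
  show "D (Dq f) z = Dq (D f) z - Dp f z - Dq F z * Dq f z"
    unfolding e by (simp add: total_D_def c[of 4 1] c[of 4 2] c[of 4 3])
  show "D (Dp f) z = Dp (D f) z - Dy f z - Dp F z * Dq f z"
    unfolding e by (simp add: total_D_def c[of 3 1] c[of 3 2] c[of 3 4])
  show "D (Dy f) z = Dy (D f) z - Dy F z * Dq f z"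
    unfolding e by (simp add: total_D_def c[of 2 1] c[of 2 3] c[of 2 4])
qed

text \<open>Oriented so that rewriting moves \<open>Dq\<close> innermost and \<open>Dy\<close>
  outermost, which gives mixed derivatives a normal form.\<close>

lemma pd_swap:
  assumes "z \<in> U" "smooth_on U f"
  shows "Dq (Dp f) z = Dp (Dq f) z" "Dq (Dy f) z = Dy (Dq f) z" "Dp (Dy f) z = Dy (Dp f) z"
    "pd i (Dq (Dp f)) z = pd i (Dp (Dq f)) z" "pd i (Dq (Dy f)) z = pd i (Dy (Dq f)) z" "pd i (Dp (Dy f)) z = pd i (Dy (Dp f)) z"
  using pd_commute[OF U assms(2,1)] pd_commute2[OF U assms(2,1)] by blast+

text \<open>The definition of \<open>K_fun\<close> solved for \<open>D (Dq F)\<close>. From this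
  rule and \<open>D_K\<close> the commutators produce the total derivatives of the further jets of
  \<open>F\<close> and \<open>K\<close> that occur, and the structure equations can be compared as
  polynomials in the remaining symbols.\<close>

lemma D_Fq: "z \<in> U \<Longrightarrow> D (Dq F) z = 6 * K z + 2/3 * (Dq F z)^2 + 3 * Dp F z"
  by (simp add: K_fun_def)

lemma D_K: "z \<in> U \<Longrightarrow> D K z = W z + 2/3 * Dq F z * K z - Dy F z"
  by (simp add: W_fun_def)

lemma pd_D_Fq: "z \<in> U \<Longrightarrow> pd i (D (Dq F)) z = 6 * pd i K z + 4/3 * Dq F z * pd i (Dq F) z + 3 * pd i (Dp F) z"
  by (subst pd_cong[OF U _ D_Fq]) (simp_all add: pdU smU algebra_simps add_divide_distrib diff_divide_distrib)

lemma pd_D_K: "z \<in> U \<Longrightarrow> pd i (D K) z = pd i W z + 2/3 * pd i (Dq F) z * K z + 2/3 * Dq F z * pd i K z - pd i (Dy F) z"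
  by (subst pd_cong[OF U _ D_K]) (simp_all add: pdU smU algebra_simps add_divide_distrib diff_divide_distrib)

lemma D_Fqq: "z \<in> U \<Longrightarrow> D (Dq (Dq F)) z = 6 * Dq K z + 1/3 * Dq F z * Dq (Dq F) z + 2 * Dp (Dq F) z"
  by (simp add: D_commute smU pd_D_Fq pd_swap algebra_simps)

lemma D_Fqy: "z \<in> U \<Longrightarrow> D (Dy (Dq F)) z = 6 * Dy K z + 4/3 * Dq F z * Dy (Dq F) z + 3 * Dy (Dp F) z - Dy F z * Dq (Dq F) z"
  by (simp add: D_commute smU pd_D_Fq pd_swap algebra_simps)

lemma pd_D_Fqq: "z \<in> U \<Longrightarrow> pd i (D (Dq (Dq F))) z = 6 * pd i (Dq K) z + 1/3 * pd i (Dq F) z * Dq (Dq F) z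
    + 1/3 * Dq F z * pd i (Dq (Dq F)) z + 2 * pd i (Dp (Dq F)) z"
  by (subst pd_cong[OF U _ D_Fqq]) (simp_all add: pdU smU algebra_simps add_divide_distrib diff_divide_distrib)

lemma D_Fqqq: "z \<in> U \<Longrightarrow> D (Dq (Dq (Dq F))) z = 6 * Dq (Dq K) z + 1/3 * (Dq (Dq F) z)^2
    - 2/3 * Dq F z * Dq (Dq (Dq F)) z + Dp (Dq (Dq F)) z"
  by (simp add: D_commute smU pd_D_Fqq pd_swap algebra_simps power2_eq_square)

lemma D_Fqqy: "z \<in> U \<Longrightarrow> D (Dy (Dq (Dq F))) z = 6 * Dy (Dq K) z + 1/3 * Dy (Dq F) z * Dq (Dq F) z
    + 1/3 * Dq F z * Dy (Dq (Dq F)) z + 2 * Dy (Dp (Dq F)) z - Dy F z * Dq (Dq (Dq F)) z"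
  by (simp add: D_commute smU pd_D_Fqq pd_swap algebra_simps power2_eq_square)

lemma D_Kq: "z \<in> U \<Longrightarrow> D (Dq K) z = Dq W z + 2/3 * Dq (Dq F) z * K z - 1/3 * Dq F z * Dq K z - Dy (Dq F) z - Dp K z"
  by (simp add: D_commute smU pd_D_K pd_swap algebra_simps)

lemma D_Kp: "z \<in> U \<Longrightarrow> D (Dp K) z = Dp W z + 2/3 * Dp (Dq F) z * K z + 2/3 * Dq F z * Dp K z - Dy (Dp F) z - Dy K z - Dp F z * Dq K z"
  by (simp add: D_commute smU pd_D_K pd_swap algebra_simps)

lemma pd_D_Kq: "z \<in> U \<Longrightarrow> pd i (D (Dq K)) z = pd i (Dq W) z + 2/3 * pd i (Dq (Dq F)) z * K z + 2/3 * Dq (Dq F) z * pd i K z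
    - 1/3 * pd i (Dq F) z * Dq K z - 1/3 * Dq F z * pd i (Dq K) z - pd i (Dy (Dq F)) z - pd i (Dp K) z"
  by (subst pd_cong[OF U _ D_Kq]) (simp_all add: pdU smU algebra_simps add_divide_distrib diff_divide_distrib)

lemma D_Kqq: "z \<in> U \<Longrightarrow> D (Dq (Dq K)) z = Dq (Dq W) z + 2/3 * Dq (Dq (Dq F)) z * K z + 1/3 * Dq (Dq F) z * Dq K z
    - 4/3 * Dq F z * Dq (Dq K) z - Dy (Dq (Dq F)) z - 2 * Dp (Dq K) z"
  by (simp add: D_commute smU pd_D_Kq pd_swap algebra_simps)

lemma D_Kpq: "z \<in> U \<Longrightarrow> D (Dp (Dq K)) z = Dp (Dq W) z + 2/3 * Dp (Dq (Dq F)) z * K z + 2/3 * Dq (Dq F) z * Dp K z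
    - 1/3 * Dp (Dq F) z * Dq K z - 1/3 * Dq F z * Dp (Dq K) z - Dy (Dp (Dq F)) z - Dp (Dp K) z - Dy (Dq K) z - Dp F z * Dq (Dq K) z"
  by (simp add: D_commute smU pd_D_Kq pd_swap algebra_simps)

lemma L_eq: "L z = 1/3 * Dq (Dq F) z * K z - 1/3 * Dq F z * Dq K z - Dp K z - 1/3 * Dy (Dq F) z"
  by (simp add: L_fun_def)

lemma pd_L: "z \<in> U \<Longrightarrow> pd i L z = 1/3 * pd i (Dq (Dq F)) z * K z + 1/3 * Dq (Dq F) z * pd i K z
    - 1/3 * pd i (Dq F) z * Dq K z - 1/3 * Dq F z * pd i (Dq K) z - pd i (Dp K) z - 1/3 * pd i (Dy (Dq F)) z"
  unfolding L_fun_def[abs_def] by (simp add: pdU smU algebra_simps add_divide_distrib diff_divide_distrib)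

lemma Lq_eq: "z \<in> U \<Longrightarrow> Dq L z = 1/3 * Dq (Dq (Dq F)) z * K z - 1/3 * Dq F z * Dq (Dq K) z - Dp (Dq K) z - 1/3 * Dy (Dq (Dq F)) z"
  by (simp add: pd_L smU pd_swap)

lemma D_L: "z \<in> U \<Longrightarrow> D L z = 1/3 * D (Dq (Dq F)) z * K z + 1/3 * Dq (Dq F) z * D K z
    - 1/3 * D (Dq F) z * Dq K z - 1/3 * Dq F z * D (Dq K) z - D (Dp K) z - 1/3 * D (Dy (Dq F)) z"
  unfolding L_fun_def[abs_def] by (simp add: D_rules smU algebra_simps add_divide_distrib diff_divide_distrib)

lemma D_Lq: "z \<in> U \<Longrightarrow> D (Dq L) z = 1/3 * D (Dq (Dq (Dq F))) z * K z + 1/3 * Dq (Dq (Dq F)) z * D K z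
    - 1/3 * D (Dq F) z * Dq (Dq K) z - 1/3 * Dq F z * D (Dq (Dq K)) z - D (Dp (Dq K)) z - 1/3 * D (Dy (Dq (Dq F))) z"
  by (subst D_cong[OF _ Lq_eq]) (simp_all add: D_rules smU algebra_simps add_divide_distrib diff_divide_distrib)

lemma pd_Lq: "z \<in> U \<Longrightarrow> pd i (Dq L) z = 1/3 * pd i (Dq (Dq (Dq F))) z * K z + 1/3 * Dq (Dq (Dq F)) z * pd i K z
    - 1/3 * pd i (Dq F) z * Dq (Dq K) z - 1/3 * Dq F z * pd i (Dq (Dq K)) z - pd i (Dp (Dq K)) z - 1/3 * pd i (Dy (Dq (Dq F))) z"
  by (subst pd_cong[OF U _ Lq_eq]) (simp_all add: pdU smU algebra_simps add_divide_distrib diff_divide_distrib)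

lemma M_eq: "M z = 2 * Dq (Dq K) z * K z - 2 * Dy (Dq K) z + 1/3 * Dq (Dq F) z * L z - 2/3 * Dq F z * Dq L z - 2 * Dp L z"
  by (simp add: M_fun_def)

lemmas jet_D = D_Fq D_K D_Fqq D_Fqy D_Fqqq D_Fqqy D_Kq D_Kp D_Kqq D_Kpq D_L D_Lq

section \<open>Curvature of \<open>omega_c\<close> on the dual frame\<close>

lemma smooth_om_nth: "smooth_on U (\<lambda>z. om F z v $ i)"
  by (intro smooth_on_vec_nth smooth_on_om_vec U F)

lemma fd_om:
  assumes z: "z \<in> U"
  shows "frechet_derivative (\<lambda>z. om F z u $ 1) (at z) v = - v$3 * u$1"
    "frechet_derivative (\<lambda>z. om F z u $ 2) (at z) v = - v$4 * u$1"
    "frechet_derivative (\<lambda>z. om F z u $ 3) (at z) v = - frechet_derivative F (at z) v * u$1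
       - 1/3 * (frechet_derivative (Dq F) (at z) v * om2 z u - Dq F z * v$4 * u$1)
       + frechet_derivative K (at z) v * om1 z u - K z * v$3 * u$1"
    "frechet_derivative (\<lambda>z. om F z u $ 4) (at z) v = 0"
proof -
  note l = pd_linear[OF smooth_om_nth z] pd_linear[OF F z] pd_linear[OF smU(2)[OF F] z] pd_linear[OF smU(4) z]
  show "frechet_derivative (\<lambda>z. om F z u $ 1) (at z) v = - v$3 * u$1"
    "frechet_derivative (\<lambda>z. om F z u $ 2) (at z) v = - v$4 * u$1"
    "frechet_derivative (\<lambda>z. om F z u $ 3) (at z) v = - frechet_derivative F (at z) v * u$1
       - 1/3 * (frechet_derivative (Dq F) (at z) v * om2 z u - Dq F z * v$4 * u$1)
       + frechet_derivative K (at z) v * om1 z u - K z * v$3 * u$1"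
    "frechet_derivative (\<lambda>z. om F z u $ 4) (at z) v = 0"
    unfolding l unfolding om_def vector_4 om1_def om2_def om3_def om4_def
    using z by (simp_all add: sum_4 pdU smU field_simps)
qed

text \<open>The frame vectors enter through their values at \<open>z\<close> and are not
  differentiated; duality with \<open>om\<close> reduces each sum of derivatives of coefficients to
  a single term.\<close>

lemma extd_sum:
  assumes c: "\<And>i. smooth_on U (c i)" and z: "z \<in> U"
  shows "extd (\<lambda>z v. \<Sum>i\<in>UNIV. c i z * om F z v $ i) z (frame F z a) (frame F z b) =
    frechet_derivative (c b) (at z) (frame F z a) - frechet_derivative (c a) (at z) (frame F z b)
      + (\<Sum>i\<in>UNIV. c i z * extd (\<lambda>z v. om F z v $ i) z (frame F z a) (frame F z b))"
proof -
  have d: "frechet_derivative (\<lambda>z. \<Sum>i\<in>UNIV. c i z * om F z u $ i) (at z) v =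
     (\<Sum>i\<in>UNIV. c i z * frechet_derivative (\<lambda>z. om F z u $ i) (at z) v + frechet_derivative (c i) (at z) v * om F z u $ i)" for u v
    by (intro fun_cong[OF frechet_derivative_eqI, where x = v] has_derivative_sum has_derivative_mult
        smooth_on_has_derivative[OF _ z] c smooth_om_nth)
  show ?thesis
    unfolding extd_def d om_frame
    by (simp add: sum.distrib right_diff_distrib sum_subtractf axis_def if_distrib[of "\<lambda>x. _ * x"] sum.delta' cong: if_cong)
qed

private abbreviation "fd a f z \<equiv> frechet_derivative f (at z) (frame F z a)"
private abbreviation "dth z a b i \<equiv> extd (\<lambda>z v. om F z v $ i) z (frame F z a) (frame F z b)"
private abbreviation "dOm z a b j \<equiv> extd (\<lambda>z v. Om0 F z v $ j) z (frame F z a) (frame F z b)"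

lemma dth_simps:
  assumes "z \<in> U"
  shows "dth z a b 1 = - frame F z a $ 3 * frame F z b $ 1 + frame F z b $ 3 * frame F z a $ 1"
    "dth z a b 2 = - frame F z a $ 4 * frame F z b $ 1 + frame F z b $ 4 * frame F z a $ 1"
    "dth z a b 3 = - fd a F z * frame F z b $ 1 + fd b F z * frame F z a $ 1
       - 1/3 * (fd a (Dq F) z * axis b 1 $ 2 - fd b (Dq F) z * axis a 1 $ 2 - Dq F z * frame F z a $ 4 * frame F z b $ 1
         + Dq F z * frame F z b $ 4 * frame F z a $ 1)
       + fd a K z * axis b 1 $ 1 - fd b K z * axis a 1 $ 1 - K z * frame F z a $ 3 * frame F z b $ 1
       + K z * frame F z b $ 3 * frame F z a $ 1"
    "dth z a b 4 = 0"
proof -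
  have "om1 z (frame F z a) = axis a 1 $ 1" "om2 z (frame F z a) = axis a 1 $ 2" for a
    using om_frame[of F z a] by (simp_all add: om_def vec_eq_iff forall_4)
  then show "dth z a b 1 = - frame F z a $ 3 * frame F z b $ 1 + frame F z b $ 3 * frame F z a $ 1"
    "dth z a b 2 = - frame F z a $ 4 * frame F z b $ 1 + frame F z b $ 4 * frame F z a $ 1"
    "dth z a b 3 = - fd a F z * frame F z b $ 1 + fd b F z * frame F z a $ 1
       - 1/3 * (fd a (Dq F) z * axis b 1 $ 2 - fd b (Dq F) z * axis a 1 $ 2 - Dq F z * frame F z a $ 4 * frame F z b $ 1
         + Dq F z * frame F z b $ 4 * frame F z a $ 1)
       + fd a K z * axis b 1 $ 1 - fd b K z * axis a 1 $ 1 - K z * frame F z a $ 3 * frame F z b $ 1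
       + K z * frame F z b $ 3 * frame F z a $ 1"
    "dth z a b 4 = 0"
    unfolding extd_def fd_om[OF assms] by (simp_all add: field_simps)
qed

lemma dOm_eq:
  assumes "z \<in> U"
  shows "dOm z a b j = fd a (\<lambda>z. oc F z $ j $ b) z - fd b (\<lambda>z. oc F z $ j $ a) z
     + (oc F z $ j $ 1 * dth z a b 1 + oc F z $ j $ 2 * dth z a b 2 + oc F z $ j $ 3 * dth z a b 3)"
  unfolding Om0_eq_oc using extd_sum[of "\<lambda>i z. oc F z $ j $ i", OF smooth_oc assms, of a b] dth_simps(4)[OF assms, of a b] by (simp add: sum_4)

text \<open>Reduces every entry of the curvature to exterior derivatives of ten scalar forms and one
  bracket of coefficient matrices.\<close>

lemma curvature_frame:
  assumes z: "z \<in> U"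
  shows "curvature (omega_c F) z (frame F z a) (frame F z b) =
    sp4_matrix (\<chi> i. dth z a b i, \<chi> j. dOm z a b j)
    + lie_br (sp4_matrix (axis a 1, \<chi> j. oc F z $ j $ a)) (sp4_matrix (axis b 1, \<chi> j. oc F z $ j $ b))"
proof -
  have L: "bounded_linear sp4_matrix" using linear_sp4_matrix linear_conv_bounded_linear by blast
  have d: "frechet_derivative (\<lambda>z. omega_c F z u) (at z) v =
    sp4_matrix (\<chi> i. frechet_derivative (\<lambda>z. om F z u $ i) (at z) v, \<chi> j. frechet_derivative (\<lambda>z. Om0 F z u $ j) (at z) v)" for u v
  proof -
    have o: "(\<lambda>z. om F z u) differentiable (at z)" "(\<lambda>z. Om0 F z u) differentiable (at z)"
      using smooth_on_differentiable[OF _ z] smooth_on_om_vec[OF U F] smooth_on_Om0[OF U F] by blast+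
    have "frechet_derivative (\<lambda>z. omega_c F z u) (at z) = (\<lambda>v. sp4_matrix (frechet_derivative (\<lambda>z. om F z u) (at z) v,
        frechet_derivative (\<lambda>z. Om0 F z u) (at z) v))"
      unfolding omega_c_eq using o
      by (intro frechet_derivative_eqI bounded_linear.has_derivative[OF L] has_derivative_Pair)
        (simp_all add: frechet_derivative_works)
    moreover have "frechet_derivative (\<lambda>z. om F z u) (at z) v = (\<chi> i. frechet_derivative (\<lambda>z. om F z u $ i) (at z) v)"
      by (simp add: vec_eq_iff frechet_derivative_bounded_linear[OF bounded_linear_vec_nth o(1)])
    moreover have "frechet_derivative (\<lambda>z. Om0 F z u) (at z) v = (\<chi> i. frechet_derivative (\<lambda>z. Om0 F z u $ i) (at z) v)"
      by (simp add: vec_eq_iff frechet_derivative_bounded_linear[OF bounded_linear_vec_nth o(2)])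
    ultimately show ?thesis by simp
  qed
  have e: "extd (omega_c F) z v v' = sp4_matrix (\<chi> i. extd (\<lambda>z v. om F z v $ i) z v v', \<chi> j. extd (\<lambda>z v. Om0 F z v $ j) z v v')" for v v'
    unfolding extd_def d by (simp add: mat4_simps field_simps)
  have o: "omega_c F z (frame F z a) = sp4_matrix (axis a 1, \<chi> j. oc F z $ j $ a)" for a
  proof -
    have "Om0 F z (frame F z a) = (\<chi> j. oc F z $ j $ a)" by (simp add: vec_eq_iff Om0_frame)
    then show ?thesis by (simp add: omega_c_eq om_frame)
  qed
  show ?thesis unfolding curvature_eq e o ..
qed

private abbreviation "C z a b \<equiv> curvature (omega_c F) z (frame F z a) (frame F z b)"

lemma frame_nth:
  "frame F z 1 $ 1 = 0" "frame F z 1 $ 2 = 1" "frame F z 1 $ 3 = 0" "frame F z 1 $ 4 = - K z"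
  "frame F z 2 $ 1 = 0" "frame F z 2 $ 2 = 0" "frame F z 2 $ 3 = 1" "frame F z 2 $ 4 = 1/3 * Dq F z"
  "frame F z 3 $ 1 = 0" "frame F z 3 $ 2 = 0" "frame F z 3 $ 3 = 0" "frame F z 3 $ 4 = 1"
  "frame F z 4 $ 1 = 1" "frame F z 4 $ 2 = z $ 3" "frame F z 4 $ 3 = z $ 4" "frame F z 4 $ 4 = F z"
  by (simp_all add: frame_def)

lemmas curv_simps = lie_br_def matrix_matrix_mult_def sum_4 dOm_eq dth_simps axis_def
  frame_derivative smooth_oc smU frame_nth oc_def pdU D_rules jet_D pd_L pd_Lq pd_swap L_eq M_eq

text \<open>Ten entries determine an \<open>sp4\<close> matrix, so together these say
  \<open>C z 2 4 = 0\<close>. After elimination of total derivatives each is an identity between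
  partial derivatives.\<close>

lemma curvature_24:
  assumes "z \<in> U"
  shows "C z 2 4 $ 1 $ 1 = 0" "C z 2 4 $ 2 $ 1 = 0" "C z 2 4 $ 3 $ 1 = 0" "C z 2 4 $ 4 $ 1 = 0"
    "C z 2 4 $ 1 $ 2 = 0" "C z 2 4 $ 2 $ 2 = 0" "C z 2 4 $ 3 $ 2 = 0"
    "C z 2 4 $ 1 $ 3 = 0" "C z 2 4 $ 2 $ 3 = 0" "C z 2 4 $ 1 $ 4 = 0"
  unfolding curvature_frame[OF assms] using assms
  by (simp add: curv_simps, (simp add: field_simps power2_eq_square)?)+

lemma curvature_34:
  assumes "z \<in> U"
  shows "C z 3 4 $ 1 $ 1 = 0" "C z 3 4 $ 2 $ 1 = 0" "C z 3 4 $ 3 $ 1 = 0" "C z 3 4 $ 4 $ 1 = 0"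
    "C z 3 4 $ 1 $ 2 = 0" "C z 3 4 $ 2 $ 2 = 0" "C z 3 4 $ 3 $ 2 = 0"
    "C z 3 4 $ 1 $ 3 = 0" "C z 3 4 $ 2 $ 3 = 0" "C z 3 4 $ 1 $ 4 = 0"
  unfolding curvature_frame[OF assms] using assms
  by (simp add: curv_simps, (simp add: field_simps power2_eq_square)?)+

text \<open>For this pair only the first two columns are constrained, as the first and third
  conditions of \<open>normal_curvature\<close> ask.\<close>

lemma curvature_13:
  assumes "z \<in> U"
  shows "C z 1 3 $ 1 $ 1 = 0" "C z 1 3 $ 2 $ 1 = 0" "C z 1 3 $ 3 $ 1 = 0" "C z 1 3 $ 4 $ 1 = 0"
    "C z 1 3 $ 1 $ 2 = 0" "C z 1 3 $ 2 $ 2 = 0" "C z 1 3 $ 3 $ 2 = 0"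
  unfolding curvature_frame[OF assms] using assms
  by (simp add: curv_simps, (simp add: field_simps power2_eq_square)?)+

lemma curvature_23:
  assumes "z \<in> U"
  shows "C z 2 3 $ 1 $ 1 = 0" "C z 2 3 $ 2 $ 1 = 0" "C z 2 3 $ 3 $ 1 = 0" "C z 2 3 $ 4 $ 1 = 0"
    "C z 2 3 $ 1 $ 2 = 0" "C z 2 3 $ 2 $ 2 = 0" "C z 2 3 $ 3 $ 2 = 0"
  unfolding curvature_frame[OF assms] using assms
  by (simp add: curv_simps, (simp add: field_simps power2_eq_square)?)+

lemma curvature_12:
  assumes "z \<in> U"
  shows "C z 1 2 $ 1 $ 1 = 0" "C z 1 2 $ 2 $ 1 = 0" "C z 1 2 $ 3 $ 1 = 0" "C z 1 2 $ 4 $ 1 = 0"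
  unfolding curvature_frame[OF assms] using assms
  by (simp add: curv_simps, (simp add: field_simps power2_eq_square)?)+

lemma curvature_14:
  assumes "z \<in> U"
  shows "C z 1 4 $ 1 $ 1 = 0" "C z 1 4 $ 2 $ 1 = 0" "C z 1 4 $ 3 $ 1 = 0" "C z 1 4 $ 4 $ 1 = 0"
  unfolding curvature_frame[OF assms] using assms
  by (simp add: curv_simps, (simp add: field_simps power2_eq_square)?)+

text \<open>The condition that couples two pairs of frame vectors instead of annihilating an entry.
  The fourth row follows from the vanishing first columns and the \<open>sp4\<close>
  relations.\<close>

lemma curvature_12_14:
  assumes "z \<in> U"
  shows "C z 1 2 $ 1 $ 2 = C z 1 4 $ 1 $ 3" "C z 1 2 $ 2 $ 2 = C z 1 4 $ 2 $ 3" "C z 1 2 $ 3 $ 2 = C z 1 4 $ 3 $ 3"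
  unfolding curvature_frame[OF assms] using assms
  by (simp add: curv_simps, (simp add: field_simps power2_eq_square)?)+

end

lemma omega_c_entries:
  "omega_c F z v $ 4 $ 1 = 2 * om F z v $ 1" "omega_c F z v $ 3 $ 1 = om F z v $ 2"
  "omega_c F z v $ 3 $ 2 = om F z v $ 3" "omega_c F z v $ 2 $ 1 = om F z v $ 4"
  by (simp_all add: omega_c_eq)

lemma bilinear_frame_expand:
  assumes "\<And>v. linear (\<kappa> v)" "\<And>v'. linear (\<lambda>v. \<kappa> v v')"
  shows "\<kappa> v v' = (\<Sum>a\<in>UNIV. \<Sum>b\<in>UNIV. (om F z v $ a * om F z v' $ b) *\<^sub>R \<kappa> (frame F z a) (frame F z b))"
proof -
  have "\<kappa> v v' = \<kappa> (\<Sum>a\<in>UNIV. om F z v $ a *\<^sub>R frame F z a) (\<Sum>b\<in>UNIV. om F z v' $ b *\<^sub>R frame F z b)"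
    using frame_expand[of v F z] frame_expand[of v' F z] by simp
  also have "\<dots> = (\<Sum>a\<in>UNIV. om F z v $ a *\<^sub>R \<kappa> (frame F z a) (\<Sum>b\<in>UNIV. om F z v' $ b *\<^sub>R frame F z b))"
    by (simp only: linear_sum[OF assms(2)] linear_cmul[OF assms(2)])
  also have "\<dots> = (\<Sum>a\<in>UNIV. om F z v $ a *\<^sub>R (\<Sum>b\<in>UNIV. om F z v' $ b *\<^sub>R \<kappa> (frame F z a) (frame F z b)))"
    by (simp only: linear_sum[OF assms(1)] linear_cmul[OF assms(1)])
  finally show ?thesis by (simp add: scaleR_sum_right)
qed

text \<open>The entries computed on the frame extend to arbitrary arguments by bilinearity and
  antisymmetry, and the \<open>sp4\<close> relations supply the entries not computed.\<close>

lemma normal_curvature_omega_c: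
  assumes U: "open U" and F: "smooth_on U F" and z: "z \<in> U"
  shows "normal_curvature (omega_c F z) (curvature (omega_c F) z)"
proof -
  define k where "k a b = curvature (omega_c F) z (frame F z a) (frame F z b)" for a b
  note sf = smooth_form_omega_c[OF U F]
  have ex: "curvature (omega_c F) z v v' = (\<Sum>a\<in>UNIV. \<Sum>b\<in>UNIV. (om F z v $ a * om F z v' $ b) *\<^sub>R k a b)" for v v'
    unfolding k_def by (rule bilinear_frame_expand[OF curvature_linear[OF sf U z]])
  have anti: "k a b = - k b a" for a b unfolding k_def by (rule curvature_antisym)
  have diag: "k a a = 0" for a using anti[of a a] by (simp add: vec_eq_iff)
  have sp: "k a b \<in> sp4" for a b unfolding k_def by (rule curvature_sp4[OF sf U z omega_c_sp4])
  note c = curvature_24[OF U F z, folded k_def] curvature_34[OF U F z, folded k_def]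
    curvature_13[OF U F z, folded k_def] curvature_23[OF U F z, folded k_def] curvature_12[OF U F z, folded k_def]
    curvature_14[OF U F z, folded k_def] curvature_12_14[OF U F z, folded k_def]
  have z24: "k 2 4 = 0" "k 3 4 = 0"
    using sp[of 2 4] sp[of 3 4] unfolding sp4_iff_entries by (simp_all add: vec_eq_iff forall_4 c)
  note kk = diag z24 anti[of 4 2] anti[of 4 3] anti[of 2 1] anti[of 3 1] anti[of 4 1] anti[of 3 2]
  have "\<forall>i. k 1 2 $ i $ 1 = 0 \<and> k 1 3 $ i $ 1 = 0 \<and> k 1 4 $ i $ 1 = 0 \<and> k 2 3 $ i $ 1 = 0"
    unfolding forall_4 by (simp add: c)
  then have k1: "k 1 2 $ i $ 1 = 0" "k 1 3 $ i $ 1 = 0" "k 1 4 $ i $ 1 = 0" "k 2 3 $ i $ 1 = 0" for i by auto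
  have "k 1 3 $ 4 $ 2 = 0" "k 2 3 $ 4 $ 2 = 0" "k 1 2 $ 4 $ 2 = k 1 4 $ 4 $ 3"
    using sp[of 1 3] sp[of 2 3] sp[of 1 2] sp[of 1 4] unfolding sp4_iff_entries by (simp_all add: c)
  then have "\<forall>i. k 1 3 $ i $ 2 = 0 \<and> k 2 3 $ i $ 2 = 0 \<and> k 1 2 $ i $ 2 = k 1 4 $ i $ 3"
    unfolding forall_4 by (simp add: c)
  then have k2: "k 1 3 $ i $ 2 = 0" "k 2 3 $ i $ 2 = 0" "k 1 2 $ i $ 2 = k 1 4 $ i $ 3" for i by auto
  show ?thesis
    unfolding normal_curvature_def omega_c_entries
  proof (intro conjI allI impI)
    show "curvature (omega_c F) z v v' $ i $ 1 = 0" for v v' i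
      unfolding ex by (simp add: sum_4 kk k1)
    show "curvature (omega_c F) z v v' = 0"
      if "2 * om F z v $ 1 = 0" "om F z v $ 2 = 0" "om F z v $ 3 = 0" "2 * om F z v' $ 1 = 0" for v v'
      unfolding ex using that by (simp add: sum_4 kk)
    show "curvature (omega_c F) z v v' $ i $ 2 = 0"
      if "2 * om F z v $ 1 = 0" "om F z v $ 2 = 0" "om F z v $ 4 = 0" for v v' i
      unfolding ex using that by (simp add: sum_4 kk k2)
    show "om F z v4 $ 4 * curvature (omega_c F) z v v2 $ i $ 2 =
        om F z v2 $ 2 * curvature (omega_c F) z v v4 $ i $ 3 + om F z v2 $ 4 * curvature (omega_c F) z v v4 $ i $ 2"
      if "2 * om F z v2 $ 1 = 0" "2 * om F z v4 $ 1 = 0" "om F z v4 $ 2 = 0" "om F z v4 $ 3 = 0" for v v2 v4 i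
      unfolding ex using that by (simp add: sum_4 kk k2 algebra_simps)
  qed
qed

lemma tanaka_normal_omega_hat:
  assumes U: "open U" "smooth_on U F"
  shows "tanaka_normal (Pc U) (omega_hat F)"
proof (rule tanaka_normalI[OF smooth_form_omega_hat[OF U] open_Pc[OF U(1)] omega_hat_sp4 omega_hat_bij[OF U]])
  fix w assume w: "w \<in> Pc U"
  then have z: "fst w \<in> U" and u: "snd w \<in> H6_dom" by (auto simp: Pc_def)
  have "normal_curvature (\<lambda>v. sp_inv (hat_g w) ** omega_c F (fst w) (fst v) ** hat_g w + mc_form (snd w) (snd v))
      (\<lambda>v v'. sp_inv (hat_g w) ** curvature (omega_c F) (fst w) (fst v) (fst v') ** hat_g w)"
    by (rule normal_curvature_gauge[OF hat_g_H6[OF w] omega_c_sp4 mc_form_nonneg[OF u]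
        normal_curvature_compose[OF normal_curvature_omega_c[OF U z]]])
  moreover have "omega_hat F w = (\<lambda>v. sp_inv (hat_g w) ** omega_c F (fst w) (fst v) ** hat_g w + mc_form (snd w) (snd v))"
    by (simp only: fun_eq_iff omega_hat_eq[OF w]) (simp add: hat_gi_def hat_g_def)
  moreover have "curvature (omega_hat F) w = (\<lambda>v v'. sp_inv (hat_g w) ** curvature (omega_c F) (fst w) (fst v) (fst v') ** hat_g w)"
    by (simp only: fun_eq_iff curvature_omega_hat[OF U w]) (simp add: hat_gi_def hat_g_def)
  ultimately show "normal_curvature (omega_hat F w) (curvature (omega_hat F) w)" by simp
qed

section \<open>Uniqueness of the normal connection\<close>

lemma lie_br_coords:
  "fst (sp4_coords (lie_br (sp4_matrix p) (sp4_matrix q))) $ 1 =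
     fst p$1 * snd q$1 - fst q$1 * snd p$1 + fst p$2 * fst q$4 - fst q$2 * fst p$4"
  "fst (sp4_coords (lie_br (sp4_matrix p) (sp4_matrix q))) $ 2 =
     fst p$1 * snd q$2 - fst q$1 * snd p$2 + fst p$2 * snd q$3 - fst q$2 * snd p$3 + fst p$3 * fst q$4 - fst q$3 * fst p$4"
  "fst (sp4_coords (lie_br (sp4_matrix p) (sp4_matrix q))) $ 3 =
     fst p$2 * snd q$2 - fst q$2 * snd p$2 - fst p$3 * snd q$1 + fst q$3 * snd p$1 + 2 * (fst p$3 * snd q$3 - fst q$3 * snd p$3)"
  "fst (sp4_coords (lie_br (sp4_matrix p) (sp4_matrix q))) $ 4 =
     fst p$1 * snd q$4 - fst q$1 * snd p$4 + fst p$2 * snd q$5 - fst q$2 * snd p$5 + fst p$4 * snd q$1 - fst q$4 * snd p$1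
       - fst p$4 * snd q$3 + fst q$4 * snd p$3"
  "snd (sp4_coords (lie_br (sp4_matrix p) (sp4_matrix q))) $ 1 =
     fst p$1 * snd q$6 - fst q$1 * snd p$6 + fst p$2 * snd q$4 - fst q$2 * snd p$4 - fst p$4 * snd q$2 + fst q$4 * snd p$2"
  "snd (sp4_coords (lie_br (sp4_matrix p) (sp4_matrix q))) $ 2 =
     1/2 * (fst p$2 * snd q$6 - fst q$2 * snd p$6) + fst p$3 * snd q$4 - fst q$3 * snd p$4 + snd p$1 * snd q$2 - snd q$1 * snd p$2
       + snd p$2 * snd q$3 - snd q$2 * snd p$3"
  "snd (sp4_coords (lie_br (sp4_matrix p) (sp4_matrix q))) $ 3 =
     1/2 * (fst p$1 * snd q$6 - fst q$1 * snd p$6) + fst p$2 * snd q$4 - fst q$2 * snd p$4 + fst p$3 * snd q$5 - fst q$3 * snd p$5"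
  "snd (sp4_coords (lie_br (sp4_matrix p) (sp4_matrix q))) $ 6 =
     snd p$1 * snd q$6 - snd q$1 * snd p$6 + 2 * (snd p$2 * snd q$4 - snd q$2 * snd p$4)"
  by (simp_all add: lie_br_def matrix_matrix_mult_def sum_4 field_simps)

lemma extd_bounded_linear:
  assumes "bounded_linear L" "smooth_form P \<eta>" "z \<in> P"
  shows "extd (\<lambda>z v. L (\<eta> z v)) z v v' = L (extd \<eta> z v v')"
proof -
  have "frechet_derivative (\<lambda>z. L (\<eta> z v)) (at z) u = L (frechet_derivative (\<lambda>z. \<eta> z v) (at z) u)" for v u
    using assms(2,3) smooth_on_differentiable unfolding smooth_form_def
    by (intro frechet_derivative_bounded_linear[OF assms(1)]) blast
  then show ?thesis by (simp add: extd_def linear_diff[OF bounded_linear.linear[OF assms(1)]])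
qed

lemma smooth_on_frame:
  assumes "open U" "smooth_on U F"
  shows "smooth_on U (\<lambda>z. frame F z a)"
proof (intro smooth_on_vec assms(1))
  fix i :: 4
  show "smooth_on U (\<lambda>z. frame F z a $ i)"
    by (rule forall_4'[of _ a]; rule forall_4'[of _ i]; simp only: frame_def vector_4)
      (intro smooth_intros smooth_on_jet assms)+
qed

text \<open>Components that vanish on all of \<open>Z\<close> have vanishing derivatives, so the
  exterior derivative becomes algebraic in the remaining ones. This is why the unknowns in the
  uniqueness proof are annihilated on the whole open set and not at one point.\<close>

lemma extd_frame:
  fixes \<delta> :: "real^4 \<Rightarrow> real^4 \<Rightarrow> real"
  assumes U: "open U" "smooth_on U F" and Z: "open Z" "Z \<subseteq> U" "z \<in> Z" and \<delta>: "smooth_form Z \<delta>"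
    and 0: "\<And>z. z \<in> Z \<Longrightarrow> \<delta> z (frame F z a) = 0" "\<And>z. z \<in> Z \<Longrightarrow> \<delta> z (frame F z b) = 0"
  shows "extd \<delta> z (frame F z a) (frame F z b) =
    (\<Sum>i\<in>UNIV. \<delta> z (frame F z i) * extd (\<lambda>z v. om F z v $ i) z (frame F z a) (frame F z b))"
proof -
  have FZ: "smooth_on Z F" using smooth_on_subset[OF U(2) Z(2)] .
  have lin: "linear (\<delta> z)" if "z \<in> Z" for z using \<delta> that by (simp add: smooth_form_def)
  have ex: "\<delta> z v = (\<Sum>i\<in>UNIV. \<delta> z (frame F z i) * om F z v $ i)" if "z \<in> Z" for z v
    by (subst frame_expand[of v F z]) (simp add: linear_sum[OF lin[OF that]] linear_cmul[OF lin[OF that]] mult.commute)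
  have c: "smooth_on Z (\<lambda>z. \<delta> z (frame F z i))" for i
  proof -
    have "smooth_on Z (\<lambda>z. \<Sum>b\<in>Basis. (frame F z i \<bullet> b) *\<^sub>R \<delta> z b)"
      using \<delta> by (intro smooth_on_sum smooth_on_scaleR Z(1) finite_Basis
          smooth_on_bounded_linear[OF bounded_linear_inner_left] smooth_on_frame FZ) (simp add: smooth_form_def)
    then show ?thesis
    proof (rule iffD1[OF smooth_on_cong[OF Z(1)], rotated])
      fix x assume "x \<in> Z"
      show "(\<Sum>b\<in>Basis. (frame F x i \<bullet> b) *\<^sub>R \<delta> x b) = \<delta> x (frame F x i)"
        by (rule linear_eq_sum_Basis[OF lin[OF \<open>x \<in> Z\<close>], symmetric])
    qed
  qed
  have fd0: "frechet_derivative (\<lambda>z. \<delta> z (frame F z i)) (at z) v = 0" if "\<And>z. z \<in> Z \<Longrightarrow> \<delta> z (frame F z i) = 0" for i v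
    by (rule fun_cong[OF frechet_derivative_eqI[OF has_derivative_transform_within_open[OF has_derivative_const[of 0] Z(1,3)]]])
      (simp add: that)
  have fd: "frechet_derivative (\<lambda>z. \<delta> z v) (at z) = frechet_derivative (\<lambda>z. \<Sum>i\<in>UNIV. \<delta> z (frame F z i) * om F z v $ i) (at z)" for v
    by (rule frechet_derivative_transform_within_open[OF smooth_on_differentiable Z(1,3) ex])
      (use \<delta> Z in \<open>auto simp: smooth_form_def\<close>)
  have "extd \<delta> z (frame F z a) (frame F z b)
      = extd (\<lambda>z v. \<Sum>i\<in>UNIV. \<delta> z (frame F z i) * om F z v $ i) z (frame F z a) (frame F z b)"
    by (simp add: extd_def fd)
  also have "\<dots> = (\<Sum>i\<in>UNIV. \<delta> z (frame F z i) * extd (\<lambda>z v. om F z v $ i) z (frame F z a) (frame F z b))"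
    using extd_sum[where c = "\<lambda>i z. \<delta> z (frame F z i)", OF Z(1) FZ c Z(3), of a b] by (simp add: fd0 0)
  finally show ?thesis .
qed


text \<open>Of the forty components of the difference on the frame, the normalisations remove
  thirteen. The other 27 are forced by curvature entries that vanish, or are coupled, for both
  connections alike.\<close>

lemma normal_connection_unique:
  assumes U: "open U" "smooth_on U F" and Z: "open Z" "Z \<subseteq> U"
    and \<eta>: "smooth_form Z \<eta>" and sp: "\<And>z v. z \<in> Z \<Longrightarrow> \<eta> z v \<in> sp4"
    and N: "\<And>z. z \<in> Z \<Longrightarrow> normal_curvature (\<eta> z) (curvature \<eta> z)"
    and th1: "\<And>z v. z \<in> Z \<Longrightarrow> \<eta> z v $ 4 $ 1 = omega_c F z v $ 4 $ 1"
    and th2: "\<And>z v. z \<in> Z \<Longrightarrow> \<eta> z v $ 3 $ 1 = omega_c F z v $ 3 $ 1"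
    and th3: "\<And>z. z \<in> Z \<Longrightarrow> \<eta> z (frame F z 4) $ 3 $ 2 = 0"
    and th4: "\<And>z. z \<in> Z \<Longrightarrow> \<eta> z (frame F z 1) $ 2 $ 1 = 0" "\<And>z. z \<in> Z \<Longrightarrow> \<eta> z (frame F z 2) $ 2 $ 1 = 0"
      "\<And>z. z \<in> Z \<Longrightarrow> \<eta> z (frame F z 3) $ 2 $ 1 = 0"
    and O1: "\<And>z. z \<in> Z \<Longrightarrow> \<eta> z (frame F z 1) $ 1 $ 1 = omega_c F z (frame F z 1) $ 1 $ 1"
    and z: "z \<in> Z"
  shows "\<eta> z v = omega_c F z v"
proof -
  have FZ: "smooth_on Z F" using smooth_on_subset[OF U(2) Z(2)] .
  define \<delta> where "\<delta> z v = \<eta> z v - omega_c F z v" for z v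
  \<comment> \<open>The components of \<open>\<eta> - omega_c\<close> on the frame.  Comparing the curvatures entry by entry, in increasing degree
    of the grading, kills them one after another.\<close>
  define A where "A j z a = fst (sp4_coords (\<delta> z (frame F z a))) $ j" for j z a
  define B where "B j z a = snd (sp4_coords (\<delta> z (frame F z a))) $ j" for j z a
  have sc: "smooth_form Z (omega_c F)" by (rule smooth_form_omega_c[OF Z(1) FZ])
  have s\<delta>: "smooth_form Z \<delta>"
    using \<eta> sc unfolding smooth_form_def \<delta>_def
    by (auto intro!: smooth_on_diff Z(1) linear_compose_sub)
  define kt where "kt j z a b = fst (sp4_coords (curvature \<eta> z (frame F z a) (frame F z b))) $ j" for j z a b
  define kw where "kw j z a b = snd (sp4_coords (curvature \<eta> z (frame F z a) (frame F z b))) $ j" for j z a b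
  define ct where "ct j z a b = fst (sp4_coords (curvature (omega_c F) z (frame F z a) (frame F z b))) $ j" for j z a b
  define cw where "cw j z a b = snd (sp4_coords (curvature (omega_c F) z (frame F z a) (frame F z b))) $ j" for j z a b
  define dth where "dth z a b i = extd (\<lambda>z v. om F z v $ i) z (frame F z a) (frame F z b)" for z a b i
  define p where "p z a = (axis a 1 :: real^4, (\<chi> j. oc F z $ j $ a))" for z a
  have frO: "sp4_coords (omega_c F z (frame F z a)) = p z a" for z a
    by (simp add: omega_c_eq p_def om_frame prod_eq_iff vec_eq_iff Om0_frame)
  have \<eta>fr: "\<eta> z (frame F z a) = sp4_matrix (p z a + sp4_coords (\<delta> z (frame F z a)))" if "z \<in> Z" for z a
    using sp[OF that, of "frame F z a"]
    by (simp add: \<delta>_def linear_diff[OF linear_sp4_coords] frO sp4_iff_coords)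
  have ofr: "omega_c F z (frame F z a) = sp4_matrix (p z a)" for z a
    using omega_c_sp4 frO by (metis sp4_iff_coords)
  have ext: "extd \<eta> z v v' = extd (omega_c F) z v v' + extd \<delta> z v v'" if "z \<in> Z" for z v v'
  proof -
    have "frechet_derivative (\<lambda>z. \<delta> z v) (at z) u = frechet_derivative (\<lambda>z. \<eta> z v) (at z) u - frechet_derivative (\<lambda>z. omega_c F z v) (at z) u" for v u
      unfolding \<delta>_def using \<eta> sc that
      by (intro fun_cong[OF frechet_derivative_eqI] has_derivative_diff smooth_on_has_derivative[OF _ that])
        (simp_all add: smooth_form_def)
    then show ?thesis by (simp add: extd_def)
  qed
  have curv: "sp4_coords (curvature \<eta> z (frame F z a) (frame F z b)) - sp4_coords (curvature (omega_c F) z (frame F z a) (frame F z b))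
      = sp4_coords (extd \<delta> z (frame F z a) (frame F z b))
        + sp4_coords (lie_br (sp4_matrix (p z a + sp4_coords (\<delta> z (frame F z a)))) (sp4_matrix (p z b + sp4_coords (\<delta> z (frame F z b)))))
        - sp4_coords (lie_br (sp4_matrix (p z a)) (sp4_matrix (p z b)))" if "z \<in> Z" for z a b
    unfolding curvature_eq ext[OF that] \<eta>fr[OF that] ofr
    by (simp add: linear_add[OF linear_sp4_coords])
  have bl: "bounded_linear (\<lambda>X. fst (sp4_coords X) $ j)" "bounded_linear (\<lambda>X. snd (sp4_coords X) $ i)" for j i
    using linear_compose[OF linear_compose[OF linear_sp4_coords linear_fst] bounded_linear.linear[OF bounded_linear_vec_nth]]
      linear_compose[OF linear_compose[OF linear_sp4_coords linear_snd] bounded_linear.linear[OF bounded_linear_vec_nth]]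
    by (simp_all add: o_def linear_conv_bounded_linear)
  have sf: "smooth_form Z (\<lambda>z v. L (\<delta> z v))" if "bounded_linear L" for L :: "real^4^4 \<Rightarrow> real"
    using s\<delta> smooth_on_bounded_linear[OF that Z(1)] linear_compose[OF _ bounded_linear.linear[OF that]]
    unfolding smooth_form_def by (auto simp: o_def)
  have eA: "fst (sp4_coords (extd \<delta> z (frame F z a) (frame F z b))) $ j = (\<Sum>i\<in>UNIV. A j z i * dth z a b i)"
    if "z \<in> Z" "\<And>z. z \<in> Z \<Longrightarrow> A j z a = 0" "\<And>z. z \<in> Z \<Longrightarrow> A j z b = 0" for z a b j
    using extd_frame[OF U Z that(1) sf[OF bl(1)[of j]], of a b] extd_bounded_linear[OF bl(1)[of j] s\<delta> that(1)] that(2,3)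
    unfolding A_def dth_def by simp
  have eB: "snd (sp4_coords (extd \<delta> z (frame F z a) (frame F z b))) $ j = (\<Sum>i\<in>UNIV. B j z i * dth z a b i)"
    if "z \<in> Z" "\<And>z. z \<in> Z \<Longrightarrow> B j z a = 0" "\<And>z. z \<in> Z \<Longrightarrow> B j z b = 0" for z a b j
    using extd_frame[OF U Z that(1) sf[OF bl(2)[of j]], of a b] extd_bounded_linear[OF bl(2)[of j] s\<delta> that(1)] that(2,3)
    unfolding B_def dth_def by simp
  have cA: "kt j z a b - ct j z a b = fst (sp4_coords (extd \<delta> z (frame F z a) (frame F z b))) $ j
        + fst (sp4_coords (lie_br (sp4_matrix (p z a + sp4_coords (\<delta> z (frame F z a)))) (sp4_matrix (p z b + sp4_coords (\<delta> z (frame F z b)))))) $ j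
        - fst (sp4_coords (lie_br (sp4_matrix (p z a)) (sp4_matrix (p z b)))) $ j" if "z \<in> Z" for z a b j
    using arg_cong[OF curv[OF that, of a b], of "\<lambda>X. fst X $ j"] unfolding kt_def ct_def by simp
  have cB: "kw j z a b - cw j z a b = snd (sp4_coords (extd \<delta> z (frame F z a) (frame F z b))) $ j
        + snd (sp4_coords (lie_br (sp4_matrix (p z a + sp4_coords (\<delta> z (frame F z a)))) (sp4_matrix (p z b + sp4_coords (\<delta> z (frame F z b)))))) $ j
        - snd (sp4_coords (lie_br (sp4_matrix (p z a)) (sp4_matrix (p z b)))) $ j" if "z \<in> Z" for z a b j
    using arg_cong[OF curv[OF that, of a b], of "\<lambda>X. snd X $ j"] unfolding kw_def cw_def by simp
  have pn: "fst (p z a) $ j = axis a 1 $ j" for z a j by (simp add: p_def)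
  have AB: "fst (sp4_coords (\<delta> z (frame F z a))) $ j = A j z a" "snd (sp4_coords (\<delta> z (frame F z a))) $ i = B i z a" for z a i j
    by (simp_all add: A_def B_def)
  \<comment> \<open>The two values -1 bring \<open>A 3 z 2\<close> into the relation of
    \<open>s5\<close>, and \<open>A 3 z 1\<close> and \<open>B 6 z 1\<close> into those of
    \<open>s6\<close> and \<open>s11\<close>.\<close>
  have dthv: "dth z 3 4 1 = 0" "dth z 3 4 2 = - 1" "dth z 2 4 1 = - 1" "dth z a b 4 = 0" if "z \<in> Z" for z a b
    unfolding dth_def dth_simps[OF Z(1) FZ that] by (simp_all add: frame_nth[OF Z(1) FZ])
  have Nc: "normal_curvature (omega_c F z) (curvature (omega_c F) z)" if "z \<in> Z" for z
    by (rule normal_curvature_omega_c[OF Z(1) FZ that])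
  note rules = lie_br_coords pn AB axis_def
  have col1: "kt 1 z a b = 0" "kt 2 z a b = 0" "kt 4 z a b = 0" "kw 1 z a b = 0"
    "ct 1 z a b = 0" "ct 2 z a b = 0" "ct 4 z a b = 0" "cw 1 z a b = 0" if "z \<in> Z" for z a b
    unfolding kt_def kw_def ct_def cw_def
    by (simp_all add: normal_curvatureD(1)[OF N[OF that]] normal_curvatureD(1)[OF Nc[OF that]])
  have "curvature \<eta> z (frame F z a) (frame F z 4) = 0" "curvature (omega_c F) z (frame F z a) (frame F z 4) = 0"
    if "z \<in> Z" "a \<noteq> 1" for z a
  proof -
    have e: "omega_c F z (frame F z 4) $ 4 $ 1 = 0" "omega_c F z (frame F z 4) $ 3 $ 1 = 0" "omega_c F z (frame F z 4) $ 3 $ 2 = 0"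
      "omega_c F z (frame F z a) $ 4 $ 1 = 0" using that(2)
      by (simp_all add: omega_c_entries om_frame axis_def)
    have "curvature \<eta> z (frame F z 4) (frame F z a) = 0"
      by (rule normal_curvatureD(2)[OF N[OF that(1)]]) (simp_all add: th1 th2 th3 that(1) e)
    then show "curvature \<eta> z (frame F z a) (frame F z 4) = 0" by (subst curvature_antisym) simp
    have "curvature (omega_c F) z (frame F z 4) (frame F z a) = 0"
      by (rule normal_curvatureD(2)[OF Nc[OF that(1)]]) (simp_all add: e)
    then show "curvature (omega_c F) z (frame F z a) (frame F z 4) = 0" by (subst curvature_antisym) simp
  qed
  then have n2: "kt j z a 4 = 0" "kw i z a 4 = 0" "ct j z a 4 = 0" "cw i z a 4 = 0" if "z \<in> Z" "a \<noteq> 1" for z a i j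
    using that unfolding kt_def kw_def ct_def cw_def by (simp_all add: linear_0[OF linear_sp4_coords])
  have k3: "curvature \<eta> z (frame F z a) (frame F z 3) $ i $ 2 = 0" "curvature (omega_c F) z (frame F z a) (frame F z 3) $ i $ 2 = 0"
    if "z \<in> Z" for z a i
  proof -
    have e: "omega_c F z (frame F z 3) $ 4 $ 1 = 0" "omega_c F z (frame F z 3) $ 3 $ 1 = 0" "omega_c F z (frame F z 3) $ 2 $ 1 = 0"
      by (simp_all add: omega_c_entries om_frame axis_def)
    have "curvature \<eta> z (frame F z 3) (frame F z a) $ i $ 2 = 0"
      by (rule normal_curvatureD(3)[OF N[OF that(1)]]) (simp_all add: th1 th2 th4 that(1) e)
    then show "curvature \<eta> z (frame F z a) (frame F z 3) $ i $ 2 = 0" by (subst curvature_antisym) simp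
    have "curvature (omega_c F) z (frame F z 3) (frame F z a) $ i $ 2 = 0"
      by (rule normal_curvatureD(3)[OF Nc[OF that(1)]]) (simp_all add: e)
    then show "curvature (omega_c F) z (frame F z a) (frame F z 3) $ i $ 2 = 0" by (subst curvature_antisym) simp
  qed
  have n3: "kt 3 z a 3 = 0" "kw 2 z a 3 = 0" "kw 3 z a 3 = 0" "ct 3 z a 3 = 0" "cw 2 z a 3 = 0" "cw 3 z a 3 = 0"
    if "z \<in> Z" for z a
    unfolding kt_def kw_def ct_def cw_def
    by (simp_all add: k3[OF that] normal_curvatureD(1)[OF N[OF that]] normal_curvatureD(1)[OF Nc[OF that]])
  have A12: "A 1 z a = 0" "A 2 z a = 0" if "z \<in> Z" for z a
    using th1[OF that] th2[OF that] by (simp_all add: A_def \<delta>_def)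
  have A34: "A 3 z 4 = 0" "A 4 z 1 = 0" "A 4 z 2 = 0" "A 4 z 3 = 0" "B 1 z 1 = 0" if "z \<in> Z" for z
    using th3[OF that] th4[OF that] O1[OF that] omega_c_entries[of F z]
    by (simp_all add: A_def B_def \<delta>_def om_frame axis_def)
  note A0 = A12 A34
  note [simp del] = sp4_coords_nth
  have eA1: "fst (sp4_coords (extd \<delta> z (frame F z a) (frame F z b))) $ 1 = 0" "fst (sp4_coords (extd \<delta> z (frame F z a) (frame F z b))) $ 2 = 0"
    if "z \<in> Z" for z a b
    using eA[OF that, of 1 a b] eA[OF that, of 2 a b] A12 that by simp_all
  \<comment> \<open>Both curvatures have vanishing first column and \<open>A 1\<close> is zero, so
    the exterior derivative drops out and each bracket leaves a single unknown.\<close>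
  have s1: "A 4 z 4 = 0" "B 1 z 2 = 0" "B 1 z 3 = 0" "B 1 z 4 = 0" if "z \<in> Z" for z
    using cA[OF that, of 1 2 4] cA[OF that, of 1 1 2] cA[OF that, of 1 1 3] cA[OF that, of 1 1 4]
    by (simp_all add: col1 eA1 rules that A0)
  have A4: "A 4 z a = 0" "B 1 z a = 0" if "z \<in> Z" for z a
    using A34[OF that] s1[OF that] by (auto intro: forall_4'[of _ a])
  have s2: "A 3 z 3 = 0" "B 2 z 4 + A 3 z 1 = 0" "B 3 z 4 + A 3 z 2 = 0" "B 2 z 2 = B 3 z 1" "B 2 z 3 = 0" "B 3 z 3 = 0" if "z \<in> Z" for z
    using cA[OF that, of 2 3 4] cA[OF that, of 2 1 4] cA[OF that, of 2 2 4] cA[OF that, of 2 1 2] cA[OF that, of 2 1 3] cA[OF that, of 2 2 3]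
    by (simp_all add: col1 eA1 rules that A0 A4)
  have s3: "B 4 z 2 = B 5 z 1" "B 4 z 3 = 0" "B 4 z 4 + B 3 z 1 = 0" "B 5 z 3 = 0" "B 5 z 4 + B 3 z 2 = 0" if "z \<in> Z" for z
    using cA[OF that, of 4 1 2] cA[OF that, of 4 1 3] cA[OF that, of 4 1 4] cA[OF that, of 4 2 3] cA[OF that, of 4 2 4]
    by (simp_all add: col1 eA A4 rules that A0)
  have s4: "B 6 z 2 = B 4 z 1" "B 6 z 3 = 0" "B 6 z 4 + B 2 z 1 = 0" "B 4 z 4 + B 2 z 2 = 0" if "z \<in> Z" for z
    using cB[OF that, of 1 1 2] cB[OF that, of 1 1 3] cB[OF that, of 1 1 4] cB[OF that, of 1 2 4]
    by (simp_all add: col1 eB A4 rules that A0)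
  \<comment> \<open>The curvature entry gives \<open>2 * B 3 z 4 = A 3 z 2\<close>, while
    \<open>s2\<close> gives \<open>B 3 z 4 = - A 3 z 2\<close>; together they leave only
    zero.\<close>
  have s5: "A 3 z 2 = 0" if "z \<in> Z" for z
    using cA[OF that, of 3 3 4] eA[OF that, of 3 3 4] s2(3)[OF that]
    by (simp add: n2 rules that A0 A4 s2(1,6) sum_4 dthv)
  have s6: "A 3 z 1 = 0" if "z \<in> Z" for z
    using cA[OF that, of 3 2 4] eA[OF that, of 3 2 4] s2(2)[OF that]
    by (simp add: n2 rules that A0 A4 s2(1,6) s5 sum_4 dthv)
  have A3: "A 3 z a = 0" if "z \<in> Z" for z a
    using that by (auto intro: forall_4'[of _ a] simp: s2 s5 s6 A34)
  have s7: "B 3 z 1 = 0" "B 3 z 2 = 0" if "z \<in> Z" for z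
    using cA[OF that, of 3 1 3] cA[OF that, of 3 2 3]
    by (simp_all add: n3 eA A3 A4 rules that A0 s2)
  have B3: "B 3 z a = 0" if "z \<in> Z" for z a
    using that s2(3)[OF that] by (auto intro: forall_4'[of _ a] simp: s2 s5 s7)
  have s8: "B 5 z 1 = 0" "B 5 z 2 = 0" if "z \<in> Z" for z
    using cB[OF that, of 3 1 3] cB[OF that, of 3 2 3]
    by (simp_all add: n3 eB B3 A3 A4 rules that A0 s4 s3)
  \<comment> \<open>The fourth condition on the second and fourth frame vectors; by the
    \<open>sp4\<close> relations its entry (3,3) is minus the entry (2,2), which is the coordinate
    \<open>kw 3\<close>.\<close>
  have tr: "kt 3 z 1 2 = - kw 3 z 1 4" "ct 3 z 1 2 = - cw 3 z 1 4" if "z \<in> Z" for z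
  proof -
    have e: "omega_c F z (frame F z 4) $ 4 $ 1 = 0" "omega_c F z (frame F z 4) $ 3 $ 1 = 0" "omega_c F z (frame F z 4) $ 3 $ 2 = 0"
      "omega_c F z (frame F z 2) $ 4 $ 1 = 0" "omega_c F z (frame F z 2) $ 3 $ 1 = 1" "omega_c F z (frame F z 2) $ 2 $ 1 = 0"
      "omega_c F z (frame F z 4) $ 2 $ 1 = 1"
      by (simp_all add: omega_c_entries om_frame axis_def)
    have e4: "\<eta> z (frame F z 4) $ 2 $ 1 = 1"
      using s1(1)[OF that] e(7) by (simp add: A_def \<delta>_def sp4_coords_nth)
    have 1: "curvature \<eta> z (frame F z 1) (frame F z 2) $ 3 $ 2 = curvature \<eta> z (frame F z 1) (frame F z 4) $ 3 $ 3"
      using normal_curvatureD(4)[OF N[OF that], of "frame F z 2" "frame F z 4" "frame F z 1" 3]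
      by (simp add: th1 th2 th3 th4 that e e4)
    have 2: "curvature (omega_c F) z (frame F z 1) (frame F z 2) $ 3 $ 2 = curvature (omega_c F) z (frame F z 1) (frame F z 4) $ 3 $ 3"
      using normal_curvatureD(4)[OF Nc[OF that], of "frame F z 2" "frame F z 4" "frame F z 1" 3] by (simp add: e)
    have "curvature \<eta> z v v' \<in> sp4" "curvature (omega_c F) z v v' \<in> sp4" for v v'
      using curvature_sp4[OF \<eta> Z(1) that sp] curvature_sp4[OF sc Z(1) that omega_c_sp4] by blast+
    then have 3: "curvature \<eta> z v v' $ 3 $ 3 = - curvature \<eta> z v v' $ 2 $ 2"
      "curvature (omega_c F) z v v' $ 3 $ 3 = - curvature (omega_c F) z v v' $ 2 $ 2" for v v'
      by (simp_all add: sp4_iff_entries)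
    show "kt 3 z 1 2 = - kw 3 z 1 4" "ct 3 z 1 2 = - cw 3 z 1 4"
      unfolding kt_def kw_def ct_def cw_def
      by (simp_all add: sp4_coords_nth 1 2 3 normal_curvatureD(1)[OF N[OF that]] normal_curvatureD(1)[OF Nc[OF that]])
  qed
  \<comment> \<open>The coupling \<open>tr\<close> together with \<open>s4\<close> turns into
    \<open>- B 2 z 1 = 1/2 * B 2 z 1\<close>.\<close>
  have s9: "B 2 z 1 = 0" if "z \<in> Z" for z
  proof -
    have "kt 3 z 1 2 - ct 3 z 1 2 = - B 2 z 1"
      unfolding cA[OF that] by (simp add: eA A3 A4 B3 rules that A0 s2)
    moreover have "kw 3 z 1 4 - cw 3 z 1 4 = 1/2 * B 6 z 4"
      unfolding cB[OF that] by (simp add: eB A3 A4 B3 rules that A0 s2 s3 add_divide_distrib)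
    ultimately show ?thesis using tr[OF that] s4(3)[OF that] by simp
  qed
  have B2: "B 2 z a = 0" if "z \<in> Z" for z a
    using that s2(2)[OF that] s2(4)[OF that] by (auto intro: forall_4'[of _ a] simp: s2 s6 s7 s9)
  have s10: "B 4 z 1 = 0" if "z \<in> Z" for z
    using cB[OF that, of 2 1 3] by (simp add: n3 eB A3 A4 B2 B3 rules that A0 s2 s3 s4)
  have B4: "B 4 z a = 0" if "z \<in> Z" for z a
    using that s3(3)[OF that] by (auto intro: forall_4'[of _ a] simp: s3 s7 s8 s10)
  \<comment> \<open>\<open>eB\<close> needs \<open>B 6\<close> to vanish on both frame vectors
    throughout \<open>Z\<close>, so \<open>s4\<close> is also supplied for all points and not just
    for \<open>z\<close>.\<close>
  have s11: "B 6 z 1 = 0" if "z \<in> Z" for z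
    using cB[OF that, of 6 2 4] eB[OF that, of 6 2 4] s4(3)[OF that] s4(3)
    by (simp add: n2 rules that A0 A4 B2 B3 B4 s4 s9 s10 sum_4 dthv algebra_simps)
  have B5: "B 5 z a = 0" if "z \<in> Z" for z a
    using that s3(5)[OF that] by (auto intro: forall_4'[of _ a] simp: s3 s7 s8)
  have B6: "B 6 z a = 0" if "z \<in> Z" for z a
    using that s4(3)[OF that] by (auto intro: forall_4'[of _ a] simp: s4 s9 s10 s11)
  have "sp4_coords (\<delta> z (frame F z a)) = 0" for a
    using z unfolding prod_eq_iff vec_eq_iff forall_4 forall_6 by (simp add: AB A0 A3 A4 B2 B3 B4 B5 B6)
  moreover have "\<delta> z v \<in> sp4" for v
    using sp[OF z] omega_c_sp4 subspace_sp4 by (auto simp: \<delta>_def intro: subspace_diff)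
  ultimately have "\<delta> z (frame F z a) = 0" for a
    by (metis sp4_iff_coords linear_0[OF linear_sp4_matrix])
  moreover have "linear (\<delta> z)" using s\<delta> z by (simp add: smooth_form_def)
  ultimately have "\<delta> z v = 0"
    by (subst frame_expand[of v F z]) (simp add: linear_sum linear_cmul)
  then show ?thesis by (simp add: \<delta>_def)
qed

section \<open>From coframe equivalences to contact transformations\<close>

lemma omega_hat_entries:
  assumes w: "w \<in> Pc U"
  shows "omega_hat F w v $ 4 $ 1 = hat_g w$1$1 * hat_g w$1$1 * (2 * om1 (fst w) (fst v))"
    "omega_hat F w v $ 3 $ 1 = hat_g w$1$1 * (hat_g w$2$2 * om2 (fst w) (fst v) + hat_g w$1$2 * (2 * om1 (fst w) (fst v)))"
    "omega_hat F w v $ 2 $ 1 = hat_g w$1$1 * (hat_g w$3$3 * om4 (fst w) (fst v) - hat_g w$2$3 * om2 (fst w) (fst v)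
        - hat_g w$1$3 * (2 * om1 (fst w) (fst v)))"
    "omega_hat F w v $ 3 $ 2 = hat_g w$2$2 * (hat_g w$1$2 * om2 (fst w) (fst v) + hat_g w$2$2 * om3 F (fst w) (fst v))
        + hat_g w$1$2 * (hat_g w$1$2 * (2 * om1 (fst w) (fst v)) + hat_g w$2$2 * om2 (fst w) (fst v))"
proof -
  have g: "hat_gi w = sp_inv (hat_g w)" by (simp add: hat_gi_def hat_g_def)
  have "mc_form (snd w) (snd v) \<in> nonneg_part" using w by (auto simp: Pc_def intro: mc_form_nonneg)
  then have m: "mc_form (snd w) (snd v) $ 4 $ 1 = 0" "mc_form (snd w) (snd v) $ 3 $ 1 = 0"
    "mc_form (snd w) (snd v) $ 2 $ 1 = 0" "mc_form (snd w) (snd v) $ 3 $ 2 = 0"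
    by (simp_all add: nonneg_part_iff borel_upper_def)
  note e = H6_conj_entries[OF hat_g_H6[OF w] omega_c_sp4]
  show "omega_hat F w v $ 4 $ 1 = hat_g w$1$1 * hat_g w$1$1 * (2 * om1 (fst w) (fst v))"
    "omega_hat F w v $ 3 $ 1 = hat_g w$1$1 * (hat_g w$2$2 * om2 (fst w) (fst v) + hat_g w$1$2 * (2 * om1 (fst w) (fst v)))"
    "omega_hat F w v $ 2 $ 1 = hat_g w$1$1 * (hat_g w$3$3 * om4 (fst w) (fst v) - hat_g w$2$3 * om2 (fst w) (fst v)
        - hat_g w$1$3 * (2 * om1 (fst w) (fst v)))"
    "omega_hat F w v $ 3 $ 2 = hat_g w$2$2 * (hat_g w$1$2 * om2 (fst w) (fst v) + hat_g w$2$2 * om3 F (fst w) (fst v))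
        + hat_g w$1$2 * (hat_g w$1$2 * (2 * om1 (fst w) (fst v)) + hat_g w$2$2 * om2 (fst w) (fst v))"
    unfolding omega_hat_eq[OF w] g by (simp_all add: m e omega_c_entries om_def)
qed

text \<open>Conjugation by an upper triangular matrix keeps the entries below the diagonal
  triangular in the base forms, so equal values of the connection identify the successive kernels.
  The factor for \<open>om1\<close> is the square of a nonzero number, which is where the
  coorientation comes from.\<close>

lemma omega_hat_eq_filtration:
  assumes w: "w \<in> Pc U" "w' \<in> Pc U'" and e: "omega_hat F' w' v' = omega_hat F w v"
  shows "om1 (fst w') (fst v') = (hat_g w$1$1 / hat_g w'$1$1)^2 * om1 (fst w) (fst v)"
    "om1 (fst w) (fst v) = 0 \<Longrightarrow> om2 (fst w') (fst v') = 0 \<longleftrightarrow> om2 (fst w) (fst v) = 0"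
    "om1 (fst w) (fst v) = 0 \<Longrightarrow> om2 (fst w) (fst v) = 0 \<Longrightarrow> om3 F' (fst w') (fst v') = 0 \<longleftrightarrow> om3 F (fst w) (fst v) = 0"
    "om1 (fst w) (fst v) = 0 \<Longrightarrow> om2 (fst w) (fst v) = 0 \<Longrightarrow> om4 (fst w') (fst v') = 0 \<longleftrightarrow> om4 (fst w) (fst v) = 0"
proof -
  note nz = H6_diag'[OF hat_g_H6[OF w(1)]] H6_diag'[OF hat_g_H6[OF w(2)]]
  have a: "omega_hat F' w' v' $ i $ j = omega_hat F w v $ i $ j" for i j using e by simp
  note E = omega_hat_entries[OF w(1), of F v] omega_hat_entries[OF w(2), of F' v']
  show 1: "om1 (fst w') (fst v') = (hat_g w$1$1 / hat_g w'$1$1)^2 * om1 (fst w) (fst v)"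
    using a[of 4 1] nz unfolding E by (simp add: field_simps power2_eq_square)
  show 2: "om2 (fst w') (fst v') = 0 \<longleftrightarrow> om2 (fst w) (fst v) = 0" if 0: "om1 (fst w) (fst v) = 0"
    using a[of 3 1] nz unfolding E by (auto simp: 1 0)
  have 0: "om1 (fst w') (fst v') = 0" "om2 (fst w') (fst v') = 0" if "om1 (fst w) (fst v) = 0" "om2 (fst w) (fst v) = 0"
    using that by (simp_all add: 1 2)
  show "om3 F' (fst w') (fst v') = 0 \<longleftrightarrow> om3 F (fst w) (fst v) = 0"
    if "om1 (fst w) (fst v) = 0" "om2 (fst w) (fst v) = 0"
    using a[of 3 2] nz unfolding E that 0[OF that] by auto
  show "om4 (fst w') (fst v') = 0 \<longleftrightarrow> om4 (fst w) (fst v) = 0"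
    if "om1 (fst w) (fst v) = 0" "om2 (fst w) (fst v) = 0"
    using a[of 2 1] nz unfolding E that 0[OF that] by auto
qed

section \<open>Projection from second to first jets\<close>

lemma jet1_nth [simp]: "jet1 z $ 1 = z $ 1" "jet1 z $ 2 = z $ 2" "jet1 z $ 3 = z $ 3"
  by (simp_all add: jet1_def)

lemma bounded_linear_jet1: "bounded_linear jet1"
  unfolding linear_conv_bounded_linear[symmetric] by (rule linearI) (simp_all add: vec_eq_iff forall_3)

text \<open>A section of \<open>jet1\<close> with constant last coordinate, used to push maps from
  second jets down to first jets.\<close>

definition jet_point :: "real \<Rightarrow> real^3 \<Rightarrow> real^4" where
  "jet_point q x = vector [x$1, x$2, x$3, q]"

lemma jet_point_nth [simp]: "jet_point q x $ 1 = x $ 1" "jet_point q x $ 2 = x $ 2" "jet_point q x $ 3 = x $ 3" "jet_point q x $ 4 = q"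
  by (simp_all add: jet_point_def)

lemma jet1_jet_point [simp]: "jet1 (jet_point q x) = x"
  by (simp add: vec_eq_iff forall_3)

lemma bounded_linear_jet_point: "bounded_linear (jet_point 0)"
  unfolding linear_conv_bounded_linear[symmetric] by (rule linearI) (simp_all add: vec_eq_iff forall_4)

lemma jet_point_eq: "jet_point q x = jet_point 0 x + q *\<^sub>R axis 4 1"
  by (simp add: vec_eq_iff forall_4 axis_def)

lemma smooth_on_jet_point: "open S \<Longrightarrow> smooth_on S (jet_point q)"
  unfolding jet_point_eq[of q, abs_def]
  by (intro smooth_on_add smooth_on_const smooth_on_bounded_linear[OF bounded_linear_jet_point] smooth_on_id)

lemma pd_nth_component:
  assumes "f differentiable (at x)"
  shows "pd i (\<lambda>x. f x $ k) x = frechet_derivative f (at x) (axis i 1) $ k"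
  unfolding pd_def by (rule frechet_derivative_bounded_linear[OF bounded_linear_vec_nth assms])

lemma vec3_sum: "v = v$1 *\<^sub>R axis 1 1 + v$2 *\<^sub>R axis 2 1 + v$3 *\<^sub>R axis 3 (1::real)" for v :: "real^3"
  by (simp add: vec_eq_iff forall_3 axis_def)

lemma vec4_sum: "v = v$1 *\<^sub>R axis 1 1 + v$2 *\<^sub>R axis 2 1 + v$3 *\<^sub>R axis 3 1 + v$4 *\<^sub>R axis 4 (1::real)" for v :: "real^4"
  by (simp add: vec_eq_iff forall_4 axis_def)

text \<open>The total derivative of a function of first jets is its derivative in the direction
  \<open>(1, p, q)\<close>, the projection of the last frame vector.\<close>

lemma total_D1_nth:
  assumes "f differentiable (at (jet1 z))"
  shows "total_D1 (\<lambda>x. f x $ k) z = frechet_derivative f (at (jet1 z)) (vector [1, z$3, z$4]) $ k"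
proof -
  have l: "linear (frechet_derivative f (at (jet1 z)))"
    using assms frechet_derivative_works has_derivative_linear by blast
  show ?thesis
    unfolding total_D1_def pd_nth_component[OF assms]
    by (subst vec3_sum[of "vector [1, z$3, z$4]"]) (simp add: linear_add[OF l] linear_cmul[OF l])
qed

lemma total_D_nth:
  assumes "g differentiable (at z)"
  shows "total_D F (\<lambda>z. g z $ k) z = frechet_derivative g (at z) (frame F z 4) $ k"
proof -
  have l: "linear (frechet_derivative g (at z))"
    using assms frechet_derivative_works has_derivative_linear by blast
  show ?thesis
    unfolding total_D_def pd_nth_component[OF assms]
    by (subst vec4_sum[of "frame F z 4"]) (simp add: linear_add[OF l] linear_cmul[OF l] frame_def)
qed

lemma om_frame_nth:
  "om1 z (frame F z a) = axis a 1 $ 1" "om2 z (frame F z a) = axis a 1 $ 2"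
  "om3 F z (frame F z a) = axis a 1 $ 3" "om4 z (frame F z a) = axis a 1 $ 4"
  using om_frame[of F z a] by (simp_all add: om_def vec_eq_iff forall_4)

lemma has_derivative_zero_on_segment:
  fixes f :: "'a::real_normed_vector \<Rightarrow> 'b::real_normed_vector"
  assumes d: "\<And>t. t \<in> {0..1} \<Longrightarrow> (f has_derivative f' t) (at (x + t *\<^sub>R v))" and 0: "\<And>t. t \<in> {0..1} \<Longrightarrow> f' t v = 0"
  shows "f (x + v) = f x"
proof -
  have "((\<lambda>t. f (x + t *\<^sub>R v)) has_vector_derivative 0) (at t within {0..1})" if "t \<in> {0..1}" for t
  proof -
    have "((\<lambda>t. x + t *\<^sub>R v) has_derivative (\<lambda>s. s *\<^sub>R v)) (at t)"
      by (auto intro!: derivative_eq_intros)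
    from has_derivative_compose[OF this d[OF that]]
    have "((\<lambda>t. f (x + t *\<^sub>R v)) has_derivative (\<lambda>s. 0)) (at t)"
      using linear_cmul[OF has_derivative_linear[OF d[OF that]]] 0[OF that] by simp
    then show ?thesis
      unfolding has_vector_derivative_def by (simp add: has_derivative_at_withinI)
  qed
  then obtain c where "\<And>t. t \<in> {0..1} \<Longrightarrow> f (x + t *\<^sub>R v) = c"
    using has_vector_derivative_zero_constant[of "{0..1::real}"] by (metis convex_real_interval(5))
  from this[of 0] this[of 1] show ?thesis by simp
qed

lemma coframe_iso_omega_hat:
  assumes "coframe_iso U F U' F' S S' \<Phi>" "w \<in> S"
  shows "w \<in> Pc U" "\<Phi> w \<in> Pc U'" "omega_hat F' (\<Phi> w) (frechet_derivative \<Phi> (at w) v) = omega_hat F w v"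
proof -
  show w: "w \<in> Pc U" using assms by (auto simp: coframe_iso_def)
  have "\<Phi> w \<in> S'" using assms by (auto simp: coframe_iso_def diffeo_def bij_betw_def)
  then show w': "\<Phi> w \<in> Pc U'" using assms by (auto simp: coframe_iso_def)
  have "coframe F' (\<Phi> w) (frechet_derivative \<Phi> (at w) v) = coframe F w v"
    using assms unfolding coframe_iso_def by blast
  then show "omega_hat F' (\<Phi> w) (frechet_derivative \<Phi> (at w) v) = omega_hat F w v"
    by (simp add: omega_hat_coframe[OF w] omega_hat_coframe[OF w'])
qed

lemma coframe_iso_contact:
  assumes iso: "coframe_iso U F U' F' S S' \<Phi>" and w0: "w0 \<in> S"
  obtains S0 V f where "open S0" "w0 \<in> S0" "S0 \<subseteq> S" "contact_transformation V f" "cooriented V f"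
    "maps_ode U F U' F' V f (fst ` S0)" "\<And>w. w \<in> S0 \<Longrightarrow> fst (\<Phi> w) = prolong f (fst w)"
proof -
  have S: "open S" and \<Phi>: "smooth_on S \<Phi>" using iso by (auto simp: coframe_iso_def diffeo_def)
  note ci = coframe_iso_omega_hat[OF iso]
  note fil = omega_hat_eq_filtration[OF ci]
  have dF: "((\<lambda>w. fst (\<Phi> w)) has_derivative (\<lambda>v. fst (frechet_derivative \<Phi> (at w) v))) (at w)" if "w \<in> S" for w
    by (rule has_derivative_fst[OF smooth_on_has_derivative[OF \<Phi> that]])
  \<comment> \<open>On vertical vectors the connection takes values in \<open>nonneg_part\<close>,
    and \<open>\<Phi>\<close> preserves the connection; \<open>omega_hat_nonneg\<close> at
    \<open>\<Phi> w\<close> then makes the image vertical.\<close>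
  have vert: "fst (frechet_derivative \<Phi> (at w) (0, y)) = 0" if w: "w \<in> S" for w y
  proof -
    have dom: "snd w \<in> H6_dom" using ci(1)[OF w] by (auto simp: Pc_def)
    have "omega_hat F w (0, y) = mc_form (snd w) y"
      unfolding omega_hat_eq[OF ci(1)[OF w]]
      by (simp add: omega_c_eq linear_0[OF linear_om_vec] linear_0[OF linear_Om0]
          linear_0[OF linear_sp4_matrix] zero_prod_def[symmetric] matrix_mult_simps)
    then have "omega_hat F' (\<Phi> w) (frechet_derivative \<Phi> (at w) (0, y)) \<in> nonneg_part"
      using mc_form_nonneg[OF dom] by (simp add: ci(3)[OF w])
    from omega_hat_nonneg(1)[OF ci(2)[OF w] this] show ?thesis .
  qed
  obtain e where e: "e > 0" "ball w0 e \<subseteq> S" using S w0 openE by blast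
  \<comment> \<open>Three distances below \<open>r\<close>, in the first jet, the last jet
    coordinate and the fibre, add up to less than \<open>e\<close>.\<close>
  define r where "r = e / 3"
  have r: "r > 0" using e by (simp add: r_def)
  define z0 where "z0 = fst w0"
  define u0 where "u0 = snd w0"
  \<comment> \<open>A cylinder over a ball of first jets: segments in the last coordinate stay
    inside it, and so do the points \<open>jet_point (z0$4) x\<close>.\<close>
  define Bz where "Bz = {z. jet1 z \<in> ball (jet1 z0) r \<and> \<bar>z$4 - z0$4\<bar> < r}"
  have box: "(z, u) \<in> S" if "z \<in> Bz" "u \<in> ball u0 r" for z u
  proof -
    have "z - z0 = jet_point 0 (jet1 (z - z0)) + (z$4 - z0$4) *\<^sub>R axis 4 1"
      by (simp add: vec_eq_iff forall_4 axis_def)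
    then have "norm (z - z0) \<le> norm (jet_point 0 (jet1 (z - z0))) + \<bar>z$4 - z0$4\<bar>"
      by (metis norm_triangle_ineq norm_scaleR norm_axis_1 mult.right_neutral)
    moreover have "norm (jet_point 0 x) = norm x" for x
      by (simp add: norm_vec_def L2_set_def sum_4 sum_3)
    moreover have "jet1 (z - z0) = jet1 z - jet1 z0" by (simp add: vec_eq_iff forall_3)
    ultimately have "norm (z - z0) < 2 * r"
      using that by (simp add: Bz_def dist_norm norm_minus_commute)
    moreover have "dist w0 (z, u) \<le> norm (z0 - z) + norm (u0 - u)"
      using norm_Pair_le[of "z0 - z" "u0 - u"] by (simp add: z0_def u0_def dist_norm minus_prod_def)
    ultimately have "dist w0 (z, u) < e"
      using that by (simp add: r_def dist_norm norm_minus_commute)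
    then show ?thesis using e by auto
  qed
  have u0: "u0 \<in> ball u0 r" and z0: "z0 \<in> Bz" using r by (simp_all add: Bz_def)
  have oBz: "open Bz"
  proof -
    have "open (jet1 -` ball (jet1 z0) r)"
      by (rule open_vimage[OF open_ball]) (rule linear_continuous_on[OF bounded_linear_jet1])
    moreover have "open {z::real^4. \<bar>z$4 - z0$4\<bar> < r}"
      by (intro open_Collect_less continuous_intros)
    ultimately show ?thesis
      using open_Int by (simp add: Bz_def Collect_conj_eq vimage_def)
  qed
  define \<phi> where "\<phi> z = fst (\<Phi> (z, u0))" for z
  \<comment> \<open>The fibre ball is convex, so the vanishing vertical derivative makes the base
    part constant along the segment to \<open>u0\<close>.\<close>
  have fstPhi: "fst (\<Phi> (z, u)) = \<phi> z" if "z \<in> Bz" "u \<in> ball u0 r" for z u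
  proof -
    have "fst (\<Phi> ((z, u0) + (0, u - u0))) = fst (\<Phi> (z, u0))"
    proof (rule has_derivative_zero_on_segment[where f = "\<lambda>w. fst (\<Phi> w)"])
      fix t :: real assume t: "t \<in> {0..1}"
      have "dist u0 (u0 + t *\<^sub>R (u - u0)) = t * norm (u - u0)" using t by (simp add: dist_norm)
      also have "\<dots> \<le> norm (u - u0)" using t by (simp add: mult_left_le_one_le)
      finally have "u0 + t *\<^sub>R (u - u0) \<in> ball u0 r" using that by (simp add: dist_norm norm_minus_commute)
      then have "(z, u0) + t *\<^sub>R (0, u - u0) \<in> S" using box[OF that(1)] by simp
      then show "((\<lambda>w. fst (\<Phi> w)) has_derivative (\<lambda>v. fst (frechet_derivative \<Phi> (at ((z, u0) + t *\<^sub>R (0, u - u0))) v))) (at ((z, u0) + t *\<^sub>R (0, u - u0)))"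
        "fst (frechet_derivative \<Phi> (at ((z, u0) + t *\<^sub>R (0, u - u0))) (0, u - u0)) = 0"
        using dF vert by blast+
    qed
    then show ?thesis by (simp add: \<phi>_def)
  qed
  have s\<phi>: "smooth_on Bz \<phi>"
    unfolding \<phi>_def
    by (intro smooth_on_fst oBz smooth_on_compose[OF oBz S _ \<Phi>] smooth_on_Pair smooth_on_id smooth_on_const)
      (use box u0 in auto)
  define D where "D z v = fst (frechet_derivative \<Phi> (at (z, u0)) (v, 0))" for z v
  have d\<phi>: "(\<phi> has_derivative D z) (at z)" if "z \<in> Bz" for z
  proof -
    have "((\<lambda>z. (z, u0)) has_derivative (\<lambda>v. (v, 0))) (at z)" by (auto intro!: derivative_eq_intros)
    from has_derivative_compose[OF this dF[OF box[OF that u0]]] show ?thesis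
      by (simp add: \<phi>_def[abs_def] D_def[abs_def])
  qed
  have fd: "frechet_derivative \<phi> (at z) = D z" if "z \<in> Bz" for z
    using frechet_derivative_eqI[OF d\<phi>[OF that]] .
  have linD: "linear (D z)" if "z \<in> Bz" for z using has_derivative_linear[OF d\<phi>[OF that]] .
  define lam where "lam z = (hat_g (z, u0) $ 1 $ 1 / hat_g (\<Phi> (z, u0)) $ 1 $ 1)^2" for z
  have f1: "om1 (\<phi> z) (D z v) = lam z * om1 z v"
    and f2: "om1 z v = 0 \<Longrightarrow> om2 (\<phi> z) (D z v) = 0 \<longleftrightarrow> om2 z v = 0"
    and f3: "om1 z v = 0 \<Longrightarrow> om2 z v = 0 \<Longrightarrow> om3 F' (\<phi> z) (D z v) = 0 \<longleftrightarrow> om3 F z v = 0"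
    and f4: "om1 z v = 0 \<Longrightarrow> om2 z v = 0 \<Longrightarrow> om4 (\<phi> z) (D z v) = 0 \<longleftrightarrow> om4 z v = 0"
    and lam: "lam z > 0" if "z \<in> Bz" for z v
  proof -
    note w = box[OF that u0]
    note m = fil[OF w w w, of "(v, 0)"]
    show "om1 (\<phi> z) (D z v) = lam z * om1 z v" using m(1) by (simp add: \<phi>_def D_def lam_def)
    show "om1 z v = 0 \<Longrightarrow> om2 (\<phi> z) (D z v) = 0 \<longleftrightarrow> om2 z v = 0" using m(2) by (simp add: \<phi>_def D_def)
    show "om1 z v = 0 \<Longrightarrow> om2 z v = 0 \<Longrightarrow> om3 F' (\<phi> z) (D z v) = 0 \<longleftrightarrow> om3 F z v = 0" using m(3) by (simp add: \<phi>_def D_def)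
    show "om1 z v = 0 \<Longrightarrow> om2 z v = 0 \<Longrightarrow> om4 (\<phi> z) (D z v) = 0 \<longleftrightarrow> om4 z v = 0" using m(4) by (simp add: \<phi>_def D_def)
    show "lam z > 0"
      using H6_diag'[OF hat_g_H6[OF ci(1)[OF w]]] H6_diag'[OF hat_g_H6[OF ci(2)[OF w]]] by (simp add: lam_def)
  qed
  \<comment> \<open>The direction of the last coordinate spans the common kernel of
    \<open>\<omega>\<^sup>1\<close>, \<open>\<omega>\<^sup>2\<close> and
    \<open>\<omega>\<^sup>4\<close>; its image lies in the corresponding kernel, so the first three
    components of \<open>\<phi>\<close> do not depend on that coordinate.\<close>
  have Dq: "D z (axis 4 1) $ 1 = 0" "D z (axis 4 1) $ 2 = 0" "D z (axis 4 1) $ 3 = 0" if "z \<in> Bz" for z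
  proof -
    have o: "om1 z (axis 4 1) = 0" "om2 z (axis 4 1) = 0" "om4 z (axis 4 1) = 0"
      by (simp_all add: om1_def om2_def om4_def axis_def)
    from f1[OF that, of "axis 4 1"] f2[OF that o(1)] f4[OF that o(1,2)] o
    show "D z (axis 4 1) $ 1 = 0" "D z (axis 4 1) $ 2 = 0" "D z (axis 4 1) $ 3 = 0"
      by (simp_all add: om1_def om2_def om4_def)
  qed
  define f where "f x = jet1 (\<phi> (jet_point (z0$4) x))" for x
  have jp: "jet_point (z0$4) x \<in> Bz" if "x \<in> ball (jet1 z0) r" for x
    using that r by (simp add: Bz_def)
  have jf: "jet1 (\<phi> z) = f (jet1 z)" if "z \<in> Bz" for z
  proof -
    let ?z = "jet_point (z0$4) (jet1 z)" and ?v = "(z$4 - z0$4) *\<^sub>R axis 4 (1::real) :: real^4"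
    have "jet1 (\<phi> (?z + ?v)) = jet1 (\<phi> ?z)"
    proof (rule has_derivative_zero_on_segment[where f = "\<lambda>z. jet1 (\<phi> z)"])
      fix t :: real assume t: "t \<in> {0..1}"
      let ?y = "?z + t *\<^sub>R ?v"
      have "\<bar>t * (z$4 - z0$4)\<bar> \<le> \<bar>z$4 - z0$4\<bar>" using t by (simp add: abs_mult mult_left_le_one_le)
      moreover have "jet1 ?y = jet1 z" by (simp add: vec_eq_iff forall_3 axis_def)
      moreover have "?y $ 4 = z0 $ 4 + t * (z$4 - z0$4)" by (simp add: axis_def)
      ultimately have y: "?y \<in> Bz" using that by (simp add: Bz_def)
      show "((\<lambda>z. jet1 (\<phi> z)) has_derivative (\<lambda>v. jet1 (D ?y v))) (at ?y)"
        by (rule bounded_linear.has_derivative[OF bounded_linear_jet1 d\<phi>[OF y]])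
      show "jet1 (D ?y ?v) = 0"
        unfolding linear_cmul[OF linD[OF y]] using Dq[OF y] by (simp add: vec_eq_iff forall_3)
    qed
    moreover have "?z + ?v = z" by (simp add: vec_eq_iff forall_4 axis_def)
    ultimately show ?thesis by (simp add: f_def)
  qed
  have sf: "smooth_on (ball (jet1 z0) r) f"
    unfolding f_def
    by (intro smooth_on_bounded_linear[OF bounded_linear_jet1] open_ball
        smooth_on_compose[OF open_ball oBz _ s\<phi>] smooth_on_jet_point) (use jp in auto)
  \<comment> \<open>The value does not depend on the last coordinate \<open>c\<close> of the lift;
    both \<open>c = 0\<close> and \<open>c = F z\<close> are used below.\<close>
  have df: "frechet_derivative f (at (jet1 z)) \<xi> = jet1 (D z (jet_point c \<xi>))" if z: "z \<in> Bz" for z \<xi> c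
  proof -
    have x: "jet1 z \<in> ball (jet1 z0) r" using z by (simp add: Bz_def)
    have fx: "(f has_derivative frechet_derivative f (at (jet1 z))) (at (jet1 z))"
      using smooth_on_has_derivative[OF sf x] .
    have 1: "((\<lambda>z. f (jet1 z)) has_derivative (\<lambda>v. frechet_derivative f (at (jet1 z)) (jet1 v))) (at z)"
      by (rule has_derivative_compose[OF bounded_linear_imp_has_derivative[OF bounded_linear_jet1] fx])
    have 2: "((\<lambda>z. f (jet1 z)) has_derivative (\<lambda>v. jet1 (D z v))) (at z)"
      by (rule has_derivative_transform_within_open[OF bounded_linear.has_derivative[OF bounded_linear_jet1 d\<phi>[OF z]] oBz z])
        (rule jf)
    show ?thesis using fun_cong[OF has_derivative_unique[OF 1 2], of "jet_point c \<xi>"] by simp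
  qed
  have x0: "jet1 z0 \<in> ball (jet1 z0) r" using r by simp
  have "inj (frechet_derivative f (at (jet1 z0)))"
  proof -
    have "\<xi> = 0" if 0: "frechet_derivative f (at (jet1 z0)) \<xi> = 0" for \<xi>
    proof -
      let ?v = "jet_point 0 \<xi>"
      have "jet1 (D z0 ?v) = 0" using 0 by (simp add: df[OF z0, of _ 0])
      then have V: "D z0 ?v $ 1 = 0" "D z0 ?v $ 2 = 0" "D z0 ?v $ 3 = 0"
        by (simp_all add: vec_eq_iff forall_3)
      have 1: "om1 z0 ?v = 0" using f1[OF z0, of ?v] lam[OF z0] V by (simp add: om1_def)
      have 2: "om2 z0 ?v = 0" using f2[OF z0 1] V by (simp add: om2_def)
      have 4: "om4 z0 ?v = 0" using f4[OF z0 1 2] V by (simp add: om4_def)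
      from 1 2 4 show "\<xi> = 0" by (simp add: om1_def om2_def om4_def vec_eq_iff forall_3)
    qed
    then show ?thesis using linear_injective_0[OF smooth_on_linear_derivative[OF sf x0]] by blast
  qed
  from smooth_local_diffeo[OF open_ball sf x0 this]
  obtain A where A: "open A" "jet1 z0 \<in> A" "A \<subseteq> ball (jet1 z0) r" "diffeo A (f ` A) f" by metis
  have diff: "f differentiable (at x)" if "x \<in> ball (jet1 z0) r" for x
    using smooth_on_differentiable[OF sf that] .
  have contact: "f x $ 3 * pd 3 (\<lambda>x. f x $ 1) x = pd 3 (\<lambda>x. f x $ 2) x"
    "f x $ 3 * (pd 1 (\<lambda>x. f x $ 1) x + x $ 3 * pd 2 (\<lambda>x. f x $ 1) x) = pd 1 (\<lambda>x. f x $ 2) x + x $ 3 * pd 2 (\<lambda>x. f x $ 2) x"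
    "pd 2 (\<lambda>x. f x $ 2) x - f x $ 3 * pd 2 (\<lambda>x. f x $ 1) x > 0"
    if x: "x \<in> ball (jet1 z0) r" for x
  proof -
    define z where "z = jet_point (z0$4) x"
    have z: "z \<in> Bz" "jet1 z = x" using jp[OF x] by (simp_all add: z_def)
    define d where "d i = D z (jet_point 0 (axis i 1))" for i
    have p: "pd i (\<lambda>x. f x $ k) x = jet1 (d i) $ k" for i k
      using pd_nth_component[OF diff[OF x], of i k] df[OF z(1), of "axis i 1" 0] z(2) by (simp add: d_def)
    have fx: "f x $ 3 = \<phi> z $ 3" using jf[OF z(1)] z(2) by (metis jet1_nth(3))
    have zx: "z $ 3 = x $ 3" by (simp add: z_def)
    have "om1 (\<phi> z) (d i) = lam z * om1 z (jet_point 0 (axis i 1))" for i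
      unfolding d_def by (rule f1[OF z(1)])
    from this[of 1] this[of 2] this[of 3]
    have e: "d 1 $ 2 - \<phi> z $ 3 * d 1 $ 1 = - (lam z * x $ 3)" "d 2 $ 2 - \<phi> z $ 3 * d 2 $ 1 = lam z" "d 3 $ 2 - \<phi> z $ 3 * d 3 $ 1 = 0"
      by (simp_all add: om1_def axis_def zx)
    show "f x $ 3 * pd 3 (\<lambda>x. f x $ 1) x = pd 3 (\<lambda>x. f x $ 2) x"
      unfolding p fx using e(3) by simp
    have "\<phi> z $ 3 * (d 1 $ 1 + x $ 3 * d 2 $ 1) = d 1 $ 2 + lam z * x $ 3 + x $ 3 * (d 2 $ 2 - lam z)"
      using e(1,2) by (simp add: algebra_simps)
    then show "f x $ 3 * (pd 1 (\<lambda>x. f x $ 1) x + x $ 3 * pd 2 (\<lambda>x. f x $ 1) x) = pd 1 (\<lambda>x. f x $ 2) x + x $ 3 * pd 2 (\<lambda>x. f x $ 2) x"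
      unfolding p fx by (simp add: algebra_simps)
    show "pd 2 (\<lambda>x. f x $ 2) x - f x $ 3 * pd 2 (\<lambda>x. f x $ 1) x > 0"
      unfolding p fx using e(2) lam[OF z(1)] by simp
  qed
  define Z where "Z = Bz \<inter> jet1 -` A"
  have oZ: "open Z"
    unfolding Z_def using oBz open_vimage[OF A(1) linear_continuous_on[OF bounded_linear_jet1]] by (rule open_Int)
  \<comment> \<open>The last frame vector is annihilated by the first three forms, so its image is a
    multiple of the corresponding vector for \<open>F'\<close>. Read in components, this is the
    prolongation formula together with the second equation.\<close>
  have D4: "D z (frame F z 4) $ 1 \<noteq> 0" "D z (frame F z 4) $ 3 = \<phi> z $ 4 * D z (frame F z 4) $ 1"
    "D z (frame F z 4) $ 4 = F' (\<phi> z) * D z (frame F z 4) $ 1"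
    and t: "total_D1 (\<lambda>x. f x $ k) z = jet1 (D z (frame F z 4)) $ k" if z: "z \<in> Bz" for z k
  proof -
    let ?v = "frame F z 4"
    have v: "om1 z ?v = 0" "om2 z ?v = 0" "om3 F z ?v = 0" "om4 z ?v = 1" by (simp_all add: om_frame_nth axis_def)
    have V: "om1 (\<phi> z) (D z ?v) = 0" "om2 (\<phi> z) (D z ?v) = 0" "om3 F' (\<phi> z) (D z ?v) = 0" "om4 (\<phi> z) (D z ?v) \<noteq> 0"
      using f1[OF z, of ?v] f2[OF z v(1)] f3[OF z v(1,2)] f4[OF z v(1,2)] v by simp_all
    show "D z (frame F z 4) $ 1 \<noteq> 0" "D z (frame F z 4) $ 3 = \<phi> z $ 4 * D z (frame F z 4) $ 1"
      using V by (simp_all add: om2_def om4_def)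
    have "D z ?v $ 4 - F' (\<phi> z) * D z ?v $ 1 = om3 F' (\<phi> z) (D z ?v) + 1/3 * Dq F' (\<phi> z) * om2 (\<phi> z) (D z ?v)
        - K_fun F' (\<phi> z) * om1 (\<phi> z) (D z ?v)"
      by (simp add: om3_def om1_def om2_def)
    then show "D z (frame F z 4) $ 4 = F' (\<phi> z) * D z (frame F z 4) $ 1" by (simp add: V)
    have "jet_point (F z) (vector [1, z$3, z$4]) = ?v" by (simp add: vec_eq_iff forall_4 frame_def)
    then have "frechet_derivative f (at (jet1 z)) (vector [1, z$3, z$4]) = jet1 (D z ?v)"
      using df[OF z, of "vector [1, z$3, z$4]" "F z"] by simp
    then show "total_D1 (\<lambda>x. f x $ k) z = jet1 (D z (frame F z 4)) $ k"
      using total_D1_nth[OF diff, of z k] z by (simp add: Bz_def)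
  qed
  have pro: "prolong f z = \<phi> z" if z: "z \<in> Bz" for z
  proof -
    have "\<phi> z $ 4 = total_D1 (\<lambda>x. f x $ 3) z / total_D1 (\<lambda>x. f x $ 1) z"
      unfolding t[OF z] using D4[OF z] by simp
    moreover have "f (jet1 z) $ 1 = \<phi> z $ 1" "f (jet1 z) $ 2 = \<phi> z $ 2" "f (jet1 z) $ 3 = \<phi> z $ 3"
      using jf[OF z] by (simp_all add: vec_eq_iff forall_3)
    ultimately show ?thesis by (simp add: prolong_def vec_eq_iff forall_4)
  qed
  define S0 where "S0 = Z \<times> ball u0 r"
  have fS0: "fst ` S0 = Z" using u0 by (auto simp: S0_def)
  show thesis
  proof (rule that)
    show "open S0" unfolding S0_def by (intro open_Times oZ open_ball)
    show "w0 \<in> S0" using z0 u0 A(2) by (simp add: S0_def Z_def mem_Times_iff z0_def[symmetric] u0_def[symmetric])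
    show "S0 \<subseteq> S" using box by (auto simp: S0_def Z_def)
    show "contact_transformation A f"
      unfolding contact_transformation_def Let_def using A(3,4) contact by blast
    show "cooriented A f"
      unfolding cooriented_def using A(3) contact(3) by blast
    show "fst (\<Phi> w) = prolong f (fst w)" if "w \<in> S0" for w
      using that fstPhi[of "fst w" "snd w"] pro[of "fst w"] by (auto simp: S0_def Z_def)
    show "maps_ode U F U' F' A f (fst ` S0)"
      unfolding maps_ode_def fS0
    proof (intro conjI ballI oZ subsetI)
      fix z assume z: "z \<in> Z"
      then have zB: "z \<in> Bz" by (simp add: Z_def)
      have w: "(z, u0) \<in> S" using box[OF zB u0] .
      show "z \<in> U" using ci(1)[OF w] by (simp add: Pc_def)
      show "jet1 z \<in> A" using z by (simp add: Z_def)
      show "total_D1 (\<lambda>x. f x $ 1) z \<noteq> 0" using t[OF zB] D4[OF zB] by simp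
      show "prolong f z \<in> U'" using ci(2)[OF w] pro[OF zB] by (auto simp: \<phi>_def Pc_def)
      have s: "smooth_on Bz (\<lambda>z. \<phi> z $ k)" for k by (intro smooth_on_vec_nth oBz s\<phi>)
      have "pd i (\<lambda>z. prolong f z $ k) z = pd i (\<lambda>z. \<phi> z $ k) z" for i k
        by (rule pd_cong[OF oBz s _ zB, symmetric]) (simp add: pro)
      then have "total_D F (\<lambda>z. prolong f z $ k) z = D z (frame F z 4) $ k" for k
        using total_D_nth[OF smooth_on_differentiable[OF s\<phi> zB], of F k] by (simp add: total_D_def fd[OF zB])
      then show "F' (prolong f z) = total_D F (\<lambda>z. prolong f z $ 4) z / total_D F (\<lambda>z. prolong f z $ 1) z"
        using D4[OF zB] by (simp add: pro[OF zB])
    qed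
  qed
qed

section \<open>From contact transformations to coframe equivalences\<close>

lemma smooth_form_compose_vector:
  assumes Z: "open Z" and \<eta>: "smooth_form Z \<eta>" and f: "smooth_on Z f"
  shows "smooth_on Z (\<lambda>z. \<eta> z (f z))"
proof -
  have lin: "linear (\<eta> z)" if "z \<in> Z" for z using \<eta> that by (simp add: smooth_form_def)
  have "smooth_on Z (\<lambda>z. \<Sum>b\<in>Basis. (f z \<bullet> b) *\<^sub>R \<eta> z b)"
    using \<eta> by (intro smooth_on_sum smooth_on_scaleR Z finite_Basis
        smooth_on_bounded_linear[OF bounded_linear_inner_left] f) (simp add: smooth_form_def)
  then show ?thesis
  proof (rule iffD1[OF smooth_on_cong[OF Z], rotated])
    fix x assume "x \<in> Z"
    show "(\<Sum>b\<in>Basis. (f x \<bullet> b) *\<^sub>R \<eta> x b) = \<eta> x (f x)"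
      by (rule linear_eq_sum_Basis[OF lin[OF \<open>x \<in> Z\<close>], symmetric])
  qed
qed

text \<open>Gauge transformations act from the right, so the later factor multiplies on the right
  and the inverses compose in reverse order. This joins two normalisation steps into one gauge
  function.\<close>

lemma gauge_form_compose:
  fixes g h gi hi :: "'w::euclidean_space \<Rightarrow> real^'n^'n"
  assumes P: "open P" and g: "smooth_on P g" "smooth_on P h" and w: "w \<in> P" and inv: "gi w ** g w = mat 1"
  shows "gauge_form h hi (gauge_form g gi \<eta>) w v = gauge_form (\<lambda>w. g w ** h w) (\<lambda>w. hi w ** gi w) \<eta> w v"
proof -
  have "frechet_derivative (\<lambda>w. g w ** h w) (at w) v = g w ** frechet_derivative h (at w) v + frechet_derivative g (at w) v ** h w"
    by (intro fun_cong[OF frechet_derivative_eqI] bounded_bilinear.FDERIV[OF bounded_bilinear_matrix_mult]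
        smooth_on_has_derivative[OF _ w] g)
  moreover have "gi w ** (g w ** X) = X" for X :: "real^'n^'n" by (simp add: matrix_mul_assoc inv)
  ultimately show ?thesis
    by (simp add: gauge_form_def matrix_mult_simps matrix_mul_assoc[symmetric])
qed

lemma gauge_form_u_matrix:
  fixes u :: "'w::euclidean_space \<Rightarrow> real^6"
  assumes "open P" "smooth_on P u" "u ` P \<subseteq> H6_dom" "w \<in> P"
  shows "gauge_form (\<lambda>w. u_matrix (u w)) (\<lambda>w. sp_inv (u_matrix (u w))) \<eta> w v =
     sp_inv (u_matrix (u w)) ** \<eta> w v ** u_matrix (u w) + mc_form (u w) (frechet_derivative u (at w) v)"
proof -
  have "frechet_derivative (\<lambda>w. u_matrix (u w)) (at w) v = frechet_derivative u_matrix (at (u w)) (frechet_derivative u (at w) v)"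
    by (rule fun_cong[OF frechet_derivative_eqI[OF has_derivative_compose[OF smooth_on_has_derivative has_derivative_u_matrix]]])
      (use assms in auto)
  then show ?thesis by (simp add: gauge_form_def mc_form_def)
qed

definition normal_connection :: "(real^4) set \<Rightarrow> (real^4 \<Rightarrow> real^4 \<Rightarrow> real^4^4) \<Rightarrow> bool" where
  "normal_connection Z \<eta> \<longleftrightarrow> smooth_form Z \<eta> \<and> (\<forall>z\<in>Z. \<forall>v. \<eta> z v \<in> sp4) \<and>
    (\<forall>z\<in>Z. normal_curvature (\<eta> z) (curvature \<eta> z))"

lemma normal_connectionD:
  assumes "normal_connection Z \<eta>"
  shows "smooth_form Z \<eta>" "z \<in> Z \<Longrightarrow> \<eta> z v \<in> sp4" "z \<in> Z \<Longrightarrow> normal_curvature (\<eta> z) (curvature \<eta> z)"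
  using assms by (auto simp: normal_connection_def)

lemma normal_connection_gauge_form:
  fixes u :: "real^4 \<Rightarrow> real^6"
  assumes Z: "open Z" and u: "smooth_on Z u" "u ` Z \<subseteq> H6_dom" and nc: "normal_connection Z \<eta>"
    and g: "g = (\<lambda>z. u_matrix (u z))" "gi = (\<lambda>z. sp_inv (u_matrix (u z)))"
  shows "smooth_on Z g" "smooth_on Z gi" "z \<in> Z \<Longrightarrow> g z \<in> H6" "z \<in> Z \<Longrightarrow> gi z ** g z = mat 1"
    "normal_connection Z (gauge_form g gi \<eta>)"
proof -
  note \<eta> = normal_connectionD(1,2)[OF nc] and N = normal_connectionD(3)[OF nc]
  show s: "smooth_on Z g" unfolding g by (rule smooth_on_u_matrix_compose[OF Z u])
  show si: "smooth_on Z gi"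
    using smooth_on_bounded_linear[OF bounded_linear_sp_inv Z s] by (simp add: g)
  have H: "g z \<in> H6" if "z \<in> Z" for z using u that by (auto simp: g intro: u_matrix_H6)
  then show "z \<in> Z \<Longrightarrow> g z \<in> H6" .
  from H have sp: "g z \<in> carrier Sp4" if "z \<in> Z" for z using that H6_iff by blast
  have i: "gi z ** g z = mat 1" if "z \<in> Z" for z using sp_inv_left[OF sp[OF that]] by (simp add: g)
  then show "z \<in> Z \<Longrightarrow> gi z ** g z = mat 1" .
  have i': "g z ** gi z = mat 1" if "z \<in> Z" for z using sp_inv_right[OF sp[OF that]] by (simp add: g)
  have 1: "smooth_form Z (gauge_form g gi \<eta>)" by (rule smooth_form_gauge[OF \<eta>(1) Z s si])
  have e: "gauge_form g gi \<eta> z v = sp_inv (g z) ** \<eta> z v ** g z + mc_form (u z) (frechet_derivative u (at z) v)" if "z \<in> Z" for z v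
    unfolding g by (rule gauge_form_u_matrix[OF Z u that])
  have m: "mc_form (u z) v \<in> nonneg_part" if "z \<in> Z" for z v using u that by (intro mc_form_nonneg) auto
  have 2: "gauge_form g gi \<eta> z v \<in> sp4" if "z \<in> Z" for z v
    unfolding e[OF that] using sp4_Ad[OF sp[OF that] \<eta>(2)[OF that]] m[OF that] subspace_sp4
    by (auto intro: subspace_add simp: nonneg_part_iff)
  have 3: "normal_curvature (gauge_form g gi \<eta> z) (curvature (gauge_form g gi \<eta>) z)" if "z \<in> Z" for z
  proof -
    have "curvature (gauge_form g gi \<eta>) z = (\<lambda>v v'. sp_inv (g z) ** curvature \<eta> z v v' ** g z)"
      using curvature_gauge[OF \<eta>(1) Z s si i i' that] by (simp add: fun_eq_iff g that)
    moreover have "gauge_form g gi \<eta> z = (\<lambda>v. sp_inv (g z) ** \<eta> z v ** g z + mc_form (u z) (frechet_derivative u (at z) v))"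
      using e[OF that] by (simp add: fun_eq_iff)
    ultimately show ?thesis
      using normal_curvature_gauge[OF H[OF that] \<eta>(2)[OF that] m[OF that] N[OF that]] by simp
  qed
  show "normal_connection Z (gauge_form g gi \<eta>)"
    using 1 2 3 by (simp add: normal_connection_def)
qed

text \<open>The hypotheses say that \<open>\<eta>\<close> respects the filtration given by the
  frame; six functions on the base then reach the normalisations of
  \<open>normal_connection_unique\<close>. Two steps are made because the sixth function depends on
  the outcome of the first five.\<close>

lemma normal_connection_gauge:
  fixes \<eta> :: "real^4 \<Rightarrow> real^4 \<Rightarrow> real^4^4"
  assumes U: "open U" "smooth_on U F" and Z: "open Z" "Z \<subseteq> U"
    and nc: "normal_connection Z \<eta>"
    and pos: "\<And>z. z \<in> Z \<Longrightarrow> \<eta> z (frame F z 1) $ 4 $ 1 > 0" "\<And>z. z \<in> Z \<Longrightarrow> \<eta> z (frame F z 2) $ 3 $ 1 \<noteq> 0"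
    and zero: "\<And>z a. z \<in> Z \<Longrightarrow> a \<noteq> 1 \<Longrightarrow> \<eta> z (frame F z a) $ 4 $ 1 = 0"
      "\<And>z. z \<in> Z \<Longrightarrow> \<eta> z (frame F z 3) $ 3 $ 1 = 0" "\<And>z. z \<in> Z \<Longrightarrow> \<eta> z (frame F z 4) $ 3 $ 1 = 0"
      "\<And>z. z \<in> Z \<Longrightarrow> \<eta> z (frame F z 4) $ 3 $ 2 = 0" "\<And>z. z \<in> Z \<Longrightarrow> \<eta> z (frame F z 3) $ 2 $ 1 = 0"
  obtains g where "smooth_on Z g" "\<And>z. z \<in> Z \<Longrightarrow> g z \<in> H6"
    "\<And>z v. z \<in> Z \<Longrightarrow> gauge_form g (\<lambda>z. sp_inv (g z)) \<eta> z v = omega_c F z v"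
proof -
  note \<eta> = normal_connectionD(1,2)[OF nc]
  have FZ: "smooth_on Z F" using smooth_on_subset[OF U(2) Z(2)] .
  define X where "X a i j z = \<eta> z (frame F z a) $ i $ j" for a i j z
  have sX: "smooth_on Z (X a i j)" for a i j
    unfolding X_def by (intro smooth_on_vec_nth Z(1) smooth_form_compose_vector[OF Z(1) \<eta>(1) smooth_on_frame[OF Z(1) FZ]])
  have ex: "\<eta> z v $ i $ j = (\<Sum>a\<in>UNIV. om F z v $ a * X a i j z)" if "z \<in> Z" for z v i j
  proof -
    have lin: "linear (\<eta> z)" using \<eta>(1) that by (simp add: smooth_form_def)
    show ?thesis
      by (subst frame_expand[of v F z]) (simp add: linear_sum[OF lin] linear_cmul[OF lin] X_def)
  qed
  define l where "l z = X 1 4 1 z / 2" for z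
  define al where "al z = X 1 3 1 z" for z
  define be where "be z = X 2 3 1 z" for z
  define c1 where "c1 z = X 1 2 1 z" for z
  define c2 where "c2 z = X 2 2 1 z" for z
  have sl: "smooth_on Z l" "smooth_on Z al" "smooth_on Z be" "smooth_on Z c1" "smooth_on Z c2"
    unfolding l_def[abs_def] al_def[abs_def] be_def[abs_def] c1_def[abs_def] c2_def[abs_def]
    by (intro smooth_on_divide smooth_on_const Z(1) sX; simp)+
  have lp: "l z > 0" "be z \<noteq> 0" if "z \<in> Z" for z using pos[OF that] by (simp_all add: l_def be_def X_def)
  \<comment> \<open>The coordinates \<open>u\<^sub>1, \<dots>, u\<^sub>5\<close> that normalise \<open>\<theta>\<^sup>1\<close>, \<open>\<theta>\<^sup>2\<close> and the \<open>\<omega>\<^sup>1\<close>- and \<open>\<omega>\<^sup>2\<close>-components of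
    \<open>\<theta>\<^sup>4\<close>; the remaining one, \<open>u\<^sub>6\<close>, is used below to normalise the \<open>\<omega>\<^sup>1\<close>-component of \<open>\<Omega>\<^sub>1\<close>.\<close>
  define u where "u z = (vector [1 / l z, - al z / (be z * l z), 1 / be z, - (be z * c1 z - c2 z * al z) / (l z)^2,
      - c2 z / l z, 0] :: real^6)" for z
  have su: "smooth_on Z u"
  proof (rule smooth_on_vec[OF Z(1)])
    fix i :: 6
    show "smooth_on Z (\<lambda>z. u z $ i)"
      unfolding u_def
      by (rule forall_6'[of _ i]; simp only: vector_6)
        (intro smooth_intros smooth_on_divide sl Z(1); use lp in force)+
  qed
  have du: "u ` Z \<subseteq> H6_dom" using lp by (auto simp: H6_dom_def u_def)
  define g where "g = (\<lambda>z. u_matrix (u z))"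
  define gi where "gi = (\<lambda>z. sp_inv (u_matrix (u z)))"
  note G = normal_connection_gauge_form[OF Z(1) su du nc g_def gi_def]
  define \<eta>1 where "\<eta>1 = gauge_form g gi \<eta>"
  have m0: "mc_form (w :: real^6) v $ 4 $ 1 = 0" "mc_form w v $ 3 $ 1 = 0" "mc_form w v $ 2 $ 1 = 0" "mc_form w v $ 3 $ 2 = 0"
    if "w \<in> H6_dom" for w v
    using mc_form_nonneg[OF that, of v] by (simp_all add: nonneg_part_iff borel_upper_def)
  have e1: "\<eta>1 z v = sp_inv (g z) ** \<eta> z v ** g z + mc_form (u z) (frechet_derivative u (at z) v)" if "z \<in> Z" for z v
    unfolding \<eta>1_def g_def gi_def by (rule gauge_form_u_matrix[OF Z(1) su du that])
  have H1: "\<eta>1 z v $ 4 $ 1 = 2 * om F z v $ 1" "\<eta>1 z v $ 3 $ 1 = om F z v $ 2"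
    "\<eta>1 z (frame F z 4) $ 3 $ 2 = 0" "\<eta>1 z (frame F z 1) $ 2 $ 1 = 0" "\<eta>1 z (frame F z 2) $ 2 $ 1 = 0"
    "\<eta>1 z (frame F z 3) $ 2 $ 1 = 0" if z: "z \<in> Z" for z v
  proof -
    have uz: "u z \<in> H6_dom" using du z by auto
    define s where "s = sqrt (1 / l z)"
    have s: "s > 0" "s * s = 1 / l z" using lp[OF z] by (simp_all add: s_def)
    note e = H6_conj_entries[OF G(3)[OF z] \<eta>(2)[OF z]]
    have x41: "\<eta> z v $ 4 $ 1 = 2 * l z * om F z v $ 1" for v
      using zero(1)[OF z] by (subst ex[OF z]) (simp add: sum_4 X_def l_def)
    have x31: "\<eta> z v $ 3 $ 1 = al z * om F z v $ 1 + be z * om F z v $ 2" for v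
      using zero(2,3)[OF z] by (subst ex[OF z]) (simp add: sum_4 X_def al_def be_def)
    have gs: "g z $ 1 $ 1 = s" "g z $ 1 $ 2 = - al z / (be z * l z) / (2 * s)" "g z $ 2 $ 2 = 1 / be z / s"
      "g z $ 1 $ 3 = (be z * c1 z - c2 z * al z) / (l z)^2 / (2 * s)" "g z $ 2 $ 3 = c2 z / l z / s" "g z $ 3 $ 3 = s * be z"
      by (simp_all add: g_def u_def s_def diff_divide_distrib)
    have ls: "l z = 1 / (s * s)" using s lp[OF z] by (simp add: field_simps)
    note nz = s(1) lp(2)[OF z]
    show "\<eta>1 z v $ 4 $ 1 = 2 * om F z v $ 1"
      using nz by (simp add: e1[OF z] m0[OF uz] e x41 gs ls)
    show "\<eta>1 z v $ 3 $ 1 = om F z v $ 2"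
      using nz by (simp add: e1[OF z] m0[OF uz] e x41 x31 gs ls field_simps)
    show "\<eta>1 z (frame F z 4) $ 3 $ 2 = 0"
      using zero(4)[OF z] by (simp add: e1[OF z] m0[OF uz] e x41 x31 om_frame axis_def)
    have c: "\<eta> z (frame F z 1) $ 2 $ 1 = c1 z" "\<eta> z (frame F z 2) $ 2 $ 1 = c2 z" by (simp_all add: c1_def c2_def X_def)
    show "\<eta>1 z (frame F z 1) $ 2 $ 1 = 0"
      using nz by (simp add: e1[OF z] m0[OF uz] e x41 x31 om_frame axis_def c gs ls) (simp add: field_simps power2_eq_square)
    show "\<eta>1 z (frame F z 2) $ 2 $ 1 = 0"
      using nz by (simp add: e1[OF z] m0[OF uz] e x41 x31 om_frame axis_def c gs ls)
    show "\<eta>1 z (frame F z 3) $ 2 $ 1 = 0"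
      using zero(5)[OF z] by (simp add: e1[OF z] m0[OF uz] e x41 x31 om_frame axis_def)
  qed
  \<comment> \<open>Conjugation by a unipotent matrix with the single off-diagonal entry
    \<open>- s z / 2\<close> in position (1,4) adds \<open>s z / 2\<close> times the entry (4,1) to
    the entry (1,1). On the first frame vector the entry (4,1) is 2, so \<open>s\<close> is exactly
    the missing amount.\<close>
  define s where "s z = omega_c F z (frame F z 1) $ 1 $ 1 - \<eta>1 z (frame F z 1) $ 1 $ 1" for z
  have ss: "smooth_on Z s"
    unfolding s_def
    by (intro smooth_on_diff smooth_on_vec_nth Z(1) smooth_form_compose_vector[OF Z(1) _ smooth_on_frame[OF Z(1) FZ]]
        smooth_form_omega_c FZ) (use normal_connectionD(1)[OF G(5)] in \<open>simp add: \<eta>1_def\<close>)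
  define u2 where "u2 z = (vector [1, 0, 1, 0, 0, s z] :: real^6)" for z
  have su2: "smooth_on Z u2"
  proof (rule smooth_on_vec[OF Z(1)])
    fix i :: 6
    show "smooth_on Z (\<lambda>z. u2 z $ i)"
      unfolding u2_def by (rule forall_6'[of _ i]; simp only: vector_6; intro smooth_on_const Z(1) ss)
  qed
  have du2: "u2 ` Z \<subseteq> H6_dom" by (auto simp: H6_dom_def u2_def)
  define h where "h = (\<lambda>z. u_matrix (u2 z))"
  define hi where "hi = (\<lambda>z. sp_inv (u_matrix (u2 z)))"
  note G1 = G(5)[folded \<eta>1_def]
  note H = normal_connection_gauge_form[OF Z(1) su2 du2 G1 h_def hi_def]
  define \<eta>2 where "\<eta>2 = gauge_form h hi \<eta>1"
  have e2: "\<eta>2 z v = sp_inv (h z) ** \<eta>1 z v ** h z + mc_form (u2 z) (frechet_derivative u2 (at z) v)" if "z \<in> Z" for z v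
    unfolding \<eta>2_def h_def hi_def by (rule gauge_form_u_matrix[OF Z(1) su2 du2 that])
  have hs: "h z $ 1 $ 1 = 1" "h z $ 1 $ 2 = 0" "h z $ 1 $ 3 = 0" "h z $ 1 $ 4 = - s z / 2" "h z $ 2 $ 1 = 0" "h z $ 2 $ 2 = 1" "h z $ 2 $ 3 = 0"
    "h z $ 2 $ 4 = 0" "h z $ 3 $ 1 = 0" "h z $ 3 $ 2 = 0" "h z $ 3 $ 3 = 1" "h z $ 3 $ 4 = 0" "h z $ 4 $ 1 = 0" "h z $ 4 $ 2 = 0" "h z $ 4 $ 3 = 0" "h z $ 4 $ 4 = 1" for z
    by (simp_all add: h_def u2_def)
  have H2: "\<eta>2 z v $ 4 $ 1 = \<eta>1 z v $ 4 $ 1" "\<eta>2 z v $ 3 $ 1 = \<eta>1 z v $ 3 $ 1"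
    "\<eta>2 z v $ 3 $ 2 = \<eta>1 z v $ 3 $ 2" "\<eta>2 z v $ 2 $ 1 = \<eta>1 z v $ 2 $ 1"
    "\<eta>2 z v $ 1 $ 1 = \<eta>1 z v $ 1 $ 1 + s z / 2 * \<eta>1 z v $ 4 $ 1" if z: "z \<in> Z" for z v
  proof -
    have uz: "u2 z \<in> H6_dom" using du2 z by auto
    note e = H6_conj_entries[OF H(3)[OF z] normal_connectionD(2)[OF G1 z]]
    show "\<eta>2 z v $ 4 $ 1 = \<eta>1 z v $ 4 $ 1" "\<eta>2 z v $ 3 $ 1 = \<eta>1 z v $ 3 $ 1"
      "\<eta>2 z v $ 3 $ 2 = \<eta>1 z v $ 3 $ 2" "\<eta>2 z v $ 2 $ 1 = \<eta>1 z v $ 2 $ 1"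
      by (simp_all add: e2[OF z] m0[OF uz] e hs)
    \<comment> \<open>The first column of \<open>h\<close> is constant, so the term with the
      derivative of \<open>h\<close> does not reach the entry (1,1).\<close>
    have dh: "frechet_derivative h (at z) v $ k $ 1 = 0" for k
    proof -
      have diff: "h differentiable (at z)" by (rule smooth_on_differentiable[OF H(1) z])
      have c: "(\<lambda>z. h z $ k $ 1) = (\<lambda>z. if k = 1 then 1 else 0)"
        by (rule forall_4'[of _ k]; simp add: hs)
      have L: "bounded_linear (\<lambda>A::real^4^4. A $ k $ 1)"
        using bounded_linear_compose[OF bounded_linear_vec_nth bounded_linear_vec_nth] .
      have "frechet_derivative (\<lambda>z. h z $ k $ 1) (at z) v = frechet_derivative h (at z) v $ k $ 1"
        by (rule frechet_derivative_bounded_linear[OF L diff])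
      then show ?thesis unfolding c by simp
    qed
    have "\<eta>2 z v $ 1 $ 1 = (hi z ** \<eta>1 z v ** h z) $ 1 $ 1 + (hi z ** frechet_derivative h (at z) v) $ 1 $ 1"
      by (simp add: \<eta>2_def gauge_form_def)
    also have "(hi z ** frechet_derivative h (at z) v) $ 1 $ 1 = 0"
      by (simp add: matrix_matrix_mult_def dh)
    also have "(hi z ** \<eta>1 z v ** h z) $ 1 $ 1 = \<eta>1 z v $ 1 $ 1 + s z / 2 * \<eta>1 z v $ 4 $ 1"
    proof -
      have "hi z = sp_inv (h z)" by (simp add: hi_def h_def)
      then show ?thesis by (simp add: sp_inv_nth matrix_matrix_mult_def sum_4 hs)
    qed
    finally show "\<eta>2 z v $ 1 $ 1 = \<eta>1 z v $ 1 $ 1 + s z / 2 * \<eta>1 z v $ 4 $ 1" by simp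
  qed
  have uniq: "\<eta>2 z v = omega_c F z v" if "z \<in> Z" for z v
  proof (rule normal_connection_unique[OF U Z normal_connectionD[OF H(5)[folded \<eta>2_def]] _ _ _ _ _ _ _ that])
    show "\<eta>2 z (frame F z 1) $ 1 $ 1 = omega_c F z (frame F z 1) $ 1 $ 1" if "z \<in> Z" for z
      by (simp add: H2[OF that] H1[OF that] om_frame axis_def s_def field_simps)
  qed (simp_all add: H1 H2 omega_c_entries)
  show thesis
  proof (rule that)
    show "smooth_on Z (\<lambda>z. g z ** h z)" by (intro smooth_on_matrix_mult Z(1) G(1) H(1))
    show "g z ** h z \<in> H6" if "z \<in> Z" for z using G(3) H(3) that H6_mult by blast
    show "gauge_form (\<lambda>z. g z ** h z) (\<lambda>z. sp_inv (g z ** h z)) \<eta> z v = omega_c F z v" if "z \<in> Z" for z v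
    proof -
      have "(\<lambda>z. sp_inv (g z ** h z)) = (\<lambda>z. hi z ** gi z)" by (simp add: sp_inv_mult hi_def gi_def h_def g_def)
      then have "gauge_form (\<lambda>z. g z ** h z) (\<lambda>z. sp_inv (g z ** h z)) \<eta> z v = \<eta>2 z v"
        using gauge_form_compose[OF Z(1) G(1) H(1) that, of gi hi \<eta> v] G(4)[OF that] by (simp add: \<eta>2_def \<eta>1_def)
      then show ?thesis using uniq[OF that] by simp
    qed
  qed
qed

lemma diffeo_inj_derivative:
  assumes "diffeo A B f" "x \<in> A"
  shows "inj (frechet_derivative f (at x))"
proof -
  have A: "open A" "smooth_on A f" "smooth_on B (inv_into A f)" "f x \<in> B" "inj_on f A"
    using assms by (auto simp: diffeo_def bij_betw_def)
  have 1: "((\<lambda>x. inv_into A f (f x)) has_derivative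
     (\<lambda>v. frechet_derivative (inv_into A f) (at (f x)) (frechet_derivative f (at x) v))) (at x)"
    by (rule has_derivative_compose[OF smooth_on_has_derivative[OF A(2) assms(2)] smooth_on_has_derivative[OF A(3,4)]])
  have 2: "((\<lambda>x. inv_into A f (f x)) has_derivative (\<lambda>v. v)) (at x)"
    by (rule has_derivative_transform_within_open[OF has_derivative_ident A(1) assms(2)]) (simp add: A(5))
  have "frechet_derivative (inv_into A f) (at (f x)) (frechet_derivative f (at x) v) = v" for v
    using fun_cong[OF has_derivative_unique[OF 1 2], of v] .
  then show ?thesis by (metis injI)
qed

text \<open>The lift sends the fibre matrix \<open>u\<close> over \<open>z\<close> to
  \<open>g z ** u\<close> over \<open>\<phi> z\<close>; by the product rule the gauge term of
  \<open>g\<close> and the Maurer-Cartan term of the fibre add up to the first connection.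
  Preserving a bijective coframe forces an injective derivative, so the lift is a local
  diffeomorphism.\<close>

lemma coframe_equivalent_of_gauge:
  assumes U: "open U" "smooth_on U F" and U': "open U'" "smooth_on U' F'" and Z: "open Z" "Z \<subseteq> U" "z \<in> Z"
    and \<phi>: "smooth_on Z \<phi>" "\<phi> ` Z \<subseteq> U'"
    and g: "smooth_on Z g" "\<And>z. z \<in> Z \<Longrightarrow> g z \<in> H6"
    and eq: "\<And>z v. z \<in> Z \<Longrightarrow> gauge_form g (\<lambda>z. sp_inv (g z)) (pullback_form \<phi> (omega_c F')) z v = omega_c F z v"
  shows "coframe_equivalent U F z U' F' (\<phi> z)"
proof -
  define P where "P = Pc Z"
  have P: "open P" "P \<subseteq> Pc U" unfolding P_def using open_Pc[OF Z(1)] Z(2) by (auto simp: Pc_def)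
  define \<Phi> where "\<Phi> w = (\<phi> (fst w), u_coords (g (fst w) ** hat_g w))" for w
  have fz: "fst w \<in> Z" if "w \<in> P" for w using that by (auto simp: P_def Pc_def)
  have gh: "g (fst w) ** hat_g w \<in> H6" if "w \<in> P" for w
    using that g(2)[OF fz[OF that]] hat_g_H6[of w Z] by (auto simp: P_def intro: H6_mult)
  have sfst: "smooth_on P fst" using smooth_on_fst[OF P(1) smooth_on_id[OF P(1)]] by simp
  have fP: "fst ` P \<subseteq> Z" using fz by (rule image_subsetI)
  note sg = smooth_on_compose[OF P(1) Z(1) fP g(1) sfst] smooth_on_compose[OF P(1) Z(1) fP \<phi>(1) sfst]
  have sh: "smooth_on P hat_g" unfolding P_def by (rule smooth_on_hat_g[OF Z(1)])
  have s\<Phi>: "smooth_on P \<Phi>"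
    unfolding \<Phi>_def
    by (intro smooth_on_Pair smooth_on_u_coords_compose smooth_on_matrix_mult P(1) sg sh) (use gh in auto)
  have \<Phi>P: "\<Phi> w \<in> Pc U'" if "w \<in> P" for w
    using \<phi>(2) fz[OF that] u_coords_mem[OF gh[OF that]] by (auto simp: \<Phi>_def Pc_def)
  have hat\<Phi>: "hat_g (\<Phi> w) = g (fst w) ** hat_g w" if "w \<in> P" for w
    using u_coords_mem[OF gh[OF that]] by (simp add: \<Phi>_def hat_g_def)
  have om: "omega_hat F' (\<Phi> w) (frechet_derivative \<Phi> (at w) v) = omega_hat F w v" if w: "w \<in> P" for w v
  proof -
    let ?z = "fst w" and ?h = "hat_g w" and ?V = "frechet_derivative \<Phi> (at w) v"
    have wU: "w \<in> Pc U" and wZ: "w \<in> Pc Z" using w P by (auto simp: P_def)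
    have d\<Phi>: "(\<Phi> has_derivative frechet_derivative \<Phi> (at w)) (at w)" by (rule smooth_on_has_derivative[OF s\<Phi> w])
    have dg: "(g has_derivative frechet_derivative g (at ?z)) (at ?z)" "(\<phi> has_derivative frechet_derivative \<phi> (at ?z)) (at ?z)"
      using smooth_on_has_derivative[OF g(1) fz[OF w]] smooth_on_has_derivative[OF \<phi>(1) fz[OF w]] .
    note dfst = bounded_linear_imp_has_derivative[OF bounded_linear_fst, of "at w"]
    have 1: "fst ?V = frechet_derivative \<phi> (at ?z) (fst v)"
    proof -
      have "((\<lambda>w. fst (\<Phi> w)) has_derivative (\<lambda>v. frechet_derivative \<phi> (at ?z) (fst v))) (at w)"
        using has_derivative_compose[OF dfst dg(2)] by (simp add: \<Phi>_def)
      from fun_cong[OF has_derivative_unique[OF has_derivative_fst[OF d\<Phi>] this], of v] show ?thesis .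
    qed
    have 2: "frechet_derivative u_matrix (at (snd (\<Phi> w))) (snd ?V)
        = g ?z ** frechet_derivative hat_g (at w) v + frechet_derivative g (at ?z) (fst v) ** ?h"
    proof -
      have a: "((\<lambda>w. hat_g (\<Phi> w)) has_derivative (\<lambda>v. frechet_derivative u_matrix (at (snd (\<Phi> w))) (snd (frechet_derivative \<Phi> (at w) v)))) (at w)"
        unfolding hat_g_def
        by (rule has_derivative_compose[OF has_derivative_snd[OF d\<Phi>] has_derivative_u_matrix])
          (use \<Phi>P[OF w] in \<open>auto simp: Pc_def\<close>)
      have b: "((\<lambda>w. g (fst w) ** hat_g w) has_derivative (\<lambda>v. g ?z ** frechet_derivative hat_g (at w) v
          + frechet_derivative g (at ?z) (fst v) ** ?h)) (at w)"
        by (intro bounded_bilinear.FDERIV[OF bounded_bilinear_matrix_mult] has_derivative_compose[OF dfst dg(1)]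
            smooth_on_has_derivative[OF sh w])
      have c: "((\<lambda>w. hat_g (\<Phi> w)) has_derivative (\<lambda>v. g ?z ** frechet_derivative hat_g (at w) v
          + frechet_derivative g (at ?z) (fst v) ** ?h)) (at w)"
        by (rule has_derivative_transform_within_open[OF b P(1) w]) (simp add: hat\<Phi>)
      from fun_cong[OF has_derivative_unique[OF a c], of v] show ?thesis .
    qed
    have gi: "hat_gi (\<Phi> w) = sp_inv ?h ** sp_inv (g ?z)"
      using hat\<Phi>[OF w] by (simp add: hat_gi_def hat_g_def[symmetric] sp_inv_mult)
    have gg: "sp_inv (g ?z) ** (g ?z ** X) = X" for X :: "real^4^4"
      using sp_inv_left[of "g ?z"] g(2)[OF fz[OF w]] by (simp add: matrix_mul_assoc H6_iff)
    have "omega_hat F' (\<Phi> w) ?V = sp_inv ?h ** gauge_form g (\<lambda>z. sp_inv (g z)) (pullback_form \<phi> (omega_c F')) ?z (fst v) ** ?h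
        + sp_inv ?h ** frechet_derivative hat_g (at w) v"
      unfolding omega_hat_eq[OF \<Phi>P[OF w]] mc_form_def 2 gi[unfolded hat_gi_def] gi hat\<Phi>[OF w] 1
      by (simp add: \<Phi>_def gauge_form_def pullback_form_def matrix_mult_simps matrix_mul_assoc[symmetric] gg)
    also have "\<dots> = omega_hat F w v"
      unfolding eq[OF fz[OF w]] omega_hat_eq[OF wU] frechet_derivative_hat_g[OF wZ]
      by (simp add: mc_form_def hat_gi_def hat_g_def)
    finally show ?thesis .
  qed
  have cof: "coframe F' (\<Phi> w) (frechet_derivative \<Phi> (at w) v) = coframe F w v" if "w \<in> P" for w v
    using om[OF that] by (simp add: coframe_def)
  define w where "w = (z, unit_coords)"
  have w: "w \<in> P" using Z unit_coords_H6_dom by (simp add: w_def P_def Pc_def)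
  have "inj (frechet_derivative \<Phi> (at w))"
  proof (rule injI)
    fix v v' assume "frechet_derivative \<Phi> (at w) v = frechet_derivative \<Phi> (at w) v'"
    then have "coframe F w v = coframe F w v'" using cof[OF w, of v] cof[OF w, of v'] by simp
    then show "v = v'" using coframe_bij[OF U subsetD[OF P(2) w]] by (simp add: bij_def inj_eq)
  qed
  from smooth_local_diffeo[OF P(1) s\<Phi> w this]
  obtain A where A: "open A" "w \<in> A" "A \<subseteq> P" "diffeo A (\<Phi> ` A) \<Phi>" by metis
  have "coframe_iso U F U' F' A (\<Phi> ` A) \<Phi>"
    unfolding coframe_iso_def
  proof (intro conjI ballI allI)
    show "A \<subseteq> Pc U" "\<Phi> ` A \<subseteq> Pc U'" using A(3) P(2) \<Phi>P by auto
  qed (use A cof in auto)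
  moreover have "fst w = z" "fst (\<Phi> w) = \<phi> z" by (simp_all add: w_def \<Phi>_def)
  ultimately show ?thesis
    unfolding coframe_equivalent_def using A(2) by metis
qed

lemma smooth_on_prolong:
  assumes V: "open V" "smooth_on V f" and Z: "open Z"
    and jV: "\<And>z. z \<in> Z \<Longrightarrow> jet1 z \<in> V" and nz: "\<And>z. z \<in> Z \<Longrightarrow> total_D1 (\<lambda>x. f x $ 1) z \<noteq> 0"
  shows "smooth_on Z (prolong f)"
proof -
  have sj: "smooth_on Z jet1" by (rule smooth_on_bounded_linear[OF bounded_linear_jet1 Z smooth_on_id[OF Z]])
  have jZ: "jet1 ` Z \<subseteq> V" using jV by auto
  have spd: "smooth_on Z (\<lambda>z. pd i (\<lambda>x. f x $ k) (jet1 z))" for i k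
    unfolding pd_def
    by (rule smooth_on_compose[OF Z V(1) jZ _ sj]) (intro smooth_on_derivative smooth_on_vec_nth V)
  have sf: "smooth_on Z (\<lambda>z. f (jet1 z) $ k)" for k
    by (rule smooth_on_compose[OF Z V(1) jZ _ sj]) (intro smooth_on_vec_nth V)
  have quot: "smooth_on Z (\<lambda>z. total_D1 (\<lambda>x. f x $ 3) z / total_D1 (\<lambda>x. f x $ 1) z)"
    unfolding total_D1_def
    by (intro smooth_on_divide smooth_on_add smooth_on_mult spd Z smooth_on_vec_nth smooth_on_id)
      (use nz in \<open>simp add: total_D1_def\<close>)
  show ?thesis
  proof (rule smooth_on_vec[OF Z])
    fix i :: 4
    show "smooth_on Z (\<lambda>z. prolong f z $ i)"
      unfolding prolong_def by (rule forall_4'[of _ i]) (simp_all only: vector_4 sf quot)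
  qed
qed

lemma contact_imp_coframe:
  assumes U: "open U" "smooth_on U F" and U': "open U'" "smooth_on U' F'"
    and c: "cooriented_contact_equivalent U F z U' F' z'"
  shows "coframe_equivalent U F z U' F' z'"
proof -
  obtain V f Z where ct: "contact_transformation V f" and co: "cooriented V f" and ode: "maps_ode U F U' F' V f Z"
    and zZ: "z \<in> Z" and zz: "prolong f z = z'"
    using c unfolding cooriented_contact_equivalent_def by metis
  have V: "open V" "smooth_on V f" and dV: "diffeo V (f ` V) f"
    using ct by (auto simp: contact_transformation_def diffeo_def)
  have Z: "open Z" "Z \<subseteq> U" using ode by (auto simp: maps_ode_def)
  have o: "jet1 z \<in> V" "total_D1 (\<lambda>x. f x $ 1) z \<noteq> 0" "prolong f z \<in> U'"
    "F' (prolong f z) = total_D F (\<lambda>z. prolong f z $ 4) z / total_D F (\<lambda>z. prolong f z $ 1) z" if "z \<in> Z" for z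
    using ode that unfolding maps_ode_def by blast+
  have diff: "f differentiable (at (jet1 z))" if "z \<in> Z" for z
    using smooth_on_differentiable[OF V(2) o(1)[OF that]] .
  define \<phi> where "\<phi> = prolong f"
  have s\<phi>: "smooth_on Z \<phi>"
    unfolding \<phi>_def by (rule smooth_on_prolong[OF V Z(1) o(1,2)])
  define \<eta> where "\<eta> = pullback_form \<phi> (omega_c F')"
  have \<phi>Z: "\<phi> ` Z \<subseteq> U'" using o(3) by (auto simp: \<phi>_def)
  note so' = smooth_form_omega_c[OF U']
  have \<eta>1: "smooth_form Z \<eta>" unfolding \<eta>_def by (rule smooth_form_pullback[OF so' U'(1) s\<phi> Z(1) \<phi>Z])
  have \<eta>2: "\<eta> z v \<in> sp4" for z v by (simp add: \<eta>_def pullback_form_def omega_c_sp4)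
  have \<eta>3: "normal_curvature (\<eta> z) (curvature \<eta> z)" if "z \<in> Z" for z
  proof -
    have "\<phi> z \<in> U'" using \<phi>Z that by auto
    note n = normal_curvature_compose[OF normal_curvature_omega_c[OF U' this], of "frechet_derivative \<phi> (at z)"]
    have "curvature \<eta> z = (\<lambda>v v'. curvature (omega_c F') (\<phi> z) (frechet_derivative \<phi> (at z) v) (frechet_derivative \<phi> (at z) v'))"
      unfolding \<eta>_def by (intro ext curvature_pullback[OF so' U'(1) s\<phi> Z(1) \<phi>Z that])
    with n show ?thesis by (simp add: \<eta>_def pullback_form_def[abs_def])
  qed
  define T where "T z = frechet_derivative \<phi> (at z)" for z
  define Df where "Df z = frechet_derivative f (at (jet1 z))" for z
  have ent: "\<eta> z v $ 4 $ 1 = 2 * om1 (\<phi> z) (T z v)" "\<eta> z v $ 3 $ 1 = om2 (\<phi> z) (T z v)"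
    "\<eta> z v $ 3 $ 2 = om3 F' (\<phi> z) (T z v)" "\<eta> z v $ 2 $ 1 = om4 (\<phi> z) (T z v)" for z v
    by (simp_all add: \<eta>_def pullback_form_def T_def omega_c_entries om_def)
  have linDf: "linear (Df z)" and injDf: "inj (Df z)" if "z \<in> Z" for z
    unfolding Df_def
    using smooth_on_linear_derivative[OF V(2) o(1)[OF that]] diffeo_inj_derivative[OF dV o(1)[OF that]] .
  \<comment> \<open>\<open>prolong f\<close> covers \<open>f\<close>, so the first three components
    of its derivative come from the derivative of \<open>f\<close> on first jets.\<close>
  have jT: "T z v $ 1 = Df z (jet1 v) $ 1" "T z v $ 2 = Df z (jet1 v) $ 2" "T z v $ 3 = Df z (jet1 v) $ 3" if z: "z \<in> Z" for z v
  proof -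
    have 1: "((\<lambda>z. jet1 (\<phi> z)) has_derivative (\<lambda>v. jet1 (T z v))) (at z)"
      unfolding T_def by (rule bounded_linear.has_derivative[OF bounded_linear_jet1 smooth_on_has_derivative[OF s\<phi> z]])
    have 2: "((\<lambda>z. f (jet1 z)) has_derivative (\<lambda>v. Df z (jet1 v))) (at z)"
      unfolding Df_def by (rule has_derivative_compose[OF bounded_linear_imp_has_derivative[OF bounded_linear_jet1]
          smooth_on_has_derivative[OF V(2) o(1)[OF z]]])
    have e: "(\<lambda>z. jet1 (\<phi> z)) = (\<lambda>z. f (jet1 z))" by (simp add: fun_eq_iff \<phi>_def prolong_def vec_eq_iff forall_3)
    have "jet1 (T z v) = Df z (jet1 v)" using fun_cong[OF has_derivative_unique[OF 1[unfolded e] 2], of v] .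
    then have "jet1 (T z v) $ k = Df z (jet1 v) $ k" for k by simp
    from this[of 1] this[of 2] this[of 3]
    show "T z v $ 1 = Df z (jet1 v) $ 1" "T z v $ 2 = Df z (jet1 v) $ 2" "T z v $ 3 = Df z (jet1 v) $ 3" by simp_all
  qed
  have \<phi>3: "\<phi> z $ 3 = f (jet1 z) $ 3" for z by (simp add: \<phi>_def prolong_def)
  have pdD: "pd i (\<lambda>x. f x $ k) (jet1 z) = Df z (axis i 1) $ k" if "z \<in> Z" for z i k
    unfolding Df_def by (rule pd_nth_component[OF diff[OF that]])
  have ct': "\<phi> z $ 3 * Df z (axis 3 1) $ 1 = Df z (axis 3 1) $ 2"
    "\<phi> z $ 3 * (Df z (axis 1 1) $ 1 + z $ 3 * Df z (axis 2 1) $ 1) = Df z (axis 1 1) $ 2 + z $ 3 * Df z (axis 2 1) $ 2"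
    "Df z (axis 2 1) $ 2 - \<phi> z $ 3 * Df z (axis 2 1) $ 1 > 0" if z: "z \<in> Z" for z
  proof -
    have j: "jet1 z $ 3 = z $ 3" by (simp add: jet1_def)
    have c: "f (jet1 z) $ 3 * pd 3 (\<lambda>x. f x $ 1) (jet1 z) = pd 3 (\<lambda>x. f x $ 2) (jet1 z)"
      "f (jet1 z) $ 3 * (pd 1 (\<lambda>x. f x $ 1) (jet1 z) + jet1 z $ 3 * pd 2 (\<lambda>x. f x $ 1) (jet1 z))
        = pd 1 (\<lambda>x. f x $ 2) (jet1 z) + jet1 z $ 3 * pd 2 (\<lambda>x. f x $ 2) (jet1 z)"
      "pd 2 (\<lambda>x. f x $ 2) (jet1 z) - f (jet1 z) $ 3 * pd 2 (\<lambda>x. f x $ 1) (jet1 z) > 0"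
      using ct co o(1)[OF z] unfolding contact_transformation_def cooriented_def Let_def by blast+
    show "\<phi> z $ 3 * Df z (axis 3 1) $ 1 = Df z (axis 3 1) $ 2"
      "\<phi> z $ 3 * (Df z (axis 1 1) $ 1 + z $ 3 * Df z (axis 2 1) $ 1) = Df z (axis 1 1) $ 2 + z $ 3 * Df z (axis 2 1) $ 2"
      "Df z (axis 2 1) $ 2 - \<phi> z $ 3 * Df z (axis 2 1) $ 1 > 0"
      using c unfolding j by (simp_all add: pdD[OF z, symmetric] \<phi>3)
  qed
  have D4: "Df z (vector [1, z$3, z$4]) $ 3 = \<phi> z $ 4 * Df z (vector [1, z$3, z$4]) $ 1"
    "Df z (vector [1, z$3, z$4]) $ 1 \<noteq> 0" if z: "z \<in> Z" for z
  proof -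
    have t: "total_D1 (\<lambda>x. f x $ k) z = Df z (vector [1, z$3, z$4]) $ k" for k
      unfolding Df_def by (rule total_D1_nth[OF diff[OF z]])
    show "Df z (vector [1, z$3, z$4]) $ 1 \<noteq> 0" using o(2)[OF z] by (simp add: t)
    then show "Df z (vector [1, z$3, z$4]) $ 3 = \<phi> z $ 4 * Df z (vector [1, z$3, z$4]) $ 1"
      by (simp add: \<phi>_def prolong_def t)
  qed
  have jf: "jet1 (frame F z 1) = axis 2 1" "jet1 (frame F z 2) = axis 3 1" "jet1 (frame F z 3) = 0"
    "jet1 (frame F z 4) = vector [1, z$3, z$4]" for z
    by (simp_all add: vec_eq_iff forall_3 frame_def axis_def)
  have dx: "Df z (vector [1, z$3, z$4]) = Df z (axis 1 1) + z$3 *\<^sub>R Df z (axis 2 1) + z$4 *\<^sub>R Df z (axis 3 1)" if "z \<in> Z" for z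
    by (subst vec3_sum[of "vector [1, z$3, z$4]"]) (simp add: linear_add[OF linDf[OF that]] linear_cmul[OF linDf[OF that]])
  \<comment> \<open>From here to \<open>be\<close> the hypotheses of
    \<open>normal_connection_gauge\<close> are collected: the first frame vector yields the
    coorientation factor, the others the contact condition and the prolongation formula.\<close>
  have b1: "om1 (\<phi> z) (T z (frame F z 1)) > 0" if "z \<in> Z" for z
    using ct'(3)[OF that] by (simp add: om1_def jT[OF that] jf)
  have b2: "om1 (\<phi> z) (T z (frame F z 2)) = 0" if "z \<in> Z" for z
    using ct'(1)[OF that] by (simp add: om1_def jT[OF that] jf)
  have b3: "om1 (\<phi> z) (T z (frame F z 3)) = 0" "om2 (\<phi> z) (T z (frame F z 3)) = 0" "om4 (\<phi> z) (T z (frame F z 3)) = 0" if "z \<in> Z" for z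
    by (simp_all add: om1_def om2_def om4_def jT[OF that] jf linear_0[OF linDf[OF that]])
  have b4: "om1 (\<phi> z) (T z (frame F z 4)) = 0" "om2 (\<phi> z) (T z (frame F z 4)) = 0" if "z \<in> Z" for z
    using ct'(1,2)[OF that] D4[OF that]
    by (simp_all add: om1_def om2_def jT[OF that] jf) (simp add: dx[OF that] algebra_simps)
  \<comment> \<open>Here \<open>maps_ode\<close> contributes the correspondence of the two
    equations: the total derivative of the last prolonged component is prescribed by
    \<open>F'\<close>.\<close>
  have b4': "om3 F' (\<phi> z) (T z (frame F z 4)) = 0" if z: "z \<in> Z" for z
  proof -
    have "total_D F (\<lambda>z. prolong f z $ k) z = T z (frame F z 4) $ k" for k
      using total_D_nth[OF smooth_on_differentiable[OF s\<phi> z], of F k] by (simp add: T_def \<phi>_def)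
    then have "F' (\<phi> z) * T z (frame F z 4) $ 1 = T z (frame F z 4) $ 4"
      using o(4)[OF z] D4(2)[OF z] by (simp add: \<phi>_def[symmetric] jT[OF z] jf)
    then have "om3 F' (\<phi> z) (T z (frame F z 4)) = - 1/3 * Dq F' (\<phi> z) * om2 (\<phi> z) (T z (frame F z 4))
        + K_fun F' (\<phi> z) * om1 (\<phi> z) (T z (frame F z 4))"
      by (simp add: om3_def om1_def om2_def)
    then show ?thesis by (simp add: b4[OF z])
  qed
  \<comment> \<open>Otherwise the images of the third coordinate direction and of
    \<open>(1, p, q)\<close> would satisfy the same two linear relations, which leave only a line,
    and would be proportional, against injectivity of the derivative of \<open>f\<close>.\<close>
  have be: "om2 (\<phi> z) (T z (frame F z 2)) \<noteq> 0" if z: "z \<in> Z" for z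
  proof
    assume "om2 (\<phi> z) (T z (frame F z 2)) = 0"
    then have 3: "Df z (axis 3 1) $ 3 = \<phi> z $ 4 * Df z (axis 3 1) $ 1"
      by (simp add: om2_def jT[OF z] jf)
    let ?d = "vector [1, z$3, z$4] :: real^3"
    define t where "t = Df z (axis 3 1) $ 1 / Df z ?d $ 1"
    have d2: "Df z ?d $ 2 = \<phi> z $ 3 * Df z ?d $ 1" using b4(1)[OF z] by (simp add: om1_def jT[OF z] jf)
    have t1: "Df z (axis 3 1) $ 1 = t * Df z ?d $ 1" using D4(2)[OF z] by (simp add: t_def)
    have "Df z (axis 3 1) = t *\<^sub>R Df z ?d"
      unfolding vec_eq_iff forall_3 using ct'(1)[OF z] 3 D4(1)[OF z] d2 t1 by (simp add: algebra_simps)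
    also have "\<dots> = Df z (t *\<^sub>R ?d)" by (simp add: linear_cmul[OF linDf[OF z]])
    finally have "axis 3 1 = t *\<^sub>R ?d" using injDf[OF z] by (simp add: inj_eq)
    then have "(axis 3 1 :: real^3) $ 1 = t" "(axis 3 1 :: real^3) $ 3 = t * z$4" by simp_all
    then show False by (simp add: axis_def)
  qed
  have nc: "normal_connection Z \<eta>" using \<eta>1 \<eta>2 \<eta>3 by (simp add: normal_connection_def)
  obtain g where g: "smooth_on Z g" "\<And>z. z \<in> Z \<Longrightarrow> g z \<in> H6"
    "\<And>z v. z \<in> Z \<Longrightarrow> gauge_form g (\<lambda>z. sp_inv (g z)) \<eta> z v = omega_c F z v"
  proof (rule normal_connection_gauge[OF U Z nc])
    show "\<eta> z (frame F z a) $ 4 $ 1 = 0" if "z \<in> Z" "a \<noteq> 1" for z a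
      using that b2[OF that(1)] b3[OF that(1)] b4[OF that(1)] exhaust_4[of a] by (auto simp: ent)
  qed (simp_all add: ent b1 b3 b4 b4' be)
  have "coframe_equivalent U F z U' F' (\<phi> z)"
    by (rule coframe_equivalent_of_gauge[OF U U' Z zZ s\<phi> \<phi>Z g(1,2) g(3)[unfolded \<eta>_def]])
  then show ?thesis using zz by (simp add: \<phi>_def)
qed

section \<open>Contact equivalence and coframe equivalence\<close>

lemma diffeo_restrict:
  assumes f: "diffeo A B f" and A': "A' \<subseteq> A" "open A'"
  shows "diffeo A' (f ` A') f"
proof -
  have A: "open A" "open B" "inj_on f A" "f ` A = B" "smooth_on A f" "smooth_on B (inv_into A f)"
    using f by (auto simp: diffeo_def bij_betw_def)
  have inj: "inj_on f A'" using inj_on_subset[OF A(3) A'(1)] .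
  have "f ` A' = B \<inter> inv_into A f -` A'"
    using A(3,4) A'(1) by (force simp: inv_into_f_f)
  then have o: "open (f ` A')"
    using continuous_open_preimage[OF smooth_on_continuous_on[OF A(6)] A(2) A'(2)] by simp
  have "smooth_on (f ` A') (inv_into A f)" by (rule smooth_on_subset[OF A(6)]) (use A A' in auto)
  moreover have "inv_into A f y = inv_into A' f y" if "y \<in> f ` A'" for y
    using that inj A(3) A'(1) by (auto simp: inv_into_f_f subset_iff)
  ultimately have "smooth_on (f ` A') (inv_into A' f)" using smooth_on_cong[OF o] by metis
  then show ?thesis
    using o A'(2) inj smooth_on_subset[OF A(5) A'(1)] by (simp add: diffeo_def bij_betw_def)
qed

section \<open>The sign of the coorientation factor\<close>

definition coorientation :: "(real^3 \<Rightarrow> real^3) \<Rightarrow> real^3 \<Rightarrow> real" where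
  "coorientation f x = pd 2 (\<lambda>x. f x $ 2) x - f x $ 3 * pd 2 (\<lambda>x. f x $ 1) x"

lemma contact_transformationD:
  assumes "contact_transformation V f"
  shows "open V" "smooth_on V f" "diffeo V (f ` V) f"
    "x \<in> V \<Longrightarrow> f x $ 3 * pd 3 (\<lambda>x. f x $ 1) x = pd 3 (\<lambda>x. f x $ 2) x"
    "x \<in> V \<Longrightarrow> f x $ 3 * (pd 1 (\<lambda>x. f x $ 1) x + x$3 * pd 2 (\<lambda>x. f x $ 1) x)
       = pd 1 (\<lambda>x. f x $ 2) x + x$3 * pd 2 (\<lambda>x. f x $ 2) x"
  using assms unfolding contact_transformation_def Let_def diffeo_def by blast+

lemma contact_transformation_restrict:
  assumes "contact_transformation V f" "V' \<subseteq> V" "open V'"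
  shows "contact_transformation V' f"
  using assms diffeo_restrict[of V "f ` V" f V'] unfolding contact_transformation_def Let_def by blast

text \<open>If the factor vanished, the derivative of \<open>f\<close> would map into the plane
  where the second component is \<open>f x $ 3\<close> times the first, and could not be
  onto.\<close>

lemma coorientation_nonzero:
  assumes ct: "contact_transformation V f" and x: "x \<in> V"
  shows "coorientation f x \<noteq> 0"
proof
  assume 0: "coorientation f x = 0"
  note c = contact_transformationD[OF ct]
  define D where "D = frechet_derivative f (at x)"
  have lin: "linear D" unfolding D_def by (rule smooth_on_linear_derivative[OF c(2) x])
  have pdD: "pd i (\<lambda>x. f x $ k) x = D (axis i 1) $ k" for i k
    unfolding D_def by (rule pd_nth_component[OF smooth_on_differentiable[OF c(2) x]])
  have "inj D" unfolding D_def by (rule diffeo_inj_derivative[OF c(3) x])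
  then have "surj D" using linear_injective_imp_surjective[OF lin] by simp
  then obtain v where v: "D v = axis 2 1" by (metis surjD)
  have "D v = v$1 *\<^sub>R D (axis 1 1) + v$2 *\<^sub>R D (axis 2 1) + v$3 *\<^sub>R D (axis 3 1)"
    by (subst vec3_sum[of v]) (simp add: linear_add[OF lin] linear_cmul[OF lin])
  moreover have "D (axis 3 1) $ 2 = f x $ 3 * D (axis 3 1) $ 1" "D (axis 2 1) $ 2 = f x $ 3 * D (axis 2 1) $ 1"
    using c(4)[OF x] 0 by (simp_all add: pdD coorientation_def)
  moreover have "D (axis 1 1) $ 2 = f x $ 3 * D (axis 1 1) $ 1"
    using c(5)[OF x] calculation(3) by (simp add: pdD algebra_simps)
  ultimately have "D v $ 2 = f x $ 3 * D v $ 1" by (simp add: algebra_simps)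
  then show False by (simp add: v axis_def)
qed

lemma smooth_on_coorientation:
  assumes "open V" "smooth_on V f"
  shows "smooth_on V (coorientation f)"
  unfolding coorientation_def[abs_def] pd_def
  by (intro smooth_on_diff smooth_on_mult smooth_on_derivative smooth_on_vec_nth assms)

text \<open>Equivalence concerns germs, so the sign at one point is enough: by continuity it
  persists on a smaller domain.\<close>

lemma contact_equivalent_cooriented:
  assumes ct: "contact_transformation V f" and ode: "maps_ode U F U' F' V f Z"
    and z: "z \<in> Z" "prolong f z = z'" and pos: "coorientation f (jet1 z) > 0"
  shows "cooriented_contact_equivalent U F z U' F' z'"
proof -
  note c = contact_transformationD[OF ct]
  have Z: "open Z" and jV: "jet1 z \<in> V" using ode z by (auto simp: maps_ode_def)
  define V' where "V' = V \<inter> coorientation f -` {0<..}"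
  have V': "open V'" "V' \<subseteq> V"
    unfolding V'_def
    using continuous_open_preimage[OF smooth_on_continuous_on[OF smooth_on_coorientation[OF c(1,2)]] c(1), of "{0<..}"]
    by auto
  define Z' where "Z' = Z \<inter> jet1 -` V'"
  have "open Z'"
    unfolding Z'_def using Z V'(1)
    by (intro open_Int open_vimage linear_continuous_on bounded_linear_jet1)
  then have "maps_ode U F U' F' V' f Z'"
    using ode unfolding maps_ode_def Z'_def by blast
  moreover have "cooriented V' f" by (auto simp: cooriented_def V'_def coorientation_def)
  moreover have "z \<in> Z'" using z jV pos by (simp add: Z'_def V'_def)
  ultimately show ?thesis
    using contact_transformation_restrict[OF ct V'(2,1)] z(2) unfolding cooriented_contact_equivalent_def by blast
qed

section \<open>Reflection of the target equation\<close>

definition reflect3 :: "real^3 \<Rightarrow> real^3" where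
  "reflect3 x = vector [x$1, - x$2, - x$3]"

lemma reflect3_nth [simp]: "reflect3 x $ 1 = x $ 1" "reflect3 x $ 2 = - x $ 2" "reflect3 x $ 3 = - x $ 3"
  by (simp_all add: reflect3_def)

lemma reflect3_reflect3 [simp]: "reflect3 (reflect3 x) = x"
  by (simp add: vec_eq_iff forall_3)

lemma reflect_nth [simp]: "reflect z $ 1 = z $ 1" "reflect z $ 2 = - z $ 2" "reflect z $ 3 = - z $ 3" "reflect z $ 4 = - z $ 4"
  by (simp_all add: reflect_def)

lemma reflect_reflect [simp]: "reflect (reflect z) = z"
  by (simp add: vec_eq_iff forall_4)

lemma reflect_ode_reflect_ode [simp]: "reflect_ode (reflect_ode F) = F"
  by (simp add: fun_eq_iff reflect_ode_def)

lemma bounded_linear_reflect3: "bounded_linear reflect3"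
  by (rule linear_conv_bounded_linear[THEN iffD1], rule linearI) (simp_all add: vec_eq_iff forall_3)

lemma bounded_linear_reflect: "bounded_linear reflect"
  by (rule linear_conv_bounded_linear[THEN iffD1], rule linearI) (simp_all add: vec_eq_iff forall_4)

lemma involution_image_eq_vimage: "(\<And>x. r (r x) = x) \<Longrightarrow> r ` S = r -` S"
  by (auto simp: image_iff) metis

lemma open_reflect:
  assumes U: "open U" "smooth_on U F"
  shows "open (reflect ` U)" "smooth_on (reflect ` U) (reflect_ode F)"
proof -
  show o: "open (reflect ` U)"
    unfolding involution_image_eq_vimage[of reflect, OF reflect_reflect]
    by (intro open_vimage U linear_continuous_on bounded_linear_reflect)
  have "smooth_on (reflect ` U) (\<lambda>z. F (reflect z))"
    by (rule smooth_on_compose[OF o U(1) _ U(2) smooth_on_bounded_linear[OF bounded_linear_reflect o smooth_on_id[OF o]]]) auto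
  then show "smooth_on (reflect ` U) (reflect_ode F)"
    unfolding reflect_ode_def[abs_def] by (rule smooth_on_minus[OF o])
qed

text \<open>Reflecting the target negates the second and third components of \<open>f\<close>. Both
  sides of each contact condition change sign, so the conditions survive, and the coorientation
  factor changes sign with them.\<close>

lemma contact_transformation_reflect:
  assumes ct: "contact_transformation V f"
  shows "contact_transformation V (\<lambda>x. reflect3 (f x))"
    and "x \<in> V \<Longrightarrow> coorientation (\<lambda>x. reflect3 (f x)) x = - coorientation f x"
proof -
  note c = contact_transformationD[OF ct]
  define g where "g = (\<lambda>x. reflect3 (f x))"
  have d: "inj_on f V" "open (f ` V)" "smooth_on (f ` V) (inv_into V f)"
    using c(3) by (auto simp: diffeo_def bij_betw_def)
  have inj: "inj_on g V" using d(1) unfolding g_def inj_on_def by (metis reflect3_reflect3)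
  have "g ` V = reflect3 ` f ` V" by (auto simp: g_def)
  also have "\<dots> = reflect3 -` f ` V" by (rule involution_image_eq_vimage) simp
  finally have gV: "g ` V = reflect3 -` f ` V" .
  have o: "open (g ` V)"
    unfolding gV by (intro open_vimage d linear_continuous_on bounded_linear_reflect3)
  have "inv_into V f (reflect3 y) = inv_into V g y" if y: "y \<in> g ` V" for y
  proof -
    obtain x where x: "x \<in> V" "y = g x" using y by blast
    have "reflect3 y = f x" by (simp add: x(2) g_def)
    then show ?thesis using x inv_into_f_f[OF inj x(1)] inv_into_f_f[OF d(1) x(1)] by simp
  qed
  moreover have "smooth_on (g ` V) (\<lambda>y. inv_into V f (reflect3 y))"
    by (rule smooth_on_compose[OF o d(2) _ d(3) smooth_on_bounded_linear[OF bounded_linear_reflect3 o smooth_on_id[OF o]]])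
      (simp add: gV image_subset_iff)
  ultimately have "smooth_on (g ` V) (inv_into V g)" using smooth_on_cong[OF o] by metis
  then have dg: "diffeo V (g ` V) g"
    using inj o c(1) smooth_on_bounded_linear[OF bounded_linear_reflect3 c(1,2)]
    by (simp add: diffeo_def bij_betw_def g_def)
  have pd: "pd i (\<lambda>x. g x $ 1) x = pd i (\<lambda>x. f x $ 1) x" "pd i (\<lambda>x. g x $ 2) x = - pd i (\<lambda>x. f x $ 2) x" if "x \<in> V" for i x
    using pd_minus[OF smooth_on_vec_nth[OF c(1,2)] that, of i] by (simp_all add: g_def)
  have g3: "g x $ 3 = - f x $ 3" for x by (simp add: g_def)
  have "contact_transformation V g"
    unfolding contact_transformation_def Let_def
  proof (intro conjI ballI dg)
    fix x assume x: "x \<in> V"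
    show "g x $ 3 * pd 3 (\<lambda>z. g z $ 1) x = pd 3 (\<lambda>z. g z $ 2) x"
      "g x $ 3 * (pd 1 (\<lambda>z. g z $ 1) x + x $ 3 * pd 2 (\<lambda>z. g z $ 1) x) = pd 1 (\<lambda>z. g z $ 2) x + x $ 3 * pd 2 (\<lambda>z. g z $ 2) x"
      using c(4,5)[OF x] by (simp_all add: pd[OF x] g3)
  qed
  then show "contact_transformation V (\<lambda>x. reflect3 (f x))" by (simp add: g_def)
  show "coorientation (\<lambda>x. reflect3 (f x)) x = - coorientation f x" if "x \<in> V"
    using pd[OF that] g3 unfolding g_def[symmetric] coorientation_def by simp
qed

lemma maps_ode_reflect:
  assumes ct: "contact_transformation V f" and ode: "maps_ode U F U' F' V f Z"
  shows "maps_ode U F (reflect ` U') (reflect_ode F') V (\<lambda>x. reflect3 (f x)) Z"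
    and "z \<in> Z \<Longrightarrow> prolong (\<lambda>x. reflect3 (f x)) z = reflect (prolong f z)"
proof -
  note c = contact_transformationD[OF ct]
  define g where "g = (\<lambda>x. reflect3 (f x))"
  have Z: "open Z" "Z \<subseteq> U" using ode by (auto simp: maps_ode_def)
  have o: "jet1 z \<in> V" "total_D1 (\<lambda>x. f x $ 1) z \<noteq> 0" "prolong f z \<in> U'"
    "F' (prolong f z) = total_D F (\<lambda>z. prolong f z $ 4) z / total_D F (\<lambda>z. prolong f z $ 1) z" if "z \<in> Z" for z
    using ode that unfolding maps_ode_def by blast+
  have t: "total_D1 (\<lambda>x. g x $ 1) z = total_D1 (\<lambda>x. f x $ 1) z" "total_D1 (\<lambda>x. g x $ 3) z = - total_D1 (\<lambda>x. f x $ 3) z"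
    if "z \<in> Z" for z
    using pd_minus[OF smooth_on_vec_nth[OF c(1,2)] o(1)[OF that]] by (simp_all add: g_def total_D1_def)
  have p: "prolong g z = reflect (prolong f z)" if "z \<in> Z" for z
    using t[OF that] by (simp add: vec_eq_iff forall_4 prolong_def) (simp add: g_def)
  then show "z \<in> Z \<Longrightarrow> prolong (\<lambda>x. reflect3 (f x)) z = reflect (prolong f z)" by (simp add: g_def)
  have sp: "smooth_on Z (\<lambda>z. prolong f z $ k)" for k
    by (intro smooth_on_vec_nth Z(1) smooth_on_prolong[OF c(1,2) Z(1) o(1,2)])
  have "pd i (\<lambda>z. prolong g z $ 4) z = - pd i (\<lambda>z. prolong f z $ 4) z" "pd i (\<lambda>z. prolong g z $ 1) z = pd i (\<lambda>z. prolong f z $ 1) z"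
    if "z \<in> Z" for i z
  proof -
    have "pd i (\<lambda>z. - prolong f z $ 4) z = pd i (\<lambda>z. prolong g z $ 4) z"
      by (rule pd_cong[OF Z(1) smooth_on_minus[OF Z(1) sp] _ that]) (simp add: p)
    then show "pd i (\<lambda>z. prolong g z $ 4) z = - pd i (\<lambda>z. prolong f z $ 4) z" by (simp add: pd_minus[OF sp that])
    show "pd i (\<lambda>z. prolong g z $ 1) z = pd i (\<lambda>z. prolong f z $ 1) z"
      by (rule pd_cong[OF Z(1) sp _ that, symmetric]) (simp add: p)
  qed
  then have T: "total_D F (\<lambda>z. prolong g z $ 4) z = - total_D F (\<lambda>z. prolong f z $ 4) z"
    "total_D F (\<lambda>z. prolong g z $ 1) z = total_D F (\<lambda>z. prolong f z $ 1) z" if "z \<in> Z" for z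
    using that by (simp_all add: total_D_def)
  have "maps_ode U F (reflect ` U') (reflect_ode F') V g Z"
    unfolding maps_ode_def
  proof (intro conjI ballI Z)
    fix z assume z: "z \<in> Z"
    show "jet1 z \<in> V" "total_D1 (\<lambda>x. g x $ 1) z \<noteq> 0" "prolong g z \<in> reflect ` U'" using o[OF z] by (simp_all add: t[OF z] p[OF z])
    show "reflect_ode F' (prolong g z) = total_D F (\<lambda>z. prolong g z $ 4) z / total_D F (\<lambda>z. prolong g z $ 1) z"
      unfolding T[OF z] p[OF z] by (simp add: reflect_ode_def o(4)[OF z])
  qed
  then show "maps_ode U F (reflect ` U') (reflect_ode F') V (\<lambda>x. reflect3 (f x)) Z" by (simp add: g_def)
qed

lemma contact_equivalent_reflect:
  assumes "contact_equivalent U F z U' F' z'"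
  shows "contact_equivalent U F z (reflect ` U') (reflect_ode F') (reflect z')"
proof -
  obtain V f Z where c: "contact_transformation V f" "maps_ode U F U' F' V f Z" "z \<in> Z" "prolong f z = z'"
    using assms unfolding contact_equivalent_def by blast
  have "prolong (\<lambda>x. reflect3 (f x)) z = reflect z'" using maps_ode_reflect(2)[OF c(1-3)] c(4) by simp
  then show ?thesis
    unfolding contact_equivalent_def
    using contact_transformation_reflect(1)[OF c(1)] maps_ode_reflect(1)[OF c(1,2)] c(3) by blast
qed

text \<open>The factor is nonzero at \<open>jet1 z\<close>, and if it is negative, composition with
  the reflection makes it positive. The converse uses that the reflection is an involution on
  domains, equations and points.\<close>

lemma contact_equivalent_iff_cooriented:
  "contact_equivalent U F z U' F' z' \<longleftrightarrow> cooriented_contact_equivalent U F z U' F' z' \<or>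
     cooriented_contact_equivalent U F z (reflect ` U') (reflect_ode F') (reflect z')"
proof
  assume "contact_equivalent U F z U' F' z'"
  then obtain V f Z where c: "contact_transformation V f" "maps_ode U F U' F' V f Z" "z \<in> Z" "prolong f z = z'"
    unfolding contact_equivalent_def by blast
  have j: "jet1 z \<in> V" using c(2,3) by (auto simp: maps_ode_def)
  show "cooriented_contact_equivalent U F z U' F' z' \<or>
     cooriented_contact_equivalent U F z (reflect ` U') (reflect_ode F') (reflect z')"
  proof (cases "coorientation f (jet1 z) > 0")
    case True
    then show ?thesis using contact_equivalent_cooriented[OF c] by blast
  next
    case False
    then have "coorientation (\<lambda>x. reflect3 (f x)) (jet1 z) > 0"
      using coorientation_nonzero[OF c(1) j] contact_transformation_reflect(2)[OF c(1) j] by simp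
    moreover have "prolong (\<lambda>x. reflect3 (f x)) z = reflect z'" using maps_ode_reflect(2)[OF c(1-3)] c(4) by simp
    ultimately show ?thesis
      using contact_equivalent_cooriented[OF contact_transformation_reflect(1)[OF c(1)] maps_ode_reflect(1)[OF c(1,2)] c(3)]
      by blast
  qed
next
  have *: "contact_equivalent U F z U' F' z'" if "cooriented_contact_equivalent U F z U' F' z'" for U' F' z'
    using that unfolding cooriented_contact_equivalent_def contact_equivalent_def by blast
  have "reflect ` reflect ` U' = U'" by (simp add: image_image)
  then have "contact_equivalent U F z U' F' z'" if "contact_equivalent U F z (reflect ` U') (reflect_ode F') (reflect z')"
    using contact_equivalent_reflect[OF that] by simp
  then show "contact_equivalent U F z U' F' z'"
    if "cooriented_contact_equivalent U F z U' F' z' \<or>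
     cooriented_contact_equivalent U F z (reflect ` U') (reflect_ode F') (reflect z')"
    using that * by blast
qed

lemma coframe_imp_contact:
  assumes "coframe_equivalent U F z U' F' z'"
  shows "cooriented_contact_equivalent U F z U' F' z'"
proof -
  obtain S S' \<Phi> w where w: "coframe_iso U F U' F' S S' \<Phi>" "w \<in> S" "fst w = z" "fst (\<Phi> w) = z'"
    using assms unfolding coframe_equivalent_def by blast
  obtain S0 V f where c: "open S0" "w \<in> S0" "S0 \<subseteq> S" "contact_transformation V f" "cooriented V f"
    "maps_ode U F U' F' V f (fst ` S0)" "\<And>w. w \<in> S0 \<Longrightarrow> fst (\<Phi> w) = prolong f (fst w)"
    using coframe_iso_contact[OF w(1,2)] by blast
  have "z \<in> fst ` S0" "prolong f z = z'" using c(2) c(7)[OF c(2)] w(3,4) by auto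
  then show ?thesis unfolding cooriented_contact_equivalent_def using c(4-6) by blast
qed

theorem theorem2p1:
  fixes F :: "real^4 \<Rightarrow> real" and U :: "(real^4) set"
  assumes "open U" and "smooth_on U F"
  shows
    "(Group.group Sp4 \<and> subgroup H6 Sp4 \<and> global_chart H6_dom u_matrix H6 \<and>
      lie_algebra (carrier Sp4) = sp4 \<and> lie_algebra H6 = nonneg_part \<and>
      (\<exists>\<rho>. linear \<rho> \<and> bij_betw \<rho> sp4 o32 \<and>
         (\<forall>A\<in>sp4. \<forall>B\<in>sp4. \<rho> (lie_br A B) = lie_br (\<rho> A) (\<rho> B)))) \<and>
     (principal_bundle H6_dom u_matrix H6 (Pc U) fst U H6_act \<and> DIM((real^4) \<times> (real^6)) = 10) \<and>
     (is_coframe (Pc U) (coframe F) \<and>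
      (\<forall>w\<in>Pc U. \<forall>v. omega_hat F w v = sp4_matrix (coframe F w v)) \<and>
      cartan_connection (carrier Sp4) H6 (Pc U) H6_act (omega_hat F) \<and>
      tanaka_normal (Pc U) (omega_hat F)) \<and>
     (u_matrix unit_coords = mat 1 \<and>
      (\<forall>z\<in>U. \<forall>v. omega_hat F (z, unit_coords) (v, 0) = omega_c F z v)) \<and>
     (\<forall>U' F'. open U' \<longrightarrow> smooth_on U' F' \<longrightarrow>
       (\<forall>z\<in>U. \<forall>z'\<in>U'.
          (cooriented_contact_equivalent U F z U' F' z' \<longleftrightarrow> coframe_equivalent U F z U' F' z') \<and>
          (contact_equivalent U F z U' F' z' \<longleftrightarrow>
             coframe_equivalent U F z U' F' z' \<or>
             coframe_equivalent U F z (reflect ` U') (reflect_ode F') (reflect z'))) \<and>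
       (\<forall>S S' \<Phi>. coframe_iso U F U' F' S S' \<Phi> \<longrightarrow>
          (\<forall>w\<in>S. \<exists>S0 V f. open S0 \<and> w \<in> S0 \<and> S0 \<subseteq> S \<and>
             contact_transformation V f \<and> cooriented V f \<and>
             maps_ode U F U' F' V f (fst ` S0) \<and>
             (\<forall>w'\<in>S0. fst (\<Phi> w') = prolong f (fst w')))))"
proof -
  note U = assms
  have co: "cooriented_contact_equivalent U F z U' F' z' \<longleftrightarrow> coframe_equivalent U F z U' F' z'"
    if "open U'" "smooth_on U' F'" for U' F' z z'
    using contact_imp_coframe[OF U that] coframe_imp_contact by blast
  have ce: "contact_equivalent U F z U' F' z' \<longleftrightarrow> coframe_equivalent U F z U' F' z' \<or>
      coframe_equivalent U F z (reflect ` U') (reflect_ode F') (reflect z')"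
    if "open U'" "smooth_on U' F'" for U' F' z z'
    unfolding contact_equivalent_iff_cooriented co[OF that] co[OF open_reflect[OF that]] ..
  have pr: "\<exists>S0 V f. open S0 \<and> w \<in> S0 \<and> S0 \<subseteq> S \<and> contact_transformation V f \<and> cooriented V f \<and>
      maps_ode U F U' F' V f (fst ` S0) \<and> (\<forall>w'\<in>S0. fst (\<Phi> w') = prolong f (fst w'))"
    if "coframe_iso U F U' F' S S' \<Phi>" "w \<in> S" for U' F' S S' \<Phi> w
    using coframe_iso_contact[OF that] by metis
  show ?thesis
    by (intro conjI allI impI ballI group_Sp4 subgroup_H6 global_chart_u_matrix lie_algebra_Sp4 lie_algebra_H6
        sp4_o32_iso principal_bundle_Pc is_coframe_Pc omega_hat_coframe cartan_connection_omega_hat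
        tanaka_normal_omega_hat u_matrix_unit_coords omega_hat_unit U co ce pr) simp_all
qed

end
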